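(* Let $f:M\to N$ be a holomorphic map between two compact complex manifolds. If $M$ has RC-positive tangent bundle and $N$ has nef cotangent bundle, then $f$ is a constant map.
   Context: Complex manifolds are connected (usual convention). RC-positivity: a Hermitian holomorphic vector bundle $(E,h)$ over a complex manifold $X$, with Chern curvature tensor $R^E$, locally $R^E_{i\bar j\alpha\bar\beta}=-\frac{\partial^2h_{\alpha\bar\beta}}{\partial z^i\partial\bar z^j}+h^{\gamma\bar\delta}\frac{\partial h_{\alpha\bar\delta}}{\partial z^i}\frac{\partial h_{\gamma\bar\beta}}{\partial\bar z^j}$, is RC-positive if for every $q\in X$ and every nonzero $v\in E_q$ there exists some nonzero $u\in T_qX$ (possibly depending on $v$) with $R^E(u,\bar u,v,\bar v)>0$. The manifold $M$ has RC-positive tangent bundle if it admits a smooth Hermitian metric $\omega_g$ such that the holomorphic tangent bundle $(T_M,\omega_g)$ is RC-positive. Nefness: a holomorphic vector bundle $E\to X$ over a compact complex manifold is nef if the tautological line bundle $\mathcal{O}_E(1)$ over $\mathbb{P}(E^* )$ is nef. Here $\pi:\mathbb{P}(E^* )\to X$ is the bundle of lines in $E^*$ (equivalently hyperplanes of $E$), and $\mathcal{O}_E(1)=\pi^*E/S$ with $S_{[\xi]}=\xi^{-1}(0)\subset E_x$ for $\xi\in E_x^*\setminus\{0\}$. A line bundle $L$ over a compact complex manifold with a fixed Hermitian metric $\omega$ is nef if for every $\varepsilon>0$ it has a smooth Hermitian metric $h_\varepsilon$ with $-\sqrt{-1}\partial\bar\partial\log h_\varepsilon\ge-\varepsilon\omega$.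 The cotangent bundle of $N$ is the holomorphic cotangent bundle $T_N^*$. *)

theory Defs
  imports "HOL-Analysis.Analysis"
begin

section \<open>Calculus on complex n-space\<close>

text \<open>
  The dimension of a manifold and the rank of a bundle are natural numbers (the projectivisation
  of a rank \<open>r\<close> bundle over an \<open>n\<close>-dimensional base has dimension \<open>n + r - 1\<close>), so
  complex \<open>n\<close>-space is the set of sequences supported in \<open>{..<n}\<close>, with the subspace
  topology of the product topology, i.e. the usual topology.
\<close>

type_synonym cvec = "nat \<Rightarrow> complex"

definition Cn :: "nat \<Rightarrow> cvec set" where
  "Cn n = {z. \<forall>i\<ge>n. z i = 0}"

definition open_Cn :: "nat \<Rightarrow> cvec set \<Rightarrow> bool" where
  "open_Cn n U \<longleftrightarrow> openin (top_of_set (Cn n)) U"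

definition unit_vec :: "nat \<Rightarrow> cvec" where
  "unit_vec k = (\<lambda>j. if j = k then 1 else 0)"

definition holo_on :: "nat \<Rightarrow> cvec set \<Rightarrow> (cvec \<Rightarrow> complex) \<Rightarrow> bool" where
  \<comment> \<open>continuous and separately holomorphic; used for open \<open>U\<close> only\<close>
  "holo_on n U f \<longleftrightarrow> continuous_on U f \<and>
     (\<forall>z\<in>U. \<forall>i<n. (\<lambda>t. f (z(i := t))) field_differentiable at (z i))"

definition real_partial :: "nat \<Rightarrow> complex \<Rightarrow> (cvec \<Rightarrow> complex) \<Rightarrow> cvec \<Rightarrow> complex" where
  \<comment> \<open>with \<open>z\<^sub>i = x\<^sub>i + \<i> y\<^sub>i\<close>: derivative along \<open>x\<^sub>i\<close> for \<open>c = 1\<close>, along \<open>y\<^sub>i\<close> for \<open>c = \<i>\<close>\<close>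
  "real_partial i c f z = vector_derivative (\<lambda>t::real. f (z(i := z i + of_real t * c))) (at 0)"

primrec Ck_on :: "nat \<Rightarrow> nat \<Rightarrow> cvec set \<Rightarrow> (cvec \<Rightarrow> complex) \<Rightarrow> bool" where
  "Ck_on n 0 U f \<longleftrightarrow> continuous_on U f"
| "Ck_on n (Suc k) U f \<longleftrightarrow> continuous_on U f \<and>
     (\<forall>i<n. \<forall>c\<in>{1, \<i>}.
        (\<forall>z\<in>U. (\<lambda>t::real. f (z(i := z i + of_real t * c))) differentiable at 0) \<and>
        Ck_on n k U (real_partial i c f))"

definition smooth_on :: "nat \<Rightarrow> cvec set \<Rightarrow> (cvec \<Rightarrow> complex) \<Rightarrow> bool" where
  "smooth_on n U f \<longleftrightarrow> (\<forall>k. Ck_on n k U f)"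

definition dz :: "nat \<Rightarrow> (cvec \<Rightarrow> complex) \<Rightarrow> cvec \<Rightarrow> complex" where
  "dz i f z = (real_partial i 1 f z - \<i> * real_partial i \<i> f z) / 2"

definition dzbar :: "nat \<Rightarrow> (cvec \<Rightarrow> complex) \<Rightarrow> cvec \<Rightarrow> complex" where
  "dzbar i f z = (real_partial i 1 f z + \<i> * real_partial i \<i> f z) / 2"


section \<open>Complex manifolds\<close>

text \<open>
  A chart is a pair \<open>(U, \<phi>)\<close>; only the values of \<open>\<phi>\<close> on \<open>U\<close> matter. The topology is the one
  determined by the atlas, and charts are homeomorphisms for it by construction.
\<close>

type_synonym 'a chart = "'a set \<times> ('a \<Rightarrow> cvec)"

record 'a cmfd =
  cm_pts :: "'a set"
  cm_dim :: nat
  cm_atlas :: "'a chart set"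

definition chart_inv :: "'a chart \<Rightarrow> cvec \<Rightarrow> 'a" where
  "chart_inv c = inv_into (fst c) (snd c)"

definition cm_topology :: "'a cmfd \<Rightarrow> 'a topology" where
  "cm_topology M = topology_generated_by
     {W. \<exists>(U, \<phi>)\<in>cm_atlas M. W \<subseteq> U \<and> open_Cn (cm_dim M) (\<phi> ` W)}"

definition holomorphic_atlas :: "'a cmfd \<Rightarrow> bool" where
  "holomorphic_atlas M \<longleftrightarrow>
     (\<Union>(U, \<phi>)\<in>cm_atlas M. U) = cm_pts M \<and>
     (\<forall>(U, \<phi>)\<in>cm_atlas M. inj_on \<phi> U \<and> open_Cn (cm_dim M) (\<phi> ` U)) \<and>
     (\<forall>(U, \<phi>)\<in>cm_atlas M. \<forall>(V, \<psi>)\<in>cm_atlas M.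
        open_Cn (cm_dim M) (\<phi> ` (U \<inter> V)) \<and>
        (\<forall>i<cm_dim M. holo_on (cm_dim M) (\<phi> ` (U \<inter> V)) (\<lambda>z. \<psi> (chart_inv (U, \<phi>) z) i)))"

definition complex_manifold :: "'a cmfd \<Rightarrow> bool" where
  "complex_manifold M \<longleftrightarrow> holomorphic_atlas M \<and>
     Hausdorff_space (cm_topology M) \<and> second_countable (cm_topology M) \<and>
     connected_space (cm_topology M)"

definition compact_complex_manifold :: "'a cmfd \<Rightarrow> bool" where
  "compact_complex_manifold M \<longleftrightarrow> complex_manifold M \<and> compact_space (cm_topology M)"

definition holomorphic_map :: "'a cmfd \<Rightarrow> 'b cmfd \<Rightarrow> ('a \<Rightarrow> 'b) \<Rightarrow> bool" where
  "holomorphic_map M N f \<longleftrightarrow> continuous_map (cm_topology M) (cm_topology N) f \<and>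
     (\<forall>(U, \<phi>)\<in>cm_atlas M. \<forall>(V, \<psi>)\<in>cm_atlas N. \<forall>i<cm_dim N.
        holo_on (cm_dim M) (\<phi> ` (U \<inter> f -` V)) (\<lambda>z. \<psi> (f (chart_inv (U, \<phi>) z)) i))"

definition holomorphic_fun_on :: "'a cmfd \<Rightarrow> 'a set \<Rightarrow> ('a \<Rightarrow> complex) \<Rightarrow> bool" where
  "holomorphic_fun_on M W F \<longleftrightarrow>
     (\<forall>(U, \<phi>)\<in>cm_atlas M. holo_on (cm_dim M) (\<phi> ` (U \<inter> W)) (\<lambda>z. F (chart_inv (U, \<phi>) z)))"

definition smooth_fun_on :: "'a cmfd \<Rightarrow> 'a set \<Rightarrow> ('a \<Rightarrow> complex) \<Rightarrow> bool" where
  "smooth_fun_on M W F \<longleftrightarrow>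
     (\<forall>(U, \<phi>)\<in>cm_atlas M. smooth_on (cm_dim M) (\<phi> ` (U \<inter> W)) (\<lambda>z. F (chart_inv (U, \<phi>) z)))"


section \<open>Holomorphic vector bundles\<close>

record 'e cvspace =
  vs_set :: "'e set"
  vs_zero :: 'e
  vs_add :: "'e \<Rightarrow> 'e \<Rightarrow> 'e"
  vs_scale :: "complex \<Rightarrow> 'e \<Rightarrow> 'e"

definition linear_iso :: "'e cvspace \<Rightarrow> nat \<Rightarrow> ('e \<Rightarrow> cvec) \<Rightarrow> bool" where
  \<comment> \<open>the vector space axioms for \<open>V\<close> follow by transport of structure\<close>
  "linear_iso V r T \<longleftrightarrow> bij_betw T (vs_set V) (Cn r) \<and>
     vs_zero V \<in> vs_set V \<and> T (vs_zero V) = (\<lambda>_. 0) \<and>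
     (\<forall>v\<in>vs_set V. \<forall>w\<in>vs_set V. vs_add V v w \<in> vs_set V \<and>
        T (vs_add V v w) = (\<lambda>i. T v i + T w i)) \<and>
     (\<forall>a. \<forall>v\<in>vs_set V. vs_scale V a v \<in> vs_set V \<and>
        T (vs_scale V a v) = (\<lambda>i. a * T v i))"

text \<open>
  The data of a bundle: base, rank, fibres and a set of local trivialisations \<open>(U, \<tau>)\<close>, where
  \<open>\<tau> x\<close> maps the fibre over \<open>x \<in> U\<close> to complex \<open>r\<close>-space.
\<close>

type_synonym ('a, 'e) trivialization = "'a set \<times> ('a \<Rightarrow> 'e \<Rightarrow> cvec)"

record ('a, 'e) vbundle =
  vb_base :: "'a cmfd"
  vb_rank :: nat
  vb_fib :: "'a \<Rightarrow> 'e cvspace"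
  vb_triv :: "('a, 'e) trivialization set"

definition vb_frame :: "('a, 'e) vbundle \<Rightarrow> ('a, 'e) trivialization \<Rightarrow> nat \<Rightarrow> 'a \<Rightarrow> 'e" where
  \<comment> \<open>the local frame \<open>e\<^sub>0, \<dots>, e\<^bsub>r-1\<^esub>\<close> belonging to a trivialisation\<close>
  "vb_frame E t \<alpha> x = inv_into (vs_set (vb_fib E x)) (snd t x) (unit_vec \<alpha>)"

text \<open>
  The positivity notions below are stated for bundle data and are meant for bundles satisfying the
  next predicate. The tangent bundle of a complex manifold satisfies it, and dual, pullback and
  quotient bundles inherit it.
\<close>

definition holomorphic_vector_bundle :: "('a, 'e) vbundle \<Rightarrow> bool" where
  "holomorphic_vector_bundle E \<longleftrightarrow> complex_manifold (vb_base E) \<and>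
     (\<Union>(U, \<tau>)\<in>vb_triv E. U) = cm_pts (vb_base E) \<and>
     (\<forall>(U, \<tau>)\<in>vb_triv E. openin (cm_topology (vb_base E)) U \<and>
        (\<forall>x\<in>U. linear_iso (vb_fib E x) (vb_rank E) (\<tau> x))) \<and>
     (\<forall>(U, \<tau>)\<in>vb_triv E. \<forall>(V, \<sigma>)\<in>vb_triv E. \<forall>\<alpha><vb_rank E. \<forall>\<beta><vb_rank E.
        holomorphic_fun_on (vb_base E) (U \<inter> V) (\<lambda>x. \<sigma> x (vb_frame E (U, \<tau>) \<alpha> x) \<beta>))"


subsection \<open>Tangent bundle\<close>

text \<open>
  A tangent vector at \<open>x\<close> is a family of coordinate vectors, one for each chart around \<open>x\<close>,
  compatible under the Jacobians of the coordinate changes. The family is zero at all other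
  arguments, so that equality of tangent vectors is equality of families.
\<close>

type_synonym 'a tvec = "'a chart \<Rightarrow> cvec"

definition jacobian :: "'a chart \<Rightarrow> 'a chart \<Rightarrow> 'a \<Rightarrow> nat \<Rightarrow> nat \<Rightarrow> complex" where
  "jacobian c c' x i j =
     deriv (\<lambda>t. snd c' (chart_inv c ((snd c x)(j := t))) i) (snd c x j)"

definition tangent_space :: "'a cmfd \<Rightarrow> 'a \<Rightarrow> 'a tvec cvspace" where
  "tangent_space M x = \<lparr>
     vs_set = {v. (\<forall>c. v c \<in> Cn (cm_dim M)) \<and>
       (\<forall>c. \<not> (c \<in> cm_atlas M \<and> x \<in> fst c) \<longrightarrow> v c = (\<lambda>_. 0)) \<and>
       (\<forall>c\<in>cm_atlas M. \<forall>c'\<in>cm_atlas M. x \<in> fst c \<inter> fst c' \<longrightarrow>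
         (\<forall>i<cm_dim M. v c' i = (\<Sum>j<cm_dim M. jacobian c c' x i j * v c j)))},
     vs_zero = (\<lambda>_ _. 0),
     vs_add = (\<lambda>v w c i. v c i + w c i),
     vs_scale = (\<lambda>a v c i. a * v c i)\<rparr>"

definition tangent_bundle :: "'a cmfd \<Rightarrow> ('a, 'a tvec) vbundle" where
  "tangent_bundle M = \<lparr>
     vb_base = M,
     vb_rank = cm_dim M,
     vb_fib = tangent_space M,
     vb_triv = {(fst c, \<lambda>x v. v c) |c. c \<in> cm_atlas M}\<rparr>"


subsection \<open>Dual, pullback and quotient bundles\<close>

definition dual_space :: "'e cvspace \<Rightarrow> ('e \<Rightarrow> complex) cvspace" where
  "dual_space V = \<lparr>
     vs_set = {\<xi>. (\<forall>v\<in>vs_set V. \<forall>w\<in>vs_set V. \<xi> (vs_add V v w) = \<xi> v + \<xi> w) \<and>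
       (\<forall>a. \<forall>v\<in>vs_set V. \<xi> (vs_scale V a v) = a * \<xi> v) \<and>
       (\<forall>v. v \<notin> vs_set V \<longrightarrow> \<xi> v = 0)},
     vs_zero = (\<lambda>_. 0),
     vs_add = (\<lambda>\<xi> \<eta> v. \<xi> v + \<eta> v),
     vs_scale = (\<lambda>a \<xi> v. a * \<xi> v)\<rparr>"

definition dual_bundle :: "('a, 'e) vbundle \<Rightarrow> ('a, 'e \<Rightarrow> complex) vbundle" where
  "dual_bundle E = \<lparr>
     vb_base = vb_base E,
     vb_rank = vb_rank E,
     vb_fib = (\<lambda>x. dual_space (vb_fib E x)),
     vb_triv = {(fst t, \<lambda>x \<xi> \<alpha>. if \<alpha> < vb_rank E then \<xi> (vb_frame E t \<alpha> x) else 0) |t.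
       t \<in> vb_triv E}\<rparr>"

definition cotangent_bundle :: "'a cmfd \<Rightarrow> ('a, 'a tvec \<Rightarrow> complex) vbundle" where
  "cotangent_bundle M = dual_bundle (tangent_bundle M)"

definition pullback_bundle :: "'b cmfd \<Rightarrow> ('b \<Rightarrow> 'a) \<Rightarrow> ('a, 'e) vbundle \<Rightarrow> ('b, 'e) vbundle" where
  "pullback_bundle Y g E = \<lparr>
     vb_base = Y,
     vb_rank = vb_rank E,
     vb_fib = (\<lambda>y. vb_fib E (g y)),
     vb_triv = {(cm_pts Y \<inter> g -` fst t, \<lambda>y. snd t (g y)) |t. t \<in> vb_triv E}\<rparr>"

definition vs_coset :: "'e cvspace \<Rightarrow> 'e set \<Rightarrow> 'e \<Rightarrow> 'e set" where
  "vs_coset V S v = {vs_add V v s |s. s \<in> S}"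

definition quotient_space :: "'e cvspace \<Rightarrow> 'e set \<Rightarrow> 'e set cvspace" where
  "quotient_space V S = \<lparr>
     vs_set = {vs_coset V S v |v. v \<in> vs_set V},
     vs_zero = S,
     vs_add = (\<lambda>A B. {vs_add V a b |a b. a \<in> A \<and> b \<in> B}),
     vs_scale = (\<lambda>k A. {vs_add V (vs_scale V k a) s |a s. a \<in> A \<and> s \<in> S})\<rparr>"

text \<open>
  The quotient of \<open>E\<close> by a holomorphic subbundle of rank \<open>s\<close> with fibres \<open>S x\<close>. It carries the
  unique holomorphic structure for which the projection from \<open>E\<close> is holomorphic: the
  trivialisations are all those in which the projection has a holomorphic matrix.
\<close>

definition quotient_bundle ::
    "('a, 'e) vbundle \<Rightarrow> nat \<Rightarrow> ('a \<Rightarrow> 'e set) \<Rightarrow> ('a, 'e set) vbundle" where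
  "quotient_bundle E s S = \<lparr>
     vb_base = vb_base E,
     vb_rank = vb_rank E - s,
     vb_fib = (\<lambda>x. quotient_space (vb_fib E x) (S x)),
     vb_triv = {(U, \<sigma>). openin (cm_topology (vb_base E)) U \<and>
       (\<forall>x\<in>U. linear_iso (quotient_space (vb_fib E x) (S x)) (vb_rank E - s) (\<sigma> x)) \<and>
       (\<forall>t\<in>vb_triv E. \<forall>\<alpha><vb_rank E. \<forall>\<beta><vb_rank E - s.
         holomorphic_fun_on (vb_base E) (U \<inter> fst t)
           (\<lambda>x. \<sigma> x (vs_coset (vb_fib E x) (S x) (vb_frame E t \<alpha> x)) \<beta>))}\<rparr>"


subsection \<open>Projectivisation and the tautological line bundle\<close>

definition vs_line :: "'e cvspace \<Rightarrow> 'e \<Rightarrow> 'e set" where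
  "vs_line V v = {vs_scale V a v |a. True}"

definition proj_pts :: "('a, 'e) vbundle \<Rightarrow> ('a \<times> 'e set) set" where
  "proj_pts F = {(x, vs_line (vb_fib F x) \<xi>) |x \<xi>.
     x \<in> cm_pts (vb_base F) \<and> \<xi> \<in> vs_set (vb_fib F x) \<and> \<xi> \<noteq> vs_zero (vb_fib F x)}"

definition proj_chart ::
    "('a, 'e) vbundle \<Rightarrow> 'a chart \<Rightarrow> ('a, 'e) trivialization \<Rightarrow> nat \<Rightarrow> ('a \<times> 'e set) chart" where
  \<comment> \<open>On the lines whose \<open>k\<close>-th fibre coordinate does not vanish identically: the base
    coordinates followed by \<open>\<xi>\<^sub>j / \<xi>\<^sub>k\<close> for \<open>j \<noteq> k\<close>, computed from the
    spanning vector \<open>\<xi>\<close> normalised by \<open>\<xi>\<^sub>k = 1\<close>.\<close>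
  "proj_chart F c t k =
     (let n = cm_dim (vb_base F); r = vb_rank F in
      ({(x, l) \<in> proj_pts F. x \<in> fst c \<inter> fst t \<and> (\<exists>\<xi>\<in>l. snd t x \<xi> k \<noteq> 0)},
       \<lambda>(x, l) i.
         if i < n then snd c x i
         else if i < n + (r - 1) then
           snd t x (THE \<xi>. \<xi> \<in> l \<and> snd t x \<xi> k = 1) (if i - n < k then i - n else Suc (i - n))
         else 0))"

definition proj_bundle :: "('a, 'e) vbundle \<Rightarrow> ('a \<times> 'e set) cmfd" where
  \<comment> \<open>the bundle of lines in \<open>F\<close>, with bundle projection \<^const>\<open>fst\<close>\<close>
  "proj_bundle F = \<lparr>
     cm_pts = proj_pts F,
     cm_dim = cm_dim (vb_base F) + (vb_rank F - 1),
     cm_atlas = {proj_chart F c t k |c t k.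
       c \<in> cm_atlas (vb_base F) \<and> t \<in> vb_triv F \<and> k < vb_rank F}\<rparr>"

definition taut_sub ::
    "('a, 'e) vbundle \<Rightarrow> 'a \<times> ('e \<Rightarrow> complex) set \<Rightarrow> 'e set" where
  "taut_sub E = (\<lambda>(x, l). {v \<in> vs_set (vb_fib E x). \<forall>\<xi>\<in>l. \<xi> v = 0})"

definition taut_line_bundle ::
    "('a, 'e) vbundle \<Rightarrow> ('a \<times> ('e \<Rightarrow> complex) set, 'e set) vbundle" where
  \<comment> \<open>the bundle \<open>\<O>\<^sub>E(1)\<close> over the bundle of lines in the dual of \<open>E\<close>\<close>
  "taut_line_bundle E =
     quotient_bundle (pullback_bundle (proj_bundle (dual_bundle E)) fst E)
       (vb_rank E - 1) (taut_sub E)"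


section \<open>Hermitian metrics and positivity\<close>

definition hermitian_metric :: "('a, 'e) vbundle \<Rightarrow> ('a \<Rightarrow> 'e \<Rightarrow> 'e \<Rightarrow> complex) \<Rightarrow> bool" where
  "hermitian_metric E h \<longleftrightarrow>
     (\<forall>x\<in>cm_pts (vb_base E). let V = vb_fib E x in
        (\<forall>u\<in>vs_set V. \<forall>v\<in>vs_set V. \<forall>w\<in>vs_set V. h x (vs_add V u v) w = h x u w + h x v w) \<and>
        (\<forall>a. \<forall>v\<in>vs_set V. \<forall>w\<in>vs_set V. h x (vs_scale V a v) w = a * h x v w) \<and>
        (\<forall>v\<in>vs_set V. \<forall>w\<in>vs_set V. h x w v = cnj (h x v w)) \<and>
        (\<forall>v\<in>vs_set V. v \<noteq> vs_zero V \<longrightarrow> Re (h x v v) > 0)) \<and>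
     (\<forall>t\<in>vb_triv E. \<forall>\<alpha><vb_rank E. \<forall>\<beta><vb_rank E.
        smooth_fun_on (vb_base E) (fst t) (\<lambda>x. h x (vb_frame E t \<alpha> x) (vb_frame E t \<beta> x)))"

definition metric_coeff ::
    "('a, 'e) vbundle \<Rightarrow> ('a \<Rightarrow> 'e \<Rightarrow> 'e \<Rightarrow> complex) \<Rightarrow> 'a chart \<Rightarrow> ('a, 'e) trivialization \<Rightarrow>
     nat \<Rightarrow> nat \<Rightarrow> cvec \<Rightarrow> complex" where
  \<comment> \<open>\<open>h\<^bsub>\<alpha>\<beta>\<^esub> = h(e\<^sub>\<alpha>, e\<^sub>\<beta>)\<close> (linear in \<open>\<alpha>\<close>, conjugate linear in \<open>\<beta>\<close>) in the coordinates of \<open>c\<close>\<close>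
  "metric_coeff E h c t \<alpha> \<beta> z =
     (let x = chart_inv c z in h x (vb_frame E t \<alpha> x) (vb_frame E t \<beta> x))"

definition inverse_coeff :: "nat \<Rightarrow> (nat \<Rightarrow> nat \<Rightarrow> complex) \<Rightarrow> nat \<Rightarrow> nat \<Rightarrow> complex" where
  \<comment> \<open>\<open>h\<^bsup>\<gamma>\<delta>\<^esup>\<close> with the second indices contracted: \<open>\<Sum>\<^sub>\<delta> h\<^bsub>\<alpha>\<delta>\<^esub> h\<^bsup>\<gamma>\<delta>\<^esup>\<close> is the Kronecker delta of \<open>\<alpha>, \<gamma>\<close>\<close>
  "inverse_coeff r H = (THE K. (\<forall>\<gamma> \<delta>. \<gamma> \<ge> r \<or> \<delta> \<ge> r \<longrightarrow> K \<gamma> \<delta> = 0) \<and>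
     (\<forall>\<alpha><r. \<forall>\<gamma><r. (\<Sum>\<delta><r. H \<alpha> \<delta> * K \<gamma> \<delta>) = (if \<alpha> = \<gamma> then 1 else 0)))"

definition chern_curvature_coeff ::
    "('a, 'e) vbundle \<Rightarrow> ('a \<Rightarrow> 'e \<Rightarrow> 'e \<Rightarrow> complex) \<Rightarrow> 'a chart \<Rightarrow> ('a, 'e) trivialization \<Rightarrow>
     'a \<Rightarrow> nat \<Rightarrow> nat \<Rightarrow> nat \<Rightarrow> nat \<Rightarrow> complex" where
  "chern_curvature_coeff E h c t x i j \<alpha> \<beta> =
     (let H = metric_coeff E h c t; z = snd c x; r = vb_rank E;
          K = inverse_coeff r (\<lambda>\<gamma> \<delta>. H \<gamma> \<delta> z)
      in - dz i (dzbar j (H \<alpha> \<beta>)) z +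
         (\<Sum>\<gamma><r. \<Sum>\<delta><r. K \<gamma> \<delta> * dz i (H \<alpha> \<delta>) z * dzbar j (H \<gamma> \<beta>) z))"

definition chern_curvature ::
    "('a, 'e) vbundle \<Rightarrow> ('a \<Rightarrow> 'e \<Rightarrow> 'e \<Rightarrow> complex) \<Rightarrow> 'a chart \<Rightarrow> ('a, 'e) trivialization \<Rightarrow>
     'a \<Rightarrow> 'a tvec \<Rightarrow> 'e \<Rightarrow> complex" where
  \<comment> \<open>\<open>R(u, \<bar>u, v, \<bar>v)\<close>, where the bar is conjugation; a real number\<close>
  "chern_curvature E h c t x u v =
     (let n = cm_dim (vb_base E); r = vb_rank E in
      \<Sum>i<n. \<Sum>j<n. \<Sum>\<alpha><r. \<Sum>\<beta><r. chern_curvature_coeff E h c t x i j \<alpha> \<beta> *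
        u c i * cnj (u c j) * snd t x v \<alpha> * cnj (snd t x v \<beta>))"

text \<open>
  \<open>R\<close> is a tensor, so in the next definition the choice of the chart and of the trivialisation
  around \<open>q\<close> is immaterial.
\<close>

definition RC_positive :: "('a, 'e) vbundle \<Rightarrow> ('a \<Rightarrow> 'e \<Rightarrow> 'e \<Rightarrow> complex) \<Rightarrow> bool" where
  "RC_positive E h \<longleftrightarrow> hermitian_metric E h \<and>
     (\<forall>q\<in>cm_pts (vb_base E). \<forall>v\<in>vs_set (vb_fib E q). v \<noteq> vs_zero (vb_fib E q) \<longrightarrow>
        (\<exists>u\<in>vs_set (tangent_space (vb_base E) q). u \<noteq> vs_zero (tangent_space (vb_base E) q) \<and>
           (\<forall>c\<in>cm_atlas (vb_base E). \<forall>t\<in>vb_triv E. q \<in> fst c \<inter> fst t \<longrightarrow>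
              Re (chern_curvature E h c t q u v) > 0)))"

definition RC_positive_tangent_bundle :: "'a cmfd \<Rightarrow> bool" where
  "RC_positive_tangent_bundle M \<longleftrightarrow> (\<exists>g. RC_positive (tangent_bundle M) g)"

definition ddbar_form :: "'a cmfd \<Rightarrow> ('a \<Rightarrow> real) \<Rightarrow> 'a chart \<Rightarrow> 'a \<Rightarrow> 'a tvec \<Rightarrow> complex" where
  \<comment> \<open>the Hermitian form \<open>\<Sum> \<partial>\<^sub>i \<partial>\<^sub>j F u\<^sub>i u\<^sub>j\<close> (\<open>j\<close> conjugated) of the real (1,1)-form \<open>\<i>\<partial>\<partial>F\<close>\<close>
  "ddbar_form X F c x u = (\<Sum>i<cm_dim X. \<Sum>j<cm_dim X.
     dz i (dzbar j (\<lambda>z. of_real (F (chart_inv c z)))) (snd c x) * u c i * cnj (u c j))"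

text \<open>
  A real (1,1)-form \<open>\<i> \<Sum> a\<^sub>i\<^sub>j dz\<^sub>i \<and> dz\<^sub>j\<close> (second factor conjugated) is identified with the Hermitian
  form \<open>(a\<^sub>i\<^sub>j)\<close>; in particular the form of a Hermitian metric \<open>\<omega>\<close> on a manifold is \<open>u \<mapsto> \<omega>(u, u)\<close>.
  On a line bundle the local weight of \<open>h\<close> is \<open>h(e, e)\<close> for a local holomorphic frame \<open>e\<close>.
  On compact bases nefness does not depend on \<open>\<omega>\<close>.
\<close>

definition nef_wrt :: "('a, 'e) vbundle \<Rightarrow> ('a \<Rightarrow> 'a tvec \<Rightarrow> 'a tvec \<Rightarrow> complex) \<Rightarrow> bool" where
  "nef_wrt L \<omega> \<longleftrightarrow>
     (\<forall>\<epsilon>>0. \<exists>h. hermitian_metric L h \<and>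
        (\<forall>c\<in>cm_atlas (vb_base L). \<forall>t\<in>vb_triv L. \<forall>x\<in>fst c \<inter> fst t.
         \<forall>u\<in>vs_set (tangent_space (vb_base L) x).
           - Re (ddbar_form (vb_base L)
                  (\<lambda>y. ln (Re (h y (vb_frame L t 0 y) (vb_frame L t 0 y)))) c x u)
             \<ge> - \<epsilon> * Re (\<omega> x u u)))"

definition nef_line_bundle :: "('a, 'e) vbundle \<Rightarrow> bool" where
  "nef_line_bundle L \<longleftrightarrow>
     (\<exists>\<omega>. hermitian_metric (tangent_bundle (vb_base L)) \<omega> \<and> nef_wrt L \<omega>)"

definition nef_vector_bundle :: "('a, 'e) vbundle \<Rightarrow> bool" where
  "nef_vector_bundle E \<longleftrightarrow> nef_line_bundle (taut_line_bundle E)"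

end

(*
  Suppose df is not identically zero. On the projectivisation of T_M, where df(v) is nonzero, consider

    (1 - delta) * log |df(v)|_F^2 + delta * (log |df(v)|^2 - auxiliary function) - log g(v, v),

  where |.|_F is the Finsler weight on T_N given by a metric on O(1) over P(T_N) whose curvature is at
  least -epsilon, and the delta-term is the flat norm in one of finitely many charts of N together with a
  bump -A |z - p|^2 / rho^2 that makes the maximum over all charts an interior one. At a maximum take
  the direction u provided by RC-positivity and the lift b of u that makes the line (z + tu, v + tb)
  parallel for g: the Levi form of -log g(v, v) is then the curvature R(u, u, v, v) / g(v, v), bounded
  below by a constant. The Fubini-Study part of the delta-term absorbs the fibre component of the
  epsilon-error, provided epsilon is small against delta, and what remains is O(delta), a contradiction.
  So df vanishes and f is locally constant.
*)
theory Submission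
  imports Defs "HOL-Complex_Analysis.Complex_Analysis" "HOL-Real_Asymp.Real_Asymp" "Jordan_Normal_Form.Determinant"
begin

section \<open>Coordinate space\<close>

text \<open>The difficulty is the fibre direction of P(T_N). The line in M is dictated by the
  curvature of g, so nothing bounds in advance the speed \<open>S\<close> at which the direction of
  df(v) turns: dividing by a small df(v) can make it very large, and nefness permits an error of
  size \<open>\<epsilon> * S\<close>. Shrinking \<open>\<epsilon>\<close> alone does not help,
  because the maximiser moves with it. A strictly positive fibre form beats the error, but a flat
  one exists only chart by chart. On overlaps the squares of two flat norms have ratio at most
  \<open>C1\<close>, and the pieces are the doubled balls of a cover; \<open>A = ln C1\<close> then
  forces a maximiser into |z - p|^2 <= 2 rho^2, short of the boundary 4 rho^2. The order of choices
  is essential: first the bounds \<open>B\<close> for the curvature, for df and for a fixed metric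
  on P(T_N); then \<open>A\<close>, \<open>\<delta>\<close> and \<open>\<epsilon>\<close>; last the
  metric on O(1), of which only the curvature bound is quantitative. The function has degree 0 in v,
  so v can be normalised; the set where df(v) is nonzero is not compact, but the function tends to
  minus infinity at its edge.\<close>

definition cnrm :: "nat \<Rightarrow> cvec \<Rightarrow> real" where
  "cnrm n x = (\<Sum>i<n. cmod (x i))"

text \<open>The l^1 distance, which adds up coordinate by coordinate and so suits telescoping.
  Coordinates from \<open>n\<close> on are ignored, hence it separates points on \<open>Cn n\<close>
  only.\<close>

definition cdist :: "nat \<Rightarrow> cvec \<Rightarrow> cvec \<Rightarrow> real" where
  "cdist n z w = (\<Sum>i<n. cmod (z i - w i))"

lemma cnrm_nonneg [simp]: "0 \<le> cnrm n x"
  by (simp add: cnrm_def sum_nonneg)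

lemma cdist_nonneg [simp]: "0 \<le> cdist n x y"
  by (simp add: cdist_def sum_nonneg)

lemma cdist_self [simp]: "cdist n z z = 0"
  by (simp add: cdist_def)

lemma cdist_triangle: "cdist n x z \<le> cdist n x y + cdist n y z"
  unfolding cdist_def sum.distrib[symmetric]
  by (rule sum_mono) (simp add: dist_norm[symmetric] dist_triangle)

lemma cmod_le_cnrm: "i < n \<Longrightarrow> cmod (x i) \<le> cnrm n x"
  unfolding cnrm_def by (rule member_le_sum) auto

lemma cmod_le_cdist: "i < n \<Longrightarrow> cmod (z i - w i) \<le> cdist n z w"
  unfolding cdist_def by (rule member_le_sum[of i "{..<n}" "\<lambda>i. cmod (z i - w i)"]) auto

lemma cdist_add: "cdist n (\<lambda>i. z i + x i) z = cnrm n x"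
  by (simp add: cdist_def cnrm_def)

lemma cdist_upd:
  assumes "i < n"
  shows "cdist n (z(i := t)) z = cmod (t - z i)"
proof -
  have "cdist n (z(i := t)) z = (\<Sum>j<n. if j = i then cmod (t - z i) else 0)"
    unfolding cdist_def by (rule sum.cong) auto
  then show ?thesis using assms by simp
qed

lemma Cn_upd: "z \<in> Cn n \<Longrightarrow> i < n \<Longrightarrow> z(i := t) \<in> Cn n"
  by (auto simp: Cn_def)

lemma Cn_add: "z \<in> Cn n \<Longrightarrow> w \<in> Cn n \<Longrightarrow> (\<lambda>i. z i + w i) \<in> Cn n"
  by (auto simp: Cn_def)

lemma Cn_scale: "z \<in> Cn n \<Longrightarrow> (\<lambda>i. a * z i) \<in> Cn n"
  by (auto simp: Cn_def)

lemma Cn_eqI: "z \<in> Cn n \<Longrightarrow> w \<in> Cn n \<Longrightarrow> (\<And>i. i < n \<Longrightarrow> z i = w i) \<Longrightarrow> z = w"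
  unfolding Cn_def by (rule ext, rename_tac j, case_tac "j < n") auto

lemma continuous_on_coord [continuous_intros]: "continuous_on S (\<lambda>z::cvec. z i)"
  by (rule continuous_on_product_then_coordinatewise[OF continuous_on_id])

lemma continuous_on_cdist: "continuous_on S (\<lambda>z. cdist n z w)"
  unfolding cdist_def by (intro continuous_intros)

text \<open>A basic open set of the product topology prescribes each coordinate separately. On
  \<open>Cn n\<close> the coordinates from \<open>n\<close> on are all 0 and agree automatically, so
  only finitely many conditions remain, and a small \<open>cdist\<close> meets them.\<close>

lemma open_fun_box:
  fixes T :: "cvec set"
  assumes "open T" "z \<in> T"
  shows "\<exists>d>0. \<forall>w\<in>Cn n. z \<in> Cn n \<longrightarrow> cdist n w z < d \<longrightarrow> w \<in> T"
proof -
  obtain X where X: "z \<in> Pi\<^sub>E UNIV X" "\<And>i. open (X i)" "finite {i. X i \<noteq> UNIV}" "Pi\<^sub>E UNIV X \<subseteq> T"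
    using product_topology_open_contains_basis[of "\<lambda>_. euclidean" UNIV T z] assms
    by (auto simp: open_fun_def)
  have "\<forall>i. \<exists>e>0. ball (z i) e \<subseteq> X i"
    using X(1,2) by (auto simp: open_contains_ball PiE_iff)
  then obtain e where e: "\<And>i. e i > 0" "\<And>i. ball (z i) (e i) \<subseteq> X i" by metis
  \<comment> \<open>The inserted 1 keeps the set nonempty when \<open>n = 0\<close>; the same device
    recurs below.\<close>
  define d where "d = Min (insert 1 (e ` {..<n}))"
  have d: "d > 0" "\<And>i. i < n \<Longrightarrow> d \<le> e i"
    unfolding d_def using e by auto
  have "w \<in> T" if w: "w \<in> Cn n" "z \<in> Cn n" "cdist n w z < d" for w
  proof -
    have "w i \<in> X i" for i
    proof (cases "i < n")
      case True
      then have "cmod (w i - z i) < e i"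
        using cmod_le_cdist[of i n w z] w d(2)[of i] by linarith
      then show ?thesis using e(2)[of i] by (auto simp: dist_norm norm_minus_commute)
    next
      case False
      then have "w i = z i" using w by (auto simp: Cn_def)
      then show ?thesis using X(1) by (auto simp: PiE_iff)
    qed
    then show ?thesis using X(4) by (auto simp: PiE_iff)
  qed
  then show ?thesis using d(1) by blast
qed

lemma open_Cn_iff:
  "open_Cn n U \<longleftrightarrow> U \<subseteq> Cn n \<and> (\<forall>z\<in>U. \<exists>d>0. \<forall>w\<in>Cn n. cdist n w z < d \<longrightarrow> w \<in> U)"
proof safe
  fix z assume "open_Cn n U" "z \<in> U"
  then obtain T where T: "open T" "U = Cn n \<inter> T"
    unfolding open_Cn_def openin_open by auto
  with \<open>z \<in> U\<close> open_fun_box[of T z n]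
  show "\<exists>d>0. \<forall>w\<in>Cn n. cdist n w z < d \<longrightarrow> w \<in> U" by auto
next
  fix z assume "open_Cn n U" "z \<in> U"
  then show "z \<in> Cn n" unfolding open_Cn_def openin_open by auto
next
  assume U: "U \<subseteq> Cn n" and *: "\<forall>z\<in>U. \<exists>d>0. \<forall>w\<in>Cn n. cdist n w z < d \<longrightarrow> w \<in> U"
  then obtain d where d: "\<And>z. z \<in> U \<Longrightarrow> d z > 0"
    "\<And>z w. z \<in> U \<Longrightarrow> w \<in> Cn n \<Longrightarrow> cdist n w z < d z \<Longrightarrow> w \<in> U" by metis
  define T where "T = (\<Union>z\<in>U. {w. cdist n w z < d z})"
  have "open T" unfolding T_def
    by (intro open_UN ballI open_Collect_less continuous_on_cdist continuous_on_const)
  moreover have "U = Cn n \<inter> T"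
    unfolding T_def using U d by (auto intro!: bexI)
  ultimately show "open_Cn n U" unfolding open_Cn_def openin_open by blast
qed

lemma open_CnE:
  assumes "open_Cn n U" "z \<in> U"
  obtains d where "d > 0" "\<And>w. w \<in> Cn n \<Longrightarrow> cdist n w z < d \<Longrightarrow> w \<in> U" "z \<in> Cn n"
  using assms open_Cn_iff by (meson subsetD)

lemma open_Cn_Int: "open_Cn n U \<Longrightarrow> open_Cn n V \<Longrightarrow> open_Cn n (U \<inter> V)"
  unfolding open_Cn_def by (rule openin_Int)

lemma open_Cn_UN: "(\<And>i. i \<in> I \<Longrightarrow> open_Cn n (U i)) \<Longrightarrow> open_Cn n (\<Union>i\<in>I. U i)"
  unfolding open_Cn_def by blast

lemma open_Cn_ball: "open_Cn n {w \<in> Cn n. cdist n w z < d}"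
proof -
  have "open {w. cdist n w z < d}"
    by (intro open_Collect_less continuous_on_cdist continuous_on_const)
  then show ?thesis unfolding open_Cn_def openin_open by blast
qed

lemma open_Cn_subset: "open_Cn n U \<Longrightarrow> U \<subseteq> Cn n"
  by (simp add: open_Cn_iff)

lemma open_Cn_vimage:
  assumes "open_Cn n U" "continuous_on U f" "f ` U \<subseteq> Cn m" "open_Cn m V"
  shows "open_Cn n {z\<in>U. f z \<in> V}"
proof -
  obtain T where T: "open T" "V = Cn m \<inter> T"
    using assms(4) unfolding open_Cn_def openin_open by auto
  have "openin (top_of_set U) (U \<inter> f -` T)"
    using assms(2) T(1) by (rule continuous_openin_preimage_gen)
  then have "openin (top_of_set (Cn n)) (U \<inter> f -` T)"
    using assms(1) openin_trans unfolding open_Cn_def by blast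
  moreover have "U \<inter> f -` T = {z\<in>U. f z \<in> V}" using T assms(3) by auto
  ultimately show ?thesis by (simp add: open_Cn_def)
qed

lemma continuous_on_Cn_iff:
  fixes f :: "cvec \<Rightarrow> 'a::metric_space"
  assumes U: "open_Cn n U"
  shows "continuous_on U f \<longleftrightarrow>
    (\<forall>z\<in>U. \<forall>e>0. \<exists>d>0. \<forall>w\<in>Cn n. cdist n w z < d \<longrightarrow> w \<in> U \<and> dist (f w) (f z) < e)"
proof safe
  fix z and e::real assume f: "continuous_on U f" and "z \<in> U" "e > 0"
  then obtain A where A: "open A" "z \<in> A" "\<And>y. y \<in> U \<Longrightarrow> y \<in> A \<Longrightarrow> f y \<in> ball (f z) e"
    unfolding continuous_on_topological by (metis centre_in_ball open_ball)
  have "z \<in> Cn n" using U \<open>z\<in>U\<close> open_Cn_iff by blast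
  obtain d1 where d1: "d1 > 0" "\<And>w. w \<in> Cn n \<Longrightarrow> cdist n w z < d1 \<Longrightarrow> w \<in> A"
    using open_fun_box[OF A(1,2), of n] \<open>z \<in> Cn n\<close> by blast
  obtain d2 where d2: "d2 > 0" "\<And>w. w \<in> Cn n \<Longrightarrow> cdist n w z < d2 \<Longrightarrow> w \<in> U"
    using open_CnE[OF U \<open>z \<in> U\<close>] by blast
  show "\<exists>d>0. \<forall>w\<in>Cn n. cdist n w z < d \<longrightarrow> w \<in> U \<and> dist (f w) (f z) < e"
    using d1 d2 A(3) by (intro exI[of _ "min d1 d2"]) (auto simp: dist_commute)
next
  assume *: "\<forall>z\<in>U. \<forall>e>0. \<exists>d>0. \<forall>w\<in>Cn n. cdist n w z < d \<longrightarrow> w \<in> U \<and> dist (f w) (f z) < e"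
  show "continuous_on U f"
    unfolding continuous_on_topological
  proof safe
    fix z B assume "z \<in> U" "open B" "f z \<in> B"
    then obtain e where e: "e > 0" "ball (f z) e \<subseteq> B" by (auto simp: open_contains_ball)
    obtain d where d: "d > 0" "\<And>w. w\<in>Cn n \<Longrightarrow> cdist n w z < d \<Longrightarrow> dist (f w) (f z) < e"
      using * \<open>z\<in>U\<close> e(1) by blast
    have "open {w. cdist n w z < d}"
      by (intro open_Collect_less continuous_on_cdist continuous_on_const)
    moreover have "z \<in> {w. cdist n w z < d}" using d by auto
    moreover have "\<forall>y\<in>U. y \<in> {w. cdist n w z < d} \<longrightarrow> f y \<in> B"
      using d(2) e(2) U open_Cn_subset by (fastforce simp: dist_commute)
    ultimately show "\<exists>A. open A \<and> z \<in> A \<and> (\<forall>y\<in>U. y \<in> A \<longrightarrow> f y \<in> B)" by blast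
  qed
qed

lemma continuous_on_CnE:
  fixes f :: "cvec \<Rightarrow> 'a::metric_space"
  assumes "open_Cn n U" "continuous_on U f" "z \<in> U" "e > 0"
  obtains d where "d > 0" "\<And>w. w \<in> Cn n \<Longrightarrow> cdist n w z < d \<Longrightarrow> w \<in> U \<and> dist (f w) (f z) < e"
  using assms continuous_on_Cn_iff by metis

text \<open>Tychonoff's theorem, with the factor \<open>{0}\<close> in every coordinate from
  \<open>n\<close> on.\<close>

lemma compact_Cn_box:
  assumes "\<And>i. i < n \<Longrightarrow> compact (S i)"
  shows "compact {z \<in> Cn n. \<forall>i<n. z i \<in> S i}"
proof -
  let ?S = "\<lambda>i. if i < n then S i else {0}"
  have "compactin (product_topology (\<lambda>_. euclidean) UNIV) (Pi\<^sub>E UNIV ?S)"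
    unfolding compactin_PiE using assms by auto
  then have "compact (Pi\<^sub>E UNIV ?S)"
    by (simp add: euclidean_product_topology)
  moreover have "Pi\<^sub>E UNIV ?S = {z \<in> Cn n. \<forall>i<n. z i \<in> S i}"
    by (auto simp: PiE_iff Cn_def split: if_splits)
  ultimately show ?thesis by simp
qed

text \<open>Telescoping over the coordinates reduces a many-variable increment to real one-variable ones.\<close>

lemma telescope_coords:
  fixes f :: "cvec \<Rightarrow> complex"
  assumes z: "z \<in> Cn n" and x: "x \<in> Cn n" and e: "0 \<le> e"
    and step: "\<And>w i c a. w \<in> Cn n \<Longrightarrow> i < n \<Longrightarrow> c \<in> {1, \<i>} \<Longrightarrow> cdist n w z + \<bar>a\<bar> \<le> 2 * cnrm n x \<Longrightarrow>
       cmod (f (w(i := w i + of_real a * c)) - f w - of_real a * D i c) \<le> e * \<bar>a\<bar>"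
  shows "cmod (f (\<lambda>i. z i + x i) - f z - (\<Sum>i<n. of_real (Re (x i)) * D i 1 + of_real (Im (x i)) * D i \<i>))
     \<le> 2 * e * cnrm n x"
proof -
  define p where "p m = (\<lambda>i. if i < m then z i + x i else z i)" for m
  have pC: "p m \<in> Cn n" for m using z x by (auto simp: p_def Cn_def)
  have pd: "cdist n (p m) z = (\<Sum>i<min m n. cmod (x i))" for m
  proof -
    have "cdist n (p m) z = (\<Sum>i<n. if i < m then cmod (x i) else 0)"
      by (auto simp: cdist_def p_def intro!: sum.cong)
    also have "\<dots> = (\<Sum>i\<in>{..<n} \<inter> {i. i < m}. cmod (x i))" by (simp add: sum.If_cases)
    also have "{..<n} \<inter> {i. i < m} = {..<min m n}" by auto
    finally show ?thesis .
  qed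
  have A: "cmod (f (p (Suc i)) - f (p i) - (of_real (Re (x i)) * D i 1 + of_real (Im (x i)) * D i \<i>))
      \<le> 2 * e * cmod (x i)" if i: "i < n" for i
  proof -
    \<comment> \<open>Each coordinate moves first by its real and then by its imaginary part. The
      way travelled is at most twice \<open>cmod (x i)\<close>, which accounts for the factor 2 both
      in the hypothesis on the steps and in the final bound.\<close>
    define w where "w = (p i)(i := p i i + of_real (Re (x i)) * 1)"
    have wC: "w \<in> Cn n" unfolding w_def by (rule Cn_upd[OF pC i])
    have s: "(\<Sum>i<i. cmod (x i)) + cmod (x i) \<le> cnrm n x"
      unfolding cnrm_def using i sum_mono2[of "{..<n}" "{..<Suc i}" "\<lambda>i. cmod (x i)"] by auto
    have pi: "cdist n (p i) z = (\<Sum>i<i. cmod (x i))" using i by (simp add: pd min_def)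
    have dw: "cdist n w z \<le> cdist n (p i) z + cmod (x i)"
      using cdist_triangle[of n w z "p i"] cdist_upd[OF i, of "p i"] abs_Re_le_cmod[of "x i"]
      by (simp add: w_def)
    have "cmod (f w - f (p i) - of_real (Re (x i)) * D i 1) \<le> e * \<bar>Re (x i)\<bar>"
      unfolding w_def
    proof (rule step[OF pC i])
      show "cdist n (p i) z + \<bar>Re (x i)\<bar> \<le> 2 * cnrm n x"
        using s pi abs_Re_le_cmod[of "x i"] cnrm_nonneg[of n x] by linarith
    qed auto
    moreover have "cmod (f (w(i := w i + of_real (Im (x i)) * \<i>)) - f w - of_real (Im (x i)) * D i \<i>) \<le> e * \<bar>Im (x i)\<bar>"
      using s pi dw abs_Im_le_cmod[of "x i"] sum_nonneg[of "{..<i}" "\<lambda>i. cmod (x i)"]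
      by (intro step[OF wC i]) auto
    moreover have "w(i := w i + of_real (Im (x i)) * \<i>) = p (Suc i)"
      by (auto simp: w_def p_def complex_eq_iff fun_eq_iff)
    moreover have "e * \<bar>Re (x i)\<bar> + e * \<bar>Im (x i)\<bar> \<le> 2 * e * cmod (x i)"
      using mult_left_mono[OF abs_Re_le_cmod[of "x i"] e] mult_left_mono[OF abs_Im_le_cmod[of "x i"] e] by simp
    moreover have "f (p (Suc i)) - f (p i) - (of_real (Re (x i)) * D i 1 + of_real (Im (x i)) * D i \<i>)
      = (f w - f (p i) - of_real (Re (x i)) * D i 1) + (f (p (Suc i)) - f w - of_real (Im (x i)) * D i \<i>)"
      by simp
    ultimately show ?thesis
      by (smt (verit, del_insts) norm_triangle_ineq)
  qed
  have "f (\<lambda>i. z i + x i) - f z = (\<Sum>i<n. f (p (Suc i)) - f (p i))"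
  proof -
    have "p n = (\<lambda>i. z i + x i)" "p 0 = z" using x by (auto simp: p_def Cn_def)
    then show ?thesis using sum_lessThan_telescope[of "\<lambda>i. f (p i)" n] by simp
  qed
  then have "cmod (f (\<lambda>i. z i + x i) - f z - (\<Sum>i<n. of_real (Re (x i)) * D i 1 + of_real (Im (x i)) * D i \<i>))
    = cmod (\<Sum>i<n. f (p (Suc i)) - f (p i) - (of_real (Re (x i)) * D i 1 + of_real (Im (x i)) * D i \<i>))"
    by (simp add: sum_subtractf)
  also have "\<dots> \<le> (\<Sum>i<n. 2 * e * cmod (x i))"
    using A by (intro sum_norm_le) auto
  also have "\<dots> = 2 * e * cnrm n x" by (simp add: cnrm_def sum_distrib_left)
  finally show ?thesis .
qed

text \<open>\<open>real_partial\<close> is a derivative at parameter 0. Translating the parameter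
  makes it the derivative at any \<open>t\<close> of one and the same line, as the mean value
  inequality requires.\<close>

lemma real_partial_line:
  assumes "\<And>t. t \<in> S \<Longrightarrow> (\<lambda>s::real. f ((w(i := w i + of_real t * c))(i := (w(i := w i + of_real t * c)) i + of_real s * c)))
     differentiable at 0" and "t \<in> S"
  shows "((\<lambda>t::real. f (w(i := w i + of_real t * c))) has_vector_derivative
     real_partial i c f (w(i := w i + of_real t * c))) (at t)"
proof -
  let ?w = "w(i := w i + of_real t * c)"
  have "((\<lambda>s::real. f (?w(i := ?w i + of_real s * c))) has_vector_derivative real_partial i c f ?w) (at 0)"
    unfolding real_partial_def using assms vector_derivative_works by blast
  then have "((\<lambda>s::real. f (w(i := w i + of_real (t + s) * c))) has_vector_derivative real_partial i c f ?w) (at (t - t))"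
    by (simp add: algebra_simps)
  moreover have "((\<lambda>x. x - t) has_vector_derivative 1) (at t)"
    by (auto intro!: derivative_eq_intros simp: has_vector_derivative_def)
  ultimately show ?thesis
    using vector_diff_chain_at[of "\<lambda>x. x - t" 1 t "\<lambda>s::real. f (w(i := w i + of_real (t + s) * c))" "real_partial i c f ?w"]
    by (simp add: o_def)
qed

section \<open>First-order Taylor expansion from continuous partial derivatives\<close>

lemma onorm_scaleR_le:
  fixes v :: "'a::real_normed_vector"
  assumes "norm v \<le> B"
  shows "onorm (\<lambda>h::real. h *\<^sub>R v) \<le> B"
proof (rule onorm_le)
  show "norm (h *\<^sub>R v) \<le> B * norm h" for h :: real
    using mult_right_mono[OF assms, of "\<bar>h\<bar>"] by (simp add: mult.commute)
qed

text \<open>The real differential of \<open>f\<close> at \<open>z\<close>, applied to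
  \<open>x\<close>. It is written in real coordinates because \<open>Ck_on\<close> speaks of
  derivatives along the real and imaginary axes.\<close>

definition dd :: "nat \<Rightarrow> (cvec \<Rightarrow> complex) \<Rightarrow> cvec \<Rightarrow> cvec \<Rightarrow> complex" where
  "dd n f z x = (\<Sum>i<n. of_real (Re (x i)) * real_partial i 1 f z + of_real (Im (x i)) * real_partial i \<i> f z)"

lemma Ck_on_1_D:
  assumes "Ck_on n (Suc k) U f" "i < n" "c \<in> {1, \<i>}"
  shows "Ck_on n k U (real_partial i c f)"
    "z \<in> U \<Longrightarrow> (\<lambda>t::real. f (z(i := z i + of_real t * c))) differentiable at 0"
  using assms by auto

lemma Ck_on_cont: "Ck_on n k U f \<Longrightarrow> continuous_on U f"
  by (cases k) auto

lemma Ck_on_mono1: "Ck_on n (Suc k) U f \<Longrightarrow> Ck_on n k U f"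
proof (induction k arbitrary: f)
  case (Suc k)
  have "Ck_on n k U (real_partial i c f)" if "i < n" "c \<in> {1,\<i>}" for i c
    using Suc.prems that unfolding Ck_on.simps(2)[of n "Suc k"] by (intro Suc.IH) blast
  then show ?case using Suc.prems by simp
qed (auto simp: Ck_on_cont)

text \<open>Continuous partial derivatives give total differentiability: on each axis-parallel piece
  of the telescope the mean value inequality bounds the error by the oscillation of one partial
  derivative near \<open>z\<close>.\<close>

lemma C1_Taylor:
  assumes f: "Ck_on n 1 U f" and U: "open_Cn n U" and z: "z \<in> U" and e: "e > 0"
  shows "\<exists>d>0. \<forall>x\<in>Cn n. cnrm n x < d \<longrightarrow> (\<lambda>i. z i + x i) \<in> U \<and>
     cmod (f (\<lambda>i. z i + x i) - f z - dd n f z x) \<le> e * cnrm n x"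
proof -
  have zC: "z \<in> Cn n" using open_CnE[OF U z] by blast
  have "\<exists>d>0. \<forall>w\<in>Cn n. cdist n w z < d \<longrightarrow> w \<in> U \<and> cmod (real_partial (fst ic) (snd ic) f w - real_partial (fst ic) (snd ic) f z) < e / 2"
    if "ic \<in> {..<n} \<times> {1,\<i>}" for ic
  proof -
    have "continuous_on U (real_partial (fst ic) (snd ic) f)"
      using f that by auto
    then show ?thesis
      using continuous_on_CnE[OF U _ z, of _ "e/2"] e by (metis half_gt_zero dist_norm)
  qed
  then obtain D where D: "\<And>ic. ic \<in> {..<n} \<times> {1,\<i>} \<Longrightarrow> D ic > 0"
    "\<And>ic w. ic \<in> {..<n} \<times> {1,\<i>} \<Longrightarrow> w\<in>Cn n \<Longrightarrow> cdist n w z < D ic \<Longrightarrow> w \<in> U \<and> cmod (real_partial (fst ic) (snd ic) f w - real_partial (fst ic) (snd ic) f z) < e / 2"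
    by metis
  obtain d0 where d0: "d0 > 0" "\<And>w. w \<in> Cn n \<Longrightarrow> cdist n w z < d0 \<Longrightarrow> w \<in> U"
    using open_CnE[OF U z] by blast
  define d where "d = Min (insert d0 (D ` ({..<n} \<times> {1,\<i>})))"
  have d: "d > 0" "d \<le> d0" "\<And>ic. ic \<in> {..<n} \<times> {1,\<i>} \<Longrightarrow> d \<le> D ic"
  proof -
    have "\<And>y. y \<in> insert d0 (D ` ({..<n} \<times> {1,\<i>})) \<Longrightarrow> y > 0" using D(1) d0(1) by blast
    then show "d > 0" unfolding d_def by (subst Min_gr_iff) auto
    show "d \<le> d0" "\<And>ic. ic \<in> {..<n} \<times> {1,\<i>} \<Longrightarrow> d \<le> D ic"
      unfolding d_def by (intro Min_le; simp)+
  qed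
  show ?thesis
  \<comment> \<open>The telescope may leave \<open>z\<close> by twice \<open>cnrm n x\<close>, hence
    half of \<open>d\<close>; its factor 2 in the error is compensated by the oscillation bound
    \<open>e / 2\<close>.\<close>
  proof (intro exI[of _ "d/2"] conjI ballI impI)
    show "d/2 > 0" using d by simp
    fix x assume x: "x \<in> Cn n" "cnrm n x < d/2"
    have "(\<lambda>i. z i + x i) \<in> Cn n" using zC x by (intro Cn_add)
    then show "(\<lambda>i. z i + x i) \<in> U"
      using d(1,2) x cdist_add[of n z x] by (intro d0(2)) auto
    have "cmod (f (\<lambda>i. z i + x i) - f z - dd n f z x) \<le> 2 * (e/2) * cnrm n x"
      unfolding dd_def
    proof (rule telescope_coords[OF zC x(1)])
      fix w i c a
      assume w: "w \<in> Cn n" "i < n" "c \<in> {1,\<i>}" "cdist n w z + \<bar>a\<bar> \<le> 2 * cnrm n x"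
      have c1: "cmod c = 1" using w by auto
      have near: "cdist n (w(i := w i + of_real t * c)) z < d" if "t \<in> closed_segment 0 a" for t
      proof -
        have "\<bar>t\<bar> \<le> \<bar>a\<bar>" using that by (auto simp: closed_segment_eq_real_ivl split: if_splits)
        moreover have "cdist n (w(i := w i + of_real t * c)) w = \<bar>t\<bar>"
          using w c1 by (simp add: cdist_upd norm_mult)
        ultimately show ?thesis using cdist_triangle[of n "w(i := w i + of_real t * c)" z w] w x by simp
      qed
      have inC: "w(i := w i + of_real t * c) \<in> Cn n" for t using w by (intro Cn_upd)
      have "norm (f (w(i := w i + of_real a * c)) - f w - (a - 0) *\<^sub>R real_partial i c f z)
          = norm ((f (w(i := w i + of_real a * c)) - of_real a * real_partial i c f z) - (f (w(i := w i + of_real 0 * c)) - of_real 0 * real_partial i c f z))"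
        by (simp add: scaleR_conv_of_real algebra_simps)
      also have "\<dots> \<le> (e/2) * norm (a - 0)"
      proof (rule differentiable_bound[of "closed_segment 0 a" "\<lambda>t. f (w(i := w i + of_real t * c)) - of_real t * real_partial i c f z"
            "\<lambda>t h. h *\<^sub>R (real_partial i c f (w(i := w i + of_real t * c)) - real_partial i c f z)" "e/2" a 0])
        fix t assume t: "t \<in> closed_segment 0 a"
        have "((\<lambda>t. f (w(i := w i + of_real t * c)) - of_real t * real_partial i c f z) has_vector_derivative
           real_partial i c f (w(i := w i + of_real t * c)) - real_partial i c f z) (at t)"
        proof (rule has_vector_derivative_diff)
          show "((\<lambda>t. f (w(i := w i + of_real t * c))) has_vector_derivative
               real_partial i c f (w(i := w i + of_real t * c))) (at t)"
          proof (rule real_partial_line[OF _ t])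
            fix t assume "t \<in> closed_segment 0 a"
            then show "(\<lambda>s::real. f ((w(i := w i + of_real t * c))(i := (w(i := w i + of_real t * c)) i + of_real s * c)))
             differentiable at 0"
              using w(2,3) f d0(2)[OF inC[of t]] near[of t] d(2)
              by (intro Ck_on_1_D(2)[of n 0 U f i c]) auto
          qed
          show "((\<lambda>t. of_real t * real_partial i c f z) has_vector_derivative real_partial i c f z) (at t)"
            by (auto intro!: derivative_eq_intros simp: has_vector_derivative_def scaleR_conv_of_real)
        qed
        then show "((\<lambda>t. f (w(i := w i + of_real t * c)) - of_real t * real_partial i c f z) has_derivative
          (\<lambda>h. h *\<^sub>R (real_partial i c f (w(i := w i + of_real t * c)) - real_partial i c f z))) (at t within closed_segment 0 a)"
          unfolding has_vector_derivative_def by (rule has_derivative_at_withinI)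
        have "cmod (real_partial i c f (w(i := w i + of_real t * c)) - real_partial i c f z) < e/2"
          using D(2)[of "(i,c)" "w(i := w i + of_real t * c)"] near[OF t] d(3)[of "(i,c)"] w inC by auto
        then show "onorm (\<lambda>h. h *\<^sub>R (real_partial i c f (w(i := w i + of_real t * c)) - real_partial i c f z)) \<le> e/2"
          by (intro onorm_scaleR_le) simp
      qed auto
      finally show "cmod (f (w(i := w i + of_real a * c)) - f w - of_real a * real_partial i c f z) \<le> e/2 * \<bar>a\<bar>"
        by (simp add: scaleR_conv_of_real)
    qed (use e in auto)
    then show "cmod (f (\<lambda>i. z i + x i) - f z - dd n f z x) \<le> e * cnrm n x" by simp
  qed
qed

section \<open>Second-order expansions\<close>

text \<open>A curve differentiable at \<open>t0\<close> grows at most linearly there, and this turns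
  the remainder of \<open>C1_Taylor\<close> into one that is small in \<open>t - t0\<close>. The
  parameter space is an arbitrary normed space, so that real and complex parameters are both
  covered.\<close>

lemma C1_chain:
  fixes p :: "'a::real_normed_vector \<Rightarrow> cvec"
  assumes f: "Ck_on n 1 U f" and U: "open_Cn n U" and z: "p t0 \<in> U"
    and pC: "\<And>t. p t \<in> Cn n"
    and P: "\<And>i. i < n \<Longrightarrow> ((\<lambda>t. p t i) has_derivative P i) (at t0)"
  shows "((\<lambda>t. f (p t)) has_derivative (\<lambda>h. dd n f (p t0) (\<lambda>i. P i h))) (at t0)"
proof -
  define z where "z = p t0"
  define x where "x t = (\<lambda>i. p t i - z i)" for t
  define R where "R t = f (p t) - f z - dd n f z (x t)" for t
  have xC: "x t \<in> Cn n" for t using pC[of t] pC[of t0] by (auto simp: x_def z_def Cn_def)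
  have zx: "(\<lambda>i. z i + x t i) = p t" for t by (simp add: x_def)
  have "\<exists>B d. B > 0 \<and> d > 0 \<and> (\<forall>t. norm (t - t0) < d \<longrightarrow> cmod (x t i) \<le> B * norm (t - t0))" if i: "i < n" for i
  proof -
    interpret bounded_linear "P i" using P[OF i] by (rule has_derivative_bounded_linear)
    obtain K where K: "K > 0" "\<And>h. norm (P i h) \<le> norm h * K" using pos_bounded by blast
    obtain d where d: "d > 0" "\<And>t. norm (t - t0) < d \<Longrightarrow> norm (p t i - p t0 i - P i (t - t0)) \<le> 1 * norm (t - t0)"
      using P[OF i] unfolding has_derivative_at_alt by (metis less_numeral_extra(1))
    have "cmod (x t i) \<le> (K + 1) * norm (t - t0)" if "norm (t - t0) < d" for t
      using d(2)[OF that] K(2)[of "t - t0"] norm_triangle_sub[of "x t i" "P i (t - t0)"]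
      by (simp add: x_def z_def algebra_simps)
    then show ?thesis using K d by (intro exI[of _ "K+1"] exI[of _ d]) auto
  qed
  then obtain B d where Bd: "\<And>i. i < n \<Longrightarrow> B i > 0" "\<And>i. i < n \<Longrightarrow> d i > 0"
    "\<And>i t. i < n \<Longrightarrow> norm (t - t0) < d i \<Longrightarrow> cmod (x t i) \<le> B i * norm (t - t0)" by metis
  define C where "C = 1 + (\<Sum>i<n. B i)"
  define D where "D = Min (insert 1 (d ` {..<n}))"
  have C: "C > 0" unfolding C_def using Bd(1) by (intro add_pos_nonneg sum_nonneg) (auto simp: less_imp_le)
  have D: "D > 0" "\<And>i. i < n \<Longrightarrow> D \<le> d i" unfolding D_def using Bd(2) by auto
  have xB: "cnrm n (x t) \<le> C * norm (t - t0)" if t: "norm (t - t0) < D" for t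
  proof -
    have "cnrm n (x t) \<le> (\<Sum>i<n. B i * norm (t - t0))"
      unfolding cnrm_def using D(2) t by (intro sum_mono Bd(3)) force+
    also have "\<dots> \<le> C * norm (t - t0)"
      unfolding C_def by (simp add: sum_distrib_right[symmetric] algebra_simps)
    finally show ?thesis .
  qed
  have R: "(R has_derivative (\<lambda>h. 0)) (at t0)"
    unfolding has_derivative_at_alt
  proof (intro conjI allI impI)
    fix e::real assume "e > 0"
    then have "e / C > 0" using C by simp
    then obtain d' where d': "d' > 0" "\<And>x. x \<in> Cn n \<Longrightarrow> cnrm n x < d' \<Longrightarrow>
      cmod (f (\<lambda>i. z i + x i) - f z - dd n f z x) \<le> e / C * cnrm n x"
      using C1_Taylor[OF f U z, of "e/C"] by (auto simp: z_def)
    have "norm (R t - R t0 - 0) \<le> e * norm (t - t0)" if t: "norm (t - t0) < min D (d' / C)" for t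
    proof -
      have "cnrm n (x t) < d'" using xB[of t] t C by (simp add: field_simps)
      then have "cmod (R t) \<le> e / C * cnrm n (x t)"
        using d'(2)[OF xC[of t]] unfolding R_def zx by simp
      also have "\<dots> \<le> e / C * (C * norm (t - t0))"
        using xB[of t] t \<open>e / C > 0\<close> by (intro mult_left_mono) auto
      also have "\<dots> = e * norm (t - t0)" using C by simp
      finally have "cmod (R t) \<le> e * norm (t - t0)" .
      moreover have "R t0 = 0" by (simp add: R_def x_def z_def dd_def)
      ultimately show ?thesis by simp
    qed
    then show "\<exists>d>0. \<forall>y. norm (y - t0) < d \<longrightarrow> norm (R y - R t0 - 0) \<le> e * norm (y - t0)"
      using D(1) d'(1) C by (intro exI[of _ "min D (d' / C)"]) auto
  qed auto
  have L: "((\<lambda>t. dd n f z (x t)) has_derivative (\<lambda>h. dd n f z (\<lambda>i. P i h))) (at t0)"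
  proof -
    have "((\<lambda>t. of_real (Re (x t i)) * real_partial i 1 f z + of_real (Im (x t i)) * real_partial i \<i> f z)
       has_derivative (\<lambda>h. of_real (Re (P i h)) * real_partial i 1 f z + of_real (Im (P i h)) * real_partial i \<i> f z)) (at t0)"
      if "i < n" for i
      unfolding x_def by (auto intro!: derivative_eq_intros has_derivative_of_real P[OF that])
    then show ?thesis unfolding dd_def by (intro has_derivative_sum) auto
  qed
  have "((\<lambda>t. f z + dd n f z (x t) + R t) has_derivative (\<lambda>h. 0 + dd n f z (\<lambda>i. P i h) + 0)) (at t0)"
    by (intro has_derivative_add has_derivative_const L R)
  moreover have "(\<lambda>t. f z + dd n f z (x t) + R t) = (\<lambda>t. f (p t))" by (auto simp: R_def)
  ultimately show ?thesis by (simp add: z_def)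
qed

lemma dd_scale_real: "dd n f z (\<lambda>i. of_real s * x i) = of_real s * dd n f z x"
  by (simp add: dd_def sum_distrib_left algebra_simps)

lemma C1_line:
  assumes f: "Ck_on n 1 U f" and U: "open_Cn n U" and z: "(\<lambda>i. z i + of_real s * x i) \<in> U"
    and zC: "z \<in> Cn n" and xC: "x \<in> Cn n"
  shows "((\<lambda>s::real. f (\<lambda>i. z i + of_real s * x i)) has_derivative
     (\<lambda>h. dd n f (\<lambda>i. z i + of_real s * x i) (\<lambda>i. of_real h * x i))) (at s)"
proof -
  define p where "p s = (\<lambda>i. z i + of_real s * x i)" for s :: real
  have "((\<lambda>t. f (p t)) has_derivative (\<lambda>h. dd n f (p s) (\<lambda>i. of_real h * x i))) (at s)"
  proof (rule C1_chain[OF f U])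
    show "p s \<in> U" using z by (simp add: p_def)
    show "p t \<in> Cn n" for t unfolding p_def using zC xC by (intro Cn_add Cn_scale)
    show "((\<lambda>t. p t i) has_derivative (\<lambda>h. of_real h * x i)) (at s)" for i
      unfolding p_def by (auto intro!: derivative_eq_intros has_derivative_of_real)
  qed
  then show ?thesis by (simp add: p_def)
qed

text \<open>The derivative of \<open>f\<close> along \<open>x\<close>, then along \<open>y\<close>.
  The two slots are kept apart; their antisymmetric part reappears as
  \<open>levi_skew\<close>.\<close>

definition ddB :: "nat \<Rightarrow> (cvec \<Rightarrow> complex) \<Rightarrow> cvec \<Rightarrow> cvec \<Rightarrow> cvec \<Rightarrow> complex" where
  "ddB n f z y x = (\<Sum>i<n. of_real (Re (x i)) * dd n (real_partial i 1 f) z y + of_real (Im (x i)) * dd n (real_partial i \<i> f) z y)"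

text \<open>On the segment from \<open>z\<close> to \<open>z + x\<close> the defect \<open>g\<close>
  has a derivative of size at most \<open>e * (cnrm n x)\<^sup>2\<close>, by
  \<open>C1_Taylor\<close> for every first partial derivative; the mean value inequality on
  \<open>{0..1}\<close> then gives the claim.\<close>

lemma C2_Taylor:
  assumes f: "Ck_on n 2 U f" and U: "open_Cn n U" and z: "z \<in> U" and e: "e > 0"
  shows "\<exists>d>0. \<forall>x\<in>Cn n. cnrm n x < d \<longrightarrow> (\<lambda>i. z i + x i) \<in> U \<and>
     cmod (f (\<lambda>i. z i + x i) - f z - dd n f z x - ddB n f z x x / 2) \<le> e * (cnrm n x)\<^sup>2"
proof -
  have f1: "Ck_on n 1 U f" using f Ck_on_mono1[of n 1 U f] by (simp add: numeral_2_eq_2)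
  have fp: "Ck_on n 1 U (real_partial i c f)" if "i < n" "c \<in> {1,\<i>}" for i c
    using Ck_on_1_D(1)[of n "Suc 0" U f i c] f that unfolding numeral_2_eq_2 One_nat_def by blast
  have zC: "z \<in> Cn n" using open_CnE[OF U z] by blast
  have "\<exists>d>0. \<forall>x\<in>Cn n. cnrm n x < d \<longrightarrow> (\<lambda>i. z i + x i) \<in> U \<and>
     cmod (real_partial (fst ic) (snd ic) f (\<lambda>i. z i + x i) - real_partial (fst ic) (snd ic) f z
      - dd n (real_partial (fst ic) (snd ic) f) z x) \<le> e/2 * cnrm n x" if "ic \<in> {..<n} \<times> {1,\<i>}" for ic
    using that e by (intro C1_Taylor[OF fp U z]) auto
  then have "\<forall>ic\<in>{..<n} \<times> {1,\<i>}. \<exists>d. d > 0 \<and> (\<forall>x\<in>Cn n. cnrm n x < d \<longrightarrow>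
     cmod (real_partial (fst ic) (snd ic) f (\<lambda>i. z i + x i) - real_partial (fst ic) (snd ic) f z
      - dd n (real_partial (fst ic) (snd ic) f) z x) \<le> e/2 * cnrm n x)" by blast
  from bchoice[OF this] obtain D where D0: "\<forall>ic\<in>{..<n} \<times> {1,\<i>}. D ic > 0 \<and> (\<forall>x\<in>Cn n. cnrm n x < D ic \<longrightarrow>
     cmod (real_partial (fst ic) (snd ic) f (\<lambda>i. z i + x i) - real_partial (fst ic) (snd ic) f z
      - dd n (real_partial (fst ic) (snd ic) f) z x) \<le> e/2 * cnrm n x)" ..
  then have D: "\<And>ic. ic \<in> {..<n} \<times> {1,\<i>} \<Longrightarrow> D ic > 0"
    "\<And>ic x. ic \<in> {..<n} \<times> {1,\<i>} \<Longrightarrow> x \<in> Cn n \<Longrightarrow> cnrm n x < D ic \<Longrightarrow>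
      cmod (real_partial (fst ic) (snd ic) f (\<lambda>i. z i + x i) - real_partial (fst ic) (snd ic) f z
      - dd n (real_partial (fst ic) (snd ic) f) z x) \<le> e/2 * cnrm n x"
    by blast+
  obtain d0 where d0: "d0 > 0" "\<And>w. w \<in> Cn n \<Longrightarrow> cdist n w z < d0 \<Longrightarrow> w \<in> U"
    using open_CnE[OF U z] by blast
  define d where "d = Min (insert d0 (D ` ({..<n} \<times> {1,\<i>})))"
  have d: "d > 0" "d \<le> d0" "\<And>ic. ic \<in> {..<n} \<times> {1,\<i>} \<Longrightarrow> d \<le> D ic"
  proof -
    have "\<And>y. y \<in> insert d0 (D ` ({..<n} \<times> {1,\<i>})) \<Longrightarrow> y > 0" using D(1) d0(1) by blast
    then show "d > 0" unfolding d_def by (subst Min_gr_iff) auto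
    show "d \<le> d0" "\<And>ic. ic \<in> {..<n} \<times> {1,\<i>} \<Longrightarrow> d \<le> D ic"
      unfolding d_def by (intro Min_le; simp)+
  qed
  show ?thesis
  proof (intro exI[of _ d] conjI ballI impI)
    fix x assume x: "x \<in> Cn n" "cnrm n x < d"
    have inU: "(\<lambda>i. z i + of_real s * x i) \<in> U" if "s \<in> {0..1}" for s
    proof (rule d0(2))
      show "(\<lambda>i. z i + of_real s * x i) \<in> Cn n" using zC x by (intro Cn_add Cn_scale)
      have "cnrm n (\<lambda>i. of_real s * x i) = s * cnrm n x"
        using that by (simp add: cnrm_def norm_mult sum_distrib_left)
      also have "\<dots> \<le> cnrm n x" using that by (simp add: mult_left_le_one_le)
      finally show "cdist n (\<lambda>i. z i + of_real s * x i) z < d0"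
        using x d cdist_add[of n z "\<lambda>i. of_real s * x i"] by simp
    qed
    show "(\<lambda>i. z i + x i) \<in> U" using inU[of 1] by simp
    define g where "g s = f (\<lambda>i. z i + of_real s * x i) - (of_real s * dd n f z x + of_real (s^2 / 2) * ddB n f z x x)" for s::real
    have "norm (g 1 - g 0) \<le> (e * (cnrm n x)\<^sup>2) * norm (1 - 0 :: real)"
    proof (rule differentiable_bound[of "{0..1}" g "\<lambda>s h. h *\<^sub>R (dd n f (\<lambda>i. z i + of_real s * x i) x - (dd n f z x + of_real s * ddB n f z x x))"])
      fix s :: real assume s: "s \<in> {0..1}"
      have "((\<lambda>s. f (\<lambda>i. z i + of_real s * x i)) has_derivative (\<lambda>h. dd n f (\<lambda>i. z i + of_real s * x i) (\<lambda>i. of_real h * x i))) (at s)"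
        using C1_line[OF f1 U inU[OF s] zC x(1)] .
      then have "(g has_derivative (\<lambda>h. h *\<^sub>R (dd n f (\<lambda>i. z i + of_real s * x i) x - (dd n f z x + of_real s * ddB n f z x x)))) (at s)"
        unfolding g_def dd_scale_real
        by (auto intro!: derivative_eq_intros simp: fun_eq_iff scaleR_conv_of_real algebra_simps)
      then show "(g has_derivative (\<lambda>h. h *\<^sub>R (dd n f (\<lambda>i. z i + of_real s * x i) x - (dd n f z x + of_real s * ddB n f z x x)))) (at s within {0..1})"
        by (rule has_derivative_at_withinI)
      define E where "E i c = real_partial i c f (\<lambda>i. z i + of_real s * x i) - real_partial i c f z - dd n (real_partial i c f) z (\<lambda>i. of_real s * x i)" for i c
      have sx: "cnrm n (\<lambda>i. of_real s * x i) \<le> cnrm n x"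
      proof -
        have "cnrm n (\<lambda>i. of_real s * x i) = s * cnrm n x"
          using s by (simp add: cnrm_def norm_mult sum_distrib_left)
        then show ?thesis using s by (simp add: mult_left_le_one_le)
      qed
      have E: "cmod (E i c) \<le> e/2 * cnrm n x" if "i < n" "c \<in> {1,\<i>}" for i c
      proof -
        have "cmod (E i c) \<le> e/2 * cnrm n (\<lambda>i. of_real s * x i)"
          using D(2)[of "(i,c)" "\<lambda>i. of_real s * x i"] that x sx d(3)[of "(i,c)"] by (auto simp: E_def intro!: Cn_scale)
        also have "\<dots> \<le> e/2 * cnrm n x" using sx e by (intro mult_left_mono) auto
        finally show ?thesis .
      qed
      have eq: "dd n f (\<lambda>i. z i + of_real s * x i) x - (dd n f z x + of_real s * ddB n f z x x)
        = (\<Sum>i<n. of_real (Re (x i)) * E i 1 + of_real (Im (x i)) * E i \<i>)"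
        unfolding dd_def[of n f] ddB_def E_def dd_scale_real
        by (simp add: sum_distrib_left sum.distrib sum_subtractf algebra_simps)
      have "cmod (dd n f (\<lambda>i. z i + of_real s * x i) x - (dd n f z x + of_real s * ddB n f z x x))
         \<le> (\<Sum>i<n. cmod (x i) * (e * cnrm n x))"
        unfolding eq
      proof (rule sum_norm_le)
        fix i assume i: "i \<in> {..<n}"
        have "cmod (of_real (Re (x i)) * E i 1 + of_real (Im (x i)) * E i \<i>) \<le> \<bar>Re (x i)\<bar> * cmod (E i 1) + \<bar>Im (x i)\<bar> * cmod (E i \<i>)"
          using norm_triangle_ineq[of "of_real (Re (x i)) * E i 1" "of_real (Im (x i)) * E i \<i>"] by (simp add: norm_mult)
        also have "\<dots> \<le> cmod (x i) * (e/2 * cnrm n x) + cmod (x i) * (e/2 * cnrm n x)"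
          using i by (intro add_mono mult_mono E abs_Re_le_cmod abs_Im_le_cmod) auto
        finally show "cmod (of_real (Re (x i)) * E i 1 + of_real (Im (x i)) * E i \<i>) \<le> cmod (x i) * (e * cnrm n x)"
          by (simp add: algebra_simps)
      qed
      also have "\<dots> = e * (cnrm n x)\<^sup>2" by (simp add: sum_distrib_right[symmetric] cnrm_def[symmetric] power2_eq_square)
      finally show "onorm (\<lambda>h. h *\<^sub>R (dd n f (\<lambda>i. z i + of_real s * x i) x - (dd n f z x + of_real s * ddB n f z x x))) \<le> e * (cnrm n x)\<^sup>2"
        by (rule onorm_scaleR_le)
    qed auto
    then show "cmod (f (\<lambda>i. z i + x i) - f z - dd n f z x - ddB n f z x x / 2) \<le> e * (cnrm n x)\<^sup>2"
      by (simp add: g_def algebra_simps)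
  qed (use d in auto)
qed

text \<open>Second-order expansion at 0 in \<open>t\<close> and \<open>cnj t\<close> with Peano
  remainder. \<open>L\<close> is the mixed coefficient, a quarter of the Laplacian; the pure
  quadratic coefficients are hidden because a Levi form does not see them. Only the behaviour at 0
  enters, so jets pass through sums, products and logarithms.\<close>

definition jet2 :: "(complex \<Rightarrow> complex) \<Rightarrow> complex \<Rightarrow> complex \<Rightarrow> complex \<Rightarrow> complex \<Rightarrow> bool" where
  "jet2 f c a b L \<longleftrightarrow> f 0 = c \<and> (\<exists>p q. (\<lambda>t. f t - (c + a * t + b * cnj t + p * t\<^sup>2 + q * (cnj t)\<^sup>2 + L * (t * cnj t)))
     \<in> o[at 0](\<lambda>t. t\<^sup>2))"

lemma jet2_cong: "jet2 f c a b L \<Longrightarrow> c = c' \<Longrightarrow> a = a' \<Longrightarrow> b = b' \<Longrightarrow> L = L' \<Longrightarrow> jet2 f c' a' b' L'"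
  by simp

lemma jet2_transform:
  assumes "jet2 f c a b L" "\<forall>\<^sub>F t in nhds 0. f t = g t"
  shows "jet2 g c a b L"
proof -
  have 0: "f 0 = g 0" using assms(2) by (rule eventually_nhds_x_imp_x)
  have ev: "\<forall>\<^sub>F t in at 0. f t = g t" using assms(2) eventually_nhds_conv_at by blast
  have "(\<lambda>t. f t - (c + a * t + b * cnj t + p * t\<^sup>2 + q * (cnj t)\<^sup>2 + L * (t * cnj t))) \<in> o[at 0](\<lambda>t. t\<^sup>2) \<longleftrightarrow>
    (\<lambda>t. g t - (c + a * t + b * cnj t + p * t\<^sup>2 + q * (cnj t)\<^sup>2 + L * (t * cnj t))) \<in> o[at 0](\<lambda>t. t\<^sup>2)" for p q
    using ev by (intro landau_o.small.in_cong) (auto elim: eventually_mono)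
  then show ?thesis using assms(1) 0 unfolding jet2_def by simp
qed

lemma jet2_const: "jet2 (\<lambda>t. c) c 0 0 0"
  unfolding jet2_def by (auto intro!: exI[of _ 0])

lemma jet2_add:
  assumes "jet2 f c a b L" "jet2 g c' a' b' L'"
  shows "jet2 (\<lambda>t. f t + g t) (c + c') (a + a') (b + b') (L + L')"
proof -
  obtain p q p' q' where
    "(\<lambda>t. f t - (c + a * t + b * cnj t + p * t\<^sup>2 + q * (cnj t)\<^sup>2 + L * (t * cnj t))) \<in> o[at 0](\<lambda>t. t\<^sup>2)"
    "(\<lambda>t. g t - (c' + a' * t + b' * cnj t + p' * t\<^sup>2 + q' * (cnj t)\<^sup>2 + L' * (t * cnj t))) \<in> o[at 0](\<lambda>t. t\<^sup>2)"
    using assms unfolding jet2_def by blast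
  from sum_in_smallo(1)[OF this] show ?thesis
    using assms unfolding jet2_def
    by (intro conjI exI[of _ "p+p'"] exI[of _ "q+q'"]) (auto simp: algebra_simps)
qed

lemma jet2_cmult:
  assumes "jet2 f c a b L"
  shows "jet2 (\<lambda>t. k * f t) (k * c) (k * a) (k * b) (k * L)"
proof -
  obtain p q where
    "(\<lambda>t. f t - (c + a * t + b * cnj t + p * t\<^sup>2 + q * (cnj t)\<^sup>2 + L * (t * cnj t))) \<in> o[at 0](\<lambda>t. t\<^sup>2)"
    using assms unfolding jet2_def by blast
  then have "(\<lambda>t. k * (f t - (c + a * t + b * cnj t + p * t\<^sup>2 + q * (cnj t)\<^sup>2 + L * (t * cnj t)))) \<in> o[at 0](\<lambda>t. t\<^sup>2)"
    by (cases "k = 0") auto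
  then show ?thesis using assms unfolding jet2_def
    by (intro conjI exI[of _ "k*p"] exI[of _ "k*q"]) (auto simp: algebra_simps)
qed

lemma jet2_cnj:
  assumes "jet2 f c a b L"
  shows "jet2 (\<lambda>t. cnj (f t)) (cnj c) (cnj b) (cnj a) (cnj L)"
proof -
  obtain p q where
    "(\<lambda>t. f t - (c + a * t + b * cnj t + p * t\<^sup>2 + q * (cnj t)\<^sup>2 + L * (t * cnj t))) \<in> o[at 0](\<lambda>t. t\<^sup>2)"
    using assms unfolding jet2_def by blast
  then have "(\<lambda>t. cnj (f t - (c + a * t + b * cnj t + p * t\<^sup>2 + q * (cnj t)\<^sup>2 + L * (t * cnj t)))) \<in> o[at 0](\<lambda>t. t\<^sup>2)"
    by (subst landau_o.small.norm_iff[symmetric]) (simp only: complex_mod_cnj landau_o.small.norm_iff)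
  then show ?thesis using assms unfolding jet2_def
    by (intro conjI exI[of _ "cnj q"] exI[of _ "cnj p"]) (auto simp: algebra_simps)
qed

lemma jet2_sum:
  assumes "\<And>i. i \<in> I \<Longrightarrow> jet2 (f i) (c i) (a i) (b i) (L i)"
  shows "jet2 (\<lambda>t. \<Sum>i\<in>I. f i t) (\<Sum>i\<in>I. c i) (\<Sum>i\<in>I. a i) (\<Sum>i\<in>I. b i) (\<Sum>i\<in>I. L i)"
proof (cases "finite I")
  case True
  then show ?thesis using assms
    by (induction I rule: finite_induct) (auto simp: jet2_const intro!: jet2_add)
qed (simp add: jet2_const)

text \<open>In the product of the two Taylor polynomials the linear parts contribute
  \<open>a * b' + b * a'\<close> to the mixed coefficient. Everything of order three or containing a
  remainder is o(t^2).\<close>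

lemma jet2_mult:
  assumes "jet2 f c a b L" "jet2 g c' a' b' L'"
  shows "jet2 (\<lambda>t. f t * g t) (c * c') (a * c' + c * a') (b * c' + c * b') (L * c' + c * L' + a * b' + b * a')"
proof -
  obtain p q p' q' where
    1: "(\<lambda>t. f t - (c + a * t + b * cnj t + p * t\<^sup>2 + q * (cnj t)\<^sup>2 + L * (t * cnj t))) \<in> o[at 0](\<lambda>t. t\<^sup>2)" and
    2: "(\<lambda>t. g t - (c' + a' * t + b' * cnj t + p' * t\<^sup>2 + q' * (cnj t)\<^sup>2 + L' * (t * cnj t))) \<in> o[at 0](\<lambda>t. t\<^sup>2)"
    using assms unfolding jet2_def by blast
  define l where "l t = a * t + b * cnj t" for t
  define l' where "l' t = a' * t + b' * cnj t" for t
  define Q where "Q t = p * t\<^sup>2 + q * (cnj t)\<^sup>2 + L * (t * cnj t)" for t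
  define Q' where "Q' t = p' * t\<^sup>2 + q' * (cnj t)\<^sup>2 + L' * (t * cnj t)" for t
  define r where "r t = f t - (c + l t + Q t)" for t
  define s where "s t = g t - (c' + l' t + Q' t)" for t
  have rs: "r \<in> o[at 0](\<lambda>t. t\<^sup>2)" "s \<in> o[at 0](\<lambda>t. t\<^sup>2)"
    using 1 2 by (simp_all add: r_def[abs_def] s_def[abs_def] l_def l'_def Q_def Q'_def algebra_simps)
  have lin: "(\<lambda>t. x * t + y * cnj t) \<in> O[at 0](\<lambda>t. t)" for x y :: complex
    by (intro sum_in_bigo landau_o.big.mult_in_1 bigoI[of _ "cmod x"] bigoI[of _ "cmod y"]) (auto simp: norm_mult)
  have quad: "(\<lambda>t. x * t\<^sup>2 + y * (cnj t)\<^sup>2 + w * (t * cnj t)) \<in> O[at 0](\<lambda>t. t\<^sup>2)" for x y w :: complex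
    by (intro sum_in_bigo bigoI[of _ "cmod x"] bigoI[of _ "cmod y"] bigoI[of _ "cmod w"])
      (auto simp: norm_mult norm_power power2_eq_square)
  have l: "l \<in> O[at 0](\<lambda>t. t)" "l' \<in> O[at 0](\<lambda>t. t)" unfolding l_def[abs_def] l'_def[abs_def] by (rule lin)+
  have Q: "Q \<in> O[at 0](\<lambda>t. t\<^sup>2)" "Q' \<in> O[at 0](\<lambda>t. t\<^sup>2)" unfolding Q_def[abs_def] Q'_def[abs_def] by (rule quad)+
  have t1: "(\<lambda>t. t) \<in> o[at 0](\<lambda>t. 1::complex)"
    by (rule smalloI_tendsto) (auto intro!: tendsto_eq_intros)
  have tt: "(\<lambda>t. t\<^sup>2 * t) \<in> o[at 0](\<lambda>t. t\<^sup>2 :: complex)"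
    using landau_o.big_small_mult[OF landau_o.big_refl[of "\<lambda>t. t\<^sup>2"] t1] by simp
  have b1: "(\<lambda>t. t\<^sup>2) \<in> O[at 0](\<lambda>t. 1::complex)"
    using landau_o.small_imp_big[OF landau_o.small_mult[OF t1 t1]] by (simp add: power2_eq_square)
  have e1: "(\<lambda>t. l t * Q' t) \<in> o[at 0](\<lambda>t. t\<^sup>2)" "(\<lambda>t. l' t * Q t) \<in> o[at 0](\<lambda>t. t\<^sup>2)"
    using landau_o.big_small_trans[OF landau_o.big.mult[OF Q(2) l(1)] tt]
      landau_o.big_small_trans[OF landau_o.big.mult[OF Q(1) l(2)] tt] by (simp_all add: mult.commute)
  have l1: "l \<in> O[at 0](\<lambda>t. 1)" "l' \<in> O[at 0](\<lambda>t. 1)" "l \<in> o[at 0](\<lambda>t. 1)"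
    using l t1 landau_o.small_imp_big landau_o.big_small_trans by blast+
  have Q1: "Q \<in> O[at 0](\<lambda>t. 1)" "Q' \<in> O[at 0](\<lambda>t. 1)"
    using Q b1 landau_o.big_trans by blast+
  have Qs: "Q \<in> o[at 0](\<lambda>t. 1)" using Q(1) landau_o.small_mult[OF t1 t1] landau_o.big_small_trans by (fastforce simp: power2_eq_square)
  have e2: "(\<lambda>t. Q t * Q' t) \<in> o[at 0](\<lambda>t. t\<^sup>2)"
    using landau_o.small_big_mult[OF Qs Q(2)] by simp
  have P1: "(\<lambda>t. c + l t + Q t) \<in> O[at 0](\<lambda>t. 1)" "(\<lambda>t. c' + l' t + Q' t) \<in> O[at 0](\<lambda>t. 1)"
    using l1 Q1 by (intro sum_in_bigo; simp)+
  have r1: "r \<in> O[at 0](\<lambda>t. 1)" using landau_o.small_imp_big[OF rs(1)] b1 landau_o.big_trans by blast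
  have e3: "(\<lambda>t. (c + l t + Q t) * s t) \<in> o[at 0](\<lambda>t. t\<^sup>2)"
    "(\<lambda>t. (c' + l' t + Q' t) * r t) \<in> o[at 0](\<lambda>t. t\<^sup>2)" "(\<lambda>t. r t * s t) \<in> o[at 0](\<lambda>t. t\<^sup>2)"
    using landau_o.big_small_mult[OF P1(1) rs(2)] landau_o.big_small_mult[OF P1(2) rs(1)]
      landau_o.big_small_mult[OF r1 rs(2)] by simp_all
  have "(\<lambda>t. l t * Q' t + l' t * Q t + Q t * Q' t + (c + l t + Q t) * s t + (c' + l' t + Q' t) * r t + r t * s t) \<in> o[at 0](\<lambda>t. t\<^sup>2)"
    by (intro sum_in_smallo e1 e2 e3)
  moreover have "l t * Q' t + l' t * Q t + Q t * Q' t + (c + l t + Q t) * s t + (c' + l' t + Q' t) * r t + r t * s t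
    = f t * g t - (c * c' + (a * c' + c * a') * t + (b * c' + c * b') * cnj t + (p * c' + c * p' + a * a') * t\<^sup>2
       + (q * c' + c * q' + b * b') * (cnj t)\<^sup>2 + (L * c' + c * L' + a * b' + b * a') * (t * cnj t))" for t
    unfolding r_def s_def l_def l'_def Q_def Q'_def by (simp add: algebra_simps power2_eq_square)
  ultimately show ?thesis using assms unfolding jet2_def
    by (intro conjI exI[of _ "p * c' + c * p' + a * a'"] exI[of _ "q * c' + c * q' + b * b'"]) auto
qed

text \<open>Linear growth at 0. It converts remainders that are small in the increment of
  \<open>f\<close> into remainders that are small in \<open>t\<close>.\<close>

lemma jet2_bigo:
  assumes "jet2 f c a b L"
  obtains B d where "B > 0" "d > 0" "\<And>t. cmod t < d \<Longrightarrow> cmod (f t - c) \<le> B * cmod t"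
proof -
  obtain p q where
    1: "(\<lambda>t. f t - (c + a * t + b * cnj t + p * t\<^sup>2 + q * (cnj t)\<^sup>2 + L * (t * cnj t))) \<in> o[at 0](\<lambda>t. t\<^sup>2)"
    using assms unfolding jet2_def by blast
  from landau_o.smallD[OF this less_numeral_extra(1)] obtain d where d: "d > 0"
    "\<And>t. t \<noteq> 0 \<Longrightarrow> cmod t < d \<Longrightarrow> cmod (f t - (c + a * t + b * cnj t + p * t\<^sup>2 + q * (cnj t)\<^sup>2 + L * (t * cnj t))) \<le> cmod (t\<^sup>2)"
    unfolding eventually_at by (auto simp: dist_norm)
  define B where "B = cmod a + cmod b + cmod p + cmod q + cmod L + 1"
  have "cmod (f t - c) \<le> B * cmod t" if t: "cmod t < min d 1" for t
  proof (cases "t = 0")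
    case True then show ?thesis using assms by (simp add: jet2_def)
  next
    case False
    let ?P = "a * t + b * cnj t + p * t\<^sup>2 + q * (cnj t)\<^sup>2 + L * (t * cnj t)"
    have t2: "(cmod t)\<^sup>2 \<le> cmod t" using t by (simp add: power2_eq_square mult_left_le_one_le)
    have "cmod (f t - c) \<le> cmod (f t - c - ?P) + cmod ?P" by (metis diff_add_cancel norm_triangle_ineq)
    also have "cmod (f t - c - ?P) \<le> (cmod t)\<^sup>2"
      using d(2)[of t] False t by (simp add: norm_power algebra_simps)
    also have "cmod ?P \<le> cmod a * cmod t + cmod b * cmod t + cmod p * (cmod t)\<^sup>2 + cmod q * (cmod t)\<^sup>2 + cmod L * (cmod t)\<^sup>2"
      by (intro norm_triangle_le add_mono) (auto simp: norm_mult norm_power power2_eq_square)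
    also have "(cmod t)\<^sup>2 + \<dots> \<le> cmod t + (cmod a * cmod t + cmod b * cmod t + cmod p * (cmod t) + cmod q * (cmod t) + cmod L * (cmod t))"
      using t2 by (intro add_mono mult_left_mono) auto
    finally show ?thesis by (simp add: B_def algebra_simps)
  qed
  then show ?thesis using d(1) by (intro that[of B "min d 1"]) (auto simp: B_def add_nonneg_pos)
qed

text \<open>Summing over the four points r, -r, ir, -ir kills the linear and the pure quadratic
  terms and leaves \<open>4 * L * r\<^sup>2\<close>. At a maximum the sum of the four increments is
  not positive, so only the remainder can contribute, and it is arbitrarily small against
  r^2.\<close>

lemma jet2_max_le:
  assumes j: "jet2 (\<lambda>t. of_real (\<phi> t)) c a b L" and m: "\<forall>\<^sub>F t in nhds 0. \<phi> t \<le> \<phi> 0"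
  shows "Re L \<le> 0"
proof (rule field_le_epsilon)
  fix e :: real assume e: "e > 0"
  obtain p q where
    1: "(\<lambda>t. of_real (\<phi> t) - (c + a * t + b * cnj t + p * t\<^sup>2 + q * (cnj t)\<^sup>2 + L * (t * cnj t))) \<in> o[at 0](\<lambda>t. t\<^sup>2)"
    using j unfolding jet2_def by blast
  have c: "c = of_real (\<phi> 0)" using j by (simp add: jet2_def)
  obtain d where d: "d > 0"
    "\<And>t. t \<noteq> 0 \<Longrightarrow> cmod t < d \<Longrightarrow> cmod (of_real (\<phi> t) - (c + a * t + b * cnj t + p * t\<^sup>2 + q * (cnj t)\<^sup>2 + L * (t * cnj t))) \<le> e * cmod (t\<^sup>2)"
    using landau_o.smallD[OF 1 e] unfolding eventually_at by (auto simp: dist_norm)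
  obtain d' where d': "d' > 0" "\<And>t. cmod t < d' \<Longrightarrow> \<phi> t \<le> \<phi> 0"
    using m unfolding eventually_nhds_metric by (auto simp: dist_norm)
  define r where "r = min d d' / 2"
  have r: "r > 0" "r < d" "r < d'" using d d' by (auto simp: r_def)
  define E where "E t = of_real (\<phi> t) - (c + a * t + b * cnj t + p * t\<^sup>2 + q * (cnj t)\<^sup>2 + L * (t * cnj t))" for t
  define T where "T = [of_real r, - of_real r, \<i> * of_real r, - \<i> * of_real r]"
  have Tr: "\<And>t. t \<in> set T \<Longrightarrow> cmod t = r" using r by (auto simp: T_def norm_mult)
  have ET: "Re (E t) \<ge> - e * r\<^sup>2" if "t \<in> set T" for t
  proof -
    have "cmod (E t) \<le> e * cmod (t\<^sup>2)" using d(2)[of t] Tr[OF that] r by (auto simp: E_def)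
    then have "cmod (E t) \<le> e * r\<^sup>2" using Tr[OF that] by (simp add: norm_power)
    then show ?thesis using abs_Re_le_cmod[of "E t"] by linarith
  qed
  have pT: "\<phi> t \<le> \<phi> 0" if "t \<in> set T" for t using d'(2)[of t] Tr[OF that] r by auto
  have s: "E (of_real r) + E (- of_real r) + E (\<i> * of_real r) + E (- \<i> * of_real r)
    = of_real (\<phi> (of_real r) + \<phi> (- of_real r) + \<phi> (\<i> * of_real r) + \<phi> (- \<i> * of_real r) - 4 * \<phi> 0) - 4 * L * of_real (r\<^sup>2)"
    unfolding E_def c by (simp add: algebra_simps power2_eq_square)
  have "- 4 * e * r\<^sup>2 \<le> Re (E (of_real r) + E (- of_real r) + E (\<i> * of_real r) + E (- \<i> * of_real r))"
    using ET[of "of_real r"] ET[of "- of_real r"] ET[of "\<i> * of_real r"] ET[of "- \<i> * of_real r"] by (simp add: T_def)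
  also have "\<dots> = (\<phi> (of_real r) + \<phi> (- of_real r) + \<phi> (\<i> * of_real r) + \<phi> (- \<i> * of_real r) - 4 * \<phi> 0) - 4 * Re L * r\<^sup>2"
    unfolding s by (simp add: power2_eq_square)
  also have "\<dots> \<le> - 4 * Re L * r\<^sup>2"
    using pT[of "of_real r"] pT[of "- of_real r"] pT[of "\<i> * of_real r"] pT[of "- \<i> * of_real r"] by (simp add: T_def)
  finally show "Re L \<le> 0 + e" using r by simp
qed

lemma ln_second_order:
  assumes "e > 0"
  shows "\<exists>d>0. \<forall>y::real. \<bar>y\<bar> < d \<longrightarrow> \<bar>ln (1 + y) - y + y\<^sup>2 / 2\<bar> \<le> e * y\<^sup>2"
proof -
  have "(\<lambda>y::real. ln (1 + y) - y + y\<^sup>2 / 2) \<in> o[at 0](\<lambda>y. y\<^sup>2)" by real_asymp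
  from landau_o.smallD[OF this assms] obtain d where d: "d > 0"
    "\<And>y. y \<noteq> 0 \<Longrightarrow> \<bar>y\<bar> < d \<Longrightarrow> \<bar>ln (1 + y) - y + y\<^sup>2 / 2\<bar> \<le> e * y\<^sup>2"
    unfolding eventually_at by (auto simp: dist_norm)
  have "\<bar>ln (1 + y) - y + y\<^sup>2 / 2\<bar> \<le> e * y\<^sup>2" if "\<bar>y\<bar> < d" for y
    using d(2)[of y] that by (cases "y = 0") auto
  then show ?thesis using d(1) by blast
qed

lemma jet2_o:
  assumes j: "jet2 f c a b L" and 0: "r 0 = 0"
    and r: "\<And>e. e > 0 \<Longrightarrow> \<exists>d>0. \<forall>t. cmod t < d \<longrightarrow> cmod (r t) \<le> e * (cmod t)\<^sup>2"
  shows "jet2 (\<lambda>t. f t + r t) c a b L"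
proof -
  have "r \<in> o[at 0](\<lambda>t. t\<^sup>2)"
  proof (rule landau_o.smallI)
    fix e :: real assume "e > 0"
    from r[OF this] show "\<forall>\<^sub>F t in at 0. norm (r t) \<le> e * norm (t\<^sup>2)"
      unfolding eventually_at by (auto simp: dist_norm norm_power)
  qed
  moreover obtain p q where
    "(\<lambda>t. f t - (c + a * t + b * cnj t + p * t\<^sup>2 + q * (cnj t)\<^sup>2 + L * (t * cnj t))) \<in> o[at 0](\<lambda>t. t\<^sup>2)"
    using j unfolding jet2_def by blast
  ultimately have "(\<lambda>t. (f t - (c + a * t + b * cnj t + p * t\<^sup>2 + q * (cnj t)\<^sup>2 + L * (t * cnj t))) + r t) \<in> o[at 0](\<lambda>t. t\<^sup>2)"
    by (intro sum_in_smallo(1))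
  then show ?thesis using j 0 unfolding jet2_def
    by (intro conjI exI[of _ p] exI[of _ q]) (auto simp: algebra_simps)
qed

text \<open>With \<open>y\<close> the relative increment of \<open>\<phi>\<close>, this is the
  expansion of ln (1 + y); the term \<open>- y\<^sup>2 / 2\<close> produces the correction
  \<open>- a * b / c\<^sup>2\<close> in the mixed coefficient.\<close>

lemma jet2_ln:
  assumes j: "jet2 (\<lambda>t. of_real (\<phi> t)) c a b L" and pos: "\<phi> 0 > 0"
  shows "jet2 (\<lambda>t. of_real (ln (\<phi> t))) (of_real (ln (\<phi> 0))) (a / c) (b / c) (L / c - a * b / c\<^sup>2)"
proof -
  have c: "c = of_real (\<phi> 0)" "c \<noteq> 0" using j pos by (auto simp: jet2_def)
  define y where "y t = (\<phi> t - \<phi> 0) / \<phi> 0" for t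
  define r where "r t = ln (1 + y t) - y t + (y t)\<^sup>2 / 2" for t
  have jy: "jet2 (\<lambda>t. of_real (y t)) 0 (a / c) (b / c) (L / c)"
    using jet2_cmult[OF jet2_add[OF j jet2_const[of "-c"]], of "1/c"] c
    by (simp add: y_def field_simps)
  have jy2: "jet2 (\<lambda>t. of_real (y t) - of_real ((y t)\<^sup>2 / 2)) 0 (a / c) (b / c) (L / c - a * b / c\<^sup>2)"
    using jet2_add[OF jy jet2_cmult[OF jet2_mult[OF jy jy], of "-1/2"]]
    by (rule jet2_transform[THEN jet2_cong]) (auto simp: power2_eq_square)
  obtain B d where B: "B > 0" "d > 0" "\<And>t. cmod t < d \<Longrightarrow> \<bar>y t\<bar> \<le> B * cmod t"
    using jet2_bigo[OF jy] by (auto simp: norm_of_real)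
  have "jet2 (\<lambda>t. (of_real (y t) - of_real ((y t)\<^sup>2 / 2)) + of_real (r t)) 0 (a / c) (b / c) (L / c - a * b / c\<^sup>2)"
  proof (rule jet2_o[OF jy2])
    show "complex_of_real (r 0) = 0" by (simp add: r_def y_def)
    fix e :: real assume "e > 0"
    then have "e / B\<^sup>2 > 0" using B by simp
    from ln_second_order[OF this] obtain d' where d': "d' > 0"
      "\<And>y::real. \<bar>y\<bar> < d' \<Longrightarrow> \<bar>ln (1 + y) - y + y\<^sup>2 / 2\<bar> \<le> e / B\<^sup>2 * y\<^sup>2" by blast
    have "cmod (of_real (r t)) \<le> e * (cmod t)\<^sup>2" if t: "cmod t < min d (d' / B)" for t
    proof -
      have yB: "\<bar>y t\<bar> \<le> B * cmod t" using B(3) t by auto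
      have "B * cmod t < d'" using t B by (simp add: field_simps)
      then have "\<bar>r t\<bar> \<le> e / B\<^sup>2 * (y t)\<^sup>2" unfolding r_def using yB by (intro d'(2)) auto
      also have "\<dots> \<le> e / B\<^sup>2 * (B * cmod t)\<^sup>2"
      proof (rule mult_left_mono)
          show "(y t)\<^sup>2 \<le> (B * cmod t)\<^sup>2"
            using power_mono[OF yB abs_ge_zero, of 2] by (simp only: power2_abs)
        qed (use \<open>e / B\<^sup>2 > 0\<close> in simp)
      also have "\<dots> = e * (cmod t)\<^sup>2" using B by (simp add: power_mult_distrib)
      finally show ?thesis by simp
    qed
    then show "\<exists>d>0. \<forall>t. cmod t < d \<longrightarrow> cmod (of_real (r t)) \<le> e * (cmod t)\<^sup>2"
      using B d' by (intro exI[of _ "min d (d' / B)"]) auto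
  qed
  then have "jet2 (\<lambda>t. of_real (ln (\<phi> 0)) + ((of_real (y t) - of_real ((y t)\<^sup>2 / 2)) + of_real (r t)))
     (of_real (ln (\<phi> 0)) + 0) (0 + a / c) (0 + b / c) (0 + (L / c - a * b / c\<^sup>2))"
    by (intro jet2_add jet2_const)
  moreover have "\<forall>\<^sub>F t in nhds 0. of_real (ln (\<phi> 0)) + ((of_real (y t) - of_real ((y t)\<^sup>2 / 2)) + of_real (r t)) = complex_of_real (ln (\<phi> t))"
  proof -
    have "\<phi> t > 0 \<Longrightarrow> of_real (ln (\<phi> 0)) + ((of_real (y t) - of_real ((y t)\<^sup>2 / 2)) + of_real (r t)) = complex_of_real (ln (\<phi> t))" for t
    proof -
      assume "\<phi> t > 0"
      moreover have "1 + y t = \<phi> t / \<phi> 0" using pos by (simp add: y_def field_simps)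
      ultimately have "ln (1 + y t) = ln (\<phi> t) - ln (\<phi> 0)" using pos by (simp add: ln_div)
      then show ?thesis by (simp add: r_def)
    qed
    moreover have "\<forall>\<^sub>F t in nhds 0. \<phi> t > 0"
      unfolding eventually_nhds_metric
    proof (intro exI[of _ "min d (1 / (2 * B))"] conjI allI impI)
      fix t :: complex assume t: "dist t 0 < min d (1 / (2 * B))"
      then have "\<bar>y t\<bar> \<le> B * cmod t" "B * cmod t < 1/2" using B by (auto simp: field_simps)
      then have "y t > - 1" by linarith
      then show "\<phi> t > 0" using pos by (simp add: y_def field_simps)
    qed (use B in auto)
    ultimately show ?thesis by (auto elim: eventually_mono)
  qed
  ultimately show ?thesis using jet2_transform by fastforce
qed

section \<open>Levi forms\<close>

text \<open>A holomorphic function has neither \<open>cnj t\<close> terms nor a mixed term. The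
  remainder is estimated through its derivative, which is o(t) because \<open>deriv f\<close> is
  again differentiable at 0.\<close>

lemma jet2_holo:
  assumes h: "f holomorphic_on ball 0 R" and R: "R > 0"
  shows "jet2 f (f 0) (deriv f 0) 0 0"
  unfolding jet2_def
proof (rule conjI[OF refl], rule exI[of _ "deriv (deriv f) 0 / 2"], rule exI[of _ 0], rule landau_o.smallI)
  fix e :: real assume e: "e > 0"
  have d: "\<And>t. t \<in> ball 0 R \<Longrightarrow> (f has_field_derivative deriv f t) (at t)"
    using h holomorphic_derivI[of f "ball 0 R"] by blast
  have "deriv f holomorphic_on ball 0 R" using h by (intro holomorphic_deriv) auto
  then have "(deriv f has_field_derivative deriv (deriv f) 0) (at 0)"
    using R by (intro holomorphic_derivI[of _ "ball 0 R"]) auto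
  then have "(deriv f has_derivative (\<lambda>h. deriv (deriv f) 0 * h)) (at 0)"
    by (simp add: has_field_derivative_def)
  then obtain d where d': "d > 0" "\<And>y. cmod y < d \<Longrightarrow> cmod (deriv f y - deriv f 0 - deriv (deriv f) 0 * y) \<le> e * cmod y"
    unfolding has_derivative_at_alt using e by fastforce
  have "cmod (f t - (f 0 + deriv f 0 * t + 0 * cnj t + deriv (deriv f) 0 / 2 * t\<^sup>2 + 0 * (cnj t)\<^sup>2 + 0 * (t * cnj t))) \<le> e * cmod (t\<^sup>2)"
    if t: "cmod t < min d R" for t
  proof -
    define g where "g s = f s - (deriv f 0 * s + deriv (deriv f) 0 / 2 * s\<^sup>2)" for s :: complex
    have "cmod (g t - g 0) \<le> (e * cmod t) * cmod (t - 0)"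
    proof (rule field_differentiable_bound[of "cball 0 (cmod t)" g "\<lambda>s::complex. deriv f s - (deriv f 0 + deriv (deriv f) 0 * s)"])
      fix s :: complex assume s: "s \<in> cball 0 (cmod t)"
      have "(g has_field_derivative (deriv f s - (deriv f 0 + deriv (deriv f) 0 * s))) (at s)"
        unfolding g_def using s t by (auto intro!: derivative_eq_intros d)
      then show "(g has_field_derivative (deriv f s - (deriv f 0 + deriv (deriv f) 0 * s))) (at s within cball 0 (cmod t))"
        by (rule has_field_derivative_at_within)
      have "cmod (deriv f s - deriv f 0 - deriv (deriv f) 0 * s) \<le> e * cmod s"
        using s t by (intro d'(2)) auto
      also have "\<dots> \<le> e * cmod t" using s e by (intro mult_left_mono) auto
      finally show "cmod (deriv f s - (deriv f 0 + deriv (deriv f) 0 * s)) \<le> e * cmod t"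
        by (simp add: algebra_simps)
    qed auto
    then show ?thesis by (simp add: g_def power2_eq_square norm_mult algebra_simps)
  qed
  then show "\<forall>\<^sub>F t in at 0. norm (f t - (f 0 + deriv f 0 * t + 0 * cnj t + deriv (deriv f) 0 / 2 * t\<^sup>2 + 0 * (cnj t)\<^sup>2 + 0 * (t * cnj t))) \<le> e * norm (t\<^sup>2)"
    unfolding eventually_at using d' R by (intro exI[of _ "min d R"]) (auto simp: dist_norm)
qed

lemma jet2_ident_lin: "jet2 (\<lambda>t. c + t * a) c a 0 0"
  unfolding jet2_def by (auto intro!: exI[of _ 0] simp: algebra_simps)

lemma dd_alt: "dd n f z x = (\<Sum>i<n. x i * dz i f z + cnj (x i) * dzbar i f z)"
  unfolding dd_def
proof (rule sum.cong[OF refl])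
  fix i
  have x: "x i = of_real (Re (x i)) + \<i> * of_real (Im (x i))" by (simp add: complex_eq)
  have y: "cnj (x i) = of_real (Re (x i)) - \<i> * of_real (Im (x i))" by (simp add: complex_eq_iff)
  show "of_real (Re (x i)) * real_partial i 1 f z + of_real (Im (x i)) * real_partial i \<i> f z
     = x i * dz i f z + cnj (x i) * dzbar i f z"
    unfolding dz_def dzbar_def by (subst (3) x, subst y) (simp add: field_simps)
qed

lemma dd_imult: "dd n f z (\<lambda>i. \<i> * x i) = \<i> * ((\<Sum>i<n. x i * dz i f z) - (\<Sum>i<n. cnj (x i) * dzbar i f z))"
  unfolding dd_alt by (simp add: sum_distrib_left sum_subtractf[symmetric] algebra_simps)

definition levi :: "nat \<Rightarrow> (cvec \<Rightarrow> complex) \<Rightarrow> cvec \<Rightarrow> cvec \<Rightarrow> complex" where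
  "levi n f z a = (\<Sum>i<n. \<Sum>j<n. dz i (dzbar j f) z * a i * cnj (a j))"

text \<open>The mixed coefficient that a real Taylor expansion along
  \<open>t \<mapsto> z + t * a\<close> produces, from the second derivatives in the directions
  \<open>a\<close> and \<open>\<i> * a\<close>. The form \<open>levi\<close> is built from iterated
  Wirtinger derivatives instead; \<open>levi_eq\<close> compares the two.\<close>

definition levi_jet :: "nat \<Rightarrow> (cvec \<Rightarrow> complex) \<Rightarrow> cvec \<Rightarrow> cvec \<Rightarrow> complex" where
  "levi_jet n f z a = (ddB n f z a a + ddB n f z (\<lambda>i. \<i> * a i) (\<lambda>i. \<i> * a i)) / 4"

text \<open>The jet of the curve has no \<open>cnj t\<close> and no mixed part, so the first-order
  term of the Taylor expansion of \<open>f\<close> contributes nothing to the mixed coefficient. In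
  the second-order term only the linear part \<open>t * a\<close> of the increment matters, which
  leaves \<open>levi_jet\<close>.\<close>

lemma jet2_curve:
  assumes f: "Ck_on n 2 U f" and U: "open_Cn n U" and z: "p 0 \<in> U"
    and pC: "\<And>t. p t \<in> Cn n"
    and p: "\<And>i. i < n \<Longrightarrow> jet2 (\<lambda>t. p t i) (p 0 i) (a i) 0 0"
  shows "jet2 (\<lambda>t. f (p t)) (f (p 0)) (\<Sum>i<n. a i * dz i f (p 0)) (\<Sum>i<n. cnj (a i) * dzbar i f (p 0)) (levi_jet n f (p 0) a)"
proof -
  define z where "z = p 0"
  define x where "x t = (\<lambda>i. p t i - z i)" for t
  have xC: "x t \<in> Cn n" for t using pC[of t] pC[of 0] by (auto simp: x_def z_def Cn_def)
  have zx: "(\<lambda>i. z i + x t i) = p t" for t by (simp add: x_def)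
  have jx: "jet2 (\<lambda>t. x t i) 0 (a i) 0 0" if "i < n" for i
    using jet2_add[OF p[OF that] jet2_const[of "- z i"]] by (simp add: x_def z_def)
  have jc: "jet2 (\<lambda>t. cnj (x t i)) 0 0 (cnj (a i)) 0" if "i < n" for i
    using jet2_cnj[OF jx[OF that]] by simp
  have jre: "jet2 (\<lambda>t. of_real (Re (x t i))) 0 (a i / 2) (cnj (a i) / 2) 0" if "i < n" for i
    using jet2_cmult[OF jet2_add[OF jx[OF that] jc[OF that]], of "1/2"]
    by (simp add: complex_add_cnj)
  have jim: "jet2 (\<lambda>t. of_real (Im (x t i))) 0 (a i / (2 * \<i>)) (- cnj (a i) / (2 * \<i>)) 0" if "i < n" for i
  proof -
    have e: "(1 / (2 * \<i>)) * (w + -1 * cnj w) = of_real (Im w)" for w by (simp add: complex_eq_iff)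
    show ?thesis
      using jet2_cmult[OF jet2_add[OF jx[OF that] jet2_cmult[OF jc[OF that], of "-1"]], of "1/(2 * \<i>)"]
      unfolding e by simp
  qed
  define A where "A g = (\<Sum>i<n. a i * dz i g z)" for g
  define B where "B g = (\<Sum>i<n. cnj (a i) * dzbar i g z)" for g
  have jdd: "jet2 (\<lambda>t. dd n g z (x t)) 0 (A g) (B g) 0" for g
  proof -
    have "jet2 (\<lambda>t. \<Sum>i<n. (dz i g z) * x t i + (dzbar i g z) * cnj (x t i)) (\<Sum>i<n. (dz i g z) * 0 + (dzbar i g z) * 0)
      (\<Sum>i<n. (dz i g z) * a i + (dzbar i g z) * 0) (\<Sum>i<n. (dz i g z) * 0 + (dzbar i g z) * cnj (a i))
      (\<Sum>i<n. (dz i g z) * 0 + (dzbar i g z) * 0)"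
      by (intro jet2_sum jet2_add jet2_cmult jx jc) auto
    then show ?thesis by (simp add: dd_alt A_def B_def mult.commute)
  qed
  have jB: "jet2 (\<lambda>t. ddB n f z (x t) (x t)) 0 0 0 (2 * levi_jet n f z a)"
  proof -
    have "jet2 (\<lambda>t. ddB n f z (x t) (x t)) 0 0 0 (\<Sum>i<n. ((a i / 2) * B (real_partial i 1 f) + (cnj (a i) / 2) * A (real_partial i 1 f))
        + ((a i / (2*\<i>)) * B (real_partial i \<i> f) + (- cnj (a i) / (2*\<i>)) * A (real_partial i \<i> f)))"
    proof -
      have "jet2 (\<lambda>t. of_real (Re (x t i)) * dd n (real_partial i 1 f) z (x t) + of_real (Im (x t i)) * dd n (real_partial i \<i> f) z (x t))
        0 0 0 (((a i / 2) * B (real_partial i 1 f) + (cnj (a i) / 2) * A (real_partial i 1 f))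
        + ((a i / (2*\<i>)) * B (real_partial i \<i> f) + (- cnj (a i) / (2*\<i>)) * A (real_partial i \<i> f)))" if "i < n" for i
        using jet2_add[OF jet2_mult[OF jre[OF that] jdd[of "real_partial i 1 f"]] jet2_mult[OF jim[OF that] jdd[of "real_partial i \<i> f"]]]
        by simp
      then show ?thesis unfolding ddB_def
        using jet2_sum[of "{..<n}" "\<lambda>i t. of_real (Re (x t i)) * dd n (real_partial i 1 f) z (x t) + of_real (Im (x t i)) * dd n (real_partial i \<i> f) z (x t)"
          "\<lambda>i. 0" "\<lambda>i. 0" "\<lambda>i. 0"] by simp
    qed
    moreover have "(\<Sum>i<n. ((a i / 2) * B (real_partial i 1 f) + (cnj (a i) / 2) * A (real_partial i 1 f))
        + ((a i / (2*\<i>)) * B (real_partial i \<i> f) + (- cnj (a i) / (2*\<i>)) * A (real_partial i \<i> f))) = 2 * levi_jet n f z a"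
    proof -
      \<comment> \<open>Let \<open>A\<close> and \<open>B\<close> be the holomorphic and the
        antiholomorphic part of the differential along \<open>a\<close>. Replacing \<open>a\<close>
        by \<open>\<i> * a\<close> changes A + B into i (A - B); this is the resulting identity for
        a single index.\<close>
      have alg: "(of_real u * (A1 + B1) + of_real v * (A2 + B2)
          + (of_real (- v) * (\<i> * (A1 - B1)) + of_real u * (\<i> * (A2 - B2)))) / 2
          = (((of_real u + \<i> * of_real v) / 2) * B1 + ((of_real u - \<i> * of_real v) / 2) * A1)
        + (((of_real u + \<i> * of_real v) / (2*\<i>)) * B2 + (- (of_real u - \<i> * of_real v) / (2*\<i>)) * A2)"
        for u v :: real and A1 B1 A2 B2 :: complex
        by (simp add: field_simps)
      have d1: "dd n g z a = A g + B g" for g by (simp add: dd_alt A_def B_def sum.distrib)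
      have d2: "dd n g z (\<lambda>i. \<i> * a i) = \<i> * (A g - B g)" for g by (simp add: dd_imult A_def B_def)
      have "2 * levi_jet n f z a = (\<Sum>i<n. (of_real (Re (a i)) * (A (real_partial i 1 f) + B (real_partial i 1 f))
          + of_real (Im (a i)) * (A (real_partial i \<i> f) + B (real_partial i \<i> f))
          + (of_real (- Im (a i)) * (\<i> * (A (real_partial i 1 f) - B (real_partial i 1 f)))
          + of_real (Re (a i)) * (\<i> * (A (real_partial i \<i> f) - B (real_partial i \<i> f))))) / 2)"
        unfolding levi_jet_def ddB_def d1 d2 by (simp add: sum.distrib sum_divide_distrib[symmetric])
      also have "\<dots> = (\<Sum>i<n. ((a i / 2) * B (real_partial i 1 f) + (cnj (a i) / 2) * A (real_partial i 1 f))
        + ((a i / (2*\<i>)) * B (real_partial i \<i> f) + (- cnj (a i) / (2*\<i>)) * A (real_partial i \<i> f)))"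
      proof (rule sum.cong[OF refl])
        fix i
        have x: "a i = of_real (Re (a i)) + \<i> * of_real (Im (a i))" by (simp add: complex_eq)
        have y: "cnj (a i) = of_real (Re (a i)) - \<i> * of_real (Im (a i))" by (simp add: complex_eq_iff)
        show "(of_real (Re (a i)) * (A (real_partial i 1 f) + B (real_partial i 1 f))
          + of_real (Im (a i)) * (A (real_partial i \<i> f) + B (real_partial i \<i> f))
          + (of_real (- Im (a i)) * (\<i> * (A (real_partial i 1 f) - B (real_partial i 1 f)))
          + of_real (Re (a i)) * (\<i> * (A (real_partial i \<i> f) - B (real_partial i \<i> f))))) / 2
          = ((a i / 2) * B (real_partial i 1 f) + (cnj (a i) / 2) * A (real_partial i 1 f))
        + ((a i / (2*\<i>)) * B (real_partial i \<i> f) + (- cnj (a i) / (2*\<i>)) * A (real_partial i \<i> f))"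
          using alg[where u="Re (a i)" and v="Im (a i)" and ?A1.0="A (real_partial i 1 f)" and ?B1.0="B (real_partial i 1 f)"
              and ?A2.0="A (real_partial i \<i> f)" and ?B2.0="B (real_partial i \<i> f)"]
          unfolding x[symmetric] y[symmetric] .
      qed
      finally show ?thesis by simp
    qed
    ultimately show ?thesis by simp
  qed
  have jT: "jet2 (\<lambda>t. f z + dd n f z (x t) + (1/2) * ddB n f z (x t) (x t)) (f z) (A f) (B f) (levi_jet n f z a)"
    using jet2_add[OF jet2_add[OF jet2_const[of "f z"] jdd[of f]] jet2_cmult[OF jB, of "1/2"]] by simp
  define r where "r t = f (p t) - f z - dd n f z (x t) - ddB n f z (x t) (x t) / 2" for t
  have "\<exists>C d. C > 0 \<and> d > 0 \<and> (\<forall>t. cmod t < d \<longrightarrow> cmod (x t i) \<le> C * cmod t)" if "i < n" for i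
    using jet2_bigo[OF jx[OF that]] by (metis diff_zero)
  then obtain C d where Cd: "\<And>i. i < n \<Longrightarrow> C i > 0" "\<And>i. i < n \<Longrightarrow> d i > 0"
    "\<And>i t. i < n \<Longrightarrow> cmod t < d i \<Longrightarrow> cmod (x t i) \<le> C i * cmod t" by metis
  define K where "K = 1 + (\<Sum>i<n. C i)"
  define D where "D = Min (insert 1 (d ` {..<n}))"
  have K: "K > 0" unfolding K_def using Cd(1) by (intro add_pos_nonneg sum_nonneg) (auto simp: less_imp_le)
  have D: "D > 0" "\<And>i. i < n \<Longrightarrow> D \<le> d i" unfolding D_def using Cd(2) by auto
  have xB: "cnrm n (x t) \<le> K * cmod t" if t: "cmod t < D" for t
  proof -
    have "cnrm n (x t) \<le> (\<Sum>i<n. C i * cmod t)"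
      unfolding cnrm_def using D(2) t by (intro sum_mono Cd(3)) force+
    also have "\<dots> \<le> K * cmod t"
      unfolding K_def by (simp add: sum_distrib_right[symmetric] algebra_simps)
    finally show ?thesis .
  qed
  have "jet2 (\<lambda>t. (f z + dd n f z (x t) + (1/2) * ddB n f z (x t) (x t)) + r t) (f z) (A f) (B f) (levi_jet n f z a)"
  proof (rule jet2_o[OF jT])
    show "r 0 = 0" by (simp add: r_def x_def z_def dd_def ddB_def)
    fix e :: real assume "e > 0"
    then have "e / K\<^sup>2 > 0" using K by simp
    from C2_Taylor[OF f U z this] obtain d' where d': "d' > 0" "\<And>x. x \<in> Cn n \<Longrightarrow> cnrm n x < d' \<Longrightarrow>
      cmod (f (\<lambda>i. z i + x i) - f z - dd n f z x - ddB n f z x x / 2) \<le> e / K\<^sup>2 * (cnrm n x)\<^sup>2" unfolding z_def by blast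
    have "cmod (r t) \<le> e * (cmod t)\<^sup>2" if t: "cmod t < min D (d' / K)" for t
    proof -
      have xb: "cnrm n (x t) \<le> K * cmod t" using xB t by auto
      have "K * cmod t < d'" using t K by (simp add: field_simps)
      then have "cmod (r t) \<le> e / K\<^sup>2 * (cnrm n (x t))\<^sup>2"
        using d'(2)[OF xC[of t]] xb unfolding r_def zx by simp
      also have "\<dots> \<le> e / K\<^sup>2 * (K * cmod t)\<^sup>2"
        using xb \<open>e / K\<^sup>2 > 0\<close> by (intro mult_left_mono power_mono) auto
      also have "\<dots> = e * (cmod t)\<^sup>2" using K by (simp add: power_mult_distrib)
      finally show ?thesis .
    qed
    then show "\<exists>d>0. \<forall>t. cmod t < d \<longrightarrow> cmod (r t) \<le> e * (cmod t)\<^sup>2"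
      using D d' K by (intro exI[of _ "min D (d' / K)"]) auto
  qed
  then show ?thesis by (simp add: r_def A_def B_def z_def)
qed

subsection \<open>Comparison with the complex Hessian\<close>

lemma eventually_line:
  assumes "open_Cn n U" "z \<in> U" "i < n"
  shows "\<forall>\<^sub>F t::real in nhds 0. z(i := z i + of_real t * c) \<in> U"
proof -
  obtain d where d: "d > 0" "\<And>w. w \<in> Cn n \<Longrightarrow> cdist n w z < d \<Longrightarrow> w \<in> U" "z \<in> Cn n"
    using open_CnE[OF assms(1,2)] by blast
  show ?thesis unfolding eventually_nhds_metric
  proof (intro exI[of _ "d / (1 + cmod c)"] conjI allI impI)
    fix t :: real assume "dist t 0 < d / (1 + cmod c)"
    then have "\<bar>t\<bar> * (1 + cmod c) < d" by (simp add: pos_less_divide_eq add_pos_nonneg)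
    moreover have "\<bar>t\<bar> * cmod c \<le> \<bar>t\<bar> * (1 + cmod c)" by (simp add: algebra_simps)
    ultimately show "z(i := z i + of_real t * c) \<in> U"
      using assms(3) d(3) by (intro d(2) Cn_upd) (auto simp: cdist_upd norm_mult)
  qed (use d in \<open>auto simp: add_pos_nonneg\<close>)
qed

lemma real_partial_cong:
  assumes "open_Cn n U" "z \<in> U" "i < n" "\<And>w. w \<in> U \<Longrightarrow> f w = g w"
  shows "real_partial i c f z = real_partial i c g z"
  unfolding real_partial_def
  by (rule vector_derivative_cong_eq)
    (use eventually_line[OF assms(1-3), of c] in \<open>auto elim!: eventually_mono simp: assms(4)\<close>)

lemma Ck_on_cong:
  assumes U: "open_Cn n U" and "\<And>w. w \<in> U \<Longrightarrow> f w = g w" "Ck_on n k U f"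
  shows "Ck_on n k U g"
  using assms(2,3)
proof (induction k arbitrary: f g)
  case 0
  then show ?case using continuous_on_eq by fastforce
next
  case (Suc k)
  have "Ck_on n k U (real_partial i c g)" if "i < n" "c \<in> {1,\<i>}" for i c
  proof (rule Suc.IH)
    show "real_partial i c f w = real_partial i c g w" if "w \<in> U" for w
      using real_partial_cong[OF U that \<open>i < n\<close> Suc.prems(1)] .
    show "Ck_on n k U (real_partial i c f)" by (rule Ck_on_1_D(1)[OF Suc.prems(2) that])
  qed
  moreover have "(\<lambda>t::real. g (z(i := z i + of_real t * c))) differentiable at 0"
    if "i < n" "c \<in> {1,\<i>}" "z \<in> U" for i c z
  proof -
    have "(\<lambda>t::real. f (z(i := z i + of_real t * c))) differentiable at 0" using Suc.prems that by auto
    moreover have ev: "\<forall>\<^sub>F t::real in nhds 0. f (z(i := z i + of_real t * c)) = g (z(i := z i + of_real t * c))"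
      by (rule eventually_mono[OF eventually_line[OF U that(3,1), of c]]) (rule Suc.prems(1))
    ultimately show ?thesis
      unfolding differentiable_def
    proof (elim exE)
      fix D assume "((\<lambda>t::real. f (z(i := z i + of_real t * c))) has_derivative D) (at 0)"
      then have "((\<lambda>t::real. g (z(i := z i + of_real t * c))) has_derivative D) (at 0)"
        by (rule has_derivative_transform_eventually)
          (use ev that(3) in \<open>auto simp: eventually_nhds_conv_at\<close>)
      then show "\<exists>D. ((\<lambda>t::real. g (z(i := z i + of_real t * c))) has_derivative D) (at 0)" by blast
    qed
  qed
  moreover have "continuous_on U g" using Suc.prems continuous_on_eq by fastforce
  ultimately show ?case by simp
qed

lemma real_partial_works:
  assumes "Ck_on n (Suc k) U f" "z \<in> U" "i < n" "c \<in> {1,\<i>}"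
  shows "((\<lambda>t::real. f (z(i := z i + of_real t * c))) has_vector_derivative real_partial i c f z) (at 0)"
  using assms unfolding real_partial_def by (intro vector_derivative_works[THEN iffD1]) auto

lemma dz_dzbar_expand:
  assumes f: "Ck_on n 2 U f" and z: "z \<in> U" and ij: "i < n" "j < n"
  shows "dz i (dzbar j f) z = (real_partial i 1 (real_partial j 1 f) z + \<i> * real_partial i 1 (real_partial j \<i> f) z
     - \<i> * real_partial i \<i> (real_partial j 1 f) z + real_partial i \<i> (real_partial j \<i> f) z) / 4"
proof -
  have fp: "Ck_on n (Suc 0) U (real_partial j c f)" if "c \<in> {1,\<i>}" for c
    using Ck_on_1_D(1)[of n "Suc 0" U f j c] f that ij unfolding numeral_2_eq_2 by blast
  have "real_partial i c (dzbar j f) z = (real_partial i c (real_partial j 1 f) z + \<i> * real_partial i c (real_partial j \<i> f) z) / 2"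
    if c: "c \<in> {1,\<i>}" for c
  proof -
    have "((\<lambda>t::real. dzbar j f (z(i := z i + of_real t * c))) has_vector_derivative
       (real_partial i c (real_partial j 1 f) z + \<i> * real_partial i c (real_partial j \<i> f) z) / 2) (at 0)"
      unfolding dzbar_def
      by (intro has_vector_derivative_divide has_vector_derivative_add has_vector_derivative_mult_right
          real_partial_works[OF fp z ij(1) c]) auto
    then show ?thesis unfolding real_partial_def[of i c "dzbar j f"] by (rule vector_derivative_at)
  qed
  note h = this
  have "real_partial i 1 (dzbar j f) z = (real_partial i 1 (real_partial j 1 f) z + \<i> * real_partial i 1 (real_partial j \<i> f) z) / 2"
    "real_partial i \<i> (dzbar j f) z = (real_partial i \<i> (real_partial j 1 f) z + \<i> * real_partial i \<i> (real_partial j \<i> f) z) / 2"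
    by (intro h; simp)+
  then show ?thesis unfolding dz_def by (simp only:) (simp add: field_simps)
qed

text \<open>The failure of symmetry of the second derivative on \<open>a\<close> and
  \<open>\<i> * a\<close>.\<close>

definition levi_skew :: "nat \<Rightarrow> (cvec \<Rightarrow> complex) \<Rightarrow> cvec \<Rightarrow> cvec \<Rightarrow> complex" where
  "levi_skew n f z a = (ddB n f z a (\<lambda>i. \<i> * a i) - ddB n f z (\<lambda>i. \<i> * a i) a) / 4"

text \<open>Both sides are combinations of the same four families of iterated real derivatives. The
  real parts of \<open>a i * cnj (a j)\<close> collect \<open>levi_jet\<close>, the imaginary parts
  collect \<open>levi_skew\<close> and a matching rest, so the comparison is made index by
  index.\<close>

lemma levi_eq:
  assumes f: "Ck_on n 2 U f" and z: "z \<in> U"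
  shows "levi n f z a = levi_jet n f z a + \<i> * levi_skew n f z a"
proof -
  define A B C D where "A i j = real_partial i 1 (real_partial j 1 f) z"
    and "B i j = real_partial i 1 (real_partial j \<i> f) z"
    and "C i j = real_partial i \<i> (real_partial j 1 f) z"
    and "D i j = real_partial i \<i> (real_partial j \<i> f) z" for i j
  have dB: "ddB n f z y x = (\<Sum>i<n. \<Sum>j<n. of_real (Re (x j)) * (of_real (Re (y i)) * A i j + of_real (Im (y i)) * C i j)
     + of_real (Im (x j)) * (of_real (Re (y i)) * B i j + of_real (Im (y i)) * D i j))" for x y
    unfolding ddB_def dd_def A_def B_def C_def D_def
    by (subst sum.swap) (simp add: sum_distrib_left sum.distrib distrib_left)
  have "levi n f z a = (\<Sum>i<n. \<Sum>j<n. (A i j + \<i> * B i j - \<i> * C i j + D i j) / 4 * a i * cnj (a j))"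
    unfolding levi_def A_def B_def C_def D_def using dz_dzbar_expand[OF f z] by (intro sum.cong refl) simp
  also have "\<dots> = levi_jet n f z a + \<i> * levi_skew n f z a"
    unfolding levi_jet_def levi_skew_def dB
    unfolding sum_distrib_left diff_divide_distrib add_divide_distrib sum_divide_distrib right_diff_distrib
    unfolding sum_subtractf[symmetric] sum.distrib[symmetric]
    by (intro sum.cong refl) (auto simp: complex_eq_iff field_simps)
  finally show ?thesis .
qed

section \<open>Holomorphic functions of several variables\<close>

definition pd :: "nat \<Rightarrow> (cvec \<Rightarrow> complex) \<Rightarrow> cvec \<Rightarrow> complex" where
  "pd i f z = deriv (\<lambda>t. f (z(i := t))) (z i)"

lemma continuous_on_upd:
  fixes g :: "'a::topological_space \<Rightarrow> cvec" and h :: "'a \<Rightarrow> complex"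
  assumes "continuous_on S g" "continuous_on S h"
  shows "continuous_on S (\<lambda>x. (g x)(i := h x))"
proof (rule continuous_on_coordinatewise_then_product)
  fix j show "continuous_on S (\<lambda>x. ((g x)(i := h x)) j)"
    using assms continuous_on_product_then_coordinatewise[OF assms(1), of j] by (cases "j = i") auto
qed

lemma holo_on_cont: "holo_on n U f \<Longrightarrow> continuous_on U f"
  by (simp add: holo_on_def)

lemma holo_on_pd:
  assumes "holo_on n U f" "z \<in> U" "i < n"
  shows "((\<lambda>t. f (z(i := t))) has_field_derivative pd i f z) (at (z i))"
  using assms unfolding holo_on_def pd_def field_differentiable_derivI by (auto intro: field_differentiable_derivI)

lemma upd_open:
  assumes "open_Cn n U" "z \<in> Cn n" "i < n"
  shows "open {t. z(i := t) \<in> U}"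
proof -
  obtain T where T: "open T" "U = Cn n \<inter> T" using assms(1) unfolding open_Cn_def openin_open by auto
  have "{t. z(i := t) \<in> U} = (\<lambda>t. z(i := t)) -` T" using T assms Cn_upd by auto
  moreover have "open ((\<lambda>t. z(i := t)) -` T)"
    by (rule open_vimage[OF T(1)]) (intro continuous_on_upd continuous_intros)
  ultimately show ?thesis by simp
qed

lemma holo_on_slice:
  assumes "holo_on n U f" "open_Cn n U" "z \<in> Cn n" "i < n"
  shows "(\<lambda>t. f (z(i := t))) holomorphic_on {t. z(i := t) \<in> U}"
  unfolding holomorphic_on_open[OF upd_open[OF assms(2-4)]]
proof
  fix t assume "t \<in> {t. z(i := t) \<in> U}"
  then show "\<exists>f'. ((\<lambda>t. f (z(i := t))) has_field_derivative f') (at t)"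
    using holo_on_pd[OF assms(1), of "z(i := t)" i] assms(4) by auto
qed

text \<open>Cauchy's formula over a circle centred at \<open>z i\<close>, not at \<open>w i\<close>:
  the contour stays fixed while \<open>w\<close> varies near \<open>z\<close>, and the regularity of
  \<open>pd i f\<close> can be read off the integrand. The margin 3 r arises because a point of the
  circle is within 2 r of \<open>w i\<close>, and \<open>w\<close> is within r of
  \<open>z\<close>.\<close>

lemma pd_integral_rep:
  assumes f: "holo_on n U f" and U: "open_Cn n U" and z: "z \<in> Cn n" and i: "i < n" and r: "r > 0"
    and sub: "\<forall>w\<in>Cn n. cdist n w z < 3 * r \<longrightarrow> w \<in> U"
    and w: "w \<in> Cn n" "cdist n w z < r"
  shows "\<And>x. w(i := circlepath (z i) r x) \<in> U" "\<And>x. circlepath (z i) r x \<noteq> w i"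
    "pd i f w = 1 / (2 * of_real pi * \<i>) * integral {0..1} (\<lambda>x. f (w(i := circlepath (z i) r x)) / (circlepath (z i) r x - w i)\<^sup>2
       * vector_derivative (circlepath (z i) r) (at x))"
proof -
  have wi: "cmod (w i - z i) < r" using cmod_le_cdist[OF i, of w z] w by linarith
  have in_U: "w(i := t) \<in> U" if "cmod (t - z i) \<le> r" for t
  proof (rule sub[rule_format])
    show "w(i := t) \<in> Cn n" using w i by (intro Cn_upd)
    have "cdist n (w(i := t)) z \<le> cdist n (w(i := t)) w + cdist n w z" by (rule cdist_triangle)
    also have "cdist n (w(i := t)) w = cmod (t - w i)" using i by (rule cdist_upd)
    also have "\<dots> \<le> cmod (t - z i) + cmod (w i - z i)" by (metis dist_norm dist_triangle2)
    finally show "cdist n (w(i := t)) z < 3 * r" using that wi w by linarith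
  qed
  have cp: "cmod (circlepath (z i) r x - z i) = r" for x
    using r by (simp add: circlepath norm_mult)
  show "\<And>x. w(i := circlepath (z i) r x) \<in> U" using in_U cp by simp
  show "\<And>x. circlepath (z i) r x \<noteq> w i" using cp wi by (metis less_irrefl)
  have hol: "(\<lambda>t. f (w(i := t))) holomorphic_on cball (z i) r"
    by (rule holomorphic_on_subset[OF holo_on_slice[OF f U w(1) i]])
      (auto simp: dist_norm norm_minus_commute intro: in_U)
  have "((\<lambda>t. f (w(i := t))) has_field_derivative
     1 / (2 * of_real pi * \<i>) * contour_integral (circlepath (z i) r) (\<lambda>u. f (w(i := u)) / (u - w i)\<^sup>2)) (at (w i))"
    using holomorphic_on_subset[OF hol ball_subset_cball] wi
    by (intro Cauchy_derivative_integral_circlepath(2) holomorphic_on_imp_continuous_on[OF hol])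
      (auto simp: dist_norm norm_minus_commute)
  then have "pd i f w = 1 / (2 * of_real pi * \<i>) * contour_integral (circlepath (z i) r) (\<lambda>u. f (w(i := u)) / (u - w i)\<^sup>2)"
    unfolding pd_def by (rule DERIV_imp_deriv)
  then show "pd i f w = 1 / (2 * of_real pi * \<i>) * integral {0..1} (\<lambda>x. f (w(i := circlepath (z i) r x)) / (circlepath (z i) r x - w i)\<^sup>2
       * vector_derivative (circlepath (z i) r) (at x))"
    by (simp add: contour_integral_integral)
qed

lemma continuous_on_circlepath: "continuous_on S (circlepath c r)"
  unfolding circlepath by (intro continuous_intros)

lemma continuous_on_vd_circlepath: "continuous_on S (\<lambda>x. vector_derivative (circlepath c r) (at x))"
  by (simp add: vector_derivative_circlepath) (intro continuous_intros)

lemma continuous_on_circlepath_snd: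
  "continuous_on S (\<lambda>x::'a::topological_space \<times> real. circlepath c r (snd x))"
  "continuous_on S (\<lambda>x::'a::topological_space \<times> real. vector_derivative (circlepath c r) (at (snd x)))"
  by (rule continuous_on_compose2[OF continuous_on_circlepath[of UNIV] continuous_on_snd[OF continuous_on_id]]
        continuous_on_compose2[OF continuous_on_vd_circlepath[of UNIV] continuous_on_snd[OF continuous_on_id]], simp)+

text \<open>Near \<open>z\<close> the derivative is an integral over a fixed contour whose integrand
  is jointly continuous in \<open>w\<close> and the contour parameter.\<close>

lemma pd_continuous:
  assumes f: "holo_on n U f" and U: "open_Cn n U" and i: "i < n"
  shows "continuous_on U (pd i f)"
  unfolding continuous_on_Cn_iff[OF U]
proof (intro ballI allI impI)
  fix z and e :: real assume z: "z \<in> U" and e: "e > 0"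
  obtain d where d: "d > 0" "\<And>w. w \<in> Cn n \<Longrightarrow> cdist n w z < d \<Longrightarrow> w \<in> U" "z \<in> Cn n"
    using open_CnE[OF U z] by blast
  define r where "r = d / 3"
  have r: "r > 0" "3 * r = d" using d by (auto simp: r_def)
  define V where "V = {w \<in> Cn n. cdist n w z < r}"
  have V: "open_Cn n V" unfolding V_def by (rule open_Cn_ball)
  have d3: "\<forall>w\<in>Cn n. cdist n w z < 3 * r \<longrightarrow> w \<in> U" using d(2) r(2) by blast
  note rep = pd_integral_rep[OF f U d(3) i r(1) d3]
  have "continuous_on (V \<times> cbox 0 1) (\<lambda>(w, x). f (w(i := circlepath (z i) r x)) / (circlepath (z i) r x - w i)\<^sup>2
       * vector_derivative (circlepath (z i) r) (at x))"
    unfolding case_prod_unfold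
  proof (intro continuous_intros)
    show "continuous_on (V \<times> cbox 0 1) (\<lambda>x. f ((fst x)(i := circlepath (z i) r (snd x))))"
    proof (rule continuous_on_compose2[OF holo_on_cont[OF f]])
      show "continuous_on (V \<times> cbox 0 1) (\<lambda>x. (fst x)(i := circlepath (z i) r (snd x)))"
        by (rule continuous_on_upd[OF continuous_on_fst[OF continuous_on_id] continuous_on_circlepath_snd(1)])
      show "(\<lambda>x. (fst x)(i := circlepath (z i) r (snd x))) ` (V \<times> cbox 0 1) \<subseteq> U"
        using rep(1) by (auto simp: V_def)
    qed
    show "continuous_on (V \<times> cbox 0 1) (\<lambda>x. circlepath (z i) r (snd x))"
      "continuous_on (V \<times> cbox 0 1) (\<lambda>x. vector_derivative (circlepath (z i) r) (at (snd x)))"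
      by (rule continuous_on_circlepath_snd)+
    show "continuous_on (V \<times> cbox 0 1) (\<lambda>x. fst x i)"
      by (rule continuous_on_product_then_coordinatewise[OF continuous_on_fst[OF continuous_on_id]])
    show "\<forall>x\<in>V \<times> cbox 0 1. (circlepath (z i) r (snd x) - fst x i)\<^sup>2 \<noteq> 0"
      using rep(2) by (auto simp: V_def)
  qed
  from integral_continuous_on_param[OF this]
  have "continuous_on V (\<lambda>w. 1 / (2 * of_real pi * \<i>) * integral (cbox 0 1) (\<lambda>x. f (w(i := circlepath (z i) r x)) / (circlepath (z i) r x - w i)\<^sup>2
       * vector_derivative (circlepath (z i) r) (at x)))"
    by (intro continuous_on_mult continuous_on_const)
  then have "continuous_on V (pd i f)"
    by (rule continuous_on_eq) (use rep(3) in \<open>auto simp: V_def\<close>)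
  then obtain d' where "d' > 0" "\<And>w. w \<in> Cn n \<Longrightarrow> cdist n w z < d' \<Longrightarrow> w \<in> V \<and> dist (pd i f w) (pd i f z) < e"
    using continuous_on_CnE[OF V _ _ e, of "pd i f" z] d r by (auto simp: V_def)
  then show "\<exists>d>0. \<forall>w\<in>Cn n. cdist n w z < d \<longrightarrow> w \<in> U \<and> dist (pd i f w) (pd i f z) < e"
    using d(2) r unfolding V_def by (intro exI[of _ d']) fastforce
qed

text \<open>In the variable \<open>i\<close> this is the holomorphy of the derivative of a
  one-variable function. In another variable \<open>j\<close> one differentiates under the Cauchy
  integral, and the derivative of the integrand is continuous by \<open>pd_continuous\<close> for
  \<open>j\<close>.\<close>

lemma holo_on_pd_holo:
  assumes f: "holo_on n U f" and U: "open_Cn n U" and i: "i < n"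
  shows "holo_on n U (pd i f)"
  unfolding holo_on_def
proof (intro conjI ballI allI impI pd_continuous[OF f U i])
  fix z j assume z: "z \<in> U" and j: "j < n"
  obtain d where d: "d > 0" "\<And>w. w \<in> Cn n \<Longrightarrow> cdist n w z < d \<Longrightarrow> w \<in> U" "z \<in> Cn n"
    using open_CnE[OF U z] by blast
  show "(\<lambda>t. pd i f (z(j := t))) field_differentiable at (z j)"
  proof (cases "j = i")
    case True
    have "deriv (\<lambda>t. f (z(i := t))) holomorphic_on {t. z(i := t) \<in> U}"
      by (rule holomorphic_deriv[OF holo_on_slice[OF f U d(3) i] upd_open[OF U d(3) i]])
    then have "deriv (\<lambda>t. f (z(i := t))) field_differentiable at (z i)"
      by (rule holomorphic_on_imp_differentiable_at[OF _ upd_open[OF U d(3) i]]) (use z in simp)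
    then show ?thesis using True by (simp add: pd_def[abs_def])
  next
    case ji: False
    define r where "r = d / 3"
    have r: "r > 0" "3 * r = d" using d by (auto simp: r_def)
    have d3: "\<forall>w\<in>Cn n. cdist n w z < 3 * r \<longrightarrow> w \<in> U" using d(2) r(2) by blast
  note rep = pd_integral_rep[OF f U d(3) i r(1) d3]
    define q where "q s = z(j := s)" for s
    have qV: "q s \<in> Cn n" "cdist n (q s) z < r" if "s \<in> ball (z j) r" for s
      using that d(3) j by (auto simp: q_def cdist_upd dist_norm norm_minus_commute intro: Cn_upd)
    \<comment> \<open>The kernel is independent of \<open>s\<close>, because changing the coordinate
      \<open>j\<close> leaves \<open>q s i = z i\<close>.\<close>
    define K where "K x = vector_derivative (circlepath (z i) r) (at x) / (circlepath (z i) r x - z i)\<^sup>2" for x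
    have qi: "q s i = z i" for s using ji by (simp add: q_def)
    have nz: "circlepath (z i) r x \<noteq> z i" for x using rep(2)[OF d(3)] r by simp
    have Kc: "continuous_on (ball (z j) r \<times> cbox 0 1) (\<lambda>x. K (snd x))"
      unfolding K_def
      by (intro continuous_on_divide continuous_on_power continuous_on_diff continuous_on_circlepath_snd continuous_on_const)
        (use nz in auto)
    have curvec: "continuous_on (ball (z j) r \<times> cbox 0 1) (\<lambda>x. (q (fst x))(i := circlepath (z i) r (snd x)))"
      unfolding q_def
      by (rule continuous_on_upd[OF continuous_on_upd[OF continuous_on_const continuous_on_fst[OF continuous_on_id]] continuous_on_circlepath_snd(1)])
    have into: "(\<lambda>x. (q (fst x))(i := circlepath (z i) r (snd x))) ` (ball (z j) r \<times> cbox 0 1) \<subseteq> U"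
      using rep(1) qV by auto
    have eq: "pd i f (q s) = 1 / (2 * of_real pi * \<i>) * integral (cbox 0 1) (\<lambda>x. f ((q s)(i := circlepath (z i) r x)) * K x)" if "s \<in> ball (z j) r" for s
      unfolding rep(3)[OF qV[OF that]] qi K_def by simp
    have "(\<lambda>s. integral (cbox 0 1) (\<lambda>x. f ((q s)(i := circlepath (z i) r x)) * K x)) holomorphic_on ball (z j) r"
    proof (rule leibniz_rule_holomorphic[where fx = "\<lambda>s x. pd j f ((q s)(i := circlepath (z i) r x)) * K x"])
      fix s x assume s: "s \<in> ball (z j) r" and x: "x \<in> cbox (0::real) 1"
      let ?w = "(q s)(i := circlepath (z i) r x)"
      have "?w \<in> U" using rep(1)[OF qV[OF s]] .
      then have "((\<lambda>t. f (?w(j := t))) has_field_derivative pd j f ?w) (at (?w j))"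
        by (rule holo_on_pd[OF f _ j])
      moreover have "?w(j := t) = (q t)(i := circlepath (z i) r x)" for t
        using ji by (auto simp: q_def fun_eq_iff)
      moreover have "?w j = s" using ji by (simp add: q_def)
      ultimately have "((\<lambda>s. f ((q s)(i := circlepath (z i) r x))) has_field_derivative pd j f ?w) (at s)" by simp
      then show "((\<lambda>s. f ((q s)(i := circlepath (z i) r x)) * K x) has_field_derivative pd j f ?w * K x) (at s within ball (z j) r)"
        by (rule DERIV_cmult_right[OF has_field_derivative_at_within])
    next
      fix s assume s: "s \<in> ball (z j) r"
      have "continuous_on (ball (z j) r \<times> cbox 0 1) (\<lambda>x. f ((q (fst x))(i := circlepath (z i) r (snd x))) * K (snd x))"
        by (intro continuous_on_mult Kc continuous_on_compose2[OF holo_on_cont[OF f] curvec into])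
      then have "continuous_on (Pair s ` cbox 0 1) (\<lambda>x. f ((q (fst x))(i := circlepath (z i) r (snd x))) * K (snd x))"
        by (rule continuous_on_subset) (use s in auto)
      moreover have "continuous_on (cbox 0 (1::real)) (Pair s)"
        by (intro continuous_on_Pair continuous_on_const continuous_on_id)
      ultimately have "continuous_on (cbox 0 1) ((\<lambda>x. f ((q (fst x))(i := circlepath (z i) r (snd x))) * K (snd x)) \<circ> Pair s)"
        by (intro continuous_on_compose)
      then have "continuous_on (cbox 0 1) (\<lambda>x. f ((q s)(i := circlepath (z i) r x)) * K x)" by (simp add: o_def)
      then show "(\<lambda>x. f ((q s)(i := circlepath (z i) r x)) * K x) integrable_on cbox 0 1"
        by (rule integrable_continuous)
    next
      show "continuous_on (ball (z j) r \<times> cbox 0 1) (\<lambda>(s, x). pd j f ((q s)(i := circlepath (z i) r x)) * K x)"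
        unfolding case_prod_unfold
        by (intro continuous_on_mult Kc continuous_on_compose2[OF pd_continuous[OF f U j] curvec into])
    qed auto
    then have "(\<lambda>s. 1 / (2 * of_real pi * \<i>) * integral (cbox 0 1) (\<lambda>x. f ((q s)(i := circlepath (z i) r x)) * K x)) holomorphic_on ball (z j) r"
      by (intro holomorphic_on_mult holomorphic_on_const)
    then have "(\<lambda>s. pd i f (q s)) holomorphic_on ball (z j) r"
      by (rule holomorphic_transform) (use eq in auto)
    then have "(\<lambda>s. pd i f (q s)) field_differentiable at (z j)"
      by (rule holomorphic_on_imp_differentiable_at) (use r in auto)
    then show ?thesis by (simp add: q_def)
  qed
qed

lemma holo_real_partial:
  assumes "holo_on n U f" "z \<in> U" "i < n"
  shows "((\<lambda>t::real. f (z(i := z i + of_real t * c))) has_vector_derivative c * pd i f z) (at 0)"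
    and "real_partial i c f z = c * pd i f z"
proof -
  have "((\<lambda>t. f (z(i := t))) has_field_derivative pd i f z) (at (z i + of_real 0 * c))"
    using holo_on_pd[OF assms] by simp
  moreover have "((\<lambda>t::real. z i + of_real t * c) has_vector_derivative c) (at 0)"
    by (auto intro!: derivative_eq_intros has_vector_derivative_of_real simp: has_vector_derivative_def scaleR_conv_of_real)
  ultimately show 1: "((\<lambda>t::real. f (z(i := z i + of_real t * c))) has_vector_derivative c * pd i f z) (at 0)"
    using field_vector_diff_chain_at[of "\<lambda>t::real. z i + of_real t * c" c 0 "\<lambda>t. f (z(i := t))" "pd i f z"]
    by (simp add: o_def)
  then show "real_partial i c f z = c * pd i f z"
    unfolding real_partial_def by (rule vector_derivative_at)
qed

text \<open>The bridge from complex to real calculus: the real partial derivatives are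
  \<open>pd i f\<close> times 1 and times the imaginary unit.\<close>

lemma holo_Ck1:
  assumes f: "holo_on n U f" and U: "open_Cn n U"
  shows "Ck_on n 1 U f"
proof -
  have "continuous_on U (real_partial i c f)" if "i < n" for i c
    by (rule continuous_on_eq[of _ "\<lambda>z. c * pd i f z"])
      (use holo_real_partial(2)[OF f _ that] in \<open>auto intro!: continuous_intros pd_continuous[OF f U that]\<close>)
  moreover have "(\<lambda>t::real. f (z(i := z i + of_real t * c))) differentiable at 0" if "z \<in> U" "i < n" for z i c
    using holo_real_partial(1)[OF f that] by (rule differentiableI_vector)
  ultimately show ?thesis using holo_on_cont[OF f] by simp
qed

lemma holo_chain:
  fixes p :: "complex \<Rightarrow> cvec"
  assumes f: "holo_on n U f" and U: "open_Cn n U" and z: "p t0 \<in> U"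
    and pC: "\<forall>\<^sub>F t in nhds t0. p t \<in> Cn n"
    and P: "\<And>i. i < n \<Longrightarrow> ((\<lambda>t. p t i) has_field_derivative P i) (at t0)"
  shows "((\<lambda>t. f (p t)) has_field_derivative (\<Sum>i<n. pd i f (p t0) * P i)) (at t0)"
proof -
  \<comment> \<open>\<open>C1_chain\<close> asks for a curve that lies in \<open>Cn n\<close> at
    every parameter; \<open>q\<close> agrees with \<open>p\<close> near \<open>t0\<close>.\<close>
  define q where "q t = (if p t \<in> Cn n then p t else p t0)" for t
  have q0: "q t0 = p t0" by (simp add: q_def)
  have ev: "\<forall>\<^sub>F t in nhds t0. p t = q t" using pC by eventually_elim (simp add: q_def)
  have "((\<lambda>t. f (q t)) has_derivative (\<lambda>h. dd n f (q t0) (\<lambda>i. P i * h))) (at t0)"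
  proof (rule C1_chain[OF holo_Ck1[OF f U] U])
    show "q t0 \<in> U" using z q0 by simp
    show "q t \<in> Cn n" for t using z open_Cn_subset[OF U] by (auto simp: q_def)
    fix i assume "i < n"
    have "((\<lambda>t. p t i) has_derivative (\<lambda>h. P i * h)) (at t0)"
      using P[OF \<open>i < n\<close>] by (simp add: has_field_derivative_def)
    then show "((\<lambda>t. q t i) has_derivative (\<lambda>h. P i * h)) (at t0)"
      by (rule has_derivative_transform_eventually)
        (use ev q0 in \<open>auto elim: eventually_mono simp: eventually_nhds_conv_at\<close>)
  qed
  then have "((\<lambda>t. f (p t)) has_derivative (\<lambda>h. dd n f (q t0) (\<lambda>i. P i * h))) (at t0)"
    by (rule has_derivative_transform_eventually)
      (use ev q0 in \<open>auto elim: eventually_mono simp: eventually_nhds_conv_at\<close>)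
  moreover have "dd n f (q t0) (\<lambda>i. P i * h) = (\<Sum>i<n. pd i f (p t0) * P i) * h" for h
    unfolding dd_def q0 sum_distrib_right
  proof (intro sum.cong refl)
    fix i assume "i \<in> {..<n}"
    then have r: "real_partial i c f (p t0) = c * pd i f (p t0)" for c
      using holo_real_partial(2)[OF f z] by simp
    have "P i * h = of_real (Re (P i * h)) + \<i> * of_real (Im (P i * h))" by (rule complex_eq)
    then show "of_real (Re (P i * h)) * real_partial i 1 f (p t0) + of_real (Im (P i * h)) * real_partial i \<i> f (p t0)
       = pd i f (p t0) * P i * h"
      unfolding r by (metis (no_types, opaque_lifting) distrib_right mult.assoc mult.commute mult_1)
  qed
  ultimately show ?thesis by (simp add: has_field_derivative_def)
qed

lemma holo_on_compose:
  assumes g: "holo_on m V g" and V: "open_Cn m V" and U: "open_Cn n U"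
    and G: "\<And>j. j < m \<Longrightarrow> holo_on n U (\<lambda>z. G z j)" and GV: "\<And>z. z \<in> U \<Longrightarrow> G z \<in> V"
  shows "holo_on n U (\<lambda>z. g (G z))"
    and "z \<in> U \<Longrightarrow> i < n \<Longrightarrow> pd i (\<lambda>z. g (G z)) z = (\<Sum>j<m. pd j g (G z) * pd i (\<lambda>z. G z j) z)"
proof -
  have der: "((\<lambda>t. g (G (z(i := t)))) has_field_derivative (\<Sum>j<m. pd j g (G z) * pd i (\<lambda>z. G z j) z)) (at (z i))"
    if z: "z \<in> U" and i: "i < n" for z i
  proof -
    have "z \<in> Cn n" using z open_Cn_subset[OF U] by auto
    have ev: "\<forall>\<^sub>F t in nhds (z i). z(i := t) \<in> U"
      using eventually_nhds_in_open[OF upd_open[OF U \<open>z \<in> Cn n\<close> i], of "z i"] z by simp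
    have "((\<lambda>t. g (G (z(i := t)))) has_field_derivative (\<Sum>j<m. pd j g (G (z(i := z i))) * pd i (\<lambda>z. G z j) z)) (at (z i))"
    proof (rule holo_chain[OF g V])
      show "G (z(i := z i)) \<in> V" using GV z by simp
      show "\<forall>\<^sub>F t in nhds (z i). G (z(i := t)) \<in> Cn m"
        using ev by eventually_elim (use GV open_Cn_subset[OF V] in blast)
      show "((\<lambda>t. G (z(i := t)) j) has_field_derivative pd i (\<lambda>z. G z j) z) (at (z i))" if "j < m" for j
        using holo_on_pd[OF G[OF that] z i] .
    qed
    then show ?thesis by simp
  qed
  show "holo_on n U (\<lambda>z. g (G z))"
    unfolding holo_on_def
  proof (intro conjI ballI allI impI)
    have "continuous_on U G"
    proof (rule continuous_on_coordinatewise_then_product)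
      fix j show "continuous_on U (\<lambda>z. G z j)"
      proof (cases "j < m")
        case True then show ?thesis using G holo_on_cont by blast
      next
        case False
        then have "G z j = 0" if "z \<in> U" for z using GV[OF that] open_Cn_subset[OF V] by (auto simp: Cn_def)
        then show ?thesis using continuous_on_eq[OF continuous_on_const[of U 0]] by metis
      qed
    qed
    then show "continuous_on U (\<lambda>z. g (G z))"
      by (rule continuous_on_compose2[OF holo_on_cont[OF g]]) (use GV in auto)
    show "(\<lambda>t. g (G (z(i := t)))) field_differentiable at (z i)" if "z \<in> U" "i < n" for z i
      using der[OF that] by (auto simp: field_differentiable_def)
  qed
  show "pd i (\<lambda>z. g (G z)) z = (\<Sum>j<m. pd j g (G z) * pd i (\<lambda>z. G z j) z)" if "z \<in> U" "i < n"
    unfolding pd_def[of i "\<lambda>z. g (G z)"] using der[OF that] by (rule DERIV_imp_deriv)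
qed

lemma holo_on_const: "holo_on n U (\<lambda>z. c)"
  by (auto simp: holo_on_def)

lemma holo_on_coord: "holo_on n U (\<lambda>z. z j)"
  unfolding holo_on_def
proof (intro conjI ballI allI impI continuous_on_coord)
  show "(\<lambda>t. (z(i := t)) j) field_differentiable at (z i)" for z :: cvec and i
    by (cases "j = i") (auto simp: field_differentiable_ident)
qed

lemma holo_on_add: "holo_on n U f \<Longrightarrow> holo_on n U g \<Longrightarrow> holo_on n U (\<lambda>z. f z + g z)"
  by (auto simp: holo_on_def intro!: continuous_intros field_differentiable_add)

lemma holo_on_mult: "holo_on n U f \<Longrightarrow> holo_on n U g \<Longrightarrow> holo_on n U (\<lambda>z. f z * g z)"
  by (auto simp: holo_on_def intro!: continuous_intros field_differentiable_mult)

lemma holo_on_divide: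
  "holo_on n U f \<Longrightarrow> holo_on n U g \<Longrightarrow> (\<And>z. z \<in> U \<Longrightarrow> g z \<noteq> 0) \<Longrightarrow> holo_on n U (\<lambda>z. f z / g z)"
  by (auto simp: holo_on_def intro!: continuous_intros field_differentiable_divide)

lemma holo_on_sum: "(\<And>i. i \<in> I \<Longrightarrow> holo_on n U (f i)) \<Longrightarrow> holo_on n U (\<lambda>z. \<Sum>i\<in>I. f i z)"
  by (induction I rule: infinite_finite_induct) (auto intro: holo_on_const holo_on_add)

lemma holo_on_subset: "holo_on n U f \<Longrightarrow> V \<subseteq> U \<Longrightarrow> holo_on n V f"
  by (auto simp: holo_on_def intro: continuous_on_subset)

lemma holo_on_cong:
  assumes U: "open_Cn n U" and f: "holo_on n U f" and eq: "\<And>z. z \<in> U \<Longrightarrow> f z = g z"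
  shows "holo_on n U g"
  unfolding holo_on_def
proof (intro conjI ballI allI impI)
  show "continuous_on U g" using continuous_on_eq[OF holo_on_cont[OF f] eq] .
  fix z i assume z: "z \<in> U" and i: "i < n"
  have zC: "z \<in> Cn n" using z open_Cn_subset[OF U] by auto
  have "((\<lambda>t. g (z(i := t))) has_field_derivative pd i f z) (at (z i))"
    by (rule has_field_derivative_transform_within_open[OF holo_on_pd[OF f z i] upd_open[OF U zC i]])
      (use z eq in auto)
  then show "(\<lambda>t. g (z(i := t))) field_differentiable at (z i)" by (auto simp: field_differentiable_def)
qed

lemma pd_cong:
  assumes U: "open_Cn n U" and z: "z \<in> U" and i: "i < n" and eq: "\<And>z. z \<in> U \<Longrightarrow> f z = g z"
  shows "pd i f z = pd i g z"
proof -
  have zC: "z \<in> Cn n" using z open_Cn_subset[OF U] by auto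
  have "\<forall>\<^sub>F t in nhds (z i). z(i := t) \<in> U"
    using eventually_nhds_in_open[OF upd_open[OF U zC i], of "z i"] z by simp
  then show ?thesis unfolding pd_def
    by (intro deriv_cong_ev) (auto elim: eventually_mono simp: eq)
qed

lemma pd_coord: "pd i (\<lambda>z. z j) z = (if i = j then 1 else 0)"
  unfolding pd_def by (cases "i = j") auto

lemma holo_on_line:
  assumes f: "holo_on n U f" and U: "open_Cn n U" and z: "z \<in> Cn n" and u: "u \<in> Cn n"
    and S: "\<And>t. t \<in> S \<Longrightarrow> (\<lambda>i. z i + t * u i) \<in> U" and oS: "open S"
  shows "(\<lambda>t. f (\<lambda>i. z i + t * u i)) holomorphic_on S"
    and "t \<in> S \<Longrightarrow> ((\<lambda>t. f (\<lambda>i. z i + t * u i)) has_field_derivative (\<Sum>i<n. pd i f (\<lambda>i. z i + t * u i) * u i)) (at t)"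
proof -
  have d: "((\<lambda>t. f (\<lambda>i. z i + t * u i)) has_field_derivative (\<Sum>i<n. pd i f (\<lambda>i. z i + t * u i) * u i)) (at t)"
    if "t \<in> S" for t
  proof (rule holo_chain[OF f U, of "\<lambda>t i. z i + t * u i"])
    show "\<forall>\<^sub>F t in nhds t. (\<lambda>i. z i + t * u i) \<in> Cn n"
      using z u by (intro always_eventually allI Cn_add Cn_scale)
    show "((\<lambda>t. z i + t * u i) has_field_derivative u i) (at t)" for i
      by (auto intro!: derivative_eq_intros)
  qed (use S that in auto)
  then show "t \<in> S \<Longrightarrow> ((\<lambda>t. f (\<lambda>i. z i + t * u i)) has_field_derivative (\<Sum>i<n. pd i f (\<lambda>i. z i + t * u i) * u i)) (at t)" .
  show "(\<lambda>t. f (\<lambda>i. z i + t * u i)) holomorphic_on S"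
    using d oS by (auto simp: holomorphic_on_open)
qed

section \<open>Conjugation and the Levi forms of Hermitian families\<close>

lemma real_partial_cnj:
  assumes U: "open_Cn n U" and f: "Ck_on n (Suc k) U f" and z: "z \<in> U" and i: "i < n" and c: "c \<in> {1,\<i>}"
    and g: "\<And>w. w \<in> U \<Longrightarrow> g w = cnj (f w)"
  shows "real_partial i c g z = cnj (real_partial i c f z)"
proof -
  have "((\<lambda>t::real. cnj (f (z(i := z i + of_real t * c)))) has_vector_derivative cnj (real_partial i c f z)) (at 0)"
    using real_partial_works[OF f z i c] by (rule bounded_linear.has_vector_derivative[OF bounded_linear_cnj])
  then have "real_partial i c (\<lambda>w. cnj (f w)) z = cnj (real_partial i c f z)"
    unfolding real_partial_def[of i c "\<lambda>w. cnj (f w)"] by (rule vector_derivative_at)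
  then show ?thesis using real_partial_cong[OF U z i, of g "\<lambda>w. cnj (f w)" c] g by simp
qed

lemma ddB_cnj:
  assumes U: "open_Cn n U" and f: "Ck_on n 2 U f" and z: "z \<in> U" and g: "\<And>w. w \<in> U \<Longrightarrow> g w = cnj (f w)"
  shows "ddB n g z y x = cnj (ddB n f z y x)"
proof -
  have f2: "Ck_on n (Suc (Suc 0)) U f" using f by (simp only: numeral_2_eq_2)
  have "real_partial i c (real_partial j c' g) z = cnj (real_partial i c (real_partial j c' f) z)"
    if "i < n" "j < n" "c \<in> {1,\<i>}" "c' \<in> {1,\<i>}" for i j c c'
    by (rule real_partial_cnj[OF U Ck_on_1_D(1)[OF f2 that(2,4)] z that(1,3)])
      (rule real_partial_cnj[OF U f2 _ that(2,4) g])
  then show ?thesis unfolding ddB_def dd_def by simp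
qed

lemma levi_skew_cnj:
  assumes U: "open_Cn n U" and f: "Ck_on n 2 U f" and z: "z \<in> U" and g: "\<And>w. w \<in> U \<Longrightarrow> g w = cnj (f w)"
  shows "levi_skew n g z a = cnj (levi_skew n f z a)"
  unfolding levi_skew_def using ddB_cnj[OF U f z g] by simp

text \<open>The skew part, which vanishes by Schwarz's theorem, is invisible here because its
  contribution is purely imaginary.\<close>

lemma Re_levi_jet_hermitian:
  assumes U: "open_Cn n U" and h: "\<And>\<alpha> \<beta>. \<alpha> < r \<Longrightarrow> \<beta> < r \<Longrightarrow> Ck_on n 2 U (h \<alpha> \<beta>)" and z: "z \<in> U"
    and herm: "\<And>\<alpha> \<beta> w. \<alpha> < r \<Longrightarrow> \<beta> < r \<Longrightarrow> w \<in> U \<Longrightarrow> h \<beta> \<alpha> w = cnj (h \<alpha> \<beta> w)"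
  shows "Re (\<Sum>\<alpha><r. \<Sum>\<beta><r. levi_jet n (h \<alpha> \<beta>) z a * v \<alpha> * cnj (v \<beta>))
       = Re (\<Sum>\<alpha><r. \<Sum>\<beta><r. levi n (h \<alpha> \<beta>) z a * v \<alpha> * cnj (v \<beta>))"
proof -
  define S where "S = (\<Sum>\<alpha><r. \<Sum>\<beta><r. levi_skew n (h \<alpha> \<beta>) z a * v \<alpha> * cnj (v \<beta>))"
  have key: "cnj (levi_skew n (h \<alpha> \<beta>) z a) = levi_skew n (h \<beta> \<alpha>) z a" if "\<alpha> < r" "\<beta> < r" for \<alpha> \<beta>
    using levi_skew_cnj[OF U h[OF that] z herm[OF that]] by simp
  have "cnj S = (\<Sum>\<alpha><r. \<Sum>\<beta><r. levi_skew n (h \<beta> \<alpha>) z a * cnj (v \<alpha>) * v \<beta>)"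
    unfolding S_def cnj_sum
    by (intro sum.cong refl) (simp add: key)
  also have "\<dots> = S" unfolding S_def by (subst sum.swap) (simp add: mult.assoc mult.left_commute mult.commute)
  finally have "Im (cnj S) = Im S" by simp
  then have "Im S = 0" by simp
  have "(\<Sum>\<alpha><r. \<Sum>\<beta><r. levi n (h \<alpha> \<beta>) z a * v \<alpha> * cnj (v \<beta>)) =
    (\<Sum>\<alpha><r. \<Sum>\<beta><r. levi_jet n (h \<alpha> \<beta>) z a * v \<alpha> * cnj (v \<beta>)) + \<i> * S"
    unfolding S_def sum_distrib_left sum.distrib[symmetric]
    using levi_eq[OF h z] by (intro sum.cong refl) (simp add: algebra_simps)
  then show ?thesis using \<open>Im S = 0\<close> by simp
qed

lemma Re_levi_jet_real:
  assumes U: "open_Cn n U" and f: "Ck_on n 2 U f" and z: "z \<in> U" and real: "\<And>w. w \<in> U \<Longrightarrow> cnj (f w) = f w"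
  shows "Re (levi_jet n f z a) = Re (levi n f z a)"
  using Re_levi_jet_hermitian[OF U, of "Suc 0" "\<lambda>_ _. f" z a "\<lambda>_. 1"] f z real by simp

section \<open>Charts and holomorphic maps\<close>

lemma chart_inv_left: "inj_on (snd c) (fst c) \<Longrightarrow> x \<in> fst c \<Longrightarrow> chart_inv c (snd c x) = x"
  by (simp add: chart_inv_def)

lemma chart_inv_image: "z \<in> snd c ` W \<Longrightarrow> W \<subseteq> fst c \<Longrightarrow> inj_on (snd c) (fst c) \<Longrightarrow> chart_inv c z \<in> W \<and> snd c (chart_inv c z) = z"
  by (auto simp: chart_inv_left subset_iff)

lemma atlasD:
  assumes "holomorphic_atlas M" "c \<in> cm_atlas M"
  shows "inj_on (snd c) (fst c)" "open_Cn (cm_dim M) (snd c ` fst c)" "fst c \<subseteq> cm_pts M"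
    "x \<in> fst c \<Longrightarrow> snd c x \<in> Cn (cm_dim M)"
proof -
  show "inj_on (snd c) (fst c)" and o: "open_Cn (cm_dim M) (snd c ` fst c)"
    using assms unfolding holomorphic_atlas_def by auto
  have "fst c \<subseteq> (\<Union>(U, \<phi>)\<in>cm_atlas M. U)" using assms(2) by (auto intro!: bexI[of _ c])
  then show "fst c \<subseteq> cm_pts M" using assms(1) unfolding holomorphic_atlas_def by simp
  show "x \<in> fst c \<Longrightarrow> snd c x \<in> Cn (cm_dim M)" using open_Cn_subset[OF o] by auto
qed

lemma atlas_overlap:
  assumes "holomorphic_atlas M" "c \<in> cm_atlas M" "c' \<in> cm_atlas M"
  shows "open_Cn (cm_dim M) (snd c ` (fst c \<inter> fst c'))"
    "i < cm_dim M \<Longrightarrow> holo_on (cm_dim M) (snd c ` (fst c \<inter> fst c')) (\<lambda>z. snd c' (chart_inv c z) i)"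
  using assms unfolding holomorphic_atlas_def by (auto simp: case_prod_beta)

lemma atlas_cover: "holomorphic_atlas M \<Longrightarrow> x \<in> cm_pts M \<Longrightarrow> \<exists>c\<in>cm_atlas M. x \<in> fst c"
proof -
  assume "holomorphic_atlas M" "x \<in> cm_pts M"
  then have "x \<in> (\<Union>(U, \<phi>)\<in>cm_atlas M. U)" unfolding holomorphic_atlas_def by simp
  then show ?thesis by (simp add: case_prod_beta)
qed

text \<open>Holomorphy purely in coordinates: openness of the coordinate domain stands in for
  continuity with respect to \<open>cm_topology\<close>. The identity is an instance, so that
  coordinate changes and maps are differentiated by the same lemmas.\<close>

definition hmap :: "'a cmfd \<Rightarrow> 'b cmfd \<Rightarrow> ('a \<Rightarrow> 'b) \<Rightarrow> bool" where
  "hmap M N f \<longleftrightarrow> (\<forall>c\<in>cm_atlas M. \<forall>d\<in>cm_atlas N. open_Cn (cm_dim M) (snd c ` (fst c \<inter> f -` fst d)) \<and>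
     (\<forall>i<cm_dim N. holo_on (cm_dim M) (snd c ` (fst c \<inter> f -` fst d)) (\<lambda>z. snd d (f (chart_inv c z)) i)))"

lemma hmap_id: "holomorphic_atlas M \<Longrightarrow> hmap M M (\<lambda>x. x)"
  unfolding hmap_def using atlas_overlap[of M] by auto

lemma continuous_on_to_Cn:
  assumes "\<And>i. i < m \<Longrightarrow> continuous_on U (\<lambda>z. G z i)" "\<And>z. z \<in> U \<Longrightarrow> G z \<in> Cn m"
  shows "continuous_on U (G :: cvec \<Rightarrow> cvec)"
proof (rule continuous_on_coordinatewise_then_product)
  fix j show "continuous_on U (\<lambda>z. G z j)"
  proof (cases "j < m")
    case False
    then have "G z j = 0" if "z \<in> U" for z using assms(2)[OF that] by (auto simp: Cn_def)
    then show ?thesis using continuous_on_eq[OF continuous_on_const[of U 0]] by metis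
  qed (use assms(1) in auto)
qed

lemma hmap_continuous:
  assumes "hmap M N f" "holomorphic_atlas M" "holomorphic_atlas N" "c \<in> cm_atlas M" "d \<in> cm_atlas N"
  shows "continuous_on (snd c ` (fst c \<inter> f -` fst d)) (\<lambda>z. snd d (f (chart_inv c z)))"
    "z \<in> snd c ` (fst c \<inter> f -` fst d) \<Longrightarrow> snd d (f (chart_inv c z)) \<in> Cn (cm_dim N)"
proof -
  show 1: "z \<in> snd c ` (fst c \<inter> f -` fst d) \<Longrightarrow> snd d (f (chart_inv c z)) \<in> Cn (cm_dim N)" for z
    using chart_inv_image[of z c "fst c \<inter> f -` fst d"] atlasD[OF assms(2,4)] atlasD(4)[OF assms(3,5)] by auto
  show "continuous_on (snd c ` (fst c \<inter> f -` fst d)) (\<lambda>z. snd d (f (chart_inv c z)))"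
    by (rule continuous_on_to_Cn[of "cm_dim N"]) (use assms 1 in \<open>auto simp: hmap_def intro!: holo_on_cont\<close>)
qed

text \<open>Induction over the generation of the topology. Injectivity of the chart carries
  intersections through the image, and a generator that lives in another chart becomes a preimage
  under the continuous coordinate change.\<close>

lemma generate_cm_open:
  assumes M: "holomorphic_atlas M" and c: "c \<in> cm_atlas M"
    and W: "generate_topology_on {W. \<exists>(U, \<phi>)\<in>cm_atlas M. W \<subseteq> U \<and> open_Cn (cm_dim M) (\<phi> ` W)} W"
  shows "open_Cn (cm_dim M) (snd c ` (W \<inter> fst c))"
  using W
proof induction
  case Empty
  then show ?case by (simp add: open_Cn_def)
next
  case (Int a b)
  have "snd c ` (a \<inter> b \<inter> fst c) = snd c ` (a \<inter> fst c) \<inter> snd c ` (b \<inter> fst c)"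
    using atlasD(1)[OF M c] by (auto simp: inj_on_def)
  then show ?case using open_Cn_Int[OF Int.IH] by simp
next
  case (UN K)
  have "snd c ` (\<Union>K \<inter> fst c) = (\<Union>k\<in>K. snd c ` (k \<inter> fst c))" by auto
  then show ?case using open_Cn_UN[of K _ "\<lambda>k. snd c ` (k \<inter> fst c)"] UN.IH by simp
next
  case (Basis s)
  then obtain c' where c': "c' \<in> cm_atlas M" "s \<subseteq> fst c'" "open_Cn (cm_dim M) (snd c' ` s)"
    by auto
  let ?U = "snd c ` (fst c \<inter> (\<lambda>x. x) -` fst c')"
  have "open_Cn (cm_dim M) {z \<in> ?U. snd c' (chart_inv c z) \<in> snd c' ` s}"
  proof (rule open_Cn_vimage)
    show "open_Cn (cm_dim M) ?U" using atlas_overlap(1)[OF M c c'(1)] by simp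
    show "continuous_on ?U (\<lambda>z. snd c' (chart_inv c z))"
      by (rule hmap_continuous(1)[OF hmap_id[OF M] M M c c'(1)])
    show "(\<lambda>z. snd c' (chart_inv c z)) ` ?U \<subseteq> Cn (cm_dim M)"
      using hmap_continuous(2)[OF hmap_id[OF M] M M c c'(1)] by auto
  qed (rule c'(3))
  moreover have "{z \<in> ?U. snd c' (chart_inv c z) \<in> snd c' ` s} = snd c ` (s \<inter> fst c)"
  proof (intro Set.set_eqI iffI)
    fix z assume "z \<in> {z \<in> ?U. snd c' (chart_inv c z) \<in> snd c' ` s}"
    then obtain x where x: "z = snd c x" "x \<in> fst c" "x \<in> fst c'" "snd c' x \<in> snd c' ` s"
      using atlasD(1)[OF M c] by (auto simp: chart_inv_left)
    then obtain y where "y \<in> s" "snd c' x = snd c' y" by auto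
    then have "x \<in> s" using inj_onD[OF atlasD(1)[OF M c'(1)], of x y] x c'(2) by auto
    then show "z \<in> snd c ` (s \<inter> fst c)" using x by auto
  next
    fix z assume "z \<in> snd c ` (s \<inter> fst c)"
    then obtain x where x: "z = snd c x" "x \<in> s" "x \<in> fst c" by auto
    then have "x \<in> fst c \<inter> (\<lambda>x. x) -` fst c'" using c'(2) by auto
    then show "z \<in> {z \<in> ?U. snd c' (chart_inv c z) \<in> snd c' ` s}"
      using x atlasD(1)[OF M c] by (auto simp: chart_inv_left)
  qed
  ultimately show ?case by simp
qed

lemma openin_cm_iff:
  assumes M: "holomorphic_atlas M"
  shows "openin (cm_topology M) W \<longleftrightarrow> W \<subseteq> cm_pts M \<and> (\<forall>c\<in>cm_atlas M. open_Cn (cm_dim M) (snd c ` (W \<inter> fst c)))"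
proof (intro iffI conjI ballI)
  let ?B = "{W. \<exists>(U, \<phi>)\<in>cm_atlas M. W \<subseteq> U \<and> open_Cn (cm_dim M) (\<phi> ` W)}"
  assume W: "openin (cm_topology M) W"
  then have g: "generate_topology_on ?B W" by (simp add: cm_topology_def openin_topology_generated_by_iff)
  show "W \<subseteq> cm_pts M"
  proof
    fix x assume "x \<in> W"
    then have "x \<in> \<Union>?B" using openin_subset[OF W] unfolding cm_topology_def topology_generated_by_topspace by blast
    then obtain V where "x \<in> V" "V \<in> ?B" by (rule UnionE)
    then obtain c where "c \<in> cm_atlas M" "V \<subseteq> fst c" by auto
    then show "x \<in> cm_pts M" using atlasD(3)[OF M] \<open>x \<in> V\<close> by blast
  qed
  show "open_Cn (cm_dim M) (snd c ` (W \<inter> fst c))" if "c \<in> cm_atlas M" for c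
    using generate_cm_open[OF M that g] .
next
  assume "W \<subseteq> cm_pts M \<and> (\<forall>c\<in>cm_atlas M. open_Cn (cm_dim M) (snd c ` (W \<inter> fst c)))"
  then have W: "W \<subseteq> cm_pts M" "\<forall>c\<in>cm_atlas M. open_Cn (cm_dim M) (snd c ` (W \<inter> fst c))" by auto
  have "W = (\<Union>c\<in>cm_atlas M. W \<inter> fst c)" using W(1) atlas_cover[OF M] by blast
  moreover have "openin (cm_topology M) (\<Union>c\<in>cm_atlas M. W \<inter> fst c)"
    unfolding cm_topology_def using W(2)
    by (intro openin_Union ballI) (auto intro!: topology_generated_by_Basis simp: case_prod_beta)
  ultimately show "openin (cm_topology M) W" by simp
qed

lemma topspace_cm: "holomorphic_atlas M \<Longrightarrow> topspace (cm_topology M) = cm_pts M"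
proof (rule antisym)
  assume M: "holomorphic_atlas M"
  show "topspace (cm_topology M) \<subseteq> cm_pts M" using openin_topspace openin_cm_iff[OF M] by blast
  have "cm_pts M \<inter> fst c = fst c" if "c \<in> cm_atlas M" for c using atlasD(3)[OF M that] by auto
  then have "openin (cm_topology M) (cm_pts M)"
    unfolding openin_cm_iff[OF M] using atlasD(2)[OF M] by auto
  then show "cm_pts M \<subseteq> topspace (cm_topology M)" by (rule openin_subset)
qed

lemma openin_chart: "holomorphic_atlas M \<Longrightarrow> c \<in> cm_atlas M \<Longrightarrow> openin (cm_topology M) (fst c)"
  unfolding openin_cm_iff using atlas_overlap(1)[of M _ c] atlasD(3)[of M c] by (auto simp: Int_commute)

lemma open_chart_image:
  "holomorphic_atlas M \<Longrightarrow> c \<in> cm_atlas M \<Longrightarrow> openin (cm_topology M) W \<Longrightarrow> open_Cn (cm_dim M) (snd c ` (fst c \<inter> W))"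
  unfolding openin_cm_iff by (auto simp: Int_commute)

lemma openin_chart_preimage:
  assumes M: "holomorphic_atlas M" and c: "c \<in> cm_atlas M" and V: "open_Cn (cm_dim M) V" "V \<subseteq> snd c ` fst c"
  shows "openin (cm_topology M) {x \<in> fst c. snd c x \<in> V}"
proof -
  have "snd c ` {x \<in> fst c. snd c x \<in> V} = V" using V(2) by auto
  then have "{x \<in> fst c. snd c x \<in> V} \<in> {W. \<exists>(U, \<phi>)\<in>cm_atlas M. W \<subseteq> U \<and> open_Cn (cm_dim M) (\<phi> ` W)}"
    using V(1) c by (auto intro!: bexI[of _ c] simp: case_prod_beta)
  then show ?thesis unfolding cm_topology_def by (rule topology_generated_by_Basis)
qed

lemma holomorphic_map_hmap:
  assumes M: "holomorphic_atlas M" and N: "holomorphic_atlas N" and f: "holomorphic_map M N f"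
  shows "hmap M N f"
  unfolding hmap_def
proof (intro ballI conjI allI impI)
  fix c d assume c: "c \<in> cm_atlas M" and d: "d \<in> cm_atlas N"
  have "openin (cm_topology M) {x \<in> topspace (cm_topology M). f x \<in> fst d}"
    using f openin_chart[OF N d] unfolding holomorphic_map_def by (auto intro: openin_continuous_map_preimage)
  from open_chart_image[OF M c this]
  show "open_Cn (cm_dim M) (snd c ` (fst c \<inter> f -` fst d))"
    using atlasD(3)[OF M c] by (auto simp: topspace_cm[OF M] Int_def vimage_def subset_iff elim!: back_subst[of "open_Cn (cm_dim M)"] intro!: image_cong)
  show "holo_on (cm_dim M) (snd c ` (fst c \<inter> f -` fst d)) (\<lambda>z. snd d (f (chart_inv c z)) i)" if "i < cm_dim N" for i
    using f c d that unfolding holomorphic_map_def by (auto simp: case_prod_beta)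
qed

text \<open>The Jacobian matrix of \<open>f\<close> between two charts. For the identity map it is
  the transition matrix \<open>jacobian\<close> of the tangent bundle.\<close>

definition dmap :: "('a \<Rightarrow> 'b) \<Rightarrow> 'a chart \<Rightarrow> 'b chart \<Rightarrow> 'a \<Rightarrow> nat \<Rightarrow> nat \<Rightarrow> complex" where
  "dmap f c d x i j = pd j (\<lambda>z. snd d (f (chart_inv c z)) i) (snd c x)"

lemma jacobian_dmap: "jacobian c c' x i j = dmap (\<lambda>x. x) c c' x i j"
  by (simp add: jacobian_def dmap_def pd_def)

text \<open>Stated for two maps, so that inserting the identity in either place yields the cocycle
  rule of the tangent bundle and the chart changes of a differential on the source and on the target
  side.\<close>

lemma dmap_chain:
  assumes M: "holomorphic_atlas M" and N: "holomorphic_atlas N" and P: "holomorphic_atlas P"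
    and f: "hmap M N f" and g: "hmap N P g"
    and c: "c \<in> cm_atlas M" "x \<in> fst c" and d: "d \<in> cm_atlas N" "f x \<in> fst d" and e: "e \<in> cm_atlas P" "g (f x) \<in> fst e"
    and i: "i < cm_dim P" and k: "k < cm_dim M"
  shows "dmap (\<lambda>x. g (f x)) c e x i k = (\<Sum>j<cm_dim N. dmap g d e (f x) i j * dmap f c d x j k)"
proof -
  let ?m = "cm_dim M" and ?n = "cm_dim N"
  let ?G = "\<lambda>z. snd d (f (chart_inv c z))" and ?V = "snd d ` (fst d \<inter> g -` fst e)"
  define U where "U = {z \<in> snd c ` (fst c \<inter> f -` fst d). ?G z \<in> ?V}"
  have U: "open_Cn ?m U" unfolding U_def
    using hmap_continuous[OF f M N c(1) d(1)] f g c d e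
    by (intro open_Cn_vimage[of _ _ _ ?n]) (auto simp: hmap_def)
  have xU: "snd c x \<in> U" unfolding U_def using c d e atlasD(1)[OF M c(1)] by (auto simp: chart_inv_left)
  have "pd k (\<lambda>z. snd e (g (chart_inv d (?G z))) i) (snd c x)
     = (\<Sum>j<?n. pd j (\<lambda>y. snd e (g (chart_inv d y)) i) (?G (snd c x)) * pd k (\<lambda>z. ?G z j) (snd c x))"
  proof (rule holo_on_compose(2)[of ?n ?V "\<lambda>y. snd e (g (chart_inv d y)) i" ?m U ?G, OF _ _ U _ _ xU k])
    show "holo_on ?n ?V (\<lambda>y. snd e (g (chart_inv d y)) i)" "open_Cn ?n ?V" using g d e i by (auto simp: hmap_def)
    show "holo_on ?m U (\<lambda>z. ?G z j)" if "j < ?n" for j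
      by (rule holo_on_subset[of _ "snd c ` (fst c \<inter> f -` fst d)"]) (use f c d that in \<open>auto simp: hmap_def U_def\<close>)
  qed (auto simp: U_def)
  moreover have "pd k (\<lambda>z. snd e (g (chart_inv d (?G z))) i) (snd c x) = pd k (\<lambda>z. snd e (g (f (chart_inv c z))) i) (snd c x)"
  proof (rule pd_cong[OF U xU k])
    fix w assume "w \<in> U"
    then obtain y where "w = snd c y" "y \<in> fst c" "f y \<in> fst d" by (auto simp: U_def)
    then show "snd e (g (chart_inv d (?G w))) i = snd e (g (f (chart_inv c w))) i"
      using atlasD(1)[OF M c(1)] atlasD(1)[OF N d(1)] by (simp add: chart_inv_left)
  qed
  moreover have "?G (snd c x) = snd d (f x)" using c atlasD(1)[OF M c(1)] by (simp add: chart_inv_left)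
  ultimately show ?thesis by (simp add: dmap_def)
qed

lemma dmap_id:
  assumes M: "holomorphic_atlas M" and c: "c \<in> cm_atlas M" "x \<in> fst c" and k: "k < cm_dim M"
  shows "dmap (\<lambda>x. x) c c x i k = (if i = k then 1 else 0)"
proof -
  have "pd k (\<lambda>z. snd c (chart_inv c z) i) (snd c x) = pd k (\<lambda>z. z i) (snd c x)"
    by (rule pd_cong[OF atlasD(2)[OF M c(1)] _ k]) (use c atlasD(1)[OF M c(1)] in \<open>auto simp: chart_inv_left\<close>)
  then show ?thesis by (auto simp: dmap_def pd_coord)
qed

lemma dmap_holo:
  assumes M: "holomorphic_atlas M" and N: "holomorphic_atlas N" and f: "hmap M N f"
    and c: "c \<in> cm_atlas M" and d: "d \<in> cm_atlas N" and i: "i < cm_dim N" and j: "j < cm_dim M"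
  shows "holo_on (cm_dim M) (snd c ` (fst c \<inter> f -` fst d)) (\<lambda>z. dmap f c d (chart_inv c z) i j)"
proof -
  have o: "open_Cn (cm_dim M) (snd c ` (fst c \<inter> f -` fst d))" using f c d by (auto simp: hmap_def)
  show ?thesis
    by (rule holo_on_cong[OF o holo_on_pd_holo[OF _ o j, of "\<lambda>z. snd d (f (chart_inv c z)) i"]])
      (use f c d i atlasD(1)[OF M c] in \<open>auto simp: hmap_def dmap_def chart_inv_left\<close>)
qed

text \<open>All other charts are reached by composing with the coordinate change, so holomorphy in
  one chart that contains \<open>W\<close> suffices.\<close>

lemma holomorphic_fun_on_chart:
  assumes M: "holomorphic_atlas M" and c: "c \<in> cm_atlas M" and W: "openin (cm_topology M) W" "W \<subseteq> fst c"
    and F: "holo_on (cm_dim M) (snd c ` W) (\<lambda>z. F (chart_inv c z))"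
  shows "holomorphic_fun_on M W F"
  unfolding holomorphic_fun_on_def
proof safe
  fix U \<phi> assume e: "(U, \<phi>) \<in> cm_atlas M"
  let ?e = "(U, \<phi>)" and ?m = "cm_dim M"
  let ?U = "\<phi> ` (U \<inter> W)"
  have o: "open_Cn ?m ?U" using open_chart_image[OF M e W(1)] by simp
  have oW: "open_Cn ?m (snd c ` W)" using open_chart_image[OF M c W(1)] W(2) by (simp add: inf.absorb2)
  have sub: "?U \<subseteq> snd ?e ` (fst ?e \<inter> fst c)" using W(2) by auto
  have "holo_on ?m ?U (\<lambda>z. F (chart_inv c (snd c (chart_inv ?e z))))"
  proof (rule holo_on_compose(1)[OF F oW o])
    show "holo_on ?m ?U (\<lambda>z. snd c (chart_inv ?e z) j)" if "j < ?m" for j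
      using holo_on_subset[OF atlas_overlap(2)[OF M e c that] sub] .
    show "snd c (chart_inv ?e z) \<in> snd c ` W" if "z \<in> ?U" for z
      using that atlasD(1)[OF M e] chart_inv_left[of ?e] by auto
  qed
  then show "holo_on ?m ?U (\<lambda>z. F (chart_inv ?e z))"
    by (rule holo_on_cong[OF o]) (use W(2) atlasD(1)[OF M e] atlasD(1)[OF M c] chart_inv_left[of ?e] chart_inv_left[of c] in auto)
qed

lemma holomorphic_fun_onD:
  "holomorphic_fun_on M W F \<Longrightarrow> c \<in> cm_atlas M \<Longrightarrow> holo_on (cm_dim M) (snd c ` (fst c \<inter> W)) (\<lambda>z. F (chart_inv c z))"
  unfolding holomorphic_fun_on_def by (auto simp: case_prod_beta)

section \<open>Linear isomorphisms and frames\<close>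

lemma linear_isoD:
  assumes "linear_iso V r T"
  shows "bij_betw T (vs_set V) (Cn r)" "vs_zero V \<in> vs_set V" "T (vs_zero V) = (\<lambda>_. 0)"
    "v \<in> vs_set V \<Longrightarrow> w \<in> vs_set V \<Longrightarrow> vs_add V v w \<in> vs_set V \<and> T (vs_add V v w) = (\<lambda>i. T v i + T w i)"
    "v \<in> vs_set V \<Longrightarrow> vs_scale V a v \<in> vs_set V \<and> T (vs_scale V a v) = (\<lambda>i. a * T v i)"
    "v \<in> vs_set V \<Longrightarrow> T v \<in> Cn r" "inj_on T (vs_set V)"
  using assms unfolding linear_iso_def by (auto simp: bij_betw_def)

definition linv :: "'e cvspace \<Rightarrow> ('e \<Rightarrow> cvec) \<Rightarrow> cvec \<Rightarrow> 'e" where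
  "linv V T a = inv_into (vs_set V) T a"

lemma linv:
  assumes "linear_iso V r T" "a \<in> Cn r"
  shows "linv V T a \<in> vs_set V" "T (linv V T a) = a"
proof -
  have "a \<in> T ` vs_set V" using assms(2) bij_betw_imp_surj_on[OF linear_isoD(1)[OF assms(1)]] by simp
  then show "linv V T a \<in> vs_set V" "T (linv V T a) = a" unfolding linv_def by (auto intro: inv_into_into f_inv_into_f)
qed

lemma linv_T: "linear_iso V r T \<Longrightarrow> v \<in> vs_set V \<Longrightarrow> linv V T (T v) = v"
  unfolding linv_def using linear_isoD(7) by (metis inv_into_f_f)

lemma unit_vec_Cn: "k < r \<Longrightarrow> Defs.unit_vec k \<in> Cn r"
  by (auto simp: Defs.unit_vec_def Cn_def)

lemma vb_frame_linv: "vb_frame E t \<alpha> x = linv (vb_fib E x) (snd t x) (Defs.unit_vec \<alpha>)"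
  by (simp add: vb_frame_def linv_def)

definition lin_on :: "'e cvspace \<Rightarrow> ('e \<Rightarrow> complex) \<Rightarrow> bool" where
  "lin_on V \<xi> \<longleftrightarrow> (\<forall>v\<in>vs_set V. \<forall>w\<in>vs_set V. \<xi> (vs_add V v w) = \<xi> v + \<xi> w) \<and>
       (\<forall>a. \<forall>v\<in>vs_set V. \<xi> (vs_scale V a v) = a * \<xi> v)"

lemma lin_on_expand:
  assumes T: "linear_iso V r T" and l: "lin_on V \<xi>" and v: "v \<in> vs_set V"
  shows "\<xi> v = (\<Sum>\<alpha><r. T v \<alpha> * \<xi> (linv V T (Defs.unit_vec \<alpha>)))"
proof -
  \<comment> \<open>Induction over the number of coordinates that may be nonzero; the last one is
    split off as a multiple of a frame vector.\<close>
  have "\<xi> (linv V T a) = (\<Sum>\<alpha><m. a \<alpha> * \<xi> (linv V T (Defs.unit_vec \<alpha>)))" if "m \<le> r" "a \<in> Cn m" for m a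
    using that
  proof (induction m arbitrary: a)
    case 0
    then have "a = (\<lambda>_. 0)" by (auto simp: Cn_def)
    then have "linv V T a = vs_zero V" using linv_T[OF T linear_isoD(2)[OF T]] linear_isoD(3)[OF T] by simp
    moreover have "vs_scale V 0 (vs_zero V) = vs_zero V"
      using linear_isoD(5)[OF T linear_isoD(2)[OF T], of 0] linear_isoD(2,3)[OF T]
      by (intro inj_onD[OF linear_isoD(7)[OF T]]) auto
    then have "\<xi> (vs_zero V) = 0" using l linear_isoD(2)[OF T] unfolding lin_on_def by (metis mult_zero_left)
    ultimately show ?case by simp
  next
    case (Suc m)
    define b where "b = a(m := 0)"
    have bC: "b \<in> Cn m" using Suc.prems by (auto simp: b_def Cn_def)
    have C: "b \<in> Cn r" "Defs.unit_vec m \<in> Cn r" "a \<in> Cn r" using bC Suc.prems by (auto simp: Cn_def Defs.unit_vec_def)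
    let ?u = "linv V T (Defs.unit_vec m)"
    let ?w = "vs_add V (linv V T b) (vs_scale V (a m) ?u)"
    have s: "vs_scale V (a m) ?u \<in> vs_set V" "T (vs_scale V (a m) ?u) = (\<lambda>i. a m * Defs.unit_vec m i)"
      using linear_isoD(5)[OF T linv(1)[OF T C(2)], of "a m"] linv(2)[OF T C(2)] by auto
    have w: "?w \<in> vs_set V" "T ?w = (\<lambda>i. b i + a m * Defs.unit_vec m i)"
      using linear_isoD(4)[OF T linv(1)[OF T C(1)] s(1)] linv(2)[OF T C(1)] s(2) by auto
    have "T ?w = a" unfolding w(2) by (auto simp: b_def Defs.unit_vec_def)
    then have "linv V T a = ?w" using linv_T[OF T w(1)] by simp
    then have "\<xi> (linv V T a) = \<xi> (linv V T b) + a m * \<xi> ?u"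
      using l linv(1)[OF T C(1)] s(1) linv(1)[OF T C(2)] unfolding lin_on_def by simp
    also have "\<xi> (linv V T b) = (\<Sum>\<alpha><m. a \<alpha> * \<xi> (linv V T (Defs.unit_vec \<alpha>)))"
    proof -
      have "(\<Sum>\<alpha><m. b \<alpha> * \<xi> (linv V T (Defs.unit_vec \<alpha>))) = (\<Sum>\<alpha><m. a \<alpha> * \<xi> (linv V T (Defs.unit_vec \<alpha>)))"
        by (intro sum.cong) (auto simp: b_def)
      then show ?thesis using Suc.IH[OF _ bC] Suc.prems(1) by simp
    qed
    finally show ?case by simp
  qed
  from this[of r "T v"] show ?thesis using linear_isoD(6)[OF T v] linv_T[OF T v] by simp
qed

lemma linear_iso_comp_lin:
  assumes "linear_iso V r T"
  shows "lin_on V (\<lambda>v. T v i)"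
  using linear_isoD(4,5)[OF assms] by (auto simp: lin_on_def)

section \<open>The tangent bundle\<close>

text \<open>A compatible family is determined by its value in one chart. Conversely the cocycle rule
  \<open>J\<close> extends every value in that chart to a compatible family.\<close>

lemma tangent_linear_iso:
  assumes M: "holomorphic_atlas M" and c: "c \<in> cm_atlas M" "x \<in> fst c"
  shows "linear_iso (tangent_space M x) (cm_dim M) (\<lambda>v. v c)"
proof -
  let ?n = "cm_dim M" and ?V = "vs_set (tangent_space M x)"
  have J: "jacobian d e x i k = (\<Sum>j<?n. jacobian d' e x i j * jacobian d d' x j k)"
    if "d \<in> cm_atlas M" "d' \<in> cm_atlas M" "e \<in> cm_atlas M" "x \<in> fst d" "x \<in> fst d'" "x \<in> fst e" "i < ?n" "k < ?n" for d d' e i k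
    using dmap_chain[OF M M M hmap_id[OF M] hmap_id[OF M] that(1,4,2,5,3,6,7,8)] by (simp add: jacobian_dmap)
  have V: "v \<in> ?V \<longleftrightarrow> (\<forall>c. v c \<in> Cn ?n) \<and> (\<forall>c. \<not> (c \<in> cm_atlas M \<and> x \<in> fst c) \<longrightarrow> v c = (\<lambda>_. 0)) \<and>
       (\<forall>c\<in>cm_atlas M. \<forall>c'\<in>cm_atlas M. x \<in> fst c \<inter> fst c' \<longrightarrow>
         (\<forall>i<?n. v c' i = (\<Sum>j<?n. jacobian c c' x i j * v c j)))" for v
    by (simp add: tangent_space_def)
  have inj: "inj_on (\<lambda>v. v c) ?V"
  proof (rule inj_onI)
    fix v w assume v: "v \<in> ?V" and w: "w \<in> ?V" and eq: "v c = w c"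
    show "v = w"
    proof
      fix c'
      show "v c' = w c'"
      proof (cases "c' \<in> cm_atlas M \<and> x \<in> fst c'")
        case True
        then have "v c' i = w c' i" if "i < ?n" for i
          using v w c that eq unfolding V by simp
        moreover have "v c' \<in> Cn ?n" "w c' \<in> Cn ?n" using v w unfolding V by blast+
        ultimately show ?thesis by (intro Cn_eqI[of _ ?n])
      next
        case False then show ?thesis using v w unfolding V by metis
      qed
    qed
  qed
  have surj: "\<exists>v\<in>?V. v c = a" if a: "a \<in> Cn ?n" for a
  proof -
    \<comment> \<open>The extension: coordinates are carried from \<open>c\<close> to every chart
      around \<open>x\<close> by the Jacobian, and the family is 0 elsewhere, as
      \<open>tangent_space\<close> demands.\<close>
    define v where "v c' = (if c' \<in> cm_atlas M \<and> x \<in> fst c' then (\<lambda>i. if i < ?n then \<Sum>j<?n. jacobian c c' x i j * a j else 0) else (\<lambda>_. 0))" for c'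
    have "v c = a"
    proof (rule Cn_eqI[OF _ a])
      show "v c \<in> Cn ?n" by (auto simp: v_def Cn_def)
      show "v c i = a i" if "i < ?n" for i
      proof -
        have e: "(if i = j then 1 else 0) * a j = (if j = i then a j else 0)" for j by simp
        have "v c i = (\<Sum>j<?n. (if i = j then 1 else 0) * a j)"
          using that c by (simp add: v_def jacobian_dmap dmap_id[OF M c])
        then show ?thesis using that unfolding e by simp
      qed
    qed
    moreover have "v \<in> ?V" unfolding V
    proof (intro conjI allI ballI impI)
      show "v c' \<in> Cn ?n" for c' by (auto simp: v_def Cn_def)
      show "v c' = (\<lambda>_. 0)" if "\<not> (c' \<in> cm_atlas M \<and> x \<in> fst c')" for c' using that by (auto simp: v_def)
      fix d e i assume de: "d \<in> cm_atlas M" "e \<in> cm_atlas M" "x \<in> fst d \<inter> fst e" "i < ?n"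
      have "v e i = (\<Sum>k<?n. (\<Sum>j<?n. jacobian d e x i j * jacobian c d x j k) * a k)"
        using de J[of c d e] c by (simp add: v_def)
      also have "\<dots> = (\<Sum>j<?n. jacobian d e x i j * (\<Sum>k<?n. jacobian c d x j k * a k))"
        unfolding sum_distrib_left sum_distrib_right by (subst sum.swap) (simp add: mult.assoc)
      also have "\<dots> = (\<Sum>j<?n. jacobian d e x i j * v d j)" using de by (simp add: v_def)
      finally show "v e i = (\<Sum>j<?n. jacobian d e x i j * v d j)" .
    qed
    ultimately show ?thesis by blast
  qed
  have z: "vs_zero (tangent_space M x) \<in> ?V" by (simp add: tangent_space_def Cn_def)
  have "bij_betw (\<lambda>v. v c) ?V (Cn ?n)"
    unfolding bij_betw_def
  proof (intro conjI inj equalityI subsetI)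
    fix a assume "a \<in> (\<lambda>v. v c) ` ?V"
    then obtain v where "v \<in> ?V" "a = v c" by blast
    then show "a \<in> Cn ?n" unfolding V by blast
  next
    fix a assume "a \<in> Cn ?n"
    then obtain v where "v \<in> ?V" "v c = a" using surj by blast
    then show "a \<in> (\<lambda>v. v c) ` ?V" by blast
  qed
  moreover have "(\<lambda>c i. v c i + w c i) \<in> ?V" if v: "v \<in> ?V" and w: "w \<in> ?V" for v w
    unfolding V
  proof (intro conjI allI ballI impI)
    show "(\<lambda>i. v c i + w c i) \<in> Cn ?n" for c using v w unfolding V by (blast intro: Cn_add)
    show "(\<lambda>i. v c i + w c i) = (\<lambda>_. 0)" if "\<not> (c \<in> cm_atlas M \<and> x \<in> fst c)" for c
    proof -
      have "v c = (\<lambda>_. 0)" "w c = (\<lambda>_. 0)" using that v w unfolding V by blast+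
      then show ?thesis by simp
    qed
    fix d e i assume de: "d \<in> cm_atlas M" "e \<in> cm_atlas M" "x \<in> fst d \<inter> fst e" "i < ?n"
    then have "v e i = (\<Sum>j<?n. jacobian d e x i j * v d j)" "w e i = (\<Sum>j<?n. jacobian d e x i j * w d j)"
      using v w unfolding V by blast+
    then show "v e i + w e i = (\<Sum>j<?n. jacobian d e x i j * (v d j + w d j))"
      by (simp only: distrib_left sum.distrib)
  qed
  moreover have "(\<lambda>c i. a * v c i) \<in> ?V" if v: "v \<in> ?V" for v a
    unfolding V
  proof (intro conjI allI ballI impI)
    show "(\<lambda>i. a * v c i) \<in> Cn ?n" for c using v unfolding V by (blast intro: Cn_scale)
    show "(\<lambda>i. a * v c i) = (\<lambda>_. 0)" if "\<not> (c \<in> cm_atlas M \<and> x \<in> fst c)" for c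
    proof -
      have "v c = (\<lambda>_. 0)" using that v unfolding V by blast
      then show ?thesis by simp
    qed
    fix d e i assume de: "d \<in> cm_atlas M" "e \<in> cm_atlas M" "x \<in> fst d \<inter> fst e" "i < ?n"
    then have "v e i = (\<Sum>j<?n. jacobian d e x i j * v d j)" using v unfolding V by blast
    then show "a * v e i = (\<Sum>j<?n. jacobian d e x i j * (a * v d j))"
      by (simp only: sum_distrib_left mult.left_commute)
  qed
  moreover have "vs_add (tangent_space M x) = (\<lambda>v w c i. v c i + w c i)" "vs_scale (tangent_space M x) = (\<lambda>a v c i. a * v c i)"
    "vs_zero (tangent_space M x) = (\<lambda>_ _. 0)" by (simp_all add: tangent_space_def)
  ultimately show ?thesis unfolding linear_iso_def using z by simp
qed

lemma tangent_transition:
  assumes M: "holomorphic_atlas M" and c: "c \<in> cm_atlas M" "c' \<in> cm_atlas M" "x \<in> fst c" "x \<in> fst c'"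
    and v: "v \<in> vs_set (tangent_space M x)" and i: "i < cm_dim M"
  shows "v c' i = (\<Sum>j<cm_dim M. dmap (\<lambda>x. x) c c' x i j * v c j)"
  using v c i by (auto simp: tangent_space_def jacobian_dmap)

definition tan_triv :: "'a chart \<Rightarrow> ('a, 'a tvec) trivialization" where
  "tan_triv c = (fst c, \<lambda>x v. v c)"

lemma tangent_triv_iff: "t \<in> vb_triv (tangent_bundle M) \<longleftrightarrow> (\<exists>c\<in>cm_atlas M. t = tan_triv c)"
proof
  assume "t \<in> vb_triv (tangent_bundle M)"
  then obtain c where "c \<in> cm_atlas M" "t = (fst c, \<lambda>x v. v c)" unfolding tangent_bundle_def by auto
  then show "\<exists>c\<in>cm_atlas M. t = tan_triv c" unfolding tan_triv_def by (rule bexI[rotated])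
next
  assume "\<exists>c\<in>cm_atlas M. t = tan_triv c"
  then show "t \<in> vb_triv (tangent_bundle M)" unfolding tangent_bundle_def tan_triv_def by auto
qed

lemma tangent_bundle_simps [simp]:
  "vb_base (tangent_bundle M) = M" "vb_rank (tangent_bundle M) = cm_dim M" "vb_fib (tangent_bundle M) = tangent_space M"
  by (simp_all add: tangent_bundle_def)

text \<open>The conditions of \<^const>\<open>holomorphic_vector_bundle\<close> that do not involve the topology of the base.\<close>

definition hvb :: "('a, 'e) vbundle \<Rightarrow> bool" where
  "hvb E \<longleftrightarrow> holomorphic_atlas (vb_base E) \<and>
     (\<Union>t\<in>vb_triv E. fst t) = cm_pts (vb_base E) \<and>
     (\<forall>t\<in>vb_triv E. openin (cm_topology (vb_base E)) (fst t) \<and>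
        (\<forall>x\<in>fst t. linear_iso (vb_fib E x) (vb_rank E) (snd t x))) \<and>
     (\<forall>t\<in>vb_triv E. \<forall>s\<in>vb_triv E. \<forall>\<alpha><vb_rank E. \<forall>\<beta><vb_rank E.
        holomorphic_fun_on (vb_base E) (fst t \<inter> fst s) (\<lambda>x. snd s x (vb_frame E t \<alpha> x) \<beta>))"

lemma hvb_tangent:
  assumes M: "holomorphic_atlas M"
  shows "hvb (tangent_bundle M)"
  unfolding hvb_def
proof (intro conjI ballI allI impI)
  show "(\<Union>t\<in>vb_triv (tangent_bundle M). fst t) = cm_pts (vb_base (tangent_bundle M))"
    using atlasD(3)[OF M] atlas_cover[OF M] by (fastforce simp: tangent_triv_iff Bex_def tan_triv_def)
  show "openin (cm_topology (vb_base (tangent_bundle M))) (fst t)" if "t \<in> vb_triv (tangent_bundle M)" for t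
    using that openin_chart[OF M] by (auto simp: tangent_triv_iff tan_triv_def)
  show "linear_iso (vb_fib (tangent_bundle M) x) (vb_rank (tangent_bundle M)) (snd t x)"
    if "t \<in> vb_triv (tangent_bundle M)" "x \<in> fst t" for t x
    using that tangent_linear_iso[OF M] by (auto simp: tangent_triv_iff tan_triv_def)
  fix t s \<alpha> \<beta> assume ts: "t \<in> vb_triv (tangent_bundle M)" "s \<in> vb_triv (tangent_bundle M)" and
    ab: "\<alpha> < vb_rank (tangent_bundle M)" "\<beta> < vb_rank (tangent_bundle M)"
  then obtain c c' where c: "c \<in> cm_atlas M" "t = tan_triv c" "c' \<in> cm_atlas M" "s = tan_triv c'"
    by (auto simp: tangent_triv_iff)
  have fr: "snd s x (vb_frame (tangent_bundle M) t \<alpha> x) \<beta> = dmap (\<lambda>x. x) c c' x \<beta> \<alpha>" if x: "x \<in> fst c \<inter> fst c'" for x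
  proof -
    let ?v = "linv (tangent_space M x) (\<lambda>v. v c) (Defs.unit_vec \<alpha>)"
    have v: "?v \<in> vs_set (tangent_space M x)" "?v c = Defs.unit_vec \<alpha>"
      using linv[OF tangent_linear_iso[OF M c(1)] unit_vec_Cn, of x \<alpha>] x ab by auto
    have "?v c' \<beta> = (\<Sum>j<cm_dim M. dmap (\<lambda>x. x) c c' x \<beta> j * Defs.unit_vec \<alpha> j)"
      using tangent_transition[OF M c(1,3) _ _ v(1), of \<beta>] x ab v(2) by simp
    also have "\<dots> = dmap (\<lambda>x. x) c c' x \<beta> \<alpha>" using ab by (simp add: Defs.unit_vec_def if_distrib cong: if_cong)
    finally show ?thesis using c by (simp add: vb_frame_linv tan_triv_def)
  qed
  have "holomorphic_fun_on M (fst c \<inter> fst c') (\<lambda>x. snd s x (vb_frame (tangent_bundle M) t \<alpha> x) \<beta>)"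
  proof (rule holomorphic_fun_on_chart[OF M c(1)])
    show "openin (cm_topology M) (fst c \<inter> fst c')" using c openin_chart[OF M] by blast
    have "holo_on (cm_dim M) (snd c ` (fst c \<inter> (\<lambda>x. x) -` fst c')) (\<lambda>z. dmap (\<lambda>x. x) c c' (chart_inv c z) \<beta> \<alpha>)"
      using ab by (intro dmap_holo[OF M M hmap_id[OF M] c(1,3)]) auto
    then have "holo_on (cm_dim M) (snd c ` (fst c \<inter> fst c')) (\<lambda>z. dmap (\<lambda>x. x) c c' (chart_inv c z) \<beta> \<alpha>)" by simp
    then show "holo_on (cm_dim M) (snd c ` (fst c \<inter> fst c')) (\<lambda>z. snd s (chart_inv c z) (vb_frame (tangent_bundle M) t \<alpha> (chart_inv c z)) \<beta>)"
      by (rule holo_on_cong[OF atlas_overlap(1)[OF M c(1,3)]])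
        (use fr atlasD(1)[OF M c(1)] in \<open>auto simp: chart_inv_left\<close>)
  qed auto
  then show "holomorphic_fun_on (vb_base (tangent_bundle M)) (fst t \<inter> fst s) (\<lambda>x. snd s x (vb_frame (tangent_bundle M) t \<alpha> x) \<beta>)"
    using c by (simp add: tan_triv_def)
qed (use M in simp)

lemma holomorphic_fun_on_cong:
  assumes M: "holomorphic_atlas M" and f: "holomorphic_fun_on M W f" and W: "openin (cm_topology M) W"
    and eq: "\<And>x. x \<in> W \<Longrightarrow> f x = g x"
  shows "holomorphic_fun_on M W g"
  unfolding holomorphic_fun_on_def case_prod_beta
proof
  fix c assume c: "c \<in> cm_atlas M"
  have "holo_on (cm_dim M) (snd c ` (fst c \<inter> W)) (\<lambda>z. g (chart_inv c z))"
  proof (rule holo_on_cong[OF open_chart_image[OF M c W] holomorphic_fun_onD[OF f c]])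
    fix z assume "z \<in> snd c ` (fst c \<inter> W)"
    then have "chart_inv c z \<in> W" using chart_inv_image[of z c "fst c \<inter> W"] atlasD(1)[OF M c] by blast
    then show "f (chart_inv c z) = g (chart_inv c z)" by (rule eq)
  qed
  then show "holo_on (cm_dim M) (snd c ` (fst c \<inter> W)) (\<lambda>z. g (chart_inv (fst c, snd c) z))" by simp
qed

section \<open>Dual bundles\<close>

lemma hvbD:
  assumes "hvb E"
  shows "holomorphic_atlas (vb_base E)"
    "t \<in> vb_triv E \<Longrightarrow> openin (cm_topology (vb_base E)) (fst t)"
    "t \<in> vb_triv E \<Longrightarrow> fst t \<subseteq> cm_pts (vb_base E)"
    "t \<in> vb_triv E \<Longrightarrow> x \<in> fst t \<Longrightarrow> linear_iso (vb_fib E x) (vb_rank E) (snd t x)"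
    "t \<in> vb_triv E \<Longrightarrow> s \<in> vb_triv E \<Longrightarrow> \<alpha> < vb_rank E \<Longrightarrow> \<beta> < vb_rank E \<Longrightarrow>
        holomorphic_fun_on (vb_base E) (fst t \<inter> fst s) (\<lambda>x. snd s x (vb_frame E t \<alpha> x) \<beta>)"
    "x \<in> cm_pts (vb_base E) \<Longrightarrow> \<exists>t\<in>vb_triv E. x \<in> fst t"
  using assms unfolding hvb_def by blast+

definition dual_iso :: "'e cvspace \<Rightarrow> nat \<Rightarrow> ('e \<Rightarrow> cvec) \<Rightarrow> ('e \<Rightarrow> complex) \<Rightarrow> cvec" where
  "dual_iso V r T \<xi> = (\<lambda>\<alpha>. if \<alpha> < r then \<xi> (linv V T (Defs.unit_vec \<alpha>)) else 0)"

lemma dual_set: "\<xi> \<in> vs_set (dual_space V) \<longleftrightarrow> lin_on V \<xi> \<and> (\<forall>v. v \<notin> vs_set V \<longrightarrow> \<xi> v = 0)"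
  by (simp add: dual_space_def lin_on_def)

text \<open>The inverse pairs coordinates bilinearly, without conjugation. Its explicit form makes
  the transition matrices of the dual bundle computable.\<close>

lemma dual_linear_iso:
  assumes T: "linear_iso V r T"
  shows "linear_iso (dual_space V) r (dual_iso V r T)"
    and "a \<in> Cn r \<Longrightarrow> linv (dual_space V) (dual_iso V r T) a = (\<lambda>v. if v \<in> vs_set V then \<Sum>\<alpha><r. a \<alpha> * T v \<alpha> else 0)"
proof -
  let ?D = "vs_set (dual_space V)"
  have inj: "inj_on (dual_iso V r T) ?D"
  proof (rule inj_onI)
    fix \<xi> \<eta> assume x: "\<xi> \<in> ?D" "\<eta> \<in> ?D" and eq: "dual_iso V r T \<xi> = dual_iso V r T \<eta>"
    show "\<xi> = \<eta>"
    proof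
      fix v show "\<xi> v = \<eta> v"
      proof (cases "v \<in> vs_set V")
        case True
        have "\<xi> (linv V T (Defs.unit_vec \<alpha>)) = \<eta> (linv V T (Defs.unit_vec \<alpha>))" if "\<alpha> < r" for \<alpha>
          using fun_cong[OF eq, of \<alpha>] that by (simp add: dual_iso_def)
        then show ?thesis
          using x lin_on_expand[OF T _ True, of \<xi>] lin_on_expand[OF T _ True, of \<eta>] by (simp add: dual_set)
      qed (use x in \<open>simp add: dual_set\<close>)
    qed
  qed
  define mk where "mk a = (\<lambda>v. if v \<in> vs_set V then \<Sum>\<alpha><r. a \<alpha> * T v \<alpha> else 0)" for a :: cvec
  have mk: "mk a \<in> ?D \<and> dual_iso V r T (mk a) = a" if a: "a \<in> Cn r" for a
  proof
    have "vs_add V v w \<in> vs_set V \<and> mk a (vs_add V v w) = mk a v + mk a w" if "v \<in> vs_set V" "w \<in> vs_set V" for v w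
      using linear_isoD(4)[OF T that] that by (simp add: mk_def distrib_left sum.distrib)
    moreover have "mk a (vs_scale V b v) = b * mk a v" if "v \<in> vs_set V" for v b
      using linear_isoD(5)[OF T that, of b] that by (simp add: mk_def sum_distrib_left mult.left_commute)
    moreover have "mk a v = 0" if "v \<notin> vs_set V" for v using that by (simp add: mk_def)
    ultimately show "mk a \<in> ?D" unfolding dual_set lin_on_def by blast
    show "dual_iso V r T (mk a) = a"
    proof
      fix \<alpha> show "dual_iso V r T (mk a) \<alpha> = a \<alpha>"
      proof (cases "\<alpha> < r")
        case True
        then have "mk a (linv V T (Defs.unit_vec \<alpha>)) = (\<Sum>\<beta><r. a \<beta> * Defs.unit_vec \<alpha> \<beta>)"
          using linv[OF T unit_vec_Cn[OF True]] by (simp add: mk_def)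
        also have "\<dots> = (\<Sum>\<beta><r. if \<beta> = \<alpha> then a \<beta> else 0)"
          by (intro sum.cong) (auto simp: Defs.unit_vec_def)
        finally show ?thesis using True by (simp add: dual_iso_def)
      qed (use a in \<open>auto simp: dual_iso_def Cn_def\<close>)
    qed
  qed
  have bij: "bij_betw (dual_iso V r T) ?D (Cn r)"
    unfolding bij_betw_def
  proof (intro conjI inj equalityI subsetI)
    show "a \<in> dual_iso V r T ` ?D" if "a \<in> Cn r" for a using mk[OF that] by (metis imageI)
  qed (auto simp: dual_iso_def Cn_def)
  have "vs_zero (dual_space V) \<in> ?D" by (simp add: dual_set lin_on_def) (simp add: dual_space_def)
  moreover have "vs_add (dual_space V) \<xi> \<eta> \<in> ?D" if "\<xi> \<in> ?D" "\<eta> \<in> ?D" for \<xi> \<eta>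
    using that unfolding dual_set lin_on_def by (auto simp: dual_space_def distrib_left)
  moreover have "vs_scale (dual_space V) a \<xi> \<in> ?D" if "\<xi> \<in> ?D" for a \<xi>
    using that unfolding dual_set lin_on_def by (auto simp: dual_space_def distrib_left)
  ultimately show iso: "linear_iso (dual_space V) r (dual_iso V r T)"
    unfolding linear_iso_def using bij by (auto simp: dual_iso_def dual_space_def fun_eq_iff)
  show "linv (dual_space V) (dual_iso V r T) a = (\<lambda>v. if v \<in> vs_set V then \<Sum>\<alpha><r. a \<alpha> * T v \<alpha> else 0)" if "a \<in> Cn r"
    using linv_T[OF iso, of "mk a"] mk[OF that] by (simp add: mk_def)
qed

definition dual_triv :: "('a, 'e) vbundle \<Rightarrow> ('a, 'e) trivialization \<Rightarrow> ('a, 'e \<Rightarrow> complex) trivialization" where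
  "dual_triv E t = (fst t, \<lambda>x. dual_iso (vb_fib E x) (vb_rank E) (snd t x))"

lemma dual_bundle_simps [simp]:
  "vb_base (dual_bundle E) = vb_base E" "vb_rank (dual_bundle E) = vb_rank E"
  "vb_fib (dual_bundle E) = (\<lambda>x. dual_space (vb_fib E x))"
  by (simp_all add: dual_bundle_def)

lemma dual_triv_set: "vb_triv (dual_bundle E) = dual_triv E ` vb_triv E"
  unfolding dual_bundle_def dual_triv_def dual_iso_def vb_frame_linv vbundle.simps by blast

lemma fst_dual_triv [simp]: "fst (dual_triv E t) = fst t"
  by (simp add: dual_triv_def)

text \<open>Dualising transposes the transition matrix and exchanges the two trivialisations. Done
  twice, it restores the original matrix; this identifies the bidual of the tangent bundle in
  \<open>Xi_change\<close>.\<close>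

lemma dual_transition:
  assumes E: "hvb E" and t: "t \<in> vb_triv E" "s \<in> vb_triv E" and x: "x \<in> fst t" "x \<in> fst s" and ab: "\<alpha> < vb_rank E" "\<beta> < vb_rank E"
  shows "snd (dual_triv E s) x (vb_frame (dual_bundle E) (dual_triv E t) \<alpha> x) \<beta> = snd t x (vb_frame E s \<beta> x) \<alpha>"
proof -
  note T = hvbD(4)[OF E t(1) x(1)] and S = hvbD(4)[OF E t(2) x(2)]
  have u: "linv (vb_fib E x) (snd s x) (Defs.unit_vec \<beta>) \<in> vs_set (vb_fib E x)"
    by (rule linv(1)[OF S unit_vec_Cn[OF ab(2)]])
  have "(\<Sum>\<gamma><vb_rank E. Defs.unit_vec \<alpha> \<gamma> * c \<gamma>) = c \<alpha>" for c :: cvec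
  proof -
    have "(\<Sum>\<gamma><vb_rank E. Defs.unit_vec \<alpha> \<gamma> * c \<gamma>) = (\<Sum>\<gamma><vb_rank E. if \<gamma> = \<alpha> then c \<gamma> else 0)"
      by (intro sum.cong) (auto simp: Defs.unit_vec_def)
    then show ?thesis using ab by simp
  qed
  then show ?thesis
    using dual_linear_iso(2)[OF T unit_vec_Cn[OF ab(1)]] u ab
    by (simp add: vb_frame_linv dual_triv_def dual_iso_def)
qed

lemma hvb_dual:
  assumes E: "hvb E"
  shows "hvb (dual_bundle E)"
  unfolding hvb_def
proof (intro conjI ballI allI impI)
  show "holomorphic_atlas (vb_base (dual_bundle E))" using hvbD(1)[OF E] by simp
  show "(\<Union>t\<in>vb_triv (dual_bundle E). fst t) = cm_pts (vb_base (dual_bundle E))"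
    using E by (simp add: dual_triv_set hvb_def)
  show "openin (cm_topology (vb_base (dual_bundle E))) (fst t)" if "t \<in> vb_triv (dual_bundle E)" for t
    using that hvbD(2)[OF E] by (auto simp: dual_triv_set)
  show "linear_iso (vb_fib (dual_bundle E) x) (vb_rank (dual_bundle E)) (snd t x)"
    if "t \<in> vb_triv (dual_bundle E)" "x \<in> fst t" for t x
    using that dual_linear_iso(1)[OF hvbD(4)[OF E]] by (auto simp: dual_triv_set dual_triv_def)
  fix t s \<alpha> \<beta> assume ts: "t \<in> vb_triv (dual_bundle E)" "s \<in> vb_triv (dual_bundle E)"
    and ab: "\<alpha> < vb_rank (dual_bundle E)" "\<beta> < vb_rank (dual_bundle E)"
  then obtain t0 s0 where t0: "t0 \<in> vb_triv E" "t = dual_triv E t0" "s0 \<in> vb_triv E" "s = dual_triv E s0"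
    by (auto simp: dual_triv_set)
  have "holomorphic_fun_on (vb_base E) (fst t0 \<inter> fst s0) (\<lambda>x. snd t0 x (vb_frame E s0 \<beta> x) \<alpha>)"
    using hvbD(5)[OF E t0(3,1), of \<beta> \<alpha>] ab by (simp add: Int_commute)
  then have "holomorphic_fun_on (vb_base E) (fst t0 \<inter> fst s0) (\<lambda>x. snd s x (vb_frame (dual_bundle E) t \<alpha> x) \<beta>)"
  proof (rule holomorphic_fun_on_cong[OF hvbD(1)[OF E]])
    show "openin (cm_topology (vb_base E)) (fst t0 \<inter> fst s0)" using hvbD(2)[OF E] t0 by blast
    show "snd t0 x (vb_frame E s0 \<beta> x) \<alpha> = snd s x (vb_frame (dual_bundle E) t \<alpha> x) \<beta>" if "x \<in> fst t0 \<inter> fst s0" for x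
      using dual_transition[OF E t0(1,3), of x \<alpha> \<beta>] that t0 ab by simp
  qed
  then show "holomorphic_fun_on (vb_base (dual_bundle E)) (fst t \<inter> fst s) (\<lambda>x. snd s x (vb_frame (dual_bundle E) t \<alpha> x) \<beta>)"
    using t0 by simp
qed

section \<open>Lines and the projectivisation\<close>

definition line_rep :: "'e cvspace \<Rightarrow> ('e \<Rightarrow> cvec) \<Rightarrow> nat \<Rightarrow> 'e set \<Rightarrow> 'e" where
  "line_rep V T k l = (THE \<xi>. \<xi> \<in> l \<and> T \<xi> k = 1)"

text \<open>The vector space laws of \<open>V\<close> are transported back along the injective map
  \<open>T\<close> by comparing coordinates.\<close>

lemma vs_scale_simps:
  assumes T: "linear_iso V r T" and \<xi>: "\<xi> \<in> vs_set V"
  shows "vs_scale V 1 \<xi> = \<xi>" "vs_scale V a (vs_scale V b \<xi>) = vs_scale V (a * b) \<xi>"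
    "vs_scale V a \<xi> = vs_zero V \<longleftrightarrow> a = 0 \<or> \<xi> = vs_zero V"
proof -
  note D = linear_isoD[OF T] 
  have s: "vs_scale V a \<xi> \<in> vs_set V" "T (vs_scale V a \<xi>) = (\<lambda>i. a * T \<xi> i)" for a using D(5)[OF \<xi>] by auto
  show "vs_scale V 1 \<xi> = \<xi>" using s[of 1] \<xi> by (intro inj_onD[OF D(7)]) auto
  show "vs_scale V a (vs_scale V b \<xi>) = vs_scale V (a * b) \<xi>"
    using s D(5)[OF s(1)] by (intro inj_onD[OF D(7)]) (auto simp: mult.assoc)
  have z: "\<eta> = vs_zero V \<longleftrightarrow> T \<eta> = (\<lambda>_. 0)" if "\<eta> \<in> vs_set V" for \<eta>
    using inj_onD[OF D(7), of \<eta> "vs_zero V"] that D(2,3) by auto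
  show "vs_scale V a \<xi> = vs_zero V \<longleftrightarrow> a = 0 \<or> \<xi> = vs_zero V"
    unfolding z[OF s(1)] z[OF \<xi>] s(2) by (auto simp: fun_eq_iff)
qed

lemma nonzero_coord:
  assumes T: "linear_iso V r T" and \<xi>: "\<xi> \<in> vs_set V" "\<xi> \<noteq> vs_zero V"
  obtains k where "k < r" "T \<xi> k \<noteq> 0"
proof -
  have "T \<xi> \<noteq> (\<lambda>_. 0)" using inj_onD[OF linear_isoD(7)[OF T], of \<xi> "vs_zero V"] \<xi> linear_isoD(2,3)[OF T] by auto
  then obtain k where "T \<xi> k \<noteq> 0" by auto
  moreover have "k < r"
  proof (rule ccontr)
    assume "\<not> k < r"
    then have "T \<xi> k = 0" using linear_isoD(6)[OF T \<xi>(1)] by (simp add: Cn_def)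
    then show False using \<open>T \<xi> k \<noteq> 0\<close> by simp
  qed
  ultimately show ?thesis using that by blast
qed

lemma line_rep:
  assumes T: "linear_iso V r T" and \<xi>: "\<xi> \<in> vs_set V" "T \<xi> k \<noteq> 0"
  shows "line_rep V T k (vs_line V \<xi>) = vs_scale V (1 / T \<xi> k) \<xi>"
  unfolding line_rep_def
proof (rule the_equality)
  note s = linear_isoD(5)[OF T \<xi>(1)]
  show "vs_scale V (1 / T \<xi> k) \<xi> \<in> vs_line V \<xi> \<and> T (vs_scale V (1 / T \<xi> k) \<xi>) k = 1"
    using s[of "1 / T \<xi> k"] \<xi>(2) by (auto simp: vs_line_def)
  fix \<eta> assume "\<eta> \<in> vs_line V \<xi> \<and> T \<eta> k = 1"
  then obtain a where a: "\<eta> = vs_scale V a \<xi>" "T \<eta> k = 1" by (auto simp: vs_line_def)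
  then have "a * T \<xi> k = 1" using s[of a] by simp
  then have "a = 1 / T \<xi> k" using \<xi>(2) by (simp add: eq_divide_eq)
  then show "\<eta> = vs_scale V (1 / T \<xi> k) \<xi>" using a by simp
qed

lemma vs_line_scale:
  assumes T: "linear_iso V r T" and \<xi>: "\<xi> \<in> vs_set V" and a: "a \<noteq> 0"
  shows "vs_line V (vs_scale V a \<xi>) = vs_line V \<xi>"
proof -
  have "vs_scale V b (vs_scale V a \<xi>) = vs_scale V (b * a) \<xi>" for b
    using vs_scale_simps[OF T \<xi>] by simp
  moreover have "vs_scale V b \<xi> = vs_scale V (b / a) (vs_scale V a \<xi>)" for b
    using vs_scale_simps[OF T \<xi>] a by simp
  ultimately have *: "\<exists>b'. vs_scale V b (vs_scale V a \<xi>) = vs_scale V b' \<xi>" "\<exists>b'. vs_scale V b \<xi> = vs_scale V b' (vs_scale V a \<xi>)" for b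
    by blast+
  show ?thesis unfolding vs_line_def
  proof (intro equalityI subsetI)
    fix \<eta> assume "\<eta> \<in> {vs_scale V b (vs_scale V a \<xi>) |b. True}"
    then show "\<eta> \<in> {vs_scale V b \<xi> |b. True}" using *(1) by blast
  next
    fix \<eta> assume "\<eta> \<in> {vs_scale V b \<xi> |b. True}"
    then show "\<eta> \<in> {vs_scale V b (vs_scale V a \<xi>) |b. True}" using *(2) by blast
  qed
qed

lemma vs_line_self: "linear_iso V r T \<Longrightarrow> \<xi> \<in> vs_set V \<Longrightarrow> \<xi> \<in> vs_line V \<xi>"
  unfolding vs_line_def using vs_scale_simps(1) by (metis (mono_tags, lifting) mem_Collect_eq)

lemma vs_line_coord:
  assumes "linear_iso V r T" "\<xi> \<in> vs_set V"
  shows "(\<exists>\<eta>\<in>vs_line V \<xi>. T \<eta> k \<noteq> 0) \<longleftrightarrow> T \<xi> k \<noteq> 0"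
  using linear_isoD(5)[OF assms] vs_line_self[OF assms] by (auto simp: vs_line_def)

text \<open>The coordinates of a chart of the projectivisation are base coordinates followed by the fibre
  coordinates without the \<open>k\<close>-th one, which is normalised to \<open>1\<close>.\<close>

definition enc :: "nat \<Rightarrow> nat \<Rightarrow> nat \<Rightarrow> cvec \<Rightarrow> cvec \<Rightarrow> cvec" where
  "enc n r k z a = (\<lambda>i. if i < n then z i else if i < n + (r - 1) then a (if i - n < k then i - n else Suc (i - n)) else 0)"

definition dec_base :: "nat \<Rightarrow> cvec \<Rightarrow> cvec" where
  "dec_base n \<zeta> = (\<lambda>i. if i < n then \<zeta> i else 0)"

definition dec_fib :: "nat \<Rightarrow> nat \<Rightarrow> nat \<Rightarrow> cvec \<Rightarrow> cvec" where
  "dec_fib n r k \<zeta> = (\<lambda>j. if j < r then (if j = k then 1 else if j < k then \<zeta> (n + j) else \<zeta> (n + (j - 1))) else 0)"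

lemma dec_Cn: "dec_base n \<zeta> \<in> Cn n" "dec_fib n r k \<zeta> \<in> Cn r"
  by (auto simp: dec_base_def dec_fib_def Cn_def)

lemma enc_Cn: "enc n r k z a \<in> Cn (n + (r - 1))"
  by (auto simp: enc_def Cn_def)

lemma dec_enc:
  assumes "z \<in> Cn n" "a \<in> Cn r" "k < r"
  shows "dec_base n (enc n r k z a) = z" "a k = 1 \<Longrightarrow> dec_fib n r k (enc n r k z a) = a"
  using assms by (auto simp: dec_base_def dec_fib_def enc_def Cn_def fun_eq_iff)

lemma enc_dec: "\<zeta> \<in> Cn (n + (r - 1)) \<Longrightarrow> k < r \<Longrightarrow> enc n r k (dec_base n \<zeta>) (dec_fib n r k \<zeta>) = \<zeta>"
  by (auto simp: dec_base_def dec_fib_def enc_def Cn_def fun_eq_iff not_less le_add_diff_inverse)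

lemma dec_fib_k: "k < r \<Longrightarrow> dec_fib n r k \<zeta> k = 1"
  by (simp add: dec_fib_def)

section \<open>Charts of the projectivised bundle and their changes\<close>

lemma proj_chart_eq:
  "fst (proj_chart F c t k) = {(x, l) \<in> proj_pts F. x \<in> fst c \<inter> fst t \<and> (\<exists>\<xi>\<in>l. snd t x \<xi> k \<noteq> 0)}"
  "snd (proj_chart F c t k) (x, l) = enc (cm_dim (vb_base F)) (vb_rank F) k (snd c x) (snd t x (line_rep (vb_fib F x) (snd t x) k l))"
  by (simp_all add: proj_chart_def Let_def enc_def line_rep_def fun_eq_iff)

context
  fixes F :: "('a, 'e) vbundle" and n r N
  assumes F: "hvb F" and n: "n = cm_dim (vb_base F)" and r: "r = vb_rank F" and N: "N = n + (r - 1)"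
begin

text \<open>A spanning vector with nonzero \<open>k\<close>-th coordinate can be divided by that
  coordinate, so the lines in the domain of a chart correspond to normalised vectors.\<close>

lemma proj_pts_iff:
  assumes "t \<in> vb_triv F" "x \<in> fst t" "k < r"
  shows "(x, l) \<in> proj_pts F \<and> (\<exists>\<xi>\<in>l. snd t x \<xi> k \<noteq> 0) \<longleftrightarrow>
     (\<exists>\<xi>\<in>vs_set (vb_fib F x). snd t x \<xi> k = 1 \<and> l = vs_line (vb_fib F x) \<xi>)"
proof -
  let ?V = "vb_fib F x" and ?T = "snd t x"
  note T = hvbD(4)[OF F assms(1,2)]
  show ?thesis
  proof
    assume "(x, l) \<in> proj_pts F \<and> (\<exists>\<xi>\<in>l. ?T \<xi> k \<noteq> 0)"
    then obtain \<xi> where x: "\<xi> \<in> vs_set ?V" "l = vs_line ?V \<xi>" "?T \<xi> k \<noteq> 0"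
      using vs_line_coord[OF T] by (auto simp: proj_pts_def)
    let ?e = "vs_scale ?V (1 / ?T \<xi> k) \<xi>"
    have "?e \<in> vs_set ?V" "?T ?e k = 1" using linear_isoD(5)[OF T x(1), of "1 / ?T \<xi> k"] x(3) by auto
    moreover have "l = vs_line ?V ?e" using vs_line_scale[OF T x(1)] x by simp
    ultimately show "\<exists>\<xi>\<in>vs_set ?V. ?T \<xi> k = 1 \<and> l = vs_line ?V \<xi>" by blast
  next
    assume "\<exists>\<xi>\<in>vs_set ?V. ?T \<xi> k = 1 \<and> l = vs_line ?V \<xi>"
    then obtain \<xi> where x: "\<xi> \<in> vs_set ?V" "?T \<xi> k = 1" "l = vs_line ?V \<xi>" by blast
    moreover have "\<xi> \<noteq> vs_zero ?V" using x(2) linear_isoD(3)[OF T] by auto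
    moreover have "x \<in> cm_pts (vb_base F)" using hvbD(3)[OF F assms(1)] assms(2) by auto
    ultimately show "(x, l) \<in> proj_pts F \<and> (\<exists>\<xi>\<in>l. ?T \<xi> k \<noteq> 0)"
      using vs_line_self[OF T x(1)] by (auto simp: proj_pts_def intro!: bexI[of _ \<xi>])
  qed
qed

text \<open>\<open>pbase\<close>, \<open>pvec\<close> and \<open>ppt\<close> spell out the inverse
  of a chart of the projectivisation: the base point, the normalised vector and the point itself.
  They are meaningful on \<open>pdom c (fst t)\<close>.\<close>

definition pbase :: "'a chart \<Rightarrow> cvec \<Rightarrow> 'a" where
  "pbase c \<zeta> = chart_inv c (dec_base n \<zeta>)"

definition pvec :: "'a chart \<Rightarrow> ('a, 'e) trivialization \<Rightarrow> nat \<Rightarrow> cvec \<Rightarrow> 'e" where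
  "pvec c t k \<zeta> = linv (vb_fib F (pbase c \<zeta>)) (snd t (pbase c \<zeta>)) (dec_fib n r k \<zeta>)"

definition ppt :: "'a chart \<Rightarrow> ('a, 'e) trivialization \<Rightarrow> nat \<Rightarrow> cvec \<Rightarrow> 'a \<times> 'e set" where
  "ppt c t k \<zeta> = (pbase c \<zeta>, vs_line (vb_fib F (pbase c \<zeta>)) (pvec c t k \<zeta>))"

text \<open>The coordinate image of the lines over \<open>W\<close> in an affine chart: the base
  coordinates are restricted, the affine fibre coordinates are free.\<close>

definition pdom :: "'a chart \<Rightarrow> 'a set \<Rightarrow> cvec set" where
  "pdom c W = {\<zeta> \<in> Cn N. dec_base n \<zeta> \<in> snd c ` (fst c \<inter> W)}"

lemma pbase_mem:
  assumes c: "c \<in> cm_atlas (vb_base F)" and z: "\<zeta> \<in> pdom c W"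
  shows "pbase c \<zeta> \<in> fst c" "pbase c \<zeta> \<in> W" "snd c (pbase c \<zeta>) = dec_base n \<zeta>"
  using z atlasD(1)[OF hvbD(1)[OF F] c] unfolding pdom_def pbase_def by (auto simp: chart_inv_left)

lemma pvec_mem:
  assumes c: "c \<in> cm_atlas (vb_base F)" and t: "t \<in> vb_triv F" and k: "k < r" and z: "\<zeta> \<in> pdom c W" "W \<subseteq> fst t"
  shows "pvec c t k \<zeta> \<in> vs_set (vb_fib F (pbase c \<zeta>))" "snd t (pbase c \<zeta>) (pvec c t k \<zeta>) = dec_fib n r k \<zeta>"
    "snd t (pbase c \<zeta>) (pvec c t k \<zeta>) k = 1" "line_rep (vb_fib F (pbase c \<zeta>)) (snd t (pbase c \<zeta>)) k (snd (ppt c t k \<zeta>)) = pvec c t k \<zeta>"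
proof -
  have x: "pbase c \<zeta> \<in> fst t" using pbase_mem(2)[OF c z(1)] z(2) by auto
  note T = hvbD(4)[OF F t x]
  show 1: "pvec c t k \<zeta> \<in> vs_set (vb_fib F (pbase c \<zeta>))" "snd t (pbase c \<zeta>) (pvec c t k \<zeta>) = dec_fib n r k \<zeta>"
    unfolding pvec_def using linv[OF T] dec_Cn(2) r by auto
  then show 2: "snd t (pbase c \<zeta>) (pvec c t k \<zeta>) k = 1" using dec_fib_k[OF k] by simp
  show "line_rep (vb_fib F (pbase c \<zeta>)) (snd t (pbase c \<zeta>)) k (snd (ppt c t k \<zeta>)) = pvec c t k \<zeta>"
    unfolding ppt_def using line_rep[OF T 1(1), of k] 2 vs_scale_simps(1)[OF T 1(1)] by simp
qed

lemma proj_chart_props: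
  assumes c: "c \<in> cm_atlas (vb_base F)" and t: "t \<in> vb_triv F" and k: "k < r"
  shows "inj_on (snd (proj_chart F c t k)) (fst (proj_chart F c t k))"
    "snd (proj_chart F c t k) ` fst (proj_chart F c t k) = pdom c (fst t)"
    "\<zeta> \<in> pdom c (fst t) \<Longrightarrow> chart_inv (proj_chart F c t k) \<zeta> = ppt c t k \<zeta>"
    "\<zeta> \<in> pdom c (fst t) \<Longrightarrow> ppt c t k \<zeta> \<in> fst (proj_chart F c t k)"
    "\<zeta> \<in> pdom c (fst t) \<Longrightarrow> snd (proj_chart F c t k) (ppt c t k \<zeta>) = \<zeta>"
    "p \<in> fst (proj_chart F c t k) \<Longrightarrow> snd (proj_chart F c t k) p \<in> pdom c (fst t) \<and> ppt c t k (snd (proj_chart F c t k) p) = p"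
proof -
  let ?pc = "proj_chart F c t k"
  note H = hvbD(1)[OF F]
  have A: "snd ?pc p \<in> pdom c (fst t) \<and> ppt c t k (snd ?pc p) = p" if p: "p \<in> fst ?pc" for p
  proof -
    obtain x l where xl: "p = (x, l)" by (cases p)
    have x: "x \<in> fst c" "x \<in> fst t" using p by (auto simp: xl proj_chart_eq)
    note T = hvbD(4)[OF F t x(2)]
    have "(x, l) \<in> proj_pts F \<and> (\<exists>\<xi>\<in>l. snd t x \<xi> k \<noteq> 0)" using p by (auto simp: xl proj_chart_eq)
    then obtain \<xi> where xi: "\<xi> \<in> vs_set (vb_fib F x)" "snd t x \<xi> k = 1" "l = vs_line (vb_fib F x) \<xi>"
      using proj_pts_iff[OF t x(2) k] by blast
    have lr: "line_rep (vb_fib F x) (snd t x) k l = \<xi>"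
      using line_rep[OF T xi(1), of k] xi(2,3) vs_scale_simps(1)[OF T xi(1)] by simp
    have a: "snd t x \<xi> \<in> Cn r" using linear_isoD(6)[OF T xi(1)] r by simp
    have z: "snd c x \<in> Cn n" using atlasD(4)[OF H c x(1)] n by simp
    have e: "snd ?pc p = enc n r k (snd c x) (snd t x \<xi>)" by (simp add: xl proj_chart_eq lr n r)
    have d: "dec_base n (snd ?pc p) = snd c x" "dec_fib n r k (snd ?pc p) = snd t x \<xi>"
      unfolding e using dec_enc[OF z a k] xi(2) by auto
    have b: "pbase c (snd ?pc p) = x" unfolding pbase_def d by (rule chart_inv_left[OF atlasD(1)[OF H c] x(1)])
    have "pvec c t k (snd ?pc p) = \<xi>" unfolding pvec_def b d using linv_T[OF T xi(1)] .
    then have "ppt c t k (snd ?pc p) = (x, vs_line (vb_fib F x) \<xi>)" unfolding ppt_def b by simp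
    then have "ppt c t k (snd ?pc p) = p" using xl xi(3) by simp
    moreover have "snd ?pc p \<in> pdom c (fst t)"
    proof -
      have "snd ?pc p \<in> Cn N" unfolding e N by (rule enc_Cn)
      then show ?thesis unfolding pdom_def using d(1) x by blast
    qed
    ultimately show ?thesis by simp
  qed
  show "snd ?pc p \<in> pdom c (fst t) \<and> ppt c t k (snd ?pc p) = p" if "p \<in> fst ?pc" by (rule A[OF that])
  have B: "ppt c t k \<zeta> \<in> fst ?pc \<and> snd ?pc (ppt c t k \<zeta>) = \<zeta>" if z: "\<zeta> \<in> pdom c (fst t)" for \<zeta>
  proof
    note pb = pbase_mem[OF c z] and pv = pvec_mem[OF c t k z order_refl]
    show "ppt c t k \<zeta> \<in> fst ?pc"
      unfolding proj_chart_eq ppt_def using pb proj_pts_iff[OF t pb(2) k, of "vs_line (vb_fib F (pbase c \<zeta>)) (pvec c t k \<zeta>)"] pv(1,3) by auto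
    have "snd ?pc (ppt c t k \<zeta>) = enc n r k (dec_base n \<zeta>) (dec_fib n r k \<zeta>)"
      unfolding ppt_def proj_chart_eq(2) n[symmetric] r[symmetric] pv(4)[unfolded ppt_def snd_conv] pv(2) pb(3) ..
    also have "\<dots> = \<zeta>"
    proof -
      have "\<zeta> \<in> Cn N" using z unfolding pdom_def by blast
      from enc_dec[OF this[unfolded N] k] show ?thesis .
    qed
    finally show "snd ?pc (ppt c t k \<zeta>) = \<zeta>" .
  qed
  show "ppt c t k \<zeta> \<in> fst ?pc" "snd ?pc (ppt c t k \<zeta>) = \<zeta>" if "\<zeta> \<in> pdom c (fst t)" using B[OF that] by blast+
  show inj: "inj_on (snd ?pc) (fst ?pc)"
  proof (rule inj_onI)
    fix p q assume p: "p \<in> fst ?pc" and q: "q \<in> fst ?pc" and e: "snd ?pc p = snd ?pc q"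
    have "p = ppt c t k (snd ?pc p)" using A[OF p] by (rule conjunct2[THEN sym])
    also have "\<dots> = ppt c t k (snd ?pc q)" unfolding e ..
    also have "\<dots> = q" using A[OF q] by (rule conjunct2)
    finally show "p = q" .
  qed
  show "snd ?pc ` fst ?pc = pdom c (fst t)"
  proof (intro equalityI subsetI)
    fix \<zeta> assume "\<zeta> \<in> snd ?pc ` fst ?pc"
    then show "\<zeta> \<in> pdom c (fst t)" using A by blast
  next
    fix \<zeta> assume z: "\<zeta> \<in> pdom c (fst t)"
    show "\<zeta> \<in> snd ?pc ` fst ?pc" by (rule image_eqI[of _ _ "ppt c t k \<zeta>"]) (use B[OF z] in auto)
  qed
  show "chart_inv ?pc \<zeta> = ppt c t k \<zeta>" if "\<zeta> \<in> pdom c (fst t)"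
    using B[OF that] chart_inv_left[OF inj, of "ppt c t k \<zeta>"] by simp
qed

text \<open>Homogeneous coordinates in the trivialisation \<open>s\<close> of the vector normalised
  in \<open>t\<close>. Chart changes of the projectivisation and the coordinate functions on O(1)
  are quotients of these.\<close>

definition gg :: "'a chart \<Rightarrow> ('a, 'e) trivialization \<Rightarrow> nat \<Rightarrow> ('a, 'e) trivialization \<Rightarrow> nat \<Rightarrow> cvec \<Rightarrow> complex" where
  "gg c t k s \<alpha> \<zeta> = snd s (pbase c \<zeta>) (pvec c t k \<zeta>) \<alpha>"

lemma holo_dec: "holo_on N U (\<lambda>\<zeta>. dec_base n \<zeta> j)" "holo_on N U (\<lambda>\<zeta>. dec_fib n r k \<zeta> j)"
proof -
  show "holo_on N U (\<lambda>\<zeta>. dec_base n \<zeta> j)"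
    by (cases "j < n") (simp_all add: dec_base_def holo_on_coord holo_on_const)
  show "holo_on N U (\<lambda>\<zeta>. dec_fib n r k \<zeta> j)"
    by (cases "j < r"; cases "j = k"; cases "j < k") (simp_all add: dec_fib_def holo_on_coord holo_on_const)
qed

lemma pdom_open:
  assumes c: "c \<in> cm_atlas (vb_base F)" and W: "openin (cm_topology (vb_base F)) W"
  shows "open_Cn N (pdom c W)"
proof -
  have 1: "open_Cn N (Cn N)" by (simp add: open_Cn_def)
  have 2: "open_Cn n (snd c ` (fst c \<inter> W))" using open_chart_image[OF hvbD(1)[OF F] c W] n by simp
  have 3: "continuous_on (Cn N) (dec_base n)"
    by (rule continuous_on_to_Cn[of n]) (rule holo_on_cont[OF holo_dec(1)], rule dec_Cn)
  have 4: "dec_base n ` Cn N \<subseteq> Cn n" using dec_Cn(1) by blast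
  from open_Cn_vimage[OF 1 3 4 2]
  show ?thesis by (simp add: pdom_def)
qed

lemma holo_pullback:
  assumes c: "c \<in> cm_atlas (vb_base F)" and W: "openin (cm_topology (vb_base F)) W" and f: "holomorphic_fun_on (vb_base F) W f"
  shows "holo_on N (pdom c W) (\<lambda>\<zeta>. f (pbase c \<zeta>))"
  unfolding pbase_def
proof (rule holo_on_compose(1)[where g = "\<lambda>z. f (chart_inv c z)" and V = "snd c ` (fst c \<inter> W)" and m = n])
  show "holo_on n (snd c ` (fst c \<inter> W)) (\<lambda>z. f (chart_inv c z))" using holomorphic_fun_onD[OF f c] n by simp
  show "open_Cn n (snd c ` (fst c \<inter> W))" using open_chart_image[OF hvbD(1)[OF F] c W] n by simp
qed (use pdom_open[OF c W] in \<open>simp_all add: holo_dec pdom_def\<close>)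

text \<open>The coordinates in \<open>s\<close> arise from the normalised fibre coordinates by the
  transition matrix of \<open>F\<close>, and both depend holomorphically on the chart
  coordinates.\<close>

lemma gg_holo:
  assumes c: "c \<in> cm_atlas (vb_base F)" and t: "t \<in> vb_triv F" and k: "k < r" and s: "s \<in> vb_triv F" and a: "\<alpha> < r"
  shows "holo_on N (pdom c (fst t \<inter> fst s)) (gg c t k s \<alpha>)"
proof -
  let ?W = "fst t \<inter> fst s"
  have W: "openin (cm_topology (vb_base F)) ?W" using hvbD(2)[OF F t] hvbD(2)[OF F s] by blast
  have "holo_on N (pdom c ?W) (\<lambda>\<zeta>. \<Sum>\<beta><r. dec_fib n r k \<zeta> \<beta> * snd s (pbase c \<zeta>) (vb_frame F t \<beta> (pbase c \<zeta>)) \<alpha>)"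
  proof (intro holo_on_sum holo_on_mult holo_dec)
    fix \<beta> assume "\<beta> \<in> {..<r}"
    then show "holo_on N (pdom c ?W) (\<lambda>\<zeta>. snd s (pbase c \<zeta>) (vb_frame F t \<beta> (pbase c \<zeta>)) \<alpha>)"
      using holo_pullback[OF c W hvbD(5)[OF F t s, of \<beta> \<alpha>]] a r by simp
  qed
  then show ?thesis
  proof (rule holo_on_cong[OF pdom_open[OF c W]])
    fix \<zeta> assume z: "\<zeta> \<in> pdom c ?W"
    have x: "pbase c \<zeta> \<in> fst t" "pbase c \<zeta> \<in> fst s" using pbase_mem[OF c z] by auto
    have pv: "pvec c t k \<zeta> \<in> vs_set (vb_fib F (pbase c \<zeta>))" "snd t (pbase c \<zeta>) (pvec c t k \<zeta>) = dec_fib n r k \<zeta>"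
      using pvec_mem[OF c t k z] by auto
    show "(\<Sum>\<beta><r. dec_fib n r k \<zeta> \<beta> * snd s (pbase c \<zeta>) (vb_frame F t \<beta> (pbase c \<zeta>)) \<alpha>) = gg c t k s \<alpha> \<zeta>"
      using lin_on_expand[OF hvbD(4)[OF F t x(1)] linear_iso_comp_lin[OF hvbD(4)[OF F s x(2)]] pv(1), of \<alpha>] pv(2)
      unfolding gg_def vb_frame_linv by (simp add: r[symmetric])
  qed
qed

definition gdom :: "'a chart \<Rightarrow> ('a, 'e) trivialization \<Rightarrow> nat \<Rightarrow> 'a set \<Rightarrow> ('a, 'e) trivialization \<Rightarrow> nat \<Rightarrow> cvec set" where
  "gdom c t k W s k' = {\<zeta> \<in> pdom c (W \<inter> (fst t \<inter> fst s)). gg c t k s k' \<zeta> \<noteq> 0}"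

lemma gdom_open:
  assumes c: "c \<in> cm_atlas (vb_base F)" and t: "t \<in> vb_triv F" and k: "k < r" and s: "s \<in> vb_triv F" and k': "k' < r"
    and W: "openin (cm_topology (vb_base F)) W"
  shows "open_Cn N (gdom c t k W s k')"
proof -
  have W': "openin (cm_topology (vb_base F)) (fst t \<inter> fst s)"
    using hvbD(2)[OF F t] hvbD(2)[OF F s] by blast
  have WW: "openin (cm_topology (vb_base F)) (W \<inter> (fst t \<inter> fst s))" using W W' by blast
  have h: "holo_on N (pdom c (W \<inter> (fst t \<inter> fst s))) (gg c t k s k')"
    by (rule holo_on_subset[OF gg_holo[OF c t k s k']]) (auto simp: pdom_def)
  obtain T where T: "open T" "pdom c (W \<inter> (fst t \<inter> fst s)) = Cn N \<inter> T"
    using pdom_open[OF c WW] unfolding open_Cn_def openin_open by auto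
  have "openin (top_of_set (pdom c (W \<inter> (fst t \<inter> fst s)))) (pdom c (W \<inter> (fst t \<inter> fst s)) \<inter> gg c t k s k' -` (- {0}))"
    by (rule continuous_openin_preimage_gen[OF holo_on_cont[OF h]]) auto
  then have "openin (top_of_set (Cn N)) (pdom c (W \<inter> (fst t \<inter> fst s)) \<inter> gg c t k s k' -` (- {0}))"
    using pdom_open[OF c WW] openin_trans unfolding open_Cn_def by blast
  moreover have "pdom c (W \<inter> (fst t \<inter> fst s)) \<inter> gg c t k s k' -` (- {0}) = gdom c t k W s k'"
    by (auto simp: gdom_def)
  ultimately show ?thesis by (simp add: open_Cn_def)
qed

text \<open>The sets \<^term>\<open>gdom c t k W s k'\<close> are the coordinate images of the lines over \<^term>\<open>W\<close> on which the
  \<open>k'\<close>-th coordinate in the trivialisation \<^term>\<open>s\<close> does not vanish.\<close>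

lemma gdom_image:
  assumes c: "c \<in> cm_atlas (vb_base F)" and t: "t \<in> vb_triv F" and k: "k < r" and s: "s \<in> vb_triv F" and k': "k' < r"
  shows "snd (proj_chart F c t k) ` (fst (proj_chart F c t k) \<inter> {(x, l) \<in> proj_pts F. x \<in> W \<inter> fst s \<and> (\<exists>\<xi>\<in>l. snd s x \<xi> k' \<noteq> 0)})
    = gdom c t k W s k'"
proof -
  let ?pc = "proj_chart F c t k"
  note P = proj_chart_props[OF c t k]
  have key: "ppt c t k \<zeta> \<in> {(x, l) \<in> proj_pts F. x \<in> W \<inter> fst s \<and> (\<exists>\<xi>\<in>l. snd s x \<xi> k' \<noteq> 0)} \<longleftrightarrow> \<zeta> \<in> gdom c t k W s k'"
    if z: "\<zeta> \<in> pdom c (fst t)" for \<zeta>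
  proof -
    have "ppt c t k \<zeta> \<in> proj_pts F" using P(4)[OF z] unfolding proj_chart_eq by auto
    moreover have "pbase c \<zeta> \<in> W \<inter> fst s \<longleftrightarrow> \<zeta> \<in> pdom c (W \<inter> (fst t \<inter> fst s))"
    proof
      assume "pbase c \<zeta> \<in> W \<inter> fst s"
      then have "dec_base n \<zeta> \<in> snd c ` (fst c \<inter> (W \<inter> (fst t \<inter> fst s)))"
        using pbase_mem[OF c z] by (metis IntD1 IntD2 IntI imageI)
      then show "\<zeta> \<in> pdom c (W \<inter> (fst t \<inter> fst s))" using z by (simp add: pdom_def)
    qed (use pbase_mem[OF c] in blast)
    moreover have "(\<exists>\<xi>\<in>vs_line (vb_fib F (pbase c \<zeta>)) (pvec c t k \<zeta>). snd s (pbase c \<zeta>) \<xi> k' \<noteq> 0) \<longleftrightarrow> gg c t k s k' \<zeta> \<noteq> 0"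
      if "pbase c \<zeta> \<in> fst s"
      unfolding gg_def by (rule vs_line_coord[OF hvbD(4)[OF F s that] pvec_mem(1)[OF c t k z order_refl]])
    ultimately show ?thesis by (auto simp: ppt_def gdom_def)
  qed
  show ?thesis
  proof (intro equalityI subsetI)
    fix \<zeta> assume "\<zeta> \<in> gdom c t k W s k'"
    moreover then have z: "\<zeta> \<in> pdom c (fst t)" by (auto simp: gdom_def pdom_def)
    ultimately show "\<zeta> \<in> snd ?pc ` (fst ?pc \<inter> {(x, l) \<in> proj_pts F. x \<in> W \<inter> fst s \<and> (\<exists>\<xi>\<in>l. snd s x \<xi> k' \<noteq> 0)})"
      using key[OF z] P(4,5)[OF z] by (intro image_eqI[of _ _ "ppt c t k \<zeta>"]) auto
  next
    fix \<zeta> assume "\<zeta> \<in> snd ?pc ` (fst ?pc \<inter> {(x, l) \<in> proj_pts F. x \<in> W \<inter> fst s \<and> (\<exists>\<xi>\<in>l. snd s x \<xi> k' \<noteq> 0)})"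
    then obtain p where p: "p \<in> fst ?pc" "p \<in> {(x, l) \<in> proj_pts F. x \<in> W \<inter> fst s \<and> (\<exists>\<xi>\<in>l. snd s x \<xi> k' \<noteq> 0)}" "\<zeta> = snd ?pc p" by blast
    then show "\<zeta> \<in> gdom c t k W s k'" using key[of \<zeta>] P(6)[OF p(1)] by simp
  qed
qed

text \<open>Renormalising the same line in \<open>s\<close> divides its spanning vector by the
  \<open>k'\<close>-th coordinate.\<close>

lemma line_rep_ppt:
  assumes c: "c \<in> cm_atlas (vb_base F)" and t: "t \<in> vb_triv F" and k: "k < r" and s: "s \<in> vb_triv F" and s': "s' \<in> vb_triv F"
    and z: "\<zeta> \<in> gdom c t k (fst s') s k'"
  shows "snd s' (pbase c \<zeta>) (line_rep (vb_fib F (pbase c \<zeta>)) (snd s (pbase c \<zeta>)) k' (snd (ppt c t k \<zeta>))) \<alpha>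
     = gg c t k s' \<alpha> \<zeta> / gg c t k s k' \<zeta>"
proof -
  have z': "\<zeta> \<in> pdom c (fst s' \<inter> (fst t \<inter> fst s))" "gg c t k s k' \<zeta> \<noteq> 0" using z by (auto simp: gdom_def)
  have x: "pbase c \<zeta> \<in> fst s" "pbase c \<zeta> \<in> fst s'" using pbase_mem[OF c z'(1)] by auto
  have pv: "pvec c t k \<zeta> \<in> vs_set (vb_fib F (pbase c \<zeta>))" using pvec_mem(1)[OF c t k z'(1)] by auto
  have "line_rep (vb_fib F (pbase c \<zeta>)) (snd s (pbase c \<zeta>)) k' (snd (ppt c t k \<zeta>))
     = vs_scale (vb_fib F (pbase c \<zeta>)) (1 / gg c t k s k' \<zeta>) (pvec c t k \<zeta>)"
    unfolding ppt_def using line_rep[OF hvbD(4)[OF F s x(1)] pv, of k'] z'(2) by (simp add: gg_def)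
  then show ?thesis
    using linear_isoD(5)[OF hvbD(4)[OF F s' x(2)] pv, of "1 / gg c t k s k' \<zeta>"] by (simp add: gg_def)
qed

lemma proj_simps [simp]:
  "cm_pts (proj_bundle F) = proj_pts F" "cm_dim (proj_bundle F) = N"
  using N n r by (simp_all add: proj_bundle_def)

lemma proj_atlas_iff: "pc \<in> cm_atlas (proj_bundle F) \<longleftrightarrow> (\<exists>c\<in>cm_atlas (vb_base F). \<exists>t\<in>vb_triv F. \<exists>k<r. pc = proj_chart F c t k)"
  unfolding proj_bundle_def r cmfd.simps by blast

lemma proj_holomorphic_atlas: "holomorphic_atlas (proj_bundle F)"
proof -
  have cover: "(\<Union>pc\<in>cm_atlas (proj_bundle F). fst pc) = proj_pts F"
  proof (intro equalityI subsetI)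
    fix p assume p: "p \<in> proj_pts F"
    then obtain x \<xi> where x: "p = (x, vs_line (vb_fib F x) \<xi>)" "x \<in> cm_pts (vb_base F)" "\<xi> \<in> vs_set (vb_fib F x)" "\<xi> \<noteq> vs_zero (vb_fib F x)"
      by (auto simp: proj_pts_def)
    obtain c where c: "c \<in> cm_atlas (vb_base F)" "x \<in> fst c" using atlas_cover[OF hvbD(1)[OF F] x(2)] by blast
    obtain t where t: "t \<in> vb_triv F" "x \<in> fst t" using hvbD(6)[OF F x(2)] by blast
    note T = hvbD(4)[OF F t]
    obtain k where k: "k < r" "snd t x \<xi> k \<noteq> 0" using nonzero_coord[OF T x(3,4)] r by blast
    have "p \<in> fst (proj_chart F c t k)"
      using p x(1) c t k vs_line_self[OF T x(3)] unfolding proj_chart_eq by auto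
    then show "p \<in> (\<Union>pc\<in>cm_atlas (proj_bundle F). fst pc)" using c t k proj_atlas_iff by blast
  next
    fix p assume "p \<in> (\<Union>pc\<in>cm_atlas (proj_bundle F). fst pc)"
    then obtain pc where "pc \<in> cm_atlas (proj_bundle F)" "p \<in> fst pc" by blast
    moreover then obtain c t k where "pc = proj_chart F c t k" using proj_atlas_iff[of pc] by blast
    ultimately have "p \<in> fst (proj_chart F c t k)" by simp
    then show "p \<in> proj_pts F" by (simp add: proj_chart_eq(1)) blast
  qed
  have over: "open_Cn N (snd pc ` (fst pc \<inter> fst pc')) \<and> (\<forall>i<N. holo_on N (snd pc ` (fst pc \<inter> fst pc')) (\<lambda>z. snd pc' (chart_inv pc z) i))"
    if pc: "pc \<in> cm_atlas (proj_bundle F)" "pc' \<in> cm_atlas (proj_bundle F)" for pc pc'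
  proof -
    obtain c t k where c: "c \<in> cm_atlas (vb_base F)" "t \<in> vb_triv F" "k < r" "pc = proj_chart F c t k"
      using pc(1) proj_atlas_iff by blast
    obtain c' s k' where s: "c' \<in> cm_atlas (vb_base F)" "s \<in> vb_triv F" "k' < r" "pc' = proj_chart F c' s k'"
      using pc(2) proj_atlas_iff by blast
    have W: "openin (cm_topology (vb_base F)) (fst c')" by (rule openin_chart[OF hvbD(1)[OF F] s(1)])
    have im: "snd pc ` (fst pc \<inter> fst pc') = gdom c t k (fst c') s k'"
      using gdom_image[OF c(1-3) s(2,3), of "fst c'"] unfolding c(4) s(4) by (simp add: proj_chart_eq(1)[of F c' s k'])
    have o: "open_Cn N (gdom c t k (fst c') s k')" by (rule gdom_open[OF c(1-3) s(2,3) W])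
    have "holo_on N (gdom c t k (fst c') s k') (\<lambda>\<zeta>. snd pc' (chart_inv pc \<zeta>) i)" if i: "i < N" for i
    proof -
      \<comment> \<open>The change of charts: base coordinates change as in the base, fibre
        coordinates are quotients of homogeneous coordinates whose numerator skips the index
        \<open>k'\<close>.\<close>
      have eq: "snd pc' (chart_inv pc \<zeta>) i = (if i < n then snd c' (pbase c \<zeta>) i
          else gg c t k s (if i - n < k' then i - n else Suc (i - n)) \<zeta> / gg c t k s k' \<zeta>)" if z: "\<zeta> \<in> gdom c t k (fst c') s k'" for \<zeta>
      proof -
        have z1: "\<zeta> \<in> pdom c (fst t)" using z by (auto simp: gdom_def pdom_def)
        have "chart_inv pc \<zeta> = (pbase c \<zeta>, snd (ppt c t k \<zeta>))"
          using proj_chart_props(3)[OF c(1-3) z1] c(4) by (simp add: ppt_def)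
        then have ci: "chart_inv (proj_chart F c t k) \<zeta> = (pbase c \<zeta>, snd (ppt c t k \<zeta>))" using c(4) by simp
        have zz: "\<zeta> \<in> gdom c t k (fst s) s k'" using z by (auto simp: gdom_def pdom_def)
        show ?thesis
          unfolding s(4) c(4) ci proj_chart_eq(2) n[symmetric] r[symmetric] enc_def line_rep_ppt[OF c(1-3) s(2,2) zz]
          by (simp only: i[unfolded N] if_True)
      qed
      have "holo_on N (gdom c t k (fst c') s k') (\<lambda>\<zeta>. if i < n then snd c' (pbase c \<zeta>) i
          else gg c t k s (if i - n < k' then i - n else Suc (i - n)) \<zeta> / gg c t k s k' \<zeta>)"
      proof (cases "i < n")
        case True
        have "holo_on n (snd c' ` fst c') (\<lambda>z. snd c' (chart_inv c' z) i)"
          using atlas_overlap(2)[OF hvbD(1)[OF F] s(1) s(1), of i] True n by simp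
        then have "holomorphic_fun_on (vb_base F) (fst c') (\<lambda>x. snd c' x i)"
          using n by (intro holomorphic_fun_on_chart[OF hvbD(1)[OF F] s(1) W]) auto
        from holo_pullback[OF c(1) W this] have "holo_on N (pdom c (fst c')) (\<lambda>\<zeta>. snd c' (pbase c \<zeta>) i)" .
        then show ?thesis using True by (auto intro: holo_on_subset simp: gdom_def pdom_def)
      next
        case False
        have hg: "holo_on N (gdom c t k (fst c') s k') (gg c t k s \<alpha>)" if "\<alpha> < r" for \<alpha>
          by (rule holo_on_subset[OF gg_holo[OF c(1-3) s(2) that]]) (auto simp: gdom_def pdom_def)
        have "holo_on N (gdom c t k (fst c') s k') (\<lambda>\<zeta>. gg c t k s (if i - n < k' then i - n else Suc (i - n)) \<zeta> / gg c t k s k' \<zeta>)"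
        proof (rule holo_on_divide)
          have "(if i - n < k' then i - n else Suc (i - n)) < r" using s(3) False i[unfolded N] by auto
          then show "holo_on N (gdom c t k (fst c') s k') (gg c t k s (if i - n < k' then i - n else Suc (i - n)))"
            by (rule hg)
          show "holo_on N (gdom c t k (fst c') s k') (gg c t k s k')"
            by (rule hg[OF s(3)])
          show "gg c t k s k' \<zeta> \<noteq> 0" if "\<zeta> \<in> gdom c t k (fst c') s k'" for \<zeta> using that unfolding gdom_def by blast
        qed
        then show ?thesis using False by simp
      qed
      then show ?thesis by (rule holo_on_cong[OF o]) (use eq in auto)
    qed
    then show ?thesis using o im by simp
  qed
  have P: "inj_on (snd pc) (fst pc) \<and> open_Cn N (snd pc ` fst pc)" if "pc \<in> cm_atlas (proj_bundle F)" for pc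
    using that over[OF that that] proj_chart_props(1) unfolding proj_atlas_iff by auto
  show ?thesis unfolding holomorphic_atlas_def case_prod_beta using cover over P by auto
qed

end

section \<open>The logarithm of a positive function of class C^2\<close>

lemma Ck_on_SucI:
  assumes U: "open_Cn n U" and c: "continuous_on U f"
    and d: "\<And>i c z. i < n \<Longrightarrow> c \<in> {1,\<i>} \<Longrightarrow> z \<in> U \<Longrightarrow>
      ((\<lambda>t::real. f (z(i := z i + of_real t * c))) has_vector_derivative D i c z) (at 0)"
    and D: "\<And>i c. i < n \<Longrightarrow> c \<in> {1,\<i>} \<Longrightarrow> Ck_on n k U (D i c)"
  shows "Ck_on n (Suc k) U f"
proof -
  have "Ck_on n k U (real_partial i c f)" if "i < n" "c \<in> {1,\<i>}" for i c
  proof (rule Ck_on_cong[OF U _ D[OF that]])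
    show "D i c w = real_partial i c f w" if "w \<in> U" for w
      unfolding real_partial_def by (rule vector_derivative_at[OF d, symmetric]) fact+
  qed
  moreover have "(\<lambda>t::real. f (z(i := z i + of_real t * c))) differentiable at 0" if "i < n" "c \<in> {1,\<i>}" "z \<in> U" for i c z
    using d[OF that] by (rule differentiableI_vector)
  ultimately show ?thesis using c by simp
qed

text \<open>The derivatives are written down explicitly: the logarithmic derivative first, then the
  quotient rule. Order 2 is what the Levi form of a weight uses.\<close>

lemma Ck_on_ln:
  assumes U: "open_Cn n U" and f: "Ck_on n 2 U f" and pos: "\<And>z. z \<in> U \<Longrightarrow> Re (f z) > 0"
  shows "Ck_on n 2 U (\<lambda>z. of_real (ln (Re (f z))))"
proof -
  have f2: "Ck_on n (Suc (Suc 0)) U f" using f by (simp only: numeral_2_eq_2)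
  have cf: "continuous_on U f" using Ck_on_cont[OF f] .
  have df: "((\<lambda>t::real. Re (f (z(i := z i + of_real t * c)))) has_real_derivative Re (real_partial i c f z)) (at 0)"
    if "i < n" "c \<in> {1,\<i>}" "z \<in> U" for i c z
    using bounded_linear.has_vector_derivative[OF bounded_linear_Re real_partial_works[OF f2 that(3,1,2)]]
    by (simp add: has_real_derivative_iff_has_vector_derivative)
  have ofr: "((\<lambda>t::real. complex_of_real (g t)) has_vector_derivative of_real D) (at 0)"
    if "(g has_real_derivative D) (at 0)" for g D
    using that by (rule has_vector_derivative_of_real)
  show ?thesis unfolding numeral_2_eq_2
  proof (rule Ck_on_SucI[where D = "\<lambda>i c z. of_real (Re (real_partial i c f z) / Re (f z))", OF U])
    show "continuous_on U (\<lambda>z. complex_of_real (ln (Re (f z))))"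
      using pos by (intro continuous_intros cf) force
    fix i c assume ic: "i < n" "c \<in> {1,\<i>}"
    show "((\<lambda>t::real. complex_of_real (ln (Re (f (z(i := z i + of_real t * c)))))) has_vector_derivative of_real (Re (real_partial i c f z) / Re (f z))) (at 0)"
      if z: "z \<in> U" for z
    proof (rule ofr)
      have "((\<lambda>t::real. ln (Re (f (z(i := z i + of_real t * c))))) has_real_derivative
         1 / Re (f (z(i := z i + of_real 0 * c))) * Re (real_partial i c f z)) (at 0)"
        using pos[OF z] by (intro DERIV_chain2[OF DERIV_ln_divide df[OF ic z]]) simp
      then show "((\<lambda>t::real. ln (Re (f (z(i := z i + of_real t * c))))) has_real_derivative Re (real_partial i c f z) / Re (f z)) (at 0)"
        by simp
    qed
    note g2 = Ck_on_1_D(1)[OF f2 ic]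
    have cg: "continuous_on U (real_partial i c f)" using Ck_on_cont[OF g2] .
    show "Ck_on n (Suc 0) U (\<lambda>z. complex_of_real (Re (real_partial i c f z) / Re (f z)))"
    proof (rule Ck_on_SucI[where D = "\<lambda>j d z. of_real ((Re (real_partial j d (real_partial i c f) z) * Re (f z)
          - Re (real_partial i c f z) * Re (real_partial j d f z)) / (Re (f z) * Re (f z)))", OF U])
      show "continuous_on U (\<lambda>z. complex_of_real (Re (real_partial i c f z) / Re (f z)))"
        using pos by (intro continuous_intros cf cg) force
      fix j d assume jd: "j < n" "d \<in> {1,\<i>}"
      show "((\<lambda>t::real. complex_of_real (Re (real_partial i c f (z(j := z j + of_real t * d))) / Re (f (z(j := z j + of_real t * d))))) has_vector_derivative
         of_real ((Re (real_partial j d (real_partial i c f) z) * Re (f z) - Re (real_partial i c f z) * Re (real_partial j d f z)) / (Re (f z) * Re (f z)))) (at 0)"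
        if z: "z \<in> U" for z
      proof (rule ofr)
        have "((\<lambda>t::real. Re (real_partial i c f (z(j := z j + of_real t * d)))) has_real_derivative Re (real_partial j d (real_partial i c f) z)) (at 0)"
          using bounded_linear.has_vector_derivative[OF bounded_linear_Re real_partial_works[OF g2 z jd]]
          by (simp add: has_real_derivative_iff_has_vector_derivative)
        from DERIV_divide[OF this df[OF jd z]] pos[OF z]
        show "((\<lambda>t::real. Re (real_partial i c f (z(j := z j + of_real t * d))) / Re (f (z(j := z j + of_real t * d)))) has_real_derivative
          (Re (real_partial j d (real_partial i c f) z) * Re (f z) - Re (real_partial i c f z) * Re (real_partial j d f z)) / (Re (f z) * Re (f z))) (at 0)"
          by simp
      qed
      have "continuous_on U (real_partial j d (real_partial i c f))" "continuous_on U (real_partial j d f)"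
        using Ck_on_cont[OF Ck_on_1_D(1)[OF g2 jd]] Ck_on_cont[OF Ck_on_1_D(1)[OF f2 jd]] by auto
      then show "Ck_on n 0 U (\<lambda>z. complex_of_real ((Re (real_partial j d (real_partial i c f) z) * Re (f z) - Re (real_partial i c f z) * Re (real_partial j d f z)) / (Re (f z) * Re (f z))))"
        unfolding Ck_on.simps using pos by (intro continuous_intros cf cg) force+
    qed
  qed
qed

lemma levi_cong:
  assumes U: "open_Cn n U" and z: "z \<in> U" and eq: "\<And>w. w \<in> U \<Longrightarrow> f w = g w"
  shows "levi n f z a = levi n g z a"
proof -
  have "dzbar j f w = dzbar j g w" if "w \<in> U" "j < n" for w j
    unfolding dzbar_def using real_partial_cong[OF U that eq] by simp
  then have "dz i (dzbar j f) z = dz i (dzbar j g) z" if "i < n" "j < n" for i j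
    unfolding dz_def using real_partial_cong[OF U z that(1), of "dzbar j f" "dzbar j g"] that by simp
  then show ?thesis unfolding levi_def by simp
qed

section \<open>The tautological quotient\<close>

text \<open>The cosets of the kernel of \<open>\<xi>\<close> are its level sets, so the fibre of the
  tautological quotient is parametrised by the value of \<open>\<xi>\<close>.\<close>

definition level_set :: "'e cvspace \<Rightarrow> ('e \<Rightarrow> complex) \<Rightarrow> complex \<Rightarrow> 'e set" where
  "level_set V \<xi> a = {v \<in> vs_set V. \<xi> v = a}"

context
  fixes V :: "'e cvspace" and r T and \<xi> :: "'e \<Rightarrow> complex"
  assumes T: "linear_iso V r T" and \<xi>: "\<xi> \<in> vs_set (dual_space V)" "\<xi> \<noteq> vs_zero (dual_space V)"
begin

lemma xi_lin:
  "v \<in> vs_set V \<Longrightarrow> w \<in> vs_set V \<Longrightarrow> vs_add V v w \<in> vs_set V \<and> \<xi> (vs_add V v w) = \<xi> v + \<xi> w"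
  "v \<in> vs_set V \<Longrightarrow> vs_scale V a v \<in> vs_set V \<and> \<xi> (vs_scale V a v) = a * \<xi> v"
  using linear_isoD(4,5)[OF T] \<xi>(1) by (auto simp: dual_set lin_on_def)

lemma vs_diff:
  assumes "v \<in> vs_set V" "u \<in> vs_set V"
  shows "\<exists>w\<in>vs_set V. vs_add V v w = u"
proof -
  let ?w = "linv V T (\<lambda>i. T u i - T v i)"
  have "(\<lambda>i. T u i - T v i) \<in> Cn r" using linear_isoD(6)[OF T] assms by (auto simp: Cn_def)
  note w = linv[OF T this]
  have "vs_add V v ?w = u"
    using linear_isoD(4)[OF T assms(1) w(1)] w(2) assms by (intro inj_onD[OF linear_isoD(7)[OF T]]) auto
  then show ?thesis using w(1) by blast
qed

lemma level_nonempty: "\<exists>v. v \<in> level_set V \<xi> a"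
proof -
  obtain v where "\<xi> v \<noteq> 0" using \<xi>(2) by (auto simp: dual_space_def fun_eq_iff)
  moreover then have "v \<in> vs_set V" using \<xi>(1) by (auto simp: dual_set)
  ultimately have "vs_scale V (a / \<xi> v) v \<in> level_set V \<xi> a" using xi_lin(2) by (simp add: level_set_def)
  then show ?thesis by blast
qed

lemma coset_level:
  assumes "v \<in> vs_set V"
  shows "vs_coset V (level_set V \<xi> 0) v = level_set V \<xi> (\<xi> v)"
proof (intro equalityI subsetI)
  fix u assume "u \<in> level_set V \<xi> (\<xi> v)"
  then have u: "u \<in> vs_set V" "\<xi> u = \<xi> v" by (auto simp: level_set_def)
  obtain w where w: "w \<in> vs_set V" "vs_add V v w = u" using vs_diff[OF assms u(1)] by blast
  then have "\<xi> w = 0" using xi_lin(1)[OF assms w(1)] u by simp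
  then show "u \<in> vs_coset V (level_set V \<xi> 0) v" using w by (auto simp: vs_coset_def level_set_def)
qed (use xi_lin(1)[OF assms] in \<open>auto simp: vs_coset_def level_set_def\<close>)

lemma quotient_set: "vs_set (quotient_space V (level_set V \<xi> 0)) = range (level_set V \<xi>)"
proof (intro equalityI subsetI)
  fix A assume "A \<in> range (level_set V \<xi>)"
  then obtain a where a: "A = level_set V \<xi> a" by auto
  obtain v where "v \<in> level_set V \<xi> a" using level_nonempty by blast
  then show "A \<in> vs_set (quotient_space V (level_set V \<xi> 0))"
    using coset_level[of v] a by (auto simp: quotient_space_def level_set_def)
qed (use coset_level in \<open>auto simp: quotient_space_def\<close>)

lemma quotient_ops:
  "vs_add (quotient_space V (level_set V \<xi> 0)) (level_set V \<xi> a) (level_set V \<xi> b) = level_set V \<xi> (a + b)"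
  "vs_scale (quotient_space V (level_set V \<xi> 0)) k (level_set V \<xi> a) = level_set V \<xi> (k * a)"
proof -
  show "vs_add (quotient_space V (level_set V \<xi> 0)) (level_set V \<xi> a) (level_set V \<xi> b) = level_set V \<xi> (a + b)"
  proof (intro equalityI subsetI)
    fix u assume "u \<in> level_set V \<xi> (a + b)"
    then have u: "u \<in> vs_set V" "\<xi> u = a + b" by (auto simp: level_set_def)
    obtain v where v: "v \<in> vs_set V" "\<xi> v = a" using level_nonempty[of a] by (auto simp: level_set_def)
    obtain w where w: "w \<in> vs_set V" "vs_add V v w = u" using vs_diff[OF v(1) u(1)] by blast
    then have "\<xi> w = b" using xi_lin(1)[OF v(1) w(1)] u v by simp
    then show "u \<in> vs_add (quotient_space V (level_set V \<xi> 0)) (level_set V \<xi> a) (level_set V \<xi> b)"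
      using v w by (auto simp: quotient_space_def level_set_def)
  qed (use xi_lin(1) in \<open>auto simp: quotient_space_def level_set_def\<close>)
  show "vs_scale (quotient_space V (level_set V \<xi> 0)) k (level_set V \<xi> a) = level_set V \<xi> (k * a)"
  proof (intro equalityI subsetI)
    fix u assume "u \<in> level_set V \<xi> (k * a)"
    then have u: "u \<in> vs_set V" "\<xi> u = k * a" by (auto simp: level_set_def)
    obtain v where v: "v \<in> vs_set V" "\<xi> v = a" using level_nonempty[of a] by (auto simp: level_set_def)
    have kv: "vs_scale V k v \<in> vs_set V" "\<xi> (vs_scale V k v) = k * a" using xi_lin(2)[OF v(1), of k] v by auto
    obtain w where w: "w \<in> vs_set V" "vs_add V (vs_scale V k v) w = u" using vs_diff[OF kv(1) u(1)] by blast
    then have "\<xi> w = 0" using xi_lin(1)[OF kv(1) w(1)] u kv by simp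
    then show "u \<in> vs_scale (quotient_space V (level_set V \<xi> 0)) k (level_set V \<xi> a)"
      using v w by (auto simp: quotient_space_def level_set_def)
  qed (use xi_lin in \<open>auto simp: quotient_space_def level_set_def\<close>)
qed

text \<open>The common value of \<open>\<xi>\<close> on a coset of its kernel; the choice of the
  representative is immaterial there, by \<open>quot_iso_level\<close>.\<close>

definition quot_iso :: "'e set \<Rightarrow> cvec" where
  "quot_iso A = (\<lambda>i. if i = 0 then \<xi> (SOME v. v \<in> A) else 0)"

lemma quot_iso_level: "quot_iso (level_set V \<xi> a) = (\<lambda>i. if i = 0 then a else 0)"
  using someI_ex[OF level_nonempty[of a]] by (auto simp: quot_iso_def level_set_def)

lemma quot_linear_iso: "linear_iso (quotient_space V (level_set V \<xi> 0)) (Suc 0) quot_iso"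
proof -
  have "bij_betw quot_iso (vs_set (quotient_space V (level_set V \<xi> 0))) (Cn (Suc 0))"
    unfolding quotient_set bij_betw_def
  proof
    show "inj_on quot_iso (range (level_set V \<xi>))"
    proof (rule inj_onI)
      fix A B assume "A \<in> range (level_set V \<xi>)" "B \<in> range (level_set V \<xi>)" and eq: "quot_iso A = quot_iso B"
      then obtain a b where ab: "A = level_set V \<xi> a" "B = level_set V \<xi> b" by blast
      have "a = b" using fun_cong[OF eq, of 0] unfolding ab quot_iso_level by simp
      then show "A = B" using ab by simp
    qed
    show "quot_iso ` range (level_set V \<xi>) = Cn (Suc 0)"
    proof (intro equalityI subsetI)
      fix a assume a: "a \<in> Cn (Suc 0)"
      have "a = quot_iso (level_set V \<xi> (a 0))" unfolding quot_iso_level using a by (auto simp: Cn_def fun_eq_iff)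
      then show "a \<in> quot_iso ` range (level_set V \<xi>)" by blast
    qed (auto simp: quot_iso_def Cn_def)
  qed
  moreover have "vs_zero (quotient_space V (level_set V \<xi> 0)) = level_set V \<xi> 0" by (simp add: quotient_space_def)
  ultimately show ?thesis unfolding linear_iso_def quotient_set
    by (auto simp: quotient_ops quot_iso_level fun_eq_iff)
qed

lemma taut_sub_level:
  "vb_fib E x = V \<Longrightarrow> taut_sub E (x, vs_line (dual_space V) \<xi>) = level_set V \<xi> 0"
  unfolding taut_sub_def vs_line_def level_set_def by (auto simp: dual_space_def intro: exI[of _ 1])

lemma linv_quot: "linv (quotient_space V (level_set V \<xi> 0)) quot_iso (Defs.unit_vec 0) = level_set V \<xi> 1"
proof -
  have "quot_iso (level_set V \<xi> 1) = Defs.unit_vec 0" by (auto simp: quot_iso_level Defs.unit_vec_def)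
  then show ?thesis using linv_T[OF quot_linear_iso, of "level_set V \<xi> 1"] by (simp add: quotient_set)
qed

text \<open>The source of the homogeneity of the weight: multiplying \<open>\<xi>\<close> by
  \<open>a\<close> divides the class on which the functional takes the value 1 by
  \<open>a\<close>.\<close>

lemma level_scale:
  assumes "a \<noteq> 0"
  shows "level_set V (vs_scale (dual_space V) a \<xi>) b = vs_scale (quotient_space V (level_set V \<xi> 0)) (1 / a) (level_set V \<xi> b)"
  unfolding quotient_ops using assms by (auto simp: level_set_def dual_space_def field_simps)

end

section \<open>The weights of a nef tautological bundle\<close>

context
  fixes E :: "('a, 'e) vbundle" and F n r N
  assumes E: "hvb E" and F: "F = dual_bundle E" and n: "n = cm_dim (vb_base E)" and r: "r = vb_rank E" and r1: "1 \<le> r"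
    and N: "N = n + (r - 1)"
begin

lemma hF: "hvb F" "n = cm_dim (vb_base F)" "r = vb_rank F"
  using hvb_dual[OF E] F n r by auto

lemmas FD = hvbD[OF hF(1)]

text \<open>A trivialisation of O(1) over the lines with nonzero \<open>k\<close>-th coordinate: a
  coset is evaluated on the normalised spanning functional.\<close>

definition taut_triv :: "('a, 'e \<Rightarrow> complex) trivialization \<Rightarrow> nat \<Rightarrow> ('a \<times> ('e \<Rightarrow> complex) set, 'e set) trivialization" where
  "taut_triv t k = ({(x, l) \<in> proj_pts F. x \<in> fst t \<and> (\<exists>\<xi>\<in>l. snd t x \<xi> k \<noteq> 0)},
     \<lambda>(x, l). quot_iso (line_rep (vb_fib F x) (snd t x) k l))"

lemma taut_triv_mem:
  assumes t: "t \<in> vb_triv F" and k: "k < r" and y: "(x, l) \<in> fst (taut_triv t k)"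
    and s: "s \<in> vb_triv E" "x \<in> fst s"
  defines "\<xi> \<equiv> line_rep (vb_fib F x) (snd t x) k l"
  shows "x \<in> fst t" "\<xi> \<in> vs_set (dual_space (vb_fib E x))" "\<xi> \<noteq> vs_zero (dual_space (vb_fib E x))"
    "l = vs_line (dual_space (vb_fib E x)) \<xi>" "linear_iso (vb_fib E x) r (snd s x)"
proof -
  show x: "x \<in> fst t" using y by (auto simp: taut_triv_def)
  note T = FD(4)[OF t x]
  have "(x, l) \<in> proj_pts F \<and> (\<exists>\<xi>\<in>l. snd t x \<xi> k \<noteq> 0)" using y by (auto simp: taut_triv_def)
  then obtain \<eta> where e: "\<eta> \<in> vs_set (vb_fib F x)" "snd t x \<eta> k = 1" "l = vs_line (vb_fib F x) \<eta>"
    using proj_pts_iff[OF hF N t x k] by blast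
  have "\<xi> = \<eta>" unfolding \<xi>_def using line_rep[OF T e(1), of k] e(2,3) vs_scale_simps(1)[OF T e(1)] by simp
  moreover have "\<eta> \<noteq> vs_zero (vb_fib F x)" using e(2) linear_isoD(3)[OF T] by auto
  ultimately show "\<xi> \<in> vs_set (dual_space (vb_fib E x))" "\<xi> \<noteq> vs_zero (dual_space (vb_fib E x))"
    "l = vs_line (dual_space (vb_fib E x)) \<xi>" using e F by auto
  show "linear_iso (vb_fib E x) r (snd s x)" using hvbD(4)[OF E s] r by simp
qed

lemma taut_simps:
  "vb_base (taut_line_bundle E) = proj_bundle F" "vb_rank (taut_line_bundle E) = Suc 0"
  "vb_fib (taut_line_bundle E) (x, l) = quotient_space (vb_fib E x) (taut_sub E (x, l))"
  using r r1 by (auto simp: taut_line_bundle_def quotient_bundle_def pullback_bundle_def F)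

lemma E_triv_ex: "t \<in> vb_triv F \<Longrightarrow> x \<in> fst t \<Longrightarrow> \<exists>s\<in>vb_triv E. x \<in> fst s"
  using hvbD(6)[OF E, of x] FD(3)[of t] F by auto

text \<open>The trivialisations of a quotient bundle are those in which the projection has a
  holomorphic matrix. Here the image of the frame vector \<open>\<alpha>\<close> is a quotient of
  two homogeneous coordinates, with nonvanishing denominator on the domain.\<close>

lemma taut_triv_in:
  assumes t: "t \<in> vb_triv F" and k: "k < r"
  shows "taut_triv t k \<in> vb_triv (taut_line_bundle E)"
proof -
  let ?Y = "proj_bundle F" and ?U = "fst (taut_triv t k)"
  note PA = proj_holomorphic_atlas[OF hF N]
  have img: "snd (proj_chart F c t1 k1) ` (fst (proj_chart F c t1 k1) \<inter> {(x, l) \<in> proj_pts F. x \<in> W \<inter> fst t \<and> (\<exists>\<xi>\<in>l. snd t x \<xi> k \<noteq> 0)})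
      = gdom F n r N c t1 k1 W t k" if "c \<in> cm_atlas (vb_base F)" "t1 \<in> vb_triv F" "k1 < r" for c t1 k1 W
    by (rule gdom_image[OF hF N that t k])
  have o: "openin (cm_topology ?Y) ?U"
    unfolding openin_cm_iff[OF PA] proj_simps[OF hF N]
  proof (intro conjI ballI)
    show "?U \<subseteq> proj_pts F" by (auto simp: taut_triv_def)
    fix pc assume "pc \<in> cm_atlas ?Y"
    then obtain c t1 k1 where c: "c \<in> cm_atlas (vb_base F)" "t1 \<in> vb_triv F" "k1 < r" "pc = proj_chart F c t1 k1"
      using proj_atlas_iff[OF hF N] by blast
    have "snd pc ` (?U \<inter> fst pc) = gdom F n r N c t1 k1 (fst t) t k"
      using img[OF c(1-3), of "fst t"] unfolding c(4) taut_triv_def by (simp add: Int_commute)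
    then show "open_Cn N (snd pc ` (?U \<inter> fst pc))" using gdom_open[OF hF N c(1-3) t k FD(2)[OF t]] by simp
  qed
  have iso: "linear_iso (quotient_space (vb_fib E x) (taut_sub E (x, l))) (Suc 0) (snd (taut_triv t k) (x, l))"
    if y: "(x, l) \<in> ?U" for x l
  proof -
    have "x \<in> fst t" using y by (auto simp: taut_triv_def)
    then obtain s where s: "s \<in> vb_triv E" "x \<in> fst s" using E_triv_ex[OF t] by blast
    note m = taut_triv_mem[OF t k y s]
    show ?thesis
      using quot_linear_iso[OF m(5,2,3)] taut_sub_level[OF m(5,2,3) refl] m(4) by (simp add: taut_triv_def)
  qed
  have hol: "holomorphic_fun_on ?Y (?U \<inter> (proj_pts F \<inter> fst -` fst s0))
      (\<lambda>y. snd (taut_triv t k) y (vs_coset (vb_fib E (fst y)) (taut_sub E y) (vb_frame E s0 \<alpha> (fst y))) 0)"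
    if s0: "s0 \<in> vb_triv E" and a: "\<alpha> < r" for s0 \<alpha>
    unfolding holomorphic_fun_on_def case_prod_beta proj_simps[OF hF N]
  proof
    fix pc assume "pc \<in> cm_atlas ?Y"
    then obtain c t1 k1 where c: "c \<in> cm_atlas (vb_base F)" "t1 \<in> vb_triv F" "k1 < r" "pc = proj_chart F c t1 k1"
      using proj_atlas_iff[OF hF N] by blast
    \<comment> \<open>Evaluating a functional on the frame vector \<open>\<alpha>\<close> of
      \<open>s0\<close> is its \<open>\<alpha>\<close>-th coordinate in the dual trivialisation,
      which brings the expression into the form \<open>gg\<close>.\<close>
    define s where "s = dual_triv E s0"
    have s: "s \<in> vb_triv F" using s0 by (simp add: s_def F dual_triv_set)
    have im: "snd pc ` (fst pc \<inter> (?U \<inter> (proj_pts F \<inter> fst -` fst s0))) = gdom F n r N c t1 k1 (fst s) t k"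
    proof -
      have "?U \<inter> (proj_pts F \<inter> fst -` fst s0) = {(x, l) \<in> proj_pts F. x \<in> fst s \<inter> fst t \<and> (\<exists>\<xi>\<in>l. snd t x \<xi> k \<noteq> 0)}"
        by (auto simp: taut_triv_def s_def)
      then show ?thesis using img[OF c(1-3), of "fst s"] c(4) by simp
    qed
    have og: "open_Cn N (gdom F n r N c t1 k1 (fst s) t k)" by (rule gdom_open[OF hF N c(1-3) t k FD(2)[OF s]])
    have "holo_on N (gdom F n r N c t1 k1 (fst s) t k) (\<lambda>\<zeta>. gg F n r c t1 k1 s \<alpha> \<zeta> / gg F n r c t1 k1 t k \<zeta>)"
    proof (rule holo_on_divide)
      show "holo_on N (gdom F n r N c t1 k1 (fst s) t k) (gg F n r c t1 k1 s \<alpha>)"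
        by (rule holo_on_subset[OF gg_holo[OF hF N c(1-3) s a]]) (auto simp: gdom_def[OF hF N] pdom_def[OF hF N])
      show "holo_on N (gdom F n r N c t1 k1 (fst s) t k) (gg F n r c t1 k1 t k)"
        by (rule holo_on_subset[OF gg_holo[OF hF N c(1-3) t k]]) (auto simp: gdom_def[OF hF N] pdom_def[OF hF N])
    qed (auto simp: gdom_def[OF hF N])
    then have "holo_on N (gdom F n r N c t1 k1 (fst s) t k)
      (\<lambda>\<zeta>. snd (taut_triv t k) (chart_inv pc \<zeta>) (vs_coset (vb_fib E (fst (chart_inv pc \<zeta>))) (taut_sub E (chart_inv pc \<zeta>)) (vb_frame E s0 \<alpha> (fst (chart_inv pc \<zeta>)))) 0)"
    proof (rule holo_on_cong[OF og])
      fix \<zeta> assume z: "\<zeta> \<in> gdom F n r N c t1 k1 (fst s) t k"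
      then obtain y where y: "y \<in> fst pc" "y \<in> ?U" "fst y \<in> fst s0" "\<zeta> = snd pc y" using im by blast
      obtain x l where xl: "y = (x, l)" by (cases y)
      have ci: "chart_inv pc \<zeta> = y"
        using chart_inv_left[OF proj_chart_props(1)[OF hF N c(1-3)]] y c(4) by simp
      have z1: "\<zeta> \<in> pdom n N c (fst t1)" using z by (auto simp: gdom_def[OF hF N] pdom_def[OF hF N])
      have pp: "ppt F n r c t1 k1 \<zeta> = y" using proj_chart_props(3)[OF hF N c(1-3) z1] ci c(4) by simp
      note m = taut_triv_mem[OF t k y(2)[unfolded xl] s0 y(3)[unfolded xl fst_conv]]
      define \<xi> where "\<xi> = line_rep (vb_fib F x) (snd t x) k l"
      have fr: "vb_frame E s0 \<alpha> x \<in> vs_set (vb_fib E x)"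
        unfolding vb_frame_linv by (rule linv(1)[OF m(5) unit_vec_Cn[OF a]])
      have "snd (taut_triv t k) y (vs_coset (vb_fib E x) (taut_sub E y) (vb_frame E s0 \<alpha> x)) 0 = \<xi> (vb_frame E s0 \<alpha> x)"
        using taut_sub_level[OF m(5,2,3) refl] m(4) coset_level[OF m(5,2,3) fr] quot_iso_level[OF m(5,2,3)]
        by (simp add: xl taut_triv_def \<xi>_def)
      also have "\<dots> = snd s x \<xi> \<alpha>" using a r by (simp add: s_def dual_triv_def dual_iso_def vb_frame_linv)
      also have "\<dots> = gg F n r c t1 k1 s \<alpha> \<zeta> / gg F n r c t1 k1 t k \<zeta>"
        using line_rep_ppt[OF hF N c(1-3) t s z, of \<alpha>] pp unfolding ppt_def[OF hF N] xl \<xi>_def by auto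
      finally show "gg F n r c t1 k1 s \<alpha> \<zeta> / gg F n r c t1 k1 t k \<zeta> =
        snd (taut_triv t k) (chart_inv pc \<zeta>) (vs_coset (vb_fib E (fst (chart_inv pc \<zeta>))) (taut_sub E (chart_inv pc \<zeta>)) (vb_frame E s0 \<alpha> (fst (chart_inv pc \<zeta>)))) 0"
        by (simp add: ci xl)
    qed
    then show "holo_on N (snd pc ` (fst pc \<inter> (?U \<inter> (proj_pts F \<inter> fst -` fst s0))))
      (\<lambda>z. snd (taut_triv t k) (chart_inv (fst pc, snd pc) z) (vs_coset (vb_fib E (fst (chart_inv (fst pc, snd pc) z))) (taut_sub E (chart_inv (fst pc, snd pc) z)) (vb_frame E s0 \<alpha> (fst (chart_inv (fst pc, snd pc) z)))) 0)"
      unfolding im by simp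
  qed
  define PB where "PB = pullback_bundle ?Y fst E"
  have PB: "vb_triv PB = {(proj_pts F \<inter> fst -` fst s, \<lambda>y. snd s (fst y)) |s. s \<in> vb_triv E}"
    "vb_fib PB = (\<lambda>y. vb_fib E (fst y))" "vb_rank PB = r" "vb_base PB = ?Y"
    using r by (auto simp: PB_def pullback_bundle_def proj_simps[OF hF N])
  have rr: "vb_rank PB - (vb_rank E - 1) = Suc 0" using r r1 PB(3) by simp
  have L: "taut_line_bundle E = quotient_bundle PB (vb_rank E - 1) (taut_sub E)"
    by (simp add: taut_line_bundle_def PB_def F)
  show ?thesis unfolding L quotient_bundle_def vbundle.simps rr
  proof (rule CollectI, unfold case_prod_beta, intro conjI ballI allI impI)
    show "openin (cm_topology (vb_base PB)) (fst (taut_triv t k))" using o PB by simp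
    show "linear_iso (quotient_space (vb_fib PB y) (taut_sub E y)) (Suc 0) (snd (taut_triv t k) y)" if "y \<in> ?U" for y
      using iso[of "fst y" "snd y"] that PB by simp
    fix s \<alpha> \<beta> assume s: "s \<in> vb_triv PB" and ab: "\<alpha> < vb_rank PB" "\<beta> < Suc 0"
    obtain s0 where s0: "s0 \<in> vb_triv E" "s = (proj_pts F \<inter> fst -` fst s0, \<lambda>y. snd s0 (fst y))" using s PB by auto
    have "vb_frame PB s \<alpha> y = vb_frame E s0 \<alpha> (fst y)" for y using s0 PB by (simp add: vb_frame_def)
    then show "holomorphic_fun_on (vb_base PB) (fst (taut_triv t k) \<inter> fst s)
       (\<lambda>x. snd (taut_triv t k) x (vs_coset (vb_fib PB x) (taut_sub E x) (vb_frame PB s \<alpha> x)) \<beta>)"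
      using hol[OF s0(1), of \<alpha>] s0(2) ab PB by simp
  qed
qed

lemma taut_frame:
  assumes t: "t \<in> vb_triv F" and k: "k < r" and y: "(x, l) \<in> fst (taut_triv t k)"
  shows "vb_frame (taut_line_bundle E) (taut_triv t k) 0 (x, l) = level_set (vb_fib E x) (line_rep (vb_fib F x) (snd t x) k l) 1"
proof -
  have "x \<in> fst t" using y by (auto simp: taut_triv_def)
  then obtain s where s: "s \<in> vb_triv E" "x \<in> fst s" using E_triv_ex[OF t] by blast
  note m = taut_triv_mem[OF t k y s]
  show ?thesis
    unfolding vb_frame_linv taut_simps using linv_quot[OF m(5,2,3)] taut_sub_level[OF m(5,2,3) refl] m(4)
    by (simp add: taut_triv_def)
qed

text \<open>The logarithm of the squared length of the class on which \<open>\<xi>\<close> equals 1.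
  By \<open>lam_scale\<close> its negative grows like 2 ln |a| when \<open>\<xi>\<close> is
  multiplied by \<open>a\<close>: it is the logarithm of a squared Finsler norm on the dual of
  \<open>E\<close>.\<close>

definition lam :: "('a \<times> ('e \<Rightarrow> complex) set \<Rightarrow> 'e set \<Rightarrow> 'e set \<Rightarrow> complex) \<Rightarrow> 'a \<Rightarrow> ('e \<Rightarrow> complex) \<Rightarrow> real" where
  "lam h x \<xi> = ln (Re (h (x, vs_line (dual_space (vb_fib E x)) \<xi>) (level_set (vb_fib E x) \<xi> 1) (level_set (vb_fib E x) \<xi> 1)))"

context
  fixes h
  assumes h: "hermitian_metric (taut_line_bundle E) h"
begin

lemma taut_point:
  assumes x: "x \<in> cm_pts (vb_base E)" and \<xi>: "\<xi> \<in> vs_set (dual_space (vb_fib E x))" "\<xi> \<noteq> vs_zero (dual_space (vb_fib E x))"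
  defines "y \<equiv> (x, vs_line (dual_space (vb_fib E x)) \<xi>)"
  shows "y \<in> cm_pts (proj_bundle F)" "vb_fib (taut_line_bundle E) y = quotient_space (vb_fib E x) (level_set (vb_fib E x) \<xi> 0)"
    "0 < Re (h y (level_set (vb_fib E x) \<xi> 1) (level_set (vb_fib E x) \<xi> 1))"
    "h y (level_set (vb_fib E x) \<xi> 1) (level_set (vb_fib E x) \<xi> 1) = cnj (h y (level_set (vb_fib E x) \<xi> 1) (level_set (vb_fib E x) \<xi> 1))"
    "h y (vs_scale (quotient_space (vb_fib E x) (level_set (vb_fib E x) \<xi> 0)) a (level_set (vb_fib E x) \<xi> 1)) (vs_scale (quotient_space (vb_fib E x) (level_set (vb_fib E x) \<xi> 0)) a (level_set (vb_fib E x) \<xi> 1))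
      = a * cnj a * h y (level_set (vb_fib E x) \<xi> 1) (level_set (vb_fib E x) \<xi> 1)"
proof -
  obtain s where s: "s \<in> vb_triv E" "x \<in> fst s" using hvbD(6)[OF E x] by blast
  note T = hvbD(4)[OF E s]
  let ?Q = "quotient_space (vb_fib E x) (level_set (vb_fib E x) \<xi> 0)" and ?e = "level_set (vb_fib E x) \<xi> 1"
  show y: "y \<in> cm_pts (proj_bundle F)"
    unfolding proj_simps[OF hF N] y_def using x \<xi> by (auto simp: proj_pts_def F)
  show Q: "vb_fib (taut_line_bundle E) y = ?Q"
    unfolding y_def taut_simps taut_sub_level[OF T \<xi> refl] ..
  have e: "level_set (vb_fib E x) \<xi> b \<in> vs_set ?Q" for b unfolding quotient_set[OF T \<xi>] by simp
  have sc: "vs_scale ?Q a ?e \<in> vs_set ?Q" unfolding quotient_ops[OF T \<xi>] by (rule e)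
  obtain v where "v \<in> ?e" using level_nonempty[OF T \<xi>] by blast
  then have v: "v \<in> vs_set (vb_fib E x)" "\<xi> v = 1" by (auto simp: level_set_def)
  have "?e \<noteq> vs_zero ?Q"
  proof
    assume "?e = vs_zero ?Q"
    then have "v \<in> level_set (vb_fib E x) \<xi> 0" using \<open>v \<in> ?e\<close> by (simp add: quotient_space_def)
    then show False using v by (simp add: level_set_def)
  qed
  then show "0 < Re (h y ?e ?e)"
    using h y e[of 1] unfolding hermitian_metric_def taut_simps(1) Let_def Q[symmetric] by blast
  show real: "h y ?e ?e = cnj (h y ?e ?e)"
    using h y e[of 1] unfolding hermitian_metric_def taut_simps(1) Let_def Q[symmetric] by blast
  have l: "h y (vs_scale ?Q b v) w = b * h y v w" if "v \<in> vs_set ?Q" "w \<in> vs_set ?Q" for b v w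
    using h y that unfolding hermitian_metric_def taut_simps(1) Let_def Q[symmetric] by blast
  have c: "h y w v = cnj (h y v w)" if "v \<in> vs_set ?Q" "w \<in> vs_set ?Q" for v w
    using h y that unfolding hermitian_metric_def taut_simps(1) Let_def Q[symmetric] by blast
  have "h y (vs_scale ?Q a ?e) (vs_scale ?Q a ?e) = a * h y ?e (vs_scale ?Q a ?e)" by (rule l[OF e sc])
  also have "h y ?e (vs_scale ?Q a ?e) = cnj (a * h y ?e ?e)" unfolding c[OF sc e] l[OF e e] ..
  finally show "h y (vs_scale ?Q a ?e) (vs_scale ?Q a ?e) = a * cnj a * h y ?e ?e" using real by simp
qed

lemma lam_scale:
  assumes x: "x \<in> cm_pts (vb_base E)" and \<xi>: "\<xi> \<in> vs_set (dual_space (vb_fib E x))" "\<xi> \<noteq> vs_zero (dual_space (vb_fib E x))"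
    and a: "a \<noteq> 0"
  shows "lam h x (vs_scale (dual_space (vb_fib E x)) a \<xi>) = lam h x \<xi> - 2 * ln (cmod a)"
proof -
  obtain s where s: "s \<in> vb_triv E" "x \<in> fst s" using hvbD(6)[OF E x] by blast
  note T = hvbD(4)[OF E s]
  note P = taut_point[OF x \<xi>]
  let ?y = "(x, vs_line (dual_space (vb_fib E x)) \<xi>)" and ?e = "level_set (vb_fib E x) \<xi> 1"
  have "1 / a * cnj (1 / a) = of_real ((1 / cmod a)\<^sup>2)"
    using complex_norm_square[of "1 / a"] by (simp add: norm_divide power_one_over)
  then have "Re (1 / a * cnj (1 / a) * h ?y ?e ?e) = (1 / cmod a)\<^sup>2 * Re (h ?y ?e ?e)"
    by simp
  then have "lam h x (vs_scale (dual_space (vb_fib E x)) a \<xi>) = ln ((1 / cmod a)\<^sup>2 * Re (h ?y ?e ?e))"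
    unfolding lam_def vs_line_scale[OF dual_linear_iso(1)[OF T] \<xi>(1) a] level_scale[OF T \<xi> a] P(5) by simp
  also have "\<dots> = ln ((1 / cmod a)\<^sup>2) + lam h x \<xi>"
    unfolding lam_def using P(3) a by (intro ln_mult_pos) auto
  also have "ln ((1 / cmod a)\<^sup>2) = - 2 * ln (cmod a)" using a by (simp add: ln_realpow ln_div)
  finally show ?thesis by simp
qed

text \<open>In a chart \<open>lam\<close> is evaluated on the normalised functional, whose class of
  value 1 is the frame of \<open>taut_triv\<close>. So \<open>lam\<close> becomes the local weight
  to which the nefness condition refers.\<close>

lemma lam_weight:
  assumes c: "c \<in> cm_atlas (vb_base E)" and t: "t \<in> vb_triv F" and k: "k < r"
  defines "pc \<equiv> proj_chart F c t k"
  defines "w \<equiv> (\<lambda>\<zeta>. of_real (lam h (pbase n c \<zeta>) (pvec F n r c t k \<zeta>))) :: cvec \<Rightarrow> complex"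
  shows "Ck_on N 2 (pdom n N c (fst t)) w"
    "\<zeta> \<in> pdom n N c (fst t) \<Longrightarrow> w \<zeta> = of_real (ln (Re (h (chart_inv pc \<zeta>)
        (vb_frame (taut_line_bundle E) (taut_triv t k) 0 (chart_inv pc \<zeta>)) (vb_frame (taut_line_bundle E) (taut_triv t k) 0 (chart_inv pc \<zeta>)))))"
proof -
  let ?D = "pdom n N c (fst t)" and ?fr = "vb_frame (taut_line_bundle E) (taut_triv t k) 0"
  have c': "c \<in> cm_atlas (vb_base F)" using c F by simp
  note P = proj_chart_props[OF hF N c' t k]
  have D: "open_Cn N ?D" by (rule pdom_open[OF hF N c' FD(2)[OF t]])
  have U: "fst pc \<subseteq> fst (taut_triv t k)" unfolding pc_def by (auto simp: proj_chart_eq taut_triv_def)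
  have key: "?fr (chart_inv pc \<zeta>) = level_set (vb_fib E (pbase n c \<zeta>)) (pvec F n r c t k \<zeta>) 1
     \<and> chart_inv pc \<zeta> = (pbase n c \<zeta>, vs_line (dual_space (vb_fib E (pbase n c \<zeta>))) (pvec F n r c t k \<zeta>))
     \<and> pbase n c \<zeta> \<in> cm_pts (vb_base E) \<and> pvec F n r c t k \<zeta> \<in> vs_set (dual_space (vb_fib E (pbase n c \<zeta>)))
     \<and> pvec F n r c t k \<zeta> \<noteq> vs_zero (dual_space (vb_fib E (pbase n c \<zeta>)))"
    if z: "\<zeta> \<in> ?D" for \<zeta>
  proof -
    have y: "chart_inv pc \<zeta> = ppt F n r c t k \<zeta>" using P(3)[OF z] by (simp add: pc_def)
    then have y': "chart_inv pc \<zeta> = (pbase n c \<zeta>, snd (ppt F n r c t k \<zeta>))" by (simp add: ppt_def[OF hF N])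
    have in_U: "(pbase n c \<zeta>, snd (ppt F n r c t k \<zeta>)) \<in> fst (taut_triv t k)" using P(4)[OF z] U y y' by (auto simp: pc_def)
    note pv = pvec_mem[OF hF N c' t k z order_refl]
    have x: "pbase n c \<zeta> \<in> fst t" using pbase_mem(2)[OF hF N c' z] .
    have "pvec F n r c t k \<zeta> \<noteq> vs_zero (vb_fib F (pbase n c \<zeta>))"
      using pv(3) linear_isoD(3)[OF FD(4)[OF t x]] by auto
    moreover have "pbase n c \<zeta> \<in> cm_pts (vb_base E)" using x FD(3)[OF t] F by auto
    moreover have "ppt F n r c t k \<zeta> = (pbase n c \<zeta>, vs_line (dual_space (vb_fib E (pbase n c \<zeta>))) (pvec F n r c t k \<zeta>))"
      unfolding ppt_def[OF hF N] by (simp add: F)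
    ultimately show ?thesis
      using taut_frame[OF t k in_U] pv(1,4) y y' by (simp add: F)
  qed
  have sm: "smooth_fun_on (proj_bundle F) (fst (taut_triv t k)) (\<lambda>y. h y (?fr y) (?fr y))"
    using h taut_triv_in[OF t k] unfolding hermitian_metric_def taut_simps by blast
  have "pc \<in> cm_atlas (proj_bundle F)" using proj_atlas_iff[OF hF N] c' t k pc_def by blast
  then have "smooth_on N (snd pc ` (fst pc \<inter> fst (taut_triv t k))) (\<lambda>z. h (chart_inv pc z) (?fr (chart_inv pc z)) (?fr (chart_inv pc z)))"
    using sm unfolding smooth_fun_on_def proj_simps[OF hF N] case_prod_beta by auto
  moreover have "snd pc ` (fst pc \<inter> fst (taut_triv t k)) = ?D" using P(2) U unfolding pc_def by (simp add: inf.absorb1)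
  ultimately have "Ck_on N 2 ?D (\<lambda>z. h (chart_inv pc z) (?fr (chart_inv pc z)) (?fr (chart_inv pc z)))"
    by (simp add: smooth_on_def)
  moreover have pos: "Re (h (chart_inv pc z) (?fr (chart_inv pc z)) (?fr (chart_inv pc z))) > 0" if "z \<in> ?D" for z
    unfolding key[OF that, THEN conjunct1] using key[OF that] taut_point(3) by simp
  ultimately have C: "Ck_on N 2 ?D (\<lambda>z. of_real (ln (Re (h (chart_inv pc z) (?fr (chart_inv pc z)) (?fr (chart_inv pc z))))))"
    by (rule Ck_on_ln[OF D])
  show eq: "w \<zeta> = of_real (ln (Re (h (chart_inv pc \<zeta>) (?fr (chart_inv pc \<zeta>)) (?fr (chart_inv pc \<zeta>)))))" if "\<zeta> \<in> ?D" for \<zeta>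
    unfolding key[OF that, THEN conjunct1] using key[OF that] by (simp add: w_def lam_def)
  show "Ck_on N 2 ?D w" by (rule Ck_on_cong[OF D _ C]) (simp add: eq)
qed

end

end

section \<open>Hermitian metrics in chart coordinates\<close>

lemma hermitian_expand:
  assumes w: "hermitian_metric (tangent_bundle Y) \<omega>" and Y: "holomorphic_atlas Y" and pc: "pc \<in> cm_atlas Y" "y \<in> fst pc"
    and u: "u \<in> vs_set (tangent_space Y y)"
  defines "e \<equiv> (\<lambda>i. vb_frame (tangent_bundle Y) (tan_triv pc) i y)"
  shows "\<omega> y u u = (\<Sum>i<cm_dim Y. \<Sum>j<cm_dim Y. \<omega> y (e i) (e j) * u pc i * cnj (u pc j))"
    "i < cm_dim Y \<Longrightarrow> j < cm_dim Y \<Longrightarrow> \<omega> y (e j) (e i) = cnj (\<omega> y (e i) (e j))"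
    "u \<noteq> vs_zero (tangent_space Y y) \<Longrightarrow> Re (\<omega> y u u) > 0"
proof -
  let ?V = "tangent_space Y y" and ?m = "cm_dim Y"
  note T = tangent_linear_iso[OF Y pc]
  have e: "e i = linv ?V (\<lambda>v. v pc) (Defs.unit_vec i)" for i by (simp add: e_def vb_frame_linv tan_triv_def)
  have ye: "y \<in> cm_pts Y" using atlasD(3)[OF Y pc(1)] pc(2) by auto
  have add: "\<omega> y (vs_add ?V a b) d = \<omega> y a d + \<omega> y b d" if "a \<in> vs_set ?V" "b \<in> vs_set ?V" "d \<in> vs_set ?V" for a b d
    using w ye that unfolding hermitian_metric_def tangent_bundle_simps Let_def by blast
  have sc: "\<omega> y (vs_scale ?V k a) d = k * \<omega> y a d" if "a \<in> vs_set ?V" "d \<in> vs_set ?V" for a d k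
    using w ye that unfolding hermitian_metric_def tangent_bundle_simps Let_def by blast
  have cj: "\<omega> y a d = cnj (\<omega> y d a)" if "a \<in> vs_set ?V" "d \<in> vs_set ?V" for a d
    using w ye that unfolding hermitian_metric_def tangent_bundle_simps Let_def by blast
  show "u \<noteq> vs_zero ?V \<Longrightarrow> Re (\<omega> y u u) > 0"
    using w ye u unfolding hermitian_metric_def tangent_bundle_simps Let_def by blast
  have lin: "lin_on ?V (\<lambda>v. \<omega> y v d)" if "d \<in> vs_set ?V" for d
    using that add sc by (simp add: lin_on_def)
  have eV: "e i \<in> vs_set ?V" if "i < ?m" for i unfolding e by (rule linv(1)[OF T unit_vec_Cn[OF that]])
  show "\<omega> y (e j) (e i) = cnj (\<omega> y (e i) (e j))" if "i < cm_dim Y" "j < cm_dim Y"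
    by (rule cj[OF eV[OF that(2)] eV[OF that(1)]])
  have "\<omega> y u u = (\<Sum>i<?m. u pc i * \<omega> y (e i) u)"
    unfolding e by (rule lin_on_expand[OF T lin[OF u] u])
  also have "\<dots> = (\<Sum>i<?m. \<Sum>j<?m. \<omega> y (e i) (e j) * u pc i * cnj (u pc j))"
  proof (intro sum.cong refl)
    fix i assume i: "i \<in> {..<?m}"
    have "\<omega> y (e i) u = cnj (\<omega> y u (e i))" using cj[OF eV u] i by simp
    also have "\<omega> y u (e i) = (\<Sum>j<?m. u pc j * \<omega> y (e j) (e i))"
      unfolding e[of "_ :: nat"] by (subst lin_on_expand[OF T lin u]) (use i eV e in auto)
    also have "cnj \<dots> = (\<Sum>j<?m. cnj (u pc j) * \<omega> y (e i) (e j))"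
      unfolding cnj_sum complex_cnj_mult
    proof (intro sum.cong refl)
      fix j assume "j \<in> {..<?m}"
      then show "cnj (u pc j) * cnj (\<omega> y (e j) (e i)) = cnj (u pc j) * \<omega> y (e i) (e j)"
        using cj[OF eV eV, of i j] i by simp
    qed
    finally show "u pc i * \<omega> y (e i) u = (\<Sum>j<?m. \<omega> y (e i) (e j) * u pc i * cnj (u pc j))"
      by (simp only: sum_distrib_left mult.commute mult.left_commute)
  qed
  finally show "\<omega> y u u = (\<Sum>i<?m. \<Sum>j<?m. \<omega> y (e i) (e j) * u pc i * cnj (u pc j))" .
qed

text \<open>Converts the metric \<open>\<omega>\<close> of the nefness condition into the coordinate
  norm; the factor is a sum of absolute values of metric coefficients and therefore continuous in
  the point.\<close>

lemma hermitian_bound: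
  assumes w: "hermitian_metric (tangent_bundle Y) \<omega>" and Y: "holomorphic_atlas Y" and pc: "pc \<in> cm_atlas Y" "y \<in> fst pc"
    and u: "u \<in> vs_set (tangent_space Y y)"
  shows "Re (\<omega> y u u) \<le> (\<Sum>i<cm_dim Y. \<Sum>j<cm_dim Y. cmod (\<omega> y (vb_frame (tangent_bundle Y) (tan_triv pc) i y) (vb_frame (tangent_bundle Y) (tan_triv pc) j y)))
     * (cnrm (cm_dim Y) (u pc))\<^sup>2"
proof -
  let ?m = "cm_dim Y" and ?w = "\<lambda>i j. \<omega> y (vb_frame (tangent_bundle Y) (tan_triv pc) i y) (vb_frame (tangent_bundle Y) (tan_triv pc) j y)"
  have "cmod (\<omega> y u u) \<le> (\<Sum>i<?m. cmod (\<Sum>j<?m. ?w i j * u pc i * cnj (u pc j)))"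
    unfolding hermitian_expand(1)[OF w Y pc u] by (rule norm_sum)
  also have "\<dots> \<le> (\<Sum>i<?m. \<Sum>j<?m. cmod (?w i j) * (cmod (u pc i) * cmod (u pc j)))"
    by (intro sum_mono order_trans[OF norm_sum]) (simp add: norm_mult mult.assoc)
  also have "\<dots> \<le> (\<Sum>i<?m. \<Sum>j<?m. cmod (?w i j) * (cnrm ?m (u pc))\<^sup>2)"
    unfolding power2_eq_square by (intro sum_mono mult_left_mono mult_mono cmod_le_cnrm) auto
  also have "\<dots> = (\<Sum>i<?m. \<Sum>j<?m. cmod (?w i j)) * (cnrm ?m (u pc))\<^sup>2" by (simp only: sum_distrib_right)
  finally show ?thesis using complex_Re_le_cmod[of "\<omega> y u u"] by linarith
qed

context
  fixes E :: "('a, 'e) vbundle" and F n r N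
  assumes E: "hvb E" and F: "F = dual_bundle E" and n: "n = cm_dim (vb_base E)" and r: "r = vb_rank E" and r1: "1 \<le> r"
    and N: "N = n + (r - 1)"
begin

text \<open>This is what the maximum principle takes from nefness. The function \<open>C\<close>
  comes from the reference metric and is fixed before \<open>\<epsilon>\<close>, while the weight
  \<open>\<Lambda>\<close> varies with \<open>\<epsilon>\<close>; the later choice of constants
  rests on this order.\<close>

lemma nef_weight:
  assumes nef: "nef_vector_bundle E"
  shows "\<exists>C. (\<forall>c\<in>cm_atlas (vb_base E). \<forall>t\<in>vb_triv F. \<forall>k<r. continuous_on (pdom n N c (fst t)) (C c t k)) \<and>
    (\<forall>\<epsilon>>0. \<exists>\<Lambda>.
      (\<forall>x\<in>cm_pts (vb_base E). \<forall>\<xi>\<in>vs_set (vb_fib F x). \<forall>a. \<xi> \<noteq> vs_zero (vb_fib F x) \<longrightarrow> a \<noteq> 0 \<longrightarrow>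
         \<Lambda> x (vs_scale (vb_fib F x) a \<xi>) = \<Lambda> x \<xi> - 2 * ln (cmod a)) \<and>
      (\<forall>c\<in>cm_atlas (vb_base E). \<forall>t\<in>vb_triv F. \<forall>k<r.
         Ck_on N 2 (pdom n N c (fst t)) (\<lambda>\<zeta>. of_real (\<Lambda> (pbase n c \<zeta>) (pvec F n r c t k \<zeta>))) \<and>
         (\<forall>\<zeta>\<in>pdom n N c (fst t). \<forall>a\<in>Cn N.
            Re (levi N (\<lambda>\<zeta>. of_real (\<Lambda> (pbase n c \<zeta>) (pvec F n r c t k \<zeta>))) \<zeta> a) \<le> \<epsilon> * (C c t k \<zeta> * (cnrm N a)\<^sup>2))))"
proof -
  let ?Y = "proj_bundle F" and ?L = "taut_line_bundle E"
  note PA = proj_holomorphic_atlas[OF hF[OF E F n r r1 N] N]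
  note dimY = proj_simps(2)[OF hF[OF E F n r r1 N] N]
  obtain \<omega> where w: "hermitian_metric (tangent_bundle ?Y) \<omega>" and nw: "nef_wrt ?L \<omega>"
    using nef unfolding nef_vector_bundle_def nef_line_bundle_def taut_simps[OF E F n r r1 N] by blast
  define C where "C c t k \<zeta> = (\<Sum>i<N. \<Sum>j<N. cmod (\<omega> (chart_inv (proj_chart F c t k) \<zeta>)
      (vb_frame (tangent_bundle ?Y) (tan_triv (proj_chart F c t k)) i (chart_inv (proj_chart F c t k) \<zeta>))
      (vb_frame (tangent_bundle ?Y) (tan_triv (proj_chart F c t k)) j (chart_inv (proj_chart F c t k) \<zeta>))))" for c t k \<zeta>
  show ?thesis
  proof (intro exI[of _ C] conjI ballI allI impI)
    fix c t k assume c: "c \<in> cm_atlas (vb_base E)" and t: "t \<in> vb_triv F" and k: "k < r"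
    have c': "c \<in> cm_atlas (vb_base F)" using c F by simp
    let ?pc = "proj_chart F c t k"
    have pc: "?pc \<in> cm_atlas ?Y" using proj_atlas_iff[OF hF[OF E F n r r1 N] N] c' t k by blast
    have im: "snd ?pc ` (fst ?pc \<inter> fst ?pc) = pdom n N c (fst t)" using proj_chart_props(2)[OF hF[OF E F n r r1 N] N c' t k] by simp
    have "continuous_on (pdom n N c (fst t)) (\<lambda>\<zeta>. \<omega> (chart_inv ?pc \<zeta>)
      (vb_frame (tangent_bundle ?Y) (tan_triv ?pc) i (chart_inv ?pc \<zeta>)) (vb_frame (tangent_bundle ?Y) (tan_triv ?pc) j (chart_inv ?pc \<zeta>)))"
      if "i < N" "j < N" for i j
    proof -
      have "tan_triv ?pc \<in> vb_triv (tangent_bundle ?Y)" using pc tangent_triv_iff by blast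
      then have "smooth_fun_on ?Y (fst (tan_triv ?pc)) (\<lambda>x. \<omega> x (vb_frame (tangent_bundle ?Y) (tan_triv ?pc) i x) (vb_frame (tangent_bundle ?Y) (tan_triv ?pc) j x))"
        using w that unfolding hermitian_metric_def tangent_bundle_simps dimY by blast
      then have "smooth_on N (snd ?pc ` (fst ?pc \<inter> fst ?pc)) (\<lambda>\<zeta>. \<omega> (chart_inv ?pc \<zeta>)
        (vb_frame (tangent_bundle ?Y) (tan_triv ?pc) i (chart_inv ?pc \<zeta>)) (vb_frame (tangent_bundle ?Y) (tan_triv ?pc) j (chart_inv ?pc \<zeta>)))"
        using pc unfolding smooth_fun_on_def dimY case_prod_beta by (auto simp: tan_triv_def)
      then have "Ck_on N 0 (pdom n N c (fst t)) (\<lambda>\<zeta>. \<omega> (chart_inv ?pc \<zeta>)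
        (vb_frame (tangent_bundle ?Y) (tan_triv ?pc) i (chart_inv ?pc \<zeta>)) (vb_frame (tangent_bundle ?Y) (tan_triv ?pc) j (chart_inv ?pc \<zeta>)))"
        unfolding im smooth_on_def by blast
      then show ?thesis by simp
    qed
    then show "continuous_on (pdom n N c (fst t)) (C c t k)"
      unfolding C_def by (intro continuous_on_sum continuous_on_norm) auto
  next
    fix \<epsilon> :: real assume eps: "\<epsilon> > 0"
    obtain h where h: "hermitian_metric ?L h" and nh: "\<forall>c\<in>cm_atlas ?Y. \<forall>t\<in>vb_triv ?L. \<forall>x\<in>fst c \<inter> fst t. \<forall>u\<in>vs_set (tangent_space ?Y x).
           - Re (ddbar_form ?Y (\<lambda>y. ln (Re (h y (vb_frame ?L t 0 y) (vb_frame ?L t 0 y)))) c x u) \<ge> - \<epsilon> * Re (\<omega> x u u)"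
      using nw eps unfolding nef_wrt_def taut_simps[OF E F n r r1 N] by blast
    show "\<exists>\<Lambda>.
      (\<forall>x\<in>cm_pts (vb_base E). \<forall>\<xi>\<in>vs_set (vb_fib F x). \<forall>a. \<xi> \<noteq> vs_zero (vb_fib F x) \<longrightarrow> a \<noteq> 0 \<longrightarrow>
         \<Lambda> x (vs_scale (vb_fib F x) a \<xi>) = \<Lambda> x \<xi> - 2 * ln (cmod a)) \<and>
      (\<forall>c\<in>cm_atlas (vb_base E). \<forall>t\<in>vb_triv F. \<forall>k<r.
         Ck_on N 2 (pdom n N c (fst t)) (\<lambda>\<zeta>. of_real (\<Lambda> (pbase n c \<zeta>) (pvec F n r c t k \<zeta>))) \<and>
         (\<forall>\<zeta>\<in>pdom n N c (fst t). \<forall>a\<in>Cn N.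
            Re (levi N (\<lambda>\<zeta>. of_real (\<Lambda> (pbase n c \<zeta>) (pvec F n r c t k \<zeta>))) \<zeta> a) \<le> \<epsilon> * (C c t k \<zeta> * (cnrm N a)\<^sup>2)))"
    proof (intro exI[of _ "lam E h"] conjI ballI allI impI)
      fix x \<xi> and a :: complex
      assume "x \<in> cm_pts (vb_base E)" "\<xi> \<in> vs_set (vb_fib F x)" "\<xi> \<noteq> vs_zero (vb_fib F x)" "a \<noteq> 0"
      then show "lam E h x (vs_scale (vb_fib F x) a \<xi>) = lam E h x \<xi> - 2 * ln (cmod a)"
        using lam_scale[OF E F n r r1 N h] by (simp add: F)
    next
      fix c t k assume c: "c \<in> cm_atlas (vb_base E)" and t: "t \<in> vb_triv F" and k: "k < r"
      show "Ck_on N 2 (pdom n N c (fst t)) (\<lambda>\<zeta>. of_real (lam E h (pbase n c \<zeta>) (pvec F n r c t k \<zeta>)))"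
        by (rule lam_weight(1)[OF E F n r r1 N h c t k])
      fix \<zeta> a assume z: "\<zeta> \<in> pdom n N c (fst t)" and a: "a \<in> Cn N"
      have c': "c \<in> cm_atlas (vb_base F)" using c F by simp
      let ?pc = "proj_chart F c t k" and ?fr = "vb_frame ?L (taut_triv F t k) 0"
      note P = proj_chart_props[OF hF[OF E F n r r1 N] N c' t k]
      have pc: "?pc \<in> cm_atlas ?Y" using proj_atlas_iff[OF hF[OF E F n r r1 N] N] c' t k by blast
      define y where "y = chart_inv ?pc \<zeta>"
      have y: "y \<in> fst ?pc" "snd ?pc y = \<zeta>" unfolding y_def using P(3,4,5)[OF z] by auto
      have yU: "y \<in> fst (taut_triv F t k)" using y(1) by (auto simp: proj_chart_eq taut_triv_def[OF E F n r r1 N])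
      define u where "u = linv (tangent_space ?Y y) (\<lambda>v. v ?pc) a"
      have u: "u \<in> vs_set (tangent_space ?Y y)" "u ?pc = a"
        unfolding u_def using linv[OF tangent_linear_iso[OF PA pc y(1)]] a dimY by auto
      have "Re (ddbar_form ?Y (\<lambda>y. ln (Re (h y (?fr y) (?fr y)))) ?pc y u) \<le> \<epsilon> * Re (\<omega> y u u)"
        using nh pc taut_triv_in[OF E F n r r1 N t k] y(1) yU u(1) by fastforce
      also have "\<dots> \<le> \<epsilon> * (C c t k \<zeta> * (cnrm N a)\<^sup>2)"
        using hermitian_bound[OF w PA pc y(1) u(1)] eps unfolding dimY u(2) C_def y_def[symmetric] by simp
      also have "ddbar_form ?Y (\<lambda>y. ln (Re (h y (?fr y) (?fr y)))) ?pc y u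
         = levi N (\<lambda>z. of_real (ln (Re (h (chart_inv ?pc z) (?fr (chart_inv ?pc z)) (?fr (chart_inv ?pc z)))))) \<zeta> a"
        unfolding ddbar_form_def levi_def dimY y(2) u(2) ..
      also have "\<dots> = levi N (\<lambda>\<zeta>. of_real (lam E h (pbase n c \<zeta>) (pvec F n r c t k \<zeta>))) \<zeta> a"
        by (rule levi_cong[OF pdom_open[OF hF[OF E F n r r1 N] N c' FD(2)[OF E F n r r1 N t]] z]) (rule lam_weight(2)[OF E F n r r1 N h c t k, symmetric])
      finally show "Re (levi N (\<lambda>\<zeta>. of_real (lam E h (pbase n c \<zeta>) (pvec F n r c t k \<zeta>))) \<zeta> a) \<le> \<epsilon> * (C c t k \<zeta> * (cnrm N a)\<^sup>2)" .
    qed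
  qed
qed

end

section \<open>The curvature as a negated Levi form\<close>

text \<open>The equation defining \<open>inverse_coeff\<close> contracts second indices, whereas the
  curvature formula leads to a contraction of first indices. Definiteness makes the matrix of
  \<open>H\<close> invertible, and a one-sided inverse of a square matrix is two-sided.\<close>

lemma inverse_coeff_left:
  fixes H :: "nat \<Rightarrow> nat \<Rightarrow> complex"
  assumes pos: "\<And>v. v \<in> Cn r \<Longrightarrow> v \<noteq> (\<lambda>_. 0) \<Longrightarrow> (\<Sum>\<alpha><r. \<Sum>\<beta><r. H \<alpha> \<beta> * v \<alpha> * cnj (v \<beta>)) \<noteq> 0"
    and b: "\<beta> < r" "\<delta> < r"
  shows "(\<Sum>\<alpha><r. H \<alpha> \<beta> * inverse_coeff r H \<alpha> \<delta>) = (if \<beta> = \<delta> then 1 else 0)"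
proof -
  define A where "A = mat r r (\<lambda>(i, j). H i j)"
  have A: "A \<in> carrier_mat r r" by (simp add: A_def)
  have "det A \<noteq> 0"
  proof
    assume "det A = 0"
    then obtain w where w: "w \<in> carrier_vec r" "w \<noteq> 0\<^sub>v r" "A *\<^sub>v w = 0\<^sub>v r"
      using det_0_iff_vec_prod_zero_field[OF A] by blast
    \<comment> \<open>The form is conjugate linear in its second argument, so the kernel vector has
      to enter conjugated.\<close>
    define v where "v i = (if i < r then cnj (w $ i) else 0)" for i
    have "(\<Sum>j<r. H i j * w $ j) = 0" if "i < r" for i
    proof -
      have "(A *\<^sub>v w) $ i = 0" using w(3) that by simp
      then show ?thesis using that w(1) by (simp add: A_def scalar_prod_def lessThan_atLeast0)
    qed
    then have "(\<Sum>\<alpha><r. \<Sum>\<beta><r. H \<alpha> \<beta> * v \<alpha> * cnj (v \<beta>)) = (\<Sum>\<alpha><r. v \<alpha> * 0)"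
    proof (intro sum.cong refl)
      fix i assume i: "i \<in> {..<r}" and z: "\<And>i. i < r \<Longrightarrow> (\<Sum>j<r. H i j * w $ j) = 0"
      have "(\<Sum>\<beta><r. H i \<beta> * v i * cnj (v \<beta>)) = v i * (\<Sum>j<r. H i j * w $ j)"
        unfolding sum_distrib_left by (intro sum.cong refl) (simp add: v_def)
      then show "(\<Sum>\<beta><r. H i \<beta> * v i * cnj (v \<beta>)) = v i * 0" using z i by simp
    qed
    then have "(\<Sum>\<alpha><r. \<Sum>\<beta><r. H \<alpha> \<beta> * v \<alpha> * cnj (v \<beta>)) = 0" by simp
    moreover have "v \<in> Cn r" by (simp add: v_def Cn_def)
    moreover have "v \<noteq> (\<lambda>_. 0)"
    proof
      assume v0: "v = (\<lambda>_. 0)"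
      have "w $ i = 0" if "i < r" for i using fun_cong[OF v0, of i] that by (simp add: v_def)
      then have "w = 0\<^sub>v r" using w(1) by (intro eq_vecI) auto
      then show False using w(2) by simp
    qed
    ultimately show False using pos by blast
  qed
  from det_non_zero_imp_unit[OF A this, of undefined]
  obtain B where B: "B \<in> carrier_mat r r" "B * A = 1\<^sub>m r" "A * B = 1\<^sub>m r"
    unfolding Units_def ring_mat_def by auto
  \<comment> \<open>The inverse matrix is transposed, because the defining equation sums over the
    second index of \<open>K\<close>.\<close>
  define K where "K \<gamma> \<delta> = (if \<gamma> < r \<and> \<delta> < r then B $$ (\<delta>, \<gamma>) else 0)" for \<gamma> \<delta>
  have mult: "(X * Y) $$ (i, j) = (\<Sum>l<r. X $$ (i, l) * Y $$ (l, j))"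
    if "X \<in> carrier_mat r r" "Y \<in> carrier_mat r r" "i < r" "j < r" for X Y :: "complex mat" and i j
    using that by (simp add: times_mat_def scalar_prod_def lessThan_atLeast0)
  have K: "inverse_coeff r H = K"
    unfolding inverse_coeff_def
  proof (rule the_equality)
    have "(\<Sum>\<delta><r. H \<alpha> \<delta> * K \<gamma> \<delta>) = (if \<alpha> = \<gamma> then 1 else 0)" if "\<alpha> < r" "\<gamma> < r" for \<alpha> \<gamma>
      using mult[OF A B(1) that] B(3) that by (simp add: K_def A_def)
    then show "(\<forall>\<gamma> \<delta>. \<gamma> \<ge> r \<or> \<delta> \<ge> r \<longrightarrow> K \<gamma> \<delta> = 0) \<and> (\<forall>\<alpha><r. \<forall>\<gamma><r. (\<Sum>\<delta><r. H \<alpha> \<delta> * K \<gamma> \<delta>) = (if \<alpha> = \<gamma> then 1 else 0))"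
      by (simp add: K_def)
    fix K' assume K': "(\<forall>\<gamma> \<delta>. \<gamma> \<ge> r \<or> \<delta> \<ge> r \<longrightarrow> K' \<gamma> \<delta> = 0) \<and> (\<forall>\<alpha><r. \<forall>\<gamma><r. (\<Sum>\<delta><r. H \<alpha> \<delta> * K' \<gamma> \<delta>) = (if \<alpha> = \<gamma> then 1 else 0))"
    define B' where "B' = mat r r (\<lambda>(d, g). K' g d)"
    have B': "B' \<in> carrier_mat r r" by (simp add: B'_def)
    have "A * B' = 1\<^sub>m r"
    proof (rule eq_matI)
      fix i j assume "i < dim_row (1\<^sub>m r :: complex mat)" "j < dim_col (1\<^sub>m r :: complex mat)"
      then have "i < r" "j < r" by auto
      then show "(A * B') $$ (i, j) = 1\<^sub>m r $$ (i, j)"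
        using mult[OF A B', of i j] K' by (simp add: A_def B'_def)
    qed (use A B' in auto)
    have "B' = 1\<^sub>m r * B'" using B' by simp
    also have "\<dots> = B * (A * B')" unfolding B(2)[symmetric] by (rule assoc_mult_mat[OF B(1) A B'])
    also have "\<dots> = B" unfolding \<open>A * B' = 1\<^sub>m r\<close> using B(1) by simp
    finally have BB: "B' = B" .
    show "K' = K"
    proof (intro ext)
      fix g d show "K' g d = K g d"
      proof (cases "g < r \<and> d < r")
        case True
        then have "K' g d = B' $$ (d, g)" by (simp add: B'_def)
        then show ?thesis using True BB by (simp add: K_def)
      next
        case False
        then have "K' g d = 0" using K' by (metis not_le)
        then show ?thesis using False by (auto simp: K_def)
      qed
    qed
  qed
  have "(\<Sum>\<alpha><r. H \<alpha> \<beta> * K \<alpha> \<delta>) = (B * A) $$ (\<delta>, \<beta>)"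
    using mult[OF B(1) A b(2,1)] b by (simp add: K_def A_def mult.commute)
  then show ?thesis unfolding K using B(2) b by auto
qed

lemma sum4_mult:
  fixes k :: complex
  shows "k * (\<Sum>a\<in>A. \<Sum>i\<in>I. x a i) * (\<Sum>b\<in>B. \<Sum>j\<in>J. y b j) = (\<Sum>a\<in>A. \<Sum>i\<in>I. \<Sum>b\<in>B. \<Sum>j\<in>J. k * x a i * y b j)"
  unfolding sum_distrib_left[of k] unfolding sum_distrib_right unfolding sum_distrib_left ..

lemma sum6_rotate:
  fixes T :: "nat \<Rightarrow> nat \<Rightarrow> nat \<Rightarrow> nat \<Rightarrow> nat \<Rightarrow> nat \<Rightarrow> complex"
  shows "(\<Sum>i<m. \<Sum>j<m. \<Sum>a<r. \<Sum>b<r. \<Sum>g<r. \<Sum>d<r. T i j a b g d)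
    = (\<Sum>g<r. \<Sum>d<r. \<Sum>a<r. \<Sum>i<m. \<Sum>b<r. \<Sum>j<m. T i j a b g d)"
  unfolding sum.cartesian_product
  by (rule sum.reindex_bij_witness[of _ "\<lambda>(g, d, a, i, b, j). (i, j, a, b, g, d)" "\<lambda>(i, j, a, b, g, d). (g, d, a, i, b, j)"]) auto

definition gjet :: "nat \<Rightarrow> nat \<Rightarrow> (nat \<Rightarrow> nat \<Rightarrow> cvec \<Rightarrow> complex) \<Rightarrow> cvec \<Rightarrow> cvec \<Rightarrow> cvec \<Rightarrow> cvec \<Rightarrow> complex" where
  \<comment> \<open>the mixed second derivative of \<open>H(v, v)\<close> along the line \<open>(z + t u, v + t b)\<close>\<close>
  "gjet m r H z v u b = (\<Sum>\<alpha><r. \<Sum>\<beta><r. levi m (H \<alpha> \<beta>) z u * v \<alpha> * cnj (v \<beta>)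
      + (\<Sum>i<m. u i * dz i (H \<alpha> \<beta>) z) * v \<alpha> * cnj (b \<beta>)
      + (\<Sum>j<m. cnj (u j) * dzbar j (H \<alpha> \<beta>) z) * b \<alpha> * cnj (v \<beta>)
      + H \<alpha> \<beta> z * b \<alpha> * cnj (b \<beta>))"

text \<open>The minimising \<open>b\<close> makes the line parallel at the base point, and there the Levi form is minus
  the curvature.\<close>

lemma curvature_eq_gjet:
  fixes H :: "nat \<Rightarrow> nat \<Rightarrow> cvec \<Rightarrow> complex" and u v z :: cvec and r m :: nat
  defines "K \<equiv> inverse_coeff r (\<lambda>\<gamma> \<delta>. H \<gamma> \<delta> z)"
  assumes pos: "\<And>v. v \<in> Cn r \<Longrightarrow> v \<noteq> (\<lambda>_. 0) \<Longrightarrow> (\<Sum>\<alpha><r. \<Sum>\<beta><r. H \<alpha> \<beta> z * v \<alpha> * cnj (v \<beta>)) \<noteq> 0"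
  shows "\<exists>b\<in>Cn r. gjet m r H z v u b = - (\<Sum>i<m. \<Sum>j<m. \<Sum>\<alpha><r. \<Sum>\<beta><r.
     (- dz i (dzbar j (H \<alpha> \<beta>)) z + (\<Sum>\<gamma><r. \<Sum>\<delta><r. K \<gamma> \<delta> * dz i (H \<alpha> \<delta>) z * dzbar j (H \<gamma> \<beta>) z))
       * u i * cnj (u j) * v \<alpha> * cnj (v \<beta>))"
proof -
  define \<theta> where "\<theta> \<delta> = (\<Sum>\<alpha><r. (\<Sum>i<m. u i * dz i (H \<alpha> \<delta>) z) * v \<alpha>)" for \<delta>
  define \<kappa> where "\<kappa> \<gamma> = (\<Sum>\<beta><r. (\<Sum>j<m. cnj (u j) * dzbar j (H \<gamma> \<beta>) z) * cnj (v \<beta>))" for \<gamma>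
  \<comment> \<open>The critical point of \<open>gjet\<close> as a function of \<open>b\<close>. It
    solves H b = - \<open>\<theta>\<close>, so the term linear in the conjugate of \<open>b\<close>
    cancels against the quadratic one.\<close>
  define b where "b \<alpha> = (if \<alpha> < r then - (\<Sum>\<delta><r. K \<alpha> \<delta> * \<theta> \<delta>) else 0)" for \<alpha>
  define L where "L = (\<Sum>\<alpha><r. \<Sum>\<beta><r. levi m (H \<alpha> \<beta>) z u * v \<alpha> * cnj (v \<beta>))"
  have Hb: "(\<Sum>\<alpha><r. H \<alpha> \<beta> z * b \<alpha>) = - \<theta> \<beta>" if "\<beta> < r" for \<beta>
  proof -
    have "(\<Sum>\<alpha><r. H \<alpha> \<beta> z * b \<alpha>) = - (\<Sum>\<alpha><r. \<Sum>\<delta><r. H \<alpha> \<beta> z * K \<alpha> \<delta> * \<theta> \<delta>)"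
      by (simp add: b_def sum_distrib_left sum_negf mult.assoc)
    also have "\<dots> = - (\<Sum>\<delta><r. (\<Sum>\<alpha><r. H \<alpha> \<beta> z * K \<alpha> \<delta>) * \<theta> \<delta>)"
      by (subst sum.swap) (simp add: sum_distrib_right)
    also have "\<dots> = - (\<Sum>\<delta><r. (if \<delta> = \<beta> then \<theta> \<delta> else 0))"
      using inverse_coeff_left[of r "\<lambda>\<alpha> \<beta>. H \<alpha> \<beta> z", OF pos that] unfolding K_def
      by (intro arg_cong[of _ _ uminus] sum.cong refl) auto
    finally show ?thesis using that by simp
  qed
  have "gjet m r H z v u b = L + (\<Sum>\<beta><r. \<theta> \<beta> * cnj (b \<beta>)) + (\<Sum>\<alpha><r. b \<alpha> * \<kappa> \<alpha>) + (\<Sum>\<beta><r. (\<Sum>\<alpha><r. H \<alpha> \<beta> z * b \<alpha>) * cnj (b \<beta>))"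
  proof -
    have 1: "(\<Sum>\<alpha><r. \<Sum>\<beta><r. (\<Sum>i<m. u i * dz i (H \<alpha> \<beta>) z) * v \<alpha> * cnj (b \<beta>)) = (\<Sum>\<beta><r. \<theta> \<beta> * cnj (b \<beta>))"
      unfolding \<theta>_def sum_distrib_right[of _ _ "cnj (b _)"] by (rule sum.swap)
    have 2: "(\<Sum>\<alpha><r. \<Sum>\<beta><r. (\<Sum>j<m. cnj (u j) * dzbar j (H \<alpha> \<beta>) z) * b \<alpha> * cnj (v \<beta>)) = (\<Sum>\<alpha><r. b \<alpha> * \<kappa> \<alpha>)"
      unfolding \<kappa>_def sum_distrib_left[of "b _"] by (intro sum.cong refl) (simp add: mult.assoc mult.left_commute)
    have 3: "(\<Sum>\<alpha><r. \<Sum>\<beta><r. H \<alpha> \<beta> z * b \<alpha> * cnj (b \<beta>)) = (\<Sum>\<beta><r. (\<Sum>\<alpha><r. H \<alpha> \<beta> z * b \<alpha>) * cnj (b \<beta>))"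
      unfolding sum_distrib_right by (rule sum.swap)
    show ?thesis unfolding gjet_def sum.distrib 1 2 3 L_def ..
  qed
  also have "\<dots> = L + (\<Sum>\<alpha><r. b \<alpha> * \<kappa> \<alpha>)" using Hb by (simp add: sum_negf)
  also have "(\<Sum>\<alpha><r. b \<alpha> * \<kappa> \<alpha>) = - (\<Sum>\<gamma><r. \<Sum>\<delta><r. K \<gamma> \<delta> * \<theta> \<delta> * \<kappa> \<gamma>)"
    by (simp add: b_def sum_negf sum_distrib_right)
  also have "(\<Sum>\<gamma><r. \<Sum>\<delta><r. K \<gamma> \<delta> * \<theta> \<delta> * \<kappa> \<gamma>)
    = (\<Sum>\<gamma><r. \<Sum>\<delta><r. \<Sum>\<alpha><r. \<Sum>i<m. \<Sum>\<beta><r. \<Sum>j<m. K \<gamma> \<delta> * (u i * dz i (H \<alpha> \<delta>) z * v \<alpha>) * (cnj (u j) * dzbar j (H \<gamma> \<beta>) z * cnj (v \<beta>)))"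
    unfolding \<theta>_def \<kappa>_def sum_distrib_right[of _ _ "v _"] sum_distrib_right[of _ _ "cnj (v _)"] sum4_mult ..
  also have "\<dots> = (\<Sum>i<m. \<Sum>j<m. \<Sum>\<alpha><r. \<Sum>\<beta><r. \<Sum>\<gamma><r. \<Sum>\<delta><r. K \<gamma> \<delta> * (u i * dz i (H \<alpha> \<delta>) z * v \<alpha>) * (cnj (u j) * dzbar j (H \<gamma> \<beta>) z * cnj (v \<beta>)))"
    by (rule sum6_rotate[symmetric])
  also have "L = (\<Sum>i<m. \<Sum>j<m. \<Sum>\<alpha><r. \<Sum>\<beta><r. dz i (dzbar j (H \<alpha> \<beta>)) z * u i * cnj (u j) * v \<alpha> * cnj (v \<beta>))"
    unfolding L_def levi_def sum_distrib_right unfolding sum.cartesian_product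
    by (rule sum.reindex_bij_witness[of _ "\<lambda>(i, j, a, b). (a, b, i, j)" "\<lambda>(a, b, i, j). (i, j, a, b)"]) auto
  finally have "gjet m r H z v u b = - (\<Sum>i<m. \<Sum>j<m. \<Sum>\<alpha><r. \<Sum>\<beta><r.
     (- dz i (dzbar j (H \<alpha> \<beta>)) z + (\<Sum>\<gamma><r. \<Sum>\<delta><r. K \<gamma> \<delta> * dz i (H \<alpha> \<delta>) z * dzbar j (H \<gamma> \<beta>) z))
       * u i * cnj (u j) * v \<alpha> * cnj (v \<beta>))"
    by (simp add: distrib_left distrib_right left_diff_distrib right_diff_distrib sum_subtractf sum.distrib sum_negf sum_distrib_left sum_distrib_right mult.assoc mult.left_commute)
  moreover have "b \<in> Cn r" by (simp add: b_def Cn_def)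
  ultimately show ?thesis by blast
qed

section \<open>The second variation at a maximum\<close>

lemma jet2_Re:
  assumes "jet2 f c a b L"
  shows "jet2 (\<lambda>t. of_real (Re (f t))) (of_real (Re c)) ((a + cnj b) / 2) ((b + cnj a) / 2) (of_real (Re L))"
proof -
  have e: "1 / 2 * (w + cnj w) = of_real (Re w)" for w by (simp add: complex_eq_iff)
  show ?thesis using jet2_cmult[OF jet2_add[OF assms jet2_cnj[OF assms]], of "1/2"]
    unfolding e by simp
qed

text \<open>ln |f|^2 is harmonic where \<open>f\<close> does not vanish: the correction
  \<open>- a * b / c\<^sup>2\<close> of \<open>jet2_ln\<close> cancels \<open>L / c\<close>.\<close>

lemma jet2_ln_norm_holo:
  assumes f: "f holomorphic_on ball 0 R" "R > 0" and nz: "f 0 \<noteq> 0"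
  shows "\<exists>a b. jet2 (\<lambda>t. of_real (ln ((cmod (f t))\<^sup>2))) (of_real (ln ((cmod (f 0))\<^sup>2))) a b 0"
proof -
  note j = jet2_holo[OF f]
  have "jet2 (\<lambda>t. f t * cnj (f t)) (f 0 * cnj (f 0)) (deriv f 0 * cnj (f 0)) (f 0 * cnj (deriv f 0)) (deriv f 0 * cnj (deriv f 0))"
    using jet2_mult[OF j jet2_cnj[OF j]] by simp
  then have "jet2 (\<lambda>t. of_real ((cmod (f t))\<^sup>2)) (f 0 * cnj (f 0)) (deriv f 0 * cnj (f 0)) (f 0 * cnj (deriv f 0)) (deriv f 0 * cnj (deriv f 0))"
    by (simp only: complex_norm_square)
  from jet2_ln[OF this] nz show ?thesis by (auto simp: power2_eq_square field_simps)
qed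

text \<open>The Fubini--Study form in the affine chart \<open>a\<^sub>j = 1\<close>, on the polydisc \<open>\<bar>a\<^sub>i\<bar> \<le> 1\<close>.\<close>

lemma jet2_ln_sumsq:
  fixes a :: "complex \<Rightarrow> nat \<Rightarrow> complex"
  assumes a: "\<And>i. i < n \<Longrightarrow> (\<lambda>t. a t i) holomorphic_on ball 0 R" and R: "R > 0" and j: "j < n"
    and one: "\<And>t. t \<in> ball 0 R \<Longrightarrow> a t j = 1" and le: "\<And>i. i < n \<Longrightarrow> cmod (a 0 i) \<le> 1"
  shows "\<exists>p q L. jet2 (\<lambda>t. of_real (ln (\<Sum>i<n. (cmod (a t i))\<^sup>2))) (of_real (ln (\<Sum>i<n. (cmod (a 0 i))\<^sup>2))) p q L
     \<and> Re L \<ge> (\<Sum>i<n. (cmod (deriv (\<lambda>t. a t i) 0))\<^sup>2) / (real n)\<^sup>2"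
proof -
  define d where "d i = deriv (\<lambda>t. a t i) 0" for i
  define S0 where "S0 = (\<Sum>i<n. (cmod (a 0 i))\<^sup>2)"
  define S1 where "S1 = (\<Sum>i<n. d i * cnj (a 0 i))"
  define S2 where "S2 = (\<Sum>i<n. (cmod (d i))\<^sup>2)"
  have dj: "d j = 0"
  proof -
    have "((\<lambda>t. a t j) has_field_derivative 0) (at 0)"
      by (rule has_field_derivative_transform_within_open[OF DERIV_const[of 1] open_ball[of 0 R]]) (use R one in auto)
    then show ?thesis unfolding d_def by (rule DERIV_imp_deriv)
  qed
  have a0j: "a 0 j = 1" using one R by simp
  have jt: "jet2 (\<lambda>t. a t i * cnj (a t i)) (a 0 i * cnj (a 0 i)) (d i * cnj (a 0 i)) (a 0 i * cnj (d i)) (d i * cnj (d i))" if "i < n" for i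
    using jet2_mult[OF jet2_holo[OF a[OF that] R] jet2_cnj[OF jet2_holo[OF a[OF that] R]]] by (simp add: d_def)
  have "jet2 (\<lambda>t. \<Sum>i<n. a t i * cnj (a t i)) (\<Sum>i<n. a 0 i * cnj (a 0 i)) S1 (\<Sum>i<n. a 0 i * cnj (d i)) (\<Sum>i<n. d i * cnj (d i))"
    unfolding S1_def by (intro jet2_sum jt) auto
  moreover have "(\<Sum>i<n. a 0 i * cnj (d i)) = cnj S1" by (simp add: S1_def mult.commute)
  ultimately have J: "jet2 (\<lambda>t. of_real (\<Sum>i<n. (cmod (a t i))\<^sup>2)) (of_real S0) S1 (cnj S1) (of_real S2)"
    by (simp add: S0_def S2_def complex_norm_square[symmetric])
  have S0: "1 \<le> S0" "S0 \<le> real n"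
  proof -
    have "(cmod (a 0 j))\<^sup>2 \<le> S0" unfolding S0_def using j by (intro member_le_sum) auto
    then show "1 \<le> S0" by (simp add: a0j)
    have "S0 \<le> (\<Sum>i<n. 1)" unfolding S0_def using le by (intro sum_mono) (simp add: power_le_one)
    then show "S0 \<le> real n" by simp
  qed
  have S2: "S2 \<ge> 0" unfolding S2_def by (intro sum_nonneg) auto
  have CS: "(cmod S1)\<^sup>2 \<le> S2 * (S0 - 1)"
  proof -
    let ?I = "{..<n} - {j}"
    have "S1 = (\<Sum>i\<in>?I. d i * cnj (a 0 i))" unfolding S1_def using j dj by (simp add: sum.remove[of _ j])
    then have "cmod S1 \<le> (\<Sum>i\<in>?I. cmod (d i) * cmod (a 0 i))"
      by (simp only:) (rule order_trans[OF norm_sum], simp add: norm_mult)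
    then have "(cmod S1)\<^sup>2 \<le> (\<Sum>i\<in>?I. cmod (d i) * cmod (a 0 i))\<^sup>2" by (intro power_mono) auto
    also have "\<dots> \<le> (\<Sum>i\<in>?I. (cmod (d i))\<^sup>2) * (\<Sum>i\<in>?I. (cmod (a 0 i))\<^sup>2)"
      by (rule Cauchy_Schwarz_ineq_sum)
    also have "(\<Sum>i\<in>?I. (cmod (d i))\<^sup>2) = S2" unfolding S2_def using j dj by (simp add: sum.remove[of _ j])
    also have "(\<Sum>i\<in>?I. (cmod (a 0 i))\<^sup>2) = S0 - 1" unfolding S0_def using j a0j by (simp add: sum.remove[of _ j])
    finally show ?thesis .
  qed
  have J2: "jet2 (\<lambda>t. of_real (ln (\<Sum>i<n. (cmod (a t i))\<^sup>2))) (of_real (ln S0)) (S1 / of_real S0) (cnj S1 / of_real S0)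
     (of_real S2 / of_real S0 - S1 * cnj S1 / (of_real S0)\<^sup>2)"
    using jet2_ln[OF J] S0 unfolding S0_def by simp
  have "Re (of_real S2 / of_real S0 - S1 * cnj S1 / (of_real S0)\<^sup>2) = S2 / S0 - (cmod S1)\<^sup>2 / S0\<^sup>2"
    unfolding complex_norm_square[symmetric] by (simp flip: of_real_power of_real_divide of_real_diff)
  also have "\<dots> = (S2 * S0 - (cmod S1)\<^sup>2) / S0\<^sup>2" using S0 by (simp add: field_simps power2_eq_square)
  also have "\<dots> \<ge> S2 / S0\<^sup>2" using CS S0 by (intro divide_right_mono) (auto simp: algebra_simps)
  finally have "Re (of_real S2 / of_real S0 - S1 * cnj S1 / (of_real S0)\<^sup>2) \<ge> S2 / S0\<^sup>2" .
  moreover have "S2 / S0\<^sup>2 \<ge> S2 / (real n)\<^sup>2" using S0 S2 by (intro divide_left_mono power_mono mult_pos_pos) auto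
  ultimately have "Re (of_real S2 / of_real S0 - S1 * cnj S1 / (of_real S0)\<^sup>2) \<ge> S2 / (real n)\<^sup>2" by linarith
  then show ?thesis using J2 unfolding S0_def S2_def d_def by blast
qed

text \<open>The product rule for jets along (z + t u, v + t b) gives \<open>gjet\<close> with
  \<open>levi_jet\<close> in the place of \<open>levi\<close>. Hermitian symmetry of the
  coefficients makes the real parts agree.\<close>

lemma jet2_metric:
  assumes U: "open_Cn m U" and H: "\<And>\<alpha> \<beta>. \<alpha> < r \<Longrightarrow> \<beta> < r \<Longrightarrow> Ck_on m 2 U (H \<alpha> \<beta>)" and z: "z \<in> U" and u: "u \<in> Cn m"
    and herm: "\<And>\<alpha> \<beta> w. \<alpha> < r \<Longrightarrow> \<beta> < r \<Longrightarrow> w \<in> U \<Longrightarrow> H \<beta> \<alpha> w = cnj (H \<alpha> \<beta> w)"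
  shows "\<exists>p q L. jet2 (\<lambda>t. of_real (Re (\<Sum>\<alpha><r. \<Sum>\<beta><r. H \<alpha> \<beta> (\<lambda>i. z i + t * u i) * (v \<alpha> + t * b \<alpha>) * cnj (v \<beta> + t * b \<beta>))))
     (of_real (Re (\<Sum>\<alpha><r. \<Sum>\<beta><r. H \<alpha> \<beta> z * v \<alpha> * cnj (v \<beta>)))) p q L \<and> Re L = Re (gjet m r H z v u b)"
proof -
  define A where "A \<alpha> \<beta> = (\<Sum>i<m. u i * dz i (H \<alpha> \<beta>) z)" for \<alpha> \<beta>
  define B where "B \<alpha> \<beta> = (\<Sum>j<m. cnj (u j) * dzbar j (H \<alpha> \<beta>) z)" for \<alpha> \<beta>
  have zC: "z \<in> Cn m" using z open_Cn_subset[OF U] by blast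
  have jH: "jet2 (\<lambda>t. H \<alpha> \<beta> (\<lambda>i. z i + t * u i)) (H \<alpha> \<beta> z) (A \<alpha> \<beta>) (B \<alpha> \<beta>) (levi_jet m (H \<alpha> \<beta>) z u)" if "\<alpha> < r" "\<beta> < r" for \<alpha> \<beta>
    using jet2_curve[OF H[OF that] U, of "\<lambda>t i. z i + t * u i" u] z zC u Cn_add[OF zC Cn_scale[OF u]] jet2_ident_lin
    by (simp add: A_def B_def)
  have jv: "jet2 (\<lambda>t. v \<alpha> + t * b \<alpha>) (v \<alpha>) (b \<alpha>) 0 0" for \<alpha> by (rule jet2_ident_lin)
  have jt: "jet2 (\<lambda>t. H \<alpha> \<beta> (\<lambda>i. z i + t * u i) * (v \<alpha> + t * b \<alpha>) * cnj (v \<beta> + t * b \<beta>)) (H \<alpha> \<beta> z * v \<alpha> * cnj (v \<beta>))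
    ((A \<alpha> \<beta> * v \<alpha> + H \<alpha> \<beta> z * b \<alpha>) * cnj (v \<beta>)) (B \<alpha> \<beta> * v \<alpha> * cnj (v \<beta>) + H \<alpha> \<beta> z * v \<alpha> * cnj (b \<beta>))
    (levi_jet m (H \<alpha> \<beta>) z u * v \<alpha> * cnj (v \<beta>) + A \<alpha> \<beta> * v \<alpha> * cnj (b \<beta>) + B \<alpha> \<beta> * b \<alpha> * cnj (v \<beta>) + H \<alpha> \<beta> z * b \<alpha> * cnj (b \<beta>))"
    if "\<alpha> < r" "\<beta> < r" for \<alpha> \<beta>
    using jet2_mult[OF jet2_mult[OF jH[OF that] jv[of \<alpha>]] jet2_cnj[OF jv[of \<beta>]]]
    by (rule jet2_cong) (simp_all add: algebra_simps)
  define L where "L = (\<Sum>\<alpha><r. \<Sum>\<beta><r. levi_jet m (H \<alpha> \<beta>) z u * v \<alpha> * cnj (v \<beta>) + A \<alpha> \<beta> * v \<alpha> * cnj (b \<beta>) + B \<alpha> \<beta> * b \<alpha> * cnj (v \<beta>) + H \<alpha> \<beta> z * b \<alpha> * cnj (b \<beta>))"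
  have J: "jet2 (\<lambda>t. \<Sum>\<alpha><r. \<Sum>\<beta><r. H \<alpha> \<beta> (\<lambda>i. z i + t * u i) * (v \<alpha> + t * b \<alpha>) * cnj (v \<beta> + t * b \<beta>))
     (\<Sum>\<alpha><r. \<Sum>\<beta><r. H \<alpha> \<beta> z * v \<alpha> * cnj (v \<beta>))
     (\<Sum>\<alpha><r. \<Sum>\<beta><r. (A \<alpha> \<beta> * v \<alpha> + H \<alpha> \<beta> z * b \<alpha>) * cnj (v \<beta>))
     (\<Sum>\<alpha><r. \<Sum>\<beta><r. B \<alpha> \<beta> * v \<alpha> * cnj (v \<beta>) + H \<alpha> \<beta> z * v \<alpha> * cnj (b \<beta>)) L"
    unfolding L_def by (intro jet2_sum jt) auto
  have R: "Re (\<Sum>\<alpha><r. \<Sum>\<beta><r. levi_jet m (H \<alpha> \<beta>) z u * v \<alpha> * cnj (v \<beta>)) = Re (\<Sum>\<alpha><r. \<Sum>\<beta><r. levi m (H \<alpha> \<beta>) z u * v \<alpha> * cnj (v \<beta>))"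
    by (rule Re_levi_jet_hermitian[OF U H z herm])
  have "Re L = Re (gjet m r H z v u b)"
    unfolding L_def gjet_def A_def B_def sum.distrib plus_complex.sel by (simp only: R)
  moreover have "Re (of_real (Re L)) = Re L" by simp
  ultimately show ?thesis using jet2_Re[OF J] by (intro exI conjI) (assumption, simp)
qed

lemma sum_lessThan_add: "(\<Sum>i<n + k. f i) = (\<Sum>i<n. f i) + (\<Sum>i<k. f (n + i :: nat) :: real)"
  by (induction k) auto

lemma sum_sq_bound:
  fixes d :: "nat \<Rightarrow> real"
  shows "(\<Sum>i<n. d i)\<^sup>2 \<le> real n * (\<Sum>i<n. (d i)\<^sup>2)"
  using Cauchy_Schwarz_ineq_sum[of "\<lambda>_. 1" d "{..<n}"] by simp

definition sqd :: "nat \<Rightarrow> cvec \<Rightarrow> cvec \<Rightarrow> real" where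
  "sqd n z p = (\<Sum>i<n. (cmod (z i - p i))\<^sup>2)"

text \<open>The coordinates of df(v) when \<open>fh\<close> is the coordinate expression of f, cut
  off so as to lie in \<open>Cn n\<close>.\<close>

definition push :: "nat \<Rightarrow> nat \<Rightarrow> (nat \<Rightarrow> cvec \<Rightarrow> complex) \<Rightarrow> cvec \<Rightarrow> cvec \<Rightarrow> cvec" where
  "push m n fh z v i = (if i < n then \<Sum>l<m. pd l (fh i) z * v l else 0)"

definition herm :: "nat \<Rightarrow> (nat \<Rightarrow> nat \<Rightarrow> cvec \<Rightarrow> complex) \<Rightarrow> cvec \<Rightarrow> cvec \<Rightarrow> real" where
  "herm m H z v = Re (\<Sum>\<alpha><m. \<Sum>\<beta><m. H \<alpha> \<beta> z * v \<alpha> * cnj (v \<beta>))"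

text \<open>The function to be maximised, in coordinates: \<open>W\<close> is minus the logarithm of the
  Finsler weight in the affine chart \<open>a\<^sub>j = 1\<close> of the projectivised target, and homogeneity turns the
  logarithm of the \<open>j\<close>-th component into the remaining terms.\<close>

definition PhiC where
  "PhiC m n fh W H \<delta> A p j z v = - (1 - \<delta>) * W (enc n n j (\<lambda>i. fh i z) (\<lambda>i. push m n fh z v i / push m n fh z v j))
     + ln ((cmod (push m n fh z v j))\<^sup>2) - \<delta> * A * sqd m z p
     + \<delta> * ln (\<Sum>i<n. (cmod (push m n fh z v i / push m n fh z v j))\<^sup>2) - ln (herm m H z v)"

text \<open>At a maximum the mixed coefficient of \<open>PhiC\<close> along (z + t u, v + t b) is
  not positive. The weight loses at most \<open>\<kappa>\<close> times the squared speed of the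
  image curve, ln |X_j|^2 is harmonic, the bump costs the flat square of \<open>u\<close>, and the
  Fubini-Study term gains \<open>S / (real n)\<^sup>2\<close>. Here \<open>S\<close> is the squared
  speed of the direction of df(v); it is left existential because it depends on \<open>b\<close> and
  on the size of df(v), and has to be absorbed rather than bounded.\<close>

lemma second_variation:
  fixes W :: "cvec \<Rightarrow> real"
  assumes O: "open_Cn m \<Omega>" and fh: "\<And>i. i < n \<Longrightarrow> holo_on m \<Omega> (fh i)" and z: "z \<in> \<Omega>" and u: "u \<in> Cn m"
    and v: "v \<in> Cn m" and b: "b \<in> Cn m" and N: "N = n + (n - 1)"
    and D: "open_Cn N D" and W: "Ck_on N 2 D (\<lambda>\<zeta>. of_real (W \<zeta>))" and j: "j < n"
    and Xj: "push m n fh z v j \<noteq> 0" and Xle: "\<And>i. i < n \<Longrightarrow> cmod (push m n fh z v i) \<le> cmod (push m n fh z v j)"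
    and \<zeta>: "enc n n j (\<lambda>i. fh i z) (\<lambda>i. push m n fh z v i / push m n fh z v j) \<in> D"
    and levi: "\<And>a. a \<in> Cn N \<Longrightarrow> Re (levi N (\<lambda>\<zeta>. of_real (W \<zeta>)) (enc n n j (\<lambda>i. fh i z) (\<lambda>i. push m n fh z v i / push m n fh z v j)) a) \<le> \<kappa> * (cnrm N a)\<^sup>2"
    and \<kappa>: "\<kappa> \<ge> 0" and \<delta>: "0 < \<delta>" "\<delta> \<le> 1"
    and H: "\<And>\<alpha> \<beta>. \<alpha> < m \<Longrightarrow> \<beta> < m \<Longrightarrow> Ck_on m 2 \<Omega> (H \<alpha> \<beta>)"
    and sym: "\<And>\<alpha> \<beta> w. \<alpha> < m \<Longrightarrow> \<beta> < m \<Longrightarrow> w \<in> \<Omega> \<Longrightarrow> H \<beta> \<alpha> w = cnj (H \<alpha> \<beta> w)"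
    and G: "herm m H z v > 0"
    and max: "\<forall>\<^sub>F t in nhds 0. PhiC m n fh W H \<delta> A p j (\<lambda>i. z i + t * u i) (\<lambda>i. v i + t * b i) \<le> PhiC m n fh W H \<delta> A p j z v"
  shows "\<exists>S\<ge>0. - Re (gjet m m H z v u b) / herm m H z v + \<delta> * S / (real n)\<^sup>2
     \<le> \<delta> * A * (\<Sum>i<m. (cmod (u i))\<^sup>2) + (1 - \<delta>) * (\<kappa> * (2 * (cnrm n (push m n fh z u))\<^sup>2 + 2 * real n * S))"
proof -
  define zt where "zt t = (\<lambda>i. z i + t * u i)" for t
  define vt where "vt t = (\<lambda>i. v i + t * b i)" for t
  define X where "X t = push m n fh (zt t) (vt t)" for t
  have zt0: "zt 0 = z" "vt 0 = v" by (auto simp: zt_def vt_def)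
  have zC: "z \<in> Cn m" using z open_Cn_subset[OF O] by blast
  obtain d where d: "d > 0" "\<And>w. w \<in> Cn m \<Longrightarrow> cdist m w z < d \<Longrightarrow> w \<in> \<Omega>" using open_CnE[OF O z] by blast
  \<comment> \<open>The summand 1 avoids a division by zero when \<open>u\<close> vanishes.\<close>
  define R0 where "R0 = d / (1 + cnrm m u)"
  have R0: "R0 > 0" using d cnrm_nonneg[of m u] by (simp add: R0_def add_pos_nonneg)
  have zin: "zt t \<in> \<Omega>" if "t \<in> ball 0 R0" for t
  proof (rule d(2))
    show "zt t \<in> Cn m" unfolding zt_def by (intro Cn_add zC Cn_scale u)
    have "cdist m (zt t) z = cmod t * cnrm m u"
      by (simp add: cdist_def zt_def cnrm_def norm_mult sum_distrib_left)
    also have "\<dots> \<le> cmod t * (1 + cnrm m u)" by (intro mult_left_mono) auto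
    also have "\<dots> < d"
    proof -
      have "0 < 1 + cnrm m u" using cnrm_nonneg[of m u] by linarith
      then show ?thesis using that by (simp add: R0_def pos_less_divide_eq)
    qed
    finally show "cdist m (zt t) z < d" .
  qed
  have holo0: "(\<lambda>t. f (zt t)) holomorphic_on ball 0 R0" if "holo_on m \<Omega> f" for f
    unfolding zt_def by (rule holo_on_line(1)[OF that O zC u]) (use zin in \<open>auto simp: zt_def\<close>)
  have Xh0: "(\<lambda>t. X t i) holomorphic_on ball 0 R0" for i
  proof (cases "i < n")
    case True
    have "(\<lambda>t. \<Sum>l<m. pd l (fh i) (zt t) * vt t l) holomorphic_on ball 0 R0"
      unfolding vt_def by (intro holomorphic_intros holo0 holo_on_pd_holo[OF fh[OF True] O]) auto
    then show ?thesis by (simp add: X_def push_def True)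
  next
    case False then show ?thesis by (simp add: X_def push_def)
  qed
  have "continuous (at 0) (\<lambda>t. X t j)"
    using holomorphic_on_imp_continuous_on[OF Xh0[of j]] R0 by (auto simp: continuous_on_eq_continuous_at)
  moreover have X0: "X 0 = push m n fh z v" by (simp add: X_def zt0)
  ultimately obtain R1 where R1: "R1 > 0" "\<And>t. dist 0 t < R1 \<Longrightarrow> X t j \<noteq> 0"
    using continuous_at_avoid[of 0 "\<lambda>t. X t j" 0] Xj by (auto simp: dist_commute)
  define R where "R = min R0 R1"
  have R: "R > 0" using R0 R1 by (simp add: R_def)
  have sub: "ball 0 R \<subseteq> ball (0::complex) R0" by (auto simp: R_def)
  have Xjn: "X t j \<noteq> 0" if "t \<in> ball 0 R" for t using R1(2)[of t] that by (auto simp: R_def)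
  have Xh: "(\<lambda>t. X t i) holomorphic_on ball 0 R" for i by (rule holomorphic_on_subset[OF Xh0 sub])
  define a where "a t i = X t i / X t j" for t i
  have ah: "(\<lambda>t. a t i) holomorphic_on ball 0 R" for i
    unfolding a_def by (intro holomorphic_on_divide Xh Xjn)
  have a1: "a t j = 1" if "t \<in> ball 0 R" for t using Xjn[OF that] by (simp add: a_def)
  have ale: "cmod (a 0 i) \<le> 1" if "i < n" for i
    using Xle[OF that] Xj by (simp add: a_def X0 norm_divide divide_le_eq_1)
  have fhh: "(\<lambda>t. fh i (zt t)) holomorphic_on ball 0 R" if "i < n" for i
    by (rule holomorphic_on_subset[OF holo0[OF fh[OF that]] sub])
  define da where "da i = deriv (\<lambda>t. a t i) 0" for i
  define S where "S = (\<Sum>i<n. (cmod (da i))\<^sup>2)"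
  have S: "S \<ge> 0" unfolding S_def by (intro sum_nonneg) auto
  define \<zeta>t where "\<zeta>t t = enc n n j (\<lambda>i. fh i (zt t)) (a t)" for t
  have \<zeta>0: "\<zeta>t 0 = enc n n j (\<lambda>i. fh i z) (\<lambda>i. push m n fh z v i / push m n fh z v j)"
    by (simp add: \<zeta>t_def zt0 a_def[abs_def] X0)
  \<comment> \<open>The velocity at \<open>t = 0\<close> of the curve in the projectivised
    target.\<close>
  define aa where "aa i = (if i < N then deriv (\<lambda>t. \<zeta>t t i) 0 else 0)" for i
  have aaC: "aa \<in> Cn N" by (simp add: aa_def Cn_def)
  have \<zeta>h: "(\<lambda>t. \<zeta>t t i) holomorphic_on ball 0 R" for i
  proof -
    have "(\<lambda>t. \<zeta>t t i) = (if i < n then (\<lambda>t. fh i (zt t)) else if i < n + (n - 1) then (\<lambda>t. a t (if i - n < j then i - n else Suc (i - n))) else (\<lambda>_. 0))"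
      unfolding \<zeta>t_def enc_def by (cases "i < n"; cases "i < n + (n - 1)"; simp only: if_True if_False)
    then show ?thesis using fhh ah by (simp split: if_split)
  qed
  have levi': "Re (levi N (\<lambda>\<zeta>. of_real (W \<zeta>)) (\<zeta>t 0) aa) \<le> \<kappa> * (cnrm N aa)\<^sup>2"
    using levi[OF aaC] by (simp add: \<zeta>0)
  have \<zeta>D: "\<zeta>t 0 \<in> D" using \<zeta> by (simp add: \<zeta>0)
  have jW: "\<exists>q q'. jet2 (\<lambda>t. of_real (W (\<zeta>t t))) (of_real (W (\<zeta>t 0))) q q' (levi_jet N (\<lambda>\<zeta>. of_real (W \<zeta>)) (\<zeta>t 0) aa)"
  proof (intro exI, rule jet2_curve[where p=\<zeta>t, OF W D \<zeta>D])
    show "\<zeta>t t \<in> Cn N" for t unfolding \<zeta>t_def N by (rule enc_Cn)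
    show "jet2 (\<lambda>t. \<zeta>t t i) (\<zeta>t 0 i) (aa i) 0 0" if "i < N" for i
      using jet2_holo[OF \<zeta>h R] that by (simp add: aa_def)
  qed
  have LW: "Re (levi_jet N (\<lambda>\<zeta>. of_real (W \<zeta>)) (\<zeta>t 0) aa) \<le> \<kappa> * (cnrm N aa)\<^sup>2"
    using Re_levi_jet_real[OF D W \<zeta>D] levi' by simp
  \<comment> \<open>The base part of the velocity is \<open>push m n fh z u\<close>; the fibre part
    is the derivative of the affine coordinates. Each 2 comes from squaring the sum of both parts,
    the factor \<open>real n\<close> from comparing the l^1 norm with the sum of squares.\<close>
  have cn: "(cnrm N aa)\<^sup>2 \<le> 2 * (cnrm n (push m n fh z u))\<^sup>2 + 2 * real n * S"
  proof -
    have A1: "(\<Sum>i<n. cmod (aa i)) = cnrm n (push m n fh z u)"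
      unfolding cnrm_def
    proof (intro sum.cong refl)
      fix i assume i: "i \<in> {..<n}"
      have "((\<lambda>t. fh i (zt t)) has_field_derivative (\<Sum>l<m. pd l (fh i) (zt 0) * u l)) (at 0)"
        unfolding zt_def using i by (intro holo_on_line(2)[OF fh O zC u, of _ "ball 0 R0"]) (use zin R0 in \<open>auto simp: zt_def\<close>)
      then have "deriv (\<lambda>t. fh i (zt t)) 0 = push m n fh z u i"
        using i by (simp add: push_def zt0 DERIV_imp_deriv)
      then show "cmod (aa i) = cmod (push m n fh z u i)" using i by (simp add: aa_def \<zeta>t_def enc_def N)
    qed
    \<comment> \<open>The numbering of fibre coordinates in \<open>enc\<close>, which skips the
      normalised index \<open>j\<close>.\<close>
    define ix where "ix i = (if i < j then i else Suc i)" for i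
    have A2: "(\<Sum>i<n - 1. cmod (aa (n + i))) \<le> (\<Sum>i<n. cmod (da i))"
    proof -
      have "(\<Sum>i<n - 1. cmod (aa (n + i))) = (\<Sum>i<n - 1. cmod (da (ix i)))"
        by (intro sum.cong refl) (simp add: aa_def \<zeta>t_def enc_def N ix_def da_def)
      also have "\<dots> = (\<Sum>i\<in>ix ` {..<n - 1}. cmod (da i))"
        by (subst sum.reindex) (auto simp: inj_on_def ix_def split: if_splits)
      also have "\<dots> \<le> (\<Sum>i<n. cmod (da i))"
        by (intro sum_mono2) (auto simp: ix_def split: if_splits)
      finally show ?thesis .
    qed
    have "cnrm N aa = cnrm n (push m n fh z u) + (\<Sum>i<n - 1. cmod (aa (n + i)))"
      unfolding N unfolding cnrm_def[of "n + (n - 1)"] sum_lessThan_add A1 ..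
    then have "cnrm N aa \<le> cnrm n (push m n fh z u) + (\<Sum>i<n. cmod (da i))" using A2 by simp
    then have "(cnrm N aa)\<^sup>2 \<le> (cnrm n (push m n fh z u) + (\<Sum>i<n. cmod (da i)))\<^sup>2" by (intro power_mono) auto
    also have "\<dots> \<le> 2 * (cnrm n (push m n fh z u))\<^sup>2 + 2 * (\<Sum>i<n. cmod (da i))\<^sup>2"
      using sum_squares_bound[of "cnrm n (push m n fh z u)" "\<Sum>i<n. cmod (da i)"] by (simp add: power2_sum)
    also have "(\<Sum>i<n. cmod (da i))\<^sup>2 \<le> real n * S" unfolding S_def by (rule sum_sq_bound)
    finally show ?thesis by simp
  qed
  obtain q1 q2 L3 where j3: "jet2 (\<lambda>t. of_real (ln (\<Sum>i<n. (cmod (a t i))\<^sup>2))) (of_real (ln (\<Sum>i<n. (cmod (a 0 i))\<^sup>2))) q1 q2 L3"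
    and L3: "Re L3 \<ge> S / (real n)\<^sup>2"
    using jet2_ln_sumsq[of n a R j, OF ah R j a1 ale] unfolding S_def da_def by blast
  obtain q3 q4 where j2: "jet2 (\<lambda>t. of_real (ln ((cmod (X t j))\<^sup>2))) (of_real (ln ((cmod (X 0 j))\<^sup>2))) q3 q4 0"
    using jet2_ln_norm_holo[OF Xh R, of j] Xj by (auto simp: X0)
  have j4: "\<exists>q q'. jet2 (\<lambda>t. of_real (sqd m (zt t) p)) (of_real (sqd m z p)) q q' (of_real (\<Sum>i<m. (cmod (u i))\<^sup>2))"
  proof -
    have "jet2 (\<lambda>t. (z i - p i + t * u i) * cnj (z i - p i + t * u i)) ((z i - p i) * cnj (z i - p i)) (u i * cnj (z i - p i)) ((z i - p i) * cnj (u i)) (u i * cnj (u i))" for i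
      using jet2_mult[OF jet2_ident_lin[of "z i - p i" "u i"] jet2_cnj[OF jet2_ident_lin[of "z i - p i" "u i"]]] by simp
    from jet2_sum[of "{..<m}", OF this]
    have "jet2 (\<lambda>t. \<Sum>i<m. (z i - p i + t * u i) * cnj (z i - p i + t * u i)) (\<Sum>i<m. (z i - p i) * cnj (z i - p i))
        (\<Sum>i<m. u i * cnj (z i - p i)) (\<Sum>i<m. (z i - p i) * cnj (u i)) (\<Sum>i<m. u i * cnj (u i))" .
    moreover have "(\<Sum>i<m. (z i - p i + t * u i) * cnj (z i - p i + t * u i)) = of_real (sqd m (zt t) p)" for t
      unfolding complex_norm_square[symmetric] sqd_def zt_def by (simp add: algebra_simps)
    moreover have "(\<Sum>i<m. (z i - p i) * cnj (z i - p i)) = of_real (sqd m z p)"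
      unfolding complex_norm_square[symmetric] sqd_def by simp
    moreover have "(\<Sum>i<m. u i * cnj (u i)) = of_real (\<Sum>i<m. (cmod (u i))\<^sup>2)"
      unfolding complex_norm_square[symmetric] by simp
    ultimately show ?thesis by auto
  qed
  obtain q5 q6 LG where jG: "jet2 (\<lambda>t. of_real (herm m H (zt t) (vt t))) (of_real (herm m H z v)) q5 q6 LG"
    and LG: "Re LG = Re (gjet m m H z v u b)"
    using jet2_metric[where H=H and r=m and v=v and b=b, OF O H z u sym] unfolding herm_def zt_def vt_def by blast
  obtain q7 q8 where j1: "jet2 (\<lambda>t. of_real (W (\<zeta>t t))) (of_real (W (\<zeta>t 0))) q7 q8 (levi_jet N (\<lambda>\<zeta>. of_real (W \<zeta>)) (\<zeta>t 0) aa)"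
    using jW by blast
  obtain q9 q10 where j4': "jet2 (\<lambda>t. of_real (sqd m (zt t) p)) (of_real (sqd m z p)) q9 q10 (of_real (\<Sum>i<m. (cmod (u i))\<^sup>2))"
    using j4 by blast
  define G0 where "G0 = herm m H z v"
  \<comment> \<open>The logarithm of the metric is replaced by its tangent line at
    \<open>G0\<close>. By concavity \<open>\<phi>\<close> lies below \<open>PhiC\<close> and agrees
    with it at \<open>t = 0\<close>, so the maximum persists, while the mixed coefficient of this
    term becomes \<open>- gjet / G0\<close> without a squared gradient.\<close>
  define \<phi> where "\<phi> t = - (1 - \<delta>) * W (\<zeta>t t) + ln ((cmod (X t j))\<^sup>2) - \<delta> * A * sqd m (zt t) p
     + \<delta> * ln (\<Sum>i<n. (cmod (a t i))\<^sup>2) - ln G0 - (herm m H (zt t) (vt t) - G0) / G0" for t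
  have J: "jet2 (\<lambda>t. of_real (- (1 - \<delta>)) * of_real (W (\<zeta>t t)) + of_real (ln ((cmod (X t j))\<^sup>2)) + of_real (- \<delta> * A) * of_real (sqd m (zt t) p)
     + of_real \<delta> * of_real (ln (\<Sum>i<n. (cmod (a t i))\<^sup>2)) + of_real (1 - ln G0) + of_real (- 1 / G0) * of_real (herm m H (zt t) (vt t)))
     (of_real (- (1 - \<delta>)) * of_real (W (\<zeta>t 0)) + of_real (ln ((cmod (X 0 j))\<^sup>2)) + of_real (- \<delta> * A) * of_real (sqd m z p)
     + of_real \<delta> * of_real (ln (\<Sum>i<n. (cmod (a 0 i))\<^sup>2)) + of_real (1 - ln G0) + of_real (- 1 / G0) * of_real (herm m H z v))
     (of_real (- (1 - \<delta>)) * q7 + q3 + of_real (- \<delta> * A) * q9 + of_real \<delta> * q1 + 0 + of_real (- 1 / G0) * q5)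
     (of_real (- (1 - \<delta>)) * q8 + q4 + of_real (- \<delta> * A) * q10 + of_real \<delta> * q2 + 0 + of_real (- 1 / G0) * q6)
     (of_real (- (1 - \<delta>)) * levi_jet N (\<lambda>\<zeta>. of_real (W \<zeta>)) (\<zeta>t 0) aa + 0 + of_real (- \<delta> * A) * of_real (\<Sum>i<m. (cmod (u i))\<^sup>2)
       + of_real \<delta> * L3 + 0 + of_real (- 1 / G0) * LG)"
    by (intro jet2_add jet2_cmult jet2_const j1 j2 j3 j4' jG)
  have fe: "of_real (- (1 - \<delta>)) * of_real (W (\<zeta>t t)) + of_real (ln ((cmod (X t j))\<^sup>2)) + of_real (- \<delta> * A) * of_real (sqd m (zt t) p)
     + of_real \<delta> * of_real (ln (\<Sum>i<n. (cmod (a t i))\<^sup>2)) + of_real (1 - ln G0) + of_real (- 1 / G0) * of_real (herm m H (zt t) (vt t))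
     = complex_of_real (\<phi> t)" for t
  proof -
    have "(herm m H (zt t) (vt t) - G0) / G0 = herm m H (zt t) (vt t) / G0 - 1"
      using G by (simp add: G0_def diff_divide_distrib)
    then show ?thesis unfolding \<phi>_def by simp
  qed
  have mx: "\<forall>\<^sub>F t in nhds 0. \<phi> t \<le> \<phi> 0"
  proof -
    obtain B d' where B: "B > 0" "d' > 0" "\<And>t. cmod t < d' \<Longrightarrow> cmod (of_real (herm m H (zt t) (vt t)) - of_real G0) \<le> B * cmod t"
      using jet2_bigo[OF jG] unfolding G0_def by metis
    \<comment> \<open>The comparison of the logarithm with its tangent line requires a positive
      argument; continuity of the metric along the line provides it near 0.\<close>
    have pos: "\<forall>\<^sub>F t in nhds 0. herm m H (zt t) (vt t) > 0"
      unfolding eventually_nhds_metric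
    proof (intro exI[of _ "min d' (G0 / B)"] conjI allI impI)
      fix t :: complex assume "dist t 0 < min d' (G0 / B)"
      then have "\<bar>herm m H (zt t) (vt t) - G0\<bar> \<le> B * cmod t" "B * cmod t < G0"
        using B(3)[of t] B(1) by (auto simp: field_simps simp flip: of_real_diff)
      then show "herm m H (zt t) (vt t) > 0" by linarith
    qed (use B G in \<open>auto simp: G0_def\<close>)
    have \<phi>0: "\<phi> 0 = PhiC m n fh W H \<delta> A p j z v"
      unfolding \<phi>_def PhiC_def \<zeta>0 zt0 X0 a_def G0_def by simp
    have "\<phi> t \<le> \<phi> 0" if "herm m H (zt t) (vt t) > 0" "PhiC m n fh W H \<delta> A p j (zt t) (vt t) \<le> PhiC m n fh W H \<delta> A p j z v" for t
    proof -
      have "ln (herm m H (zt t) (vt t)) - ln G0 \<le> (herm m H (zt t) (vt t) - G0) / G0"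
        using G that(1) by (intro ln_diff_le) (auto simp: G0_def)
      then have "\<phi> t \<le> PhiC m n fh W H \<delta> A p j (zt t) (vt t)"
        unfolding \<phi>_def PhiC_def \<zeta>t_def a_def[abs_def] X_def by simp
      then show ?thesis using that(2) \<phi>0 by simp
    qed
    moreover have "\<forall>\<^sub>F t in nhds 0. PhiC m n fh W H \<delta> A p j (zt t) (vt t) \<le> PhiC m n fh W H \<delta> A p j z v"
      using max unfolding zt_def vt_def .
    ultimately show ?thesis using pos by (auto elim: eventually_elim2)
  qed
  have "Re (of_real (- (1 - \<delta>)) * levi_jet N (\<lambda>\<zeta>. of_real (W \<zeta>)) (\<zeta>t 0) aa + 0 + of_real (- \<delta> * A) * of_real (\<Sum>i<m. (cmod (u i))\<^sup>2)
       + of_real \<delta> * L3 + 0 + of_real (- 1 / G0) * LG) \<le> 0"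
    by (rule jet2_max_le[OF J[unfolded fe] mx])
  then have 1: "- (1 - \<delta>) * Re (levi_jet N (\<lambda>\<zeta>. of_real (W \<zeta>)) (\<zeta>t 0) aa) - \<delta> * A * (\<Sum>i<m. (cmod (u i))\<^sup>2) + \<delta> * Re L3 - Re LG / G0 \<le> 0"
    by simp
  have "(1 - \<delta>) * Re (levi_jet N (\<lambda>\<zeta>. of_real (W \<zeta>)) (\<zeta>t 0) aa) \<le> (1 - \<delta>) * (\<kappa> * (2 * (cnrm n (push m n fh z u))\<^sup>2 + 2 * real n * S))"
    using LW mult_left_mono[OF cn \<kappa>] \<delta> by (intro mult_left_mono) auto
  moreover have "\<delta> * (S / (real n)\<^sup>2) \<le> \<delta> * Re L3" using L3 \<delta> by (intro mult_left_mono) auto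
  moreover have "- g / h + \<delta> * S' / n2 \<le> X' + Y" if "- (1 - \<delta>) * L - X' + \<delta> * l3 - g / h \<le> 0" "(1 - \<delta>) * L \<le> Y" "\<delta> * (S' / n2) \<le> \<delta> * l3"
    for g h S' n2 X' Y L l3 :: real
  proof -
    have "- (1 - \<delta>) * L = - ((1 - \<delta>) * L)" "- g / h = - (g / h)" "\<delta> * S' / n2 = \<delta> * (S' / n2)" by (simp_all add: algebra_simps)
    then show ?thesis using that by linarith
  qed
  ultimately show ?thesis using 1 S unfolding LG G0_def by blast
qed

section \<open>Compactness\<close>

text \<open>Formulated for predicates rather than functions because the witnesses behind
  \<open>P y C\<close> may jump from one neighbourhood to the next, as in
  \<open>bound_RC\<close>.\<close>

lemma compact_uniform:
  fixes P :: "'x::topological_space \<Rightarrow> real \<Rightarrow> bool"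
  assumes K: "compact K" and loc: "\<And>x. x \<in> K \<Longrightarrow> \<exists>U C. open U \<and> x \<in> U \<and> (\<forall>y\<in>U \<inter> K. P y C)"
    and mono: "\<And>y C C'. P y C \<Longrightarrow> C \<le> C' \<Longrightarrow> P y C'"
  shows "\<exists>C. \<forall>y\<in>K. P y C"
proof -
  obtain U C where UC: "\<And>x. x \<in> K \<Longrightarrow> open (U x)" "\<And>x. x \<in> K \<Longrightarrow> x \<in> U x" "\<And>x y. x \<in> K \<Longrightarrow> y \<in> U x \<inter> K \<Longrightarrow> P y (C x)"
    using loc by metis
  have "K \<subseteq> (\<Union>x\<in>K. U x)" using UC(2) by blast
  then obtain F where F: "F \<subseteq> K" "finite F" "K \<subseteq> (\<Union>x\<in>F. U x)"
    using compactE_image[OF K, of K U] UC(1) by metis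
  have "P y (Max (insert 0 (C ` F)))" if "y \<in> K" for y
  proof -
    obtain x where x: "x \<in> F" "y \<in> U x" using F(3) \<open>y \<in> K\<close> by blast
    then have "P y (C x)" using UC(3) F(1) \<open>y \<in> K\<close> by blast
    moreover have "C x \<le> Max (insert 0 (C ` F))" using x F(2) by (intro Max_ge) auto
    ultimately show ?thesis by (rule mono)
  qed
  then show ?thesis by blast
qed

text \<open>The constant is made at least 1 so that it can safely serve as a denominator and be
  raised to powers later.\<close>

lemma finite_uniform:
  fixes P :: "'x \<Rightarrow> real \<Rightarrow> bool"
  assumes F: "finite F" and ex: "\<And>x. x \<in> F \<Longrightarrow> \<exists>C. P x C" and mono: "\<And>y C C'. P y C \<Longrightarrow> C \<le> C' \<Longrightarrow> P y C'"
  shows "\<exists>C\<ge>1. \<forall>x\<in>F. P x C"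
proof -
  obtain C where C: "\<And>x. x \<in> F \<Longrightarrow> P x (C x)" using ex by metis
  have "P x (Max (insert 1 (C ` F)))" if "x \<in> F" for x
    by (rule mono[OF C[OF that]]) (use F that in \<open>auto intro!: Max_ge\<close>)
  moreover have "Max (insert 1 (C ` F)) \<ge> 1" using F by (intro Max_ge) auto
  ultimately show ?thesis by blast
qed

lemma continuous_pos_nbhd:
  fixes h :: "'x::topological_space \<Rightarrow> real"
  assumes "continuous_on K h" "x \<in> K" "h x > 0"
  shows "\<exists>U. open U \<and> x \<in> U \<and> (\<forall>y\<in>U \<inter> K. h y > 0)"
  using assms(1)[unfolded continuous_on_topological, rule_format, OF assms(2), of "{0<..}"] assms(3) by auto

lemma continuous_bounded_above:
  fixes h :: "'x::topological_space \<Rightarrow> real"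
  assumes "compact K" "continuous_on K h"
  shows "\<exists>C. \<forall>x\<in>K. h x \<le> C"
proof -
  have "bdd_above (h ` K)"
    by (rule bounded_imp_bdd_above[OF compact_imp_bounded[OF compact_continuous_image[OF assms(2,1)]]])
  then show ?thesis unfolding bdd_above_def by blast
qed

lemma finite_compact_max:
  fixes h :: "'i \<Rightarrow> 'x::topological_space \<Rightarrow> real"
  assumes F: "finite I" and S: "\<And>i. i \<in> I \<Longrightarrow> compact (S i)" "\<And>i. i \<in> I \<Longrightarrow> continuous_on (S i) (h i)"
    and ne: "i1 \<in> I" "s1 \<in> S i1"
  shows "\<exists>i0\<in>I. \<exists>s0\<in>S i0. \<forall>i\<in>I. \<forall>s\<in>S i. h i s \<le> h i0 s0"
proof -
  have "compact (\<Union>i\<in>I. h i ` S i)" using F S by (intro compact_UN compact_continuous_image) auto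
  moreover have "(\<Union>i\<in>I. h i ` S i) \<noteq> {}" using ne by blast
  ultimately obtain y where "y \<in> (\<Union>i\<in>I. h i ` S i)" "\<forall>t\<in>(\<Union>i\<in>I. h i ` S i). t \<le> y"
    using compact_attains_sup by blast
  then show ?thesis by auto
qed

lemma Ck2_cont:
  assumes f: "Ck_on n 2 U f" and ij: "i < n" "j < n"
  shows "continuous_on U (dz i f)" "continuous_on U (dzbar i f)" "continuous_on U (dz i (dzbar j f))" "continuous_on U f"
proof -
  have f2: "Ck_on n (Suc (Suc 0)) U f" using f by (simp only: numeral_2_eq_2)
  have c1: "continuous_on U (real_partial i c f)" if "c \<in> {1,\<i>}" for c
    using Ck_on_cont[OF Ck_on_1_D(1)[OF f2 ij(1) that]] .
  show "continuous_on U (dz i f)" "continuous_on U (dzbar i f)"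
    unfolding dz_def[abs_def] dzbar_def[abs_def] by (intro continuous_intros c1; simp)+
  have c2: "continuous_on U (real_partial i c (real_partial j c' f))" if "c \<in> {1,\<i>}" "c' \<in> {1,\<i>}" for c c'
    using Ck_on_cont[OF Ck_on_1_D(1)[OF Ck_on_1_D(1)[OF f2 ij(2) that(2)] ij(1) that(1)]] .
  have "continuous_on U (\<lambda>z. (real_partial i 1 (real_partial j 1 f) z + \<i> * real_partial i 1 (real_partial j \<i> f) z
     - \<i> * real_partial i \<i> (real_partial j 1 f) z + real_partial i \<i> (real_partial j \<i> f) z) / 4)"
    by (intro continuous_intros c2) auto
  then show "continuous_on U (dz i (dzbar j f))"
    by (rule continuous_on_eq) (use dz_dzbar_expand[OF f _ ij] in auto)
  show "continuous_on U f" by (rule Ck_on_cont[OF f])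
qed

lemma continuous_snd_coord: "continuous_on S (\<lambda>x :: 'x::topological_space \<times> cvec. snd x i)"
  by (rule continuous_on_product_then_coordinatewise[OF continuous_on_snd[OF continuous_on_id]])

lemma continuous_fst_comp:
  assumes "continuous_on U f" "\<And>x. x \<in> S \<Longrightarrow> fst x \<in> U"
  shows "continuous_on S (\<lambda>x. f (fst x))"
  by (rule continuous_on_compose2[OF assms(1) continuous_on_fst[OF continuous_on_id]]) (use assms(2) in auto)

text \<open>The direction \<open>u\<close> and the lift \<open>b\<close> stay fixed while point and
  vector vary, so a pair that works at one point keeps working nearby.\<close>

lemma continuous_gjet:
  assumes H: "\<And>\<alpha> \<beta>. \<alpha> < m \<Longrightarrow> \<beta> < m \<Longrightarrow> Ck_on m 2 U (H \<alpha> \<beta>)" and S: "\<And>x. x \<in> S \<Longrightarrow> fst x \<in> U"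
  shows "continuous_on S (\<lambda>x. gjet m m H (fst x) (snd x) u b)" "continuous_on S (\<lambda>x. herm m H (fst x) (snd x))"
proof -
  show "continuous_on S (\<lambda>x. gjet m m H (fst x) (snd x) u b)"
    unfolding gjet_def levi_def
    by (intro continuous_on_sum continuous_on_add continuous_on_mult continuous_on_const continuous_on_cnj continuous_snd_coord
        continuous_fst_comp[OF Ck2_cont(1)[OF H] S] continuous_fst_comp[OF Ck2_cont(2)[OF H] S]
        continuous_fst_comp[OF Ck2_cont(3)[OF H] S] continuous_fst_comp[OF Ck_on_cont[OF H] S]) auto
  show "continuous_on S (\<lambda>x. herm m H (fst x) (snd x))"
    unfolding herm_def
    by (intro continuous_on_Re continuous_on_sum continuous_on_mult continuous_on_cnj continuous_snd_coord
        continuous_fst_comp[OF Ck_on_cont[OF H] S]) auto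
qed

section \<open>The differential of a map\<close>

lemma tangent_frame_transition:
  assumes N: "holomorphic_atlas N" and d: "d \<in> cm_atlas N" "d' \<in> cm_atlas N" "y \<in> fst d" "y \<in> fst d'"
    and ab: "\<alpha> < cm_dim N" "\<beta> < cm_dim N"
  shows "snd (tan_triv d') y (vb_frame (tangent_bundle N) (tan_triv d) \<alpha> y) \<beta> = dmap (\<lambda>x. x) d d' y \<beta> \<alpha>"
proof -
  let ?v = "linv (tangent_space N y) (\<lambda>v. v d) (Defs.unit_vec \<alpha>)"
  have v: "?v \<in> vs_set (tangent_space N y)" "?v d = Defs.unit_vec \<alpha>"
    using linv[OF tangent_linear_iso[OF N d(1,3)] unit_vec_Cn[OF ab(1)]] by auto
  have e: "dmap (\<lambda>x. x) d d' y \<beta> j * Defs.unit_vec \<alpha> j = (if j = \<alpha> then dmap (\<lambda>x. x) d d' y \<beta> j else 0)" for j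
    by (simp add: Defs.unit_vec_def)
  have "?v d' \<beta> = (\<Sum>j<cm_dim N. dmap (\<lambda>x. x) d d' y \<beta> j * Defs.unit_vec \<alpha> j)"
    using tangent_transition[OF N d v(1) ab(2)] v(2) by simp
  also have "\<dots> = dmap (\<lambda>x. x) d d' y \<beta> \<alpha>" unfolding e using ab by simp
  finally show ?thesis by (simp add: vb_frame_linv tan_triv_def)
qed

text \<open>For the cotangent bundle, O(1) lives over the lines in its dual, so tangent vectors of
  \<open>N\<close> enter as elements of the bidual. This is the trivialisation obtained from a chart
  by dualising twice.\<close>

definition bitriv :: "'b cmfd \<Rightarrow> 'b chart \<Rightarrow> ('b, ('b tvec \<Rightarrow> complex) \<Rightarrow> complex) trivialization" where
  "bitriv N d = dual_triv (cotangent_bundle N) (dual_triv (tangent_bundle N) (tan_triv d))"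

definition bidual :: "'b cmfd \<Rightarrow> ('b, ('b tvec \<Rightarrow> complex) \<Rightarrow> complex) vbundle" where
  "bidual N = dual_bundle (cotangent_bundle N)"

definition Xi :: "'b cmfd \<Rightarrow> 'b chart \<Rightarrow> 'b \<Rightarrow> cvec \<Rightarrow> ('b tvec \<Rightarrow> complex) \<Rightarrow> complex" where
  \<comment> \<open>the element of the bidual of \<open>T\<^sub>yN\<close> belonging to the coordinate vector \<open>a\<close>\<close>
  "Xi N d y a = linv (vb_fib (bidual N) y) (snd (bitriv N d) y) a"

lemma bidual_simps [simp]: "vb_base (bidual N) = N" "vb_rank (bidual N) = cm_dim N"
  by (simp_all add: bidual_def cotangent_bundle_def)

lemma cotangent_simps [simp]: "vb_base (cotangent_bundle N) = N" "vb_rank (cotangent_bundle N) = cm_dim N"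
  by (simp_all add: cotangent_bundle_def)

lemma hvb_cotangent: "holomorphic_atlas N \<Longrightarrow> hvb (cotangent_bundle N)"
  unfolding cotangent_bundle_def by (intro hvb_dual hvb_tangent)

lemma hvb_bidual: "holomorphic_atlas N \<Longrightarrow> hvb (bidual N)"
  unfolding bidual_def by (intro hvb_dual hvb_cotangent)

lemma bitriv_in: "d \<in> cm_atlas N \<Longrightarrow> bitriv N d \<in> vb_triv (bidual N)"
  using tangent_triv_iff[of "tan_triv d" N] by (auto simp: bitriv_def bidual_def cotangent_bundle_def dual_triv_set)

lemma fst_bitriv [simp]: "fst (bitriv N d) = fst d"
  by (simp add: bitriv_def tan_triv_def)

lemma bidual_iso:
  assumes "holomorphic_atlas N" "d \<in> cm_atlas N" "y \<in> fst d"
  shows "linear_iso (vb_fib (bidual N) y) (cm_dim N) (snd (bitriv N d) y)"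
  using hvbD(4)[OF hvb_bidual[OF assms(1)] bitriv_in[OF assms(2)], of y] assms(3) by simp

text \<open>Two dualisations transpose twice and exchange the charts twice, so bidual coordinates
  transform by the Jacobian, exactly as tangent vectors do. Hence \<open>Xi\<close> does not depend
  on the chart.\<close>

lemma Xi_change:
  assumes N: "holomorphic_atlas N" and d: "d \<in> cm_atlas N" "d' \<in> cm_atlas N" "y \<in> fst d" "y \<in> fst d'"
    and a: "a \<in> Cn (cm_dim N)" "a' \<in> Cn (cm_dim N)"
    and eq: "\<And>\<beta>. \<beta> < cm_dim N \<Longrightarrow> a' \<beta> = (\<Sum>\<alpha><cm_dim N. dmap (\<lambda>x. x) d d' y \<beta> \<alpha> * a \<alpha>)"
  shows "Xi N d' y a' = Xi N d y a"
proof -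
  let ?n = "cm_dim N" and ?V = "vb_fib (bidual N) y"
  note T = bidual_iso[OF N d(1,3)] and T' = bidual_iso[OF N d(2,4)]
  have x: "Xi N d y a \<in> vs_set ?V" "snd (bitriv N d) y (Xi N d y a) = a"
    unfolding Xi_def using linv[OF T a(1)] by auto
  have tr: "snd (bitriv N d') y (linv ?V (snd (bitriv N d) y) (Defs.unit_vec \<alpha>)) \<beta> = dmap (\<lambda>x. x) d d' y \<beta> \<alpha>"
    if ab: "\<alpha> < ?n" "\<beta> < ?n" for \<alpha> \<beta>
  proof -
    let ?t = "dual_triv (tangent_bundle N) (tan_triv d)" and ?s = "dual_triv (tangent_bundle N) (tan_triv d')"
    have td: "tan_triv d \<in> vb_triv (tangent_bundle N)" "tan_triv d' \<in> vb_triv (tangent_bundle N)"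
      using d tangent_triv_iff by blast+
    then have ts: "?t \<in> vb_triv (cotangent_bundle N)" "?s \<in> vb_triv (cotangent_bundle N)"
      by (auto simp: cotangent_bundle_def dual_triv_set)
    have "snd (bitriv N d') y (vb_frame (bidual N) (bitriv N d) \<alpha> y) \<beta> = snd ?t y (vb_frame (cotangent_bundle N) ?s \<beta> y) \<alpha>"
      unfolding bitriv_def bidual_def using d ab
      by (intro dual_transition[OF hvb_cotangent[OF N] ts]) (auto simp: tan_triv_def)
    also have "\<dots> = snd (tan_triv d') y (vb_frame (tangent_bundle N) (tan_triv d) \<alpha> y) \<beta>"
      unfolding cotangent_bundle_def using d ab
      by (intro dual_transition[OF hvb_tangent[OF N] td(2,1)]) (auto simp: tan_triv_def)
    also have "\<dots> = dmap (\<lambda>x. x) d d' y \<beta> \<alpha>" by (rule tangent_frame_transition[OF N d ab])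
    finally show ?thesis by (simp add: vb_frame_linv)
  qed
  have "snd (bitriv N d') y (Xi N d y a) = a'"
  proof (rule Cn_eqI[OF linear_isoD(6)[OF T' x(1)] a(2)])
    fix \<beta> assume b: "\<beta> < ?n"
    have "snd (bitriv N d') y (Xi N d y a) \<beta> = (\<Sum>\<alpha><?n. a \<alpha> * snd (bitriv N d') y (linv ?V (snd (bitriv N d) y) (Defs.unit_vec \<alpha>)) \<beta>)"
      using lin_on_expand[OF T linear_iso_comp_lin[OF T', of \<beta>] x(1)] x(2) by simp
    also have "\<dots> = a' \<beta>" unfolding eq[OF b] using tr b by (intro sum.cong) auto
    finally show "snd (bitriv N d') y (Xi N d y a) \<beta> = a' \<beta>" .
  qed
  then show ?thesis using linv_T[OF T' x(1)] by (simp add: Xi_def)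
qed

lemma Xi_props:
  assumes N: "holomorphic_atlas N" and d: "d \<in> cm_atlas N" "y \<in> fst d" and a: "a \<in> Cn (cm_dim N)"
  shows "Xi N d y a \<in> vs_set (vb_fib (bidual N) y)" "a \<noteq> (\<lambda>_. 0) \<Longrightarrow> Xi N d y a \<noteq> vs_zero (vb_fib (bidual N) y)"
    "Xi N d y (\<lambda>i. k * a i) = vs_scale (vb_fib (bidual N) y) k (Xi N d y a)"
proof -
  note T = bidual_iso[OF N d]
  show x: "Xi N d y a \<in> vs_set (vb_fib (bidual N) y)" unfolding Xi_def by (rule linv(1)[OF T a])
  have Tx: "snd (bitriv N d) y (Xi N d y a) = a" unfolding Xi_def by (rule linv(2)[OF T a])
  show "Xi N d y a \<noteq> vs_zero (vb_fib (bidual N) y)" if "a \<noteq> (\<lambda>_. 0)"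
    using Tx linear_isoD(3)[OF T] that by metis
  have s: "vs_scale (vb_fib (bidual N) y) k (Xi N d y a) \<in> vs_set (vb_fib (bidual N) y)"
    "snd (bitriv N d) y (vs_scale (vb_fib (bidual N) y) k (Xi N d y a)) = (\<lambda>i. k * a i)"
    using linear_isoD(5)[OF T x, of k] Tx by auto
  show "Xi N d y (\<lambda>i. k * a i) = vs_scale (vb_fib (bidual N) y) k (Xi N d y a)"
    using linv_T[OF T s(1), unfolded s(2)] unfolding Xi_def .
qed

lemma continuous_on_sqd: "continuous_on S (\<lambda>z. sqd n z p)"
  unfolding sqd_def by (intro continuous_intros)

lemma cmod_le_sqd: "i < n \<Longrightarrow> (cmod (z i - p i))\<^sup>2 \<le> sqd n z p"
  unfolding sqd_def by (rule member_le_sum[of i "{..<n}" "\<lambda>i. (cmod (z i - p i))\<^sup>2"]) auto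

lemma compact_sqd:
  assumes C: "closed C" and \<rho>: "\<rho> \<ge> 0"
  shows "compact {z \<in> Cn n. sqd n z p \<le> \<rho>\<^sup>2 \<and> z \<in> C}"
proof -
  have b: "compact {z \<in> Cn n. \<forall>i<n. z i \<in> cball (p i) \<rho>}" by (rule compact_Cn_box) auto
  have c: "closed ({z. sqd n z p \<le> \<rho>\<^sup>2} \<inter> C)"
    by (intro closed_Int C closed_Collect_le continuous_on_sqd continuous_on_const)
  have "{z \<in> Cn n. \<forall>i<n. z i \<in> cball (p i) \<rho>} \<inter> ({z. sqd n z p \<le> \<rho>\<^sup>2} \<inter> C) = {z \<in> Cn n. sqd n z p \<le> \<rho>\<^sup>2 \<and> z \<in> C}"
  proof -
    have "z i \<in> cball (p i) \<rho>" if "sqd n z p \<le> \<rho>\<^sup>2" "i < n" for z i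
    proof -
      have "(cmod (z i - p i))\<^sup>2 \<le> \<rho>\<^sup>2" using cmod_le_sqd[OF that(2), of z p] that(1) by simp
      then have "cmod (z i - p i) \<le> \<rho>" using \<rho> by (rule power2_le_imp_le)
      then show ?thesis by (simp add: dist_norm norm_minus_commute)
    qed
    then show ?thesis by blast
  qed
  then show ?thesis using compact_Int_closed[OF b c] by simp
qed

text \<open>The closed ball of twice the radius: balls of radius \<open>\<rho>\<close> will cover
  the source, and the maximum is sought on the doubled ones.\<close>

definition KK :: "nat \<Rightarrow> cvec \<Rightarrow> real \<Rightarrow> cvec set" where
  "KK m p \<rho> = {z \<in> Cn m. sqd m z p \<le> (2 * \<rho>)\<^sup>2}"

definition SS :: "nat \<Rightarrow> cvec set" where
  "SS m = {v \<in> Cn m. sqd m v (\<lambda>_. 0) = 1}"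

lemma compact_KK: "\<rho> \<ge> 0 \<Longrightarrow> compact (KK m p \<rho>)"
  using compact_sqd[of UNIV "2 * \<rho>" m p] by (simp add: KK_def)

lemma compact_SS: "compact (SS m)"
proof -
  have "closed {v. sqd m v (\<lambda>_. 0) = 1}"
    by (intro closed_Collect_eq continuous_on_sqd continuous_on_const)
  from compact_sqd[OF this, of 1 m "\<lambda>_. 0"] show ?thesis
    by (rule back_subst[of compact]) (auto simp: SS_def)
qed

lemma SS_nonzero: "v \<in> SS m \<Longrightarrow> v \<in> Cn m \<and> v \<noteq> (\<lambda>_. 0)"
  by (auto simp: SS_def sqd_def)

text \<open>\<open>NN\<close> is the dimension of the projectivised tangent bundle of
  \<open>N\<close>; truncated subtraction makes it 0 when \<open>n = 0\<close>.\<close>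

locale rc_map =
  fixes M :: "'a cmfd" and N :: "'b cmfd" and f :: "'a \<Rightarrow> 'b" and g :: "'a \<Rightarrow> 'a tvec \<Rightarrow> 'a tvec \<Rightarrow> complex" and m n NN :: nat
  assumes M: "holomorphic_atlas M" and N: "holomorphic_atlas N" and f: "hmap M N f"
    and m: "m = cm_dim M" and n: "n = cm_dim N" and NN: "NN = n + (n - 1)"
    and g: "RC_positive (tangent_bundle M) g"
begin

definition fh :: "'a chart \<Rightarrow> 'b chart \<Rightarrow> nat \<Rightarrow> cvec \<Rightarrow> complex" where
  "fh c d i z = snd d (f (chart_inv c z)) i"

definition Om :: "'a chart \<Rightarrow> 'b chart \<Rightarrow> cvec set" where
  "Om c d = snd c ` (fst c \<inter> f -` fst d)"

definition Hc :: "'a chart \<Rightarrow> nat \<Rightarrow> nat \<Rightarrow> cvec \<Rightarrow> complex" where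
  "Hc c = metric_coeff (tangent_bundle M) g c (tan_triv c)"

lemma gh: "hermitian_metric (tangent_bundle M) g"
  using g by (simp add: RC_positive_def)

lemma Om_props:
  assumes "c \<in> cm_atlas M" "d \<in> cm_atlas N"
  shows "open_Cn m (Om c d)" "i < n \<Longrightarrow> holo_on m (Om c d) (fh c d i)" "Om c d \<subseteq> snd c ` fst c"
    "z \<in> Om c d \<Longrightarrow> chart_inv c z \<in> fst c \<and> f (chart_inv c z) \<in> fst d \<and> snd c (chart_inv c z) = z"
    "x \<in> fst c \<Longrightarrow> f x \<in> fst d \<Longrightarrow> snd c x \<in> Om c d \<and> chart_inv c (snd c x) = x"
    "z \<in> Om c d \<Longrightarrow> (\<lambda>i. fh c d i z) = snd d (f (chart_inv c z)) \<and> snd d (f (chart_inv c z)) \<in> Cn n"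
    "(\<lambda>i. fh c d i z) = snd d (f (chart_inv c z))"
proof -
  have "open_Cn m (Om c d) \<and> (\<forall>i<n. holo_on m (Om c d) (fh c d i))"
    using f assms unfolding hmap_def Om_def m n fh_def[abs_def] by blast
  then show "open_Cn m (Om c d)" "i < n \<Longrightarrow> holo_on m (Om c d) (fh c d i)" by auto
  show "Om c d \<subseteq> snd c ` fst c" by (auto simp: Om_def)
  note inj = atlasD(1)[OF M assms(1)]
  show i: "chart_inv c z \<in> fst c \<and> f (chart_inv c z) \<in> fst d \<and> snd c (chart_inv c z) = z" if "z \<in> Om c d" for z
    using chart_inv_image[OF that[unfolded Om_def] _ inj] by blast
  show "x \<in> fst c \<Longrightarrow> f x \<in> fst d \<Longrightarrow> snd c x \<in> Om c d \<and> chart_inv c (snd c x) = x"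
    using chart_inv_left[OF inj] by (auto simp: Om_def)
  show e: "(\<lambda>i. fh c d i z) = snd d (f (chart_inv c z))" for z by (simp add: fh_def)
  show "z \<in> Om c d \<Longrightarrow> (\<lambda>i. fh c d i z) = snd d (f (chart_inv c z)) \<and> snd d (f (chart_inv c z)) \<in> Cn n"
    using i e atlasD(4)[OF N assms(2)] n by simp
qed

lemma Hc_props:
  assumes c: "c \<in> cm_atlas M"
  shows "\<alpha> < m \<Longrightarrow> \<beta> < m \<Longrightarrow> Ck_on m 2 (snd c ` fst c) (Hc c \<alpha> \<beta>)"
    "\<alpha> < m \<Longrightarrow> \<beta> < m \<Longrightarrow> w \<in> snd c ` fst c \<Longrightarrow> Hc c \<beta> \<alpha> w = cnj (Hc c \<alpha> \<beta> w)"
    "x \<in> fst c \<Longrightarrow> V \<in> vs_set (tangent_space M x) \<Longrightarrow> herm m (Hc c) (snd c x) (V c) = Re (g x V V)"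
    "x \<in> fst c \<Longrightarrow> V \<in> vs_set (tangent_space M x) \<Longrightarrow> V \<noteq> vs_zero (tangent_space M x) \<Longrightarrow> Re (g x V V) > 0"
    "z \<in> snd c ` fst c \<Longrightarrow> v \<in> Cn m \<Longrightarrow> v \<noteq> (\<lambda>_. 0) \<Longrightarrow> herm m (Hc c) z v > 0"
proof -
  note inj = atlasD(1)[OF M c]
  have e: "Hc c \<alpha> \<beta> (snd c x) = g x (vb_frame (tangent_bundle M) (tan_triv c) \<alpha> x) (vb_frame (tangent_bundle M) (tan_triv c) \<beta> x)"
    if "x \<in> fst c" for \<alpha> \<beta> x
    using chart_inv_left[OF inj that] by (simp add: Hc_def metric_coeff_def Let_def)
  show "Ck_on m 2 (snd c ` fst c) (Hc c \<alpha> \<beta>)" if "\<alpha> < m" "\<beta> < m" for \<alpha> \<beta>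
  proof -
    have "tan_triv c \<in> vb_triv (tangent_bundle M)" using c tangent_triv_iff by blast
    then have "smooth_fun_on M (fst (tan_triv c)) (\<lambda>x. g x (vb_frame (tangent_bundle M) (tan_triv c) \<alpha> x) (vb_frame (tangent_bundle M) (tan_triv c) \<beta> x))"
      using gh that m unfolding hermitian_metric_def tangent_bundle_simps by blast
    then have "smooth_on m (snd c ` (fst c \<inter> fst c)) (Hc c \<alpha> \<beta>)"
      using c unfolding smooth_fun_on_def case_prod_beta Hc_def metric_coeff_def[abs_def] Let_def m by (auto simp: tan_triv_def)
    then have "Ck_on m 2 (snd c ` (fst c \<inter> fst c)) (Hc c \<alpha> \<beta>)" unfolding smooth_on_def by blast
    then show ?thesis by simp
  qed
  show "Hc c \<beta> \<alpha> w = cnj (Hc c \<alpha> \<beta> w)" if ab: "\<alpha> < m" "\<beta> < m" and w: "w \<in> snd c ` fst c" for \<alpha> \<beta> w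
  proof -
    obtain x where x: "x \<in> fst c" "w = snd c x" using w by blast
    have "vs_zero (tangent_space M x) \<in> vs_set (tangent_space M x)" using linear_isoD(2)[OF tangent_linear_iso[OF M c x(1)]] .
    from hermitian_expand(2)[OF gh M c x(1) this, of \<alpha> \<beta>] show ?thesis using ab m unfolding x(2) e[OF x(1)] by simp
  qed
  show h: "herm m (Hc c) (snd c x) (V c) = Re (g x V V)" if "x \<in> fst c" "V \<in> vs_set (tangent_space M x)" for x V
    using hermitian_expand(1)[OF gh M c that] by (simp add: herm_def m e[OF that(1)])
  show p: "Re (g x V V) > 0" if "x \<in> fst c" "V \<in> vs_set (tangent_space M x)" "V \<noteq> vs_zero (tangent_space M x)" for x V
    by (rule hermitian_expand(3)[OF gh M c that])
  show "herm m (Hc c) z v > 0" if z: "z \<in> snd c ` fst c" and v: "v \<in> Cn m" "v \<noteq> (\<lambda>_. 0)"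
  proof -
    obtain x where x: "x \<in> fst c" "z = snd c x" using z by blast
    note T = tangent_linear_iso[OF M c x(1)]
    define V where "V = linv (tangent_space M x) (\<lambda>v. v c) v"
    have V: "V \<in> vs_set (tangent_space M x)" "V c = v" unfolding V_def using linv[OF T] v m by auto
    moreover have "V \<noteq> vs_zero (tangent_space M x)" using V(2) v(2) linear_isoD(3)[OF T] by metis
    ultimately show ?thesis using h[OF x(1), of V] p[OF x(1), of V] x(2) by simp
  qed
qed

text \<open>RC-positivity supplies \<open>u\<close>, and \<open>curvature_eq_gjet\<close> supplies
  the lift \<open>b\<close> that turns positive curvature into a negative mixed second derivative of
  g(v, v).\<close>

lemma RC_gjet:
  assumes c: "c \<in> cm_atlas M" and z: "z \<in> snd c ` fst c" and v: "v \<in> Cn m" "v \<noteq> (\<lambda>_. 0)"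
  shows "\<exists>u\<in>Cn m. \<exists>b\<in>Cn m. Re (gjet m m (Hc c) z v u b) < 0"
proof -
  obtain x where x: "x \<in> fst c" "z = snd c x" using z by blast
  note T = tangent_linear_iso[OF M c x(1)]
  define V where "V = linv (tangent_space M x) (\<lambda>v. v c) v"
  have V: "V \<in> vs_set (tangent_space M x)" "V c = v" unfolding V_def using linv[OF T] v m by auto
  have V0: "V \<noteq> vs_zero (tangent_space M x)" using V(2) v(2) linear_isoD(3)[OF T] by metis
  have xM: "x \<in> cm_pts M" using atlasD(3)[OF M c] x by auto
  have tc: "tan_triv c \<in> vb_triv (tangent_bundle M)" "x \<in> fst c \<inter> fst (tan_triv c)"
    using c tangent_triv_iff x(1) by (blast, simp add: tan_triv_def)
  obtain u where u: "u \<in> vs_set (tangent_space M x)" and R: "Re (chern_curvature (tangent_bundle M) g c (tan_triv c) x u V) > 0"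
    using g xM V(1) V0 c tc unfolding RC_positive_def tangent_bundle_simps by blast
  have "\<exists>b\<in>Cn m. gjet m m (Hc c) z v (u c) b = - (\<Sum>i<m. \<Sum>j<m. \<Sum>\<alpha><m. \<Sum>\<beta><m.
     (- dz i (dzbar j (Hc c \<alpha> \<beta>)) z + (\<Sum>\<gamma><m. \<Sum>\<delta><m. inverse_coeff m (\<lambda>\<gamma> \<delta>. Hc c \<gamma> \<delta> z) \<gamma> \<delta> * dz i (Hc c \<alpha> \<delta>) z * dzbar j (Hc c \<gamma> \<beta>) z))
       * u c i * cnj (u c j) * v \<alpha> * cnj (v \<beta>))"
  proof (rule curvature_eq_gjet)
    fix w assume "w \<in> Cn m" "w \<noteq> (\<lambda>_. 0)"
    then have "herm m (Hc c) z w > 0" by (rule Hc_props(5)[OF c z])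
    then show "(\<Sum>\<alpha><m. \<Sum>\<beta><m. Hc c \<alpha> \<beta> z * w \<alpha> * cnj (w \<beta>)) \<noteq> 0"
      unfolding herm_def by (metis less_irrefl zero_complex.sel(1))
  qed
  moreover have "chern_curvature (tangent_bundle M) g c (tan_triv c) x u V = (\<Sum>i<m. \<Sum>j<m. \<Sum>\<alpha><m. \<Sum>\<beta><m.
     (- dz i (dzbar j (Hc c \<alpha> \<beta>)) z + (\<Sum>\<gamma><m. \<Sum>\<delta><m. inverse_coeff m (\<lambda>\<gamma> \<delta>. Hc c \<gamma> \<delta> z) \<gamma> \<delta> * dz i (Hc c \<alpha> \<delta>) z * dzbar j (Hc c \<gamma> \<beta>) z))
       * u c i * cnj (u c j) * v \<alpha> * cnj (v \<beta>))"
    unfolding chern_curvature_def chern_curvature_coeff_def Let_def tangent_bundle_simps Hc_def[symmetric] m[symmetric] x(2)[symmetric]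
    by (simp add: tan_triv_def V(2))
  ultimately obtain b where b: "b \<in> Cn m" "gjet m m (Hc c) z v (u c) b = - chern_curvature (tangent_bundle M) g c (tan_triv c) x u V"
    by auto
  have "u c \<in> Cn m" using linear_isoD(6)[OF T u] m by simp
  moreover have "Re (gjet m m (Hc c) z v (u c) b) < 0" using b(2) R by simp
  ultimately show ?thesis using b(1) by blast
qed

abbreviation "psh c d \<equiv> push m n (fh c d)"

lemma push_Cn: "push m n h z v \<in> Cn n"
  by (simp add: push_def Cn_def)

lemma push_scale: "push m n h z (\<lambda>i. k * v i) = (\<lambda>i. k * push m n h z v i)"
  by (auto simp: push_def fun_eq_iff sum_distrib_left mult.left_commute)

lemma push_dmap:
  "i < n \<Longrightarrow> psh c d (snd c x) v i = (\<Sum>l<m. dmap f c d x i l * v l)"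
  by (simp add: push_def dmap_def fh_def[abs_def])

text \<open>\<open>A\<close> and \<open>B\<close> expand the Jacobian of \<open>f\<close> from
  \<open>c\<close> to \<open>d'\<close> in two ways, through \<open>c'\<close> on the source and
  through \<open>d\<close> on the target; comparing them on \<open>V\<close> gives the rule.\<close>

lemma push_change:
  assumes c: "c \<in> cm_atlas M" "c' \<in> cm_atlas M" "x \<in> fst c" "x \<in> fst c'" and d: "d \<in> cm_atlas N" "d' \<in> cm_atlas N" "f x \<in> fst d" "f x \<in> fst d'"
    and V: "V \<in> vs_set (tangent_space M x)" and i: "i < n"
  shows "psh c' d' (snd c' x) (V c') i = (\<Sum>l<n. dmap (\<lambda>x. x) d d' (f x) i l * psh c d (snd c x) (V c) l)"
proof -
  have A: "dmap f c d' x i j = (\<Sum>k<m. dmap f c' d' x i k * dmap (\<lambda>x. x) c c' x k j)" if "j < m" for j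
    using dmap_chain[OF M M N hmap_id[OF M] f c(1,3) c(2) c(4) d(2) d(4), of i j] i that n m by simp
  have B: "dmap f c d' x i j = (\<Sum>l<n. dmap (\<lambda>x. x) d d' (f x) i l * dmap f c d x l j)" if "j < m" for j
    using dmap_chain[OF M N N f hmap_id[OF N] c(1,3) d(1,3) d(2,4), of i j] i that n m by simp
  have "psh c' d' (snd c' x) (V c') i = (\<Sum>k<m. dmap f c' d' x i k * (\<Sum>j<m. dmap (\<lambda>x. x) c c' x k j * V c j))"
    unfolding push_dmap[OF i] using tangent_transition[OF M c V] m by (intro sum.cong refl) simp
  also have "\<dots> = (\<Sum>j<m. (\<Sum>k<m. dmap f c' d' x i k * dmap (\<lambda>x. x) c c' x k j) * V c j)"
    unfolding sum_distrib_left sum_distrib_right by (subst sum.swap) (simp add: mult.assoc)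
  also have "\<dots> = (\<Sum>j<m. (\<Sum>l<n. dmap (\<lambda>x. x) d d' (f x) i l * dmap f c d x l j) * V c j)"
    using A B by (intro sum.cong refl) simp
  also have "\<dots> = (\<Sum>l<n. dmap (\<lambda>x. x) d d' (f x) i l * (\<Sum>j<m. dmap f c d x l j * V c j))"
    unfolding sum_distrib_left sum_distrib_right by (subst sum.swap) (simp add: mult.assoc)
  finally show ?thesis by (simp add: push_dmap)
qed

lemma Xi_push_change:
  assumes c: "c \<in> cm_atlas M" "c' \<in> cm_atlas M" "x \<in> fst c" "x \<in> fst c'" and d: "d \<in> cm_atlas N" "d' \<in> cm_atlas N" "f x \<in> fst d" "f x \<in> fst d'"
    and V: "V \<in> vs_set (tangent_space M x)"
  shows "Xi N d' (f x) (psh c' d' (snd c' x) (V c')) = Xi N d (f x) (psh c d (snd c x) (V c))"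
  using push_change[OF assms] push_Cn n by (intro Xi_change[OF N d]) auto

text \<open>\<open>PhiC\<close> as a function of a point and a tangent vector. The weight and the
  metric are intrinsic; what genuinely depends on the charts is the
  \<open>\<delta>\<close>-term.\<close>

definition Ph where
  "Ph \<Lambda> \<delta> A c d p x V = - (1 - \<delta>) * \<Lambda> (f x) (Xi N d (f x) (psh c d (snd c x) (V c)))
     + \<delta> * (- A * sqd m (snd c x) p + ln (\<Sum>i<n. (cmod (psh c d (snd c x) (V c) i))\<^sup>2)) - ln (Re (g x V V))"

definition Wt where
  "Wt \<Lambda> d j \<zeta> = \<Lambda> (pbase n d \<zeta>) (pvec (bidual N) n n d (bitriv N d) j \<zeta>)"

lemma bd: "hvb (bidual N)" "n = cm_dim (vb_base (bidual N))" "n = vb_rank (bidual N)"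
  using hvb_bidual[OF N] n by auto

lemma enc_pdom:
  assumes d: "d \<in> cm_atlas N" "y \<in> fst d" and a: "a \<in> Cn n" "a j = 1" and j: "j < n"
  shows "enc n n j (snd d y) a \<in> pdom n NN d (fst d)" "pbase n d (enc n n j (snd d y) a) = y"
    "pvec (bidual N) n n d (bitriv N d) j (enc n n j (snd d y) a) = Xi N d y a"
proof -
  have zC: "snd d y \<in> Cn n" using atlasD(4)[OF N d] n by simp
  note de = dec_enc[OF zC a(1) j]
  show "enc n n j (snd d y) a \<in> pdom n NN d (fst d)"
    unfolding pdom_def[OF bd NN] mem_Collect_eq de(1) using enc_Cn[of n n j "snd d y" a, folded NN] d(2) by blast
  show b: "pbase n d (enc n n j (snd d y) a) = y"
    unfolding pbase_def[OF bd NN] de(1) by (rule chart_inv_left[OF atlasD(1)[OF N d(1)] d(2)])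
  show "pvec (bidual N) n n d (bitriv N d) j (enc n n j (snd d y) a) = Xi N d y a"
    unfolding pvec_def[OF bd NN] b de(2)[OF a(2)] Xi_def ..
qed

text \<open>Minus \<open>\<Lambda>\<close> scales like the logarithm of a squared norm.\<close>

definition lscale where
  "lscale \<Lambda> \<longleftrightarrow> (\<forall>x\<in>cm_pts N. \<forall>\<xi>\<in>vs_set (vb_fib (bidual N) x). \<forall>a. \<xi> \<noteq> vs_zero (vb_fib (bidual N) x) \<longrightarrow> a \<noteq> 0 \<longrightarrow>
         \<Lambda> x (vs_scale (vb_fib (bidual N) x) a \<xi>) = \<Lambda> x \<xi> - 2 * ln (cmod a))"

text \<open>Homogeneity moves the component \<open>j\<close> out of the weight and out of the sum of
  squares. Its logarithm ln |X_j| then occurs with the coefficients -2 (1 - delta), 2 and -2 delta,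
  which cancel, so the index \<open>j\<close> leaves no trace.\<close>

lemma PhiC_Ph:
  assumes c: "c \<in> cm_atlas M" "x \<in> fst c" and d: "d \<in> cm_atlas N" "f x \<in> fst d" and V: "V \<in> vs_set (tangent_space M x)"
    and j: "j < n" "psh c d (snd c x) (V c) j \<noteq> 0" and L: "lscale \<Lambda>"
  shows "PhiC m n (fh c d) (Wt \<Lambda> d j) (Hc c) \<delta> A p j (snd c x) (V c) = Ph \<Lambda> \<delta> A c d p x V"
proof -
  define X where "X = psh c d (snd c x) (V c)"
  have XC: "X \<in> Cn n" unfolding X_def by (rule push_Cn)
  have Xj: "X j \<noteq> 0" using j by (simp add: X_def)
  define a where "a = (\<lambda>i. X i / X j)"
  have a: "a \<in> Cn n" "a j = 1" using XC Xj by (auto simp: a_def Cn_def)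
  have fx: "(\<lambda>i. fh c d i (snd c x)) = snd d (f x)"
    using Om_props(5)[OF c(1) d(1) c(2) d(2)] by (simp add: fh_def)
  note ep = enc_pdom[OF d a j(1)]
  have W: "Wt \<Lambda> d j (enc n n j (\<lambda>i. fh c d i (snd c x)) (\<lambda>i. X i / X j)) = \<Lambda> (f x) (Xi N d (f x) a)"
    unfolding fx a_def[symmetric] Wt_def ep(2,3) ..
  have "X = (\<lambda>i. X j * a i)" using Xj by (simp add: a_def)
  then have XX: "Xi N d (f x) X = vs_scale (vb_fib (bidual N) (f x)) (X j) (Xi N d (f x) a)"
    using Xi_props(3)[OF N d, of a "X j"] a n by simp
  have "f x \<in> cm_pts N" using atlasD(3)[OF N d(1)] d(2) by auto
  moreover have "a \<noteq> (\<lambda>_. 0)" using a(2) by auto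
  ultimately have L1: "\<Lambda> (f x) (Xi N d (f x) X) = \<Lambda> (f x) (Xi N d (f x) a) - 2 * ln (cmod (X j))"
    unfolding XX using L Xi_props(1,2)[OF N d] a n Xj unfolding lscale_def by blast
  have S: "(\<Sum>i<n. (cmod (X i / X j))\<^sup>2) = (\<Sum>i<n. (cmod (X i))\<^sup>2) / (cmod (X j))\<^sup>2"
    by (simp add: norm_divide power_divide sum_divide_distrib)
  have "(cmod (X j))\<^sup>2 \<le> (\<Sum>i<n. (cmod (X i))\<^sup>2)" using j by (intro member_le_sum) auto
  moreover have "(cmod (X j))\<^sup>2 > 0" using Xj by simp
  ultimately have pos: "(\<Sum>i<n. (cmod (X i))\<^sup>2) > 0" by linarith
  have lnS: "ln (\<Sum>i<n. (cmod (X i / X j))\<^sup>2) = ln (\<Sum>i<n. (cmod (X i))\<^sup>2) - 2 * ln (cmod (X j))"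
    unfolding S using pos Xj by (simp add: ln_div ln_realpow)
  have ln2: "ln ((cmod (X j))\<^sup>2) = 2 * ln (cmod (X j))" using Xj by (simp add: ln_realpow)
  show ?thesis
    unfolding PhiC_def Ph_def X_def[symmetric] W lnS ln2 Hc_props(3)[OF c V] L1 by (simp add: algebra_simps)
qed

text \<open>ln |k|^2 enters with weight 1 - delta from the Finsler norm, delta from the flat norm
  and -1 from the metric, in total 0.\<close>

lemma Ph_scale:
  assumes c: "c \<in> cm_atlas M" "x \<in> fst c" and d: "d \<in> cm_atlas N" "f x \<in> fst d" and V: "V \<in> vs_set (tangent_space M x)"
    and X: "psh c d (snd c x) (V c) \<noteq> (\<lambda>_. 0)" and L: "lscale \<Lambda>" and k: "k \<noteq> 0" and V0: "V \<noteq> vs_zero (tangent_space M x)"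
  shows "Ph \<Lambda> \<delta> A c d p x (vs_scale (tangent_space M x) k V) = Ph \<Lambda> \<delta> A c d p x V"
proof -
  note T = tangent_linear_iso[OF M c]
  define X where "X = psh c d (snd c x) (V c)"
  have XC: "X \<in> Cn n" unfolding X_def by (rule push_Cn)
  have kV: "vs_scale (tangent_space M x) k V \<in> vs_set (tangent_space M x)" "vs_scale (tangent_space M x) k V c = (\<lambda>i. k * V c i)"
    using linear_isoD(5)[OF T V, of k] by auto
  have kX: "psh c d (snd c x) (vs_scale (tangent_space M x) k V c) = (\<lambda>i. k * X i)" unfolding kV(2) push_scale X_def ..
  have "f x \<in> cm_pts N" using atlasD(3)[OF N d(1)] d(2) by auto
  then have L1: "\<Lambda> (f x) (Xi N d (f x) (\<lambda>i. k * X i)) = \<Lambda> (f x) (Xi N d (f x) X) - 2 * ln (cmod k)"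
    using Xi_props[OF N d, of X] XC n X k L unfolding lscale_def X_def[symmetric] by auto
  obtain i where i: "i < n" "X i \<noteq> 0"
    using X XC unfolding X_def[symmetric] Cn_def fun_eq_iff by (metis (mono_tags, lifting) mem_Collect_eq not_less)
  have "0 < (cmod (X i))\<^sup>2" using i by simp
  also have "\<dots> \<le> (\<Sum>i<n. (cmod (X i))\<^sup>2)" using i by (intro member_le_sum) auto
  finally have pos: "(\<Sum>i<n. (cmod (X i))\<^sup>2) > 0" .
  have "(\<Sum>i<n. (cmod (k * X i))\<^sup>2) = (cmod k)\<^sup>2 * (\<Sum>i<n. (cmod (X i))\<^sup>2)"
    by (simp add: norm_mult power_mult_distrib sum_distrib_left)
  then have lnS: "ln (\<Sum>i<n. (cmod (k * X i))\<^sup>2) = 2 * ln (cmod k) + ln (\<Sum>i<n. (cmod (X i))\<^sup>2)"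
    using pos k by (simp add: ln_mult_pos ln_realpow)
  have "herm m (Hc c) (snd c x) (\<lambda>i. k * V c i) = (cmod k)\<^sup>2 * herm m (Hc c) (snd c x) (V c)"
  proof -
    have "(\<Sum>\<alpha><m. \<Sum>\<beta><m. Hc c \<alpha> \<beta> (snd c x) * (k * V c \<alpha>) * cnj (k * V c \<beta>))
      = (k * cnj k) * (\<Sum>\<alpha><m. \<Sum>\<beta><m. Hc c \<alpha> \<beta> (snd c x) * V c \<alpha> * cnj (V c \<beta>))"
      unfolding sum_distrib_left by (intro sum.cong refl) (simp add: mult.assoc mult.left_commute mult.commute)
    then show ?thesis unfolding herm_def complex_norm_square[symmetric] by simp
  qed
  then have "Re (g x (vs_scale (tangent_space M x) k V) (vs_scale (tangent_space M x) k V)) = (cmod k)\<^sup>2 * Re (g x V V)"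
    using Hc_props(3)[OF c kV(1)] Hc_props(3)[OF c V] kV(2) by simp
  moreover have "Re (g x V V) > 0" by (rule Hc_props(4)[OF c V V0])
  ultimately have lg: "ln (Re (g x (vs_scale (tangent_space M x) k V) (vs_scale (tangent_space M x) k V))) = 2 * ln (cmod k) + ln (Re (g x V V))"
    using k by (simp add: ln_mult_pos ln_realpow)
  show ?thesis unfolding Ph_def kX L1 lnS lg X_def[symmetric] by (simp add: algebra_simps)
qed

end

section \<open>Uniform constants\<close>

lemma continuous_enc:
  assumes "\<And>i. i < n \<Longrightarrow> continuous_on S (\<lambda>x. \<phi> x i)" "\<And>i. continuous_on S (\<lambda>x. \<alpha> x i)"
  shows "continuous_on S (\<lambda>x. enc n r j (\<phi> x) (\<alpha> x))"
proof (rule continuous_on_coordinatewise_then_product)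
  fix i
  have e: "(\<lambda>x. enc n r j (\<phi> x) (\<alpha> x) i) = (if i < n then (\<lambda>x. \<phi> x i) else if i < n + (r - 1) then (\<lambda>x. \<alpha> x (if i - n < j then i - n else Suc (i - n))) else (\<lambda>_. 0))"
    unfolding enc_def by (cases "i < n"; cases "i < n + (r - 1)"; simp only: if_True if_False)
  show "continuous_on S (\<lambda>x. enc n r j (\<phi> x) (\<alpha> x) i)" unfolding e using assms by (simp split: if_split)
qed

lemma sqd_eq: "sqd m z z = 0"
  by (simp add: sqd_def)

lemma in_KK: "z \<in> Cn m \<Longrightarrow> sqd m z p < \<rho>\<^sup>2 \<Longrightarrow> z \<in> KK m p \<rho>"
proof -
  assume z: "z \<in> Cn m" "sqd m z p < \<rho>\<^sup>2"
  have "(2 * \<rho>)\<^sup>2 = 4 * \<rho>\<^sup>2" by (simp add: power_mult_distrib)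
  then have "sqd m z p \<le> (2 * \<rho>)\<^sup>2" using z(2) zero_le_power2[of \<rho>] by linarith
  then show ?thesis using z(1) by (simp add: KK_def)
qed

lemma cdist_le_sqd:
  assumes "\<rho> \<ge> 0" "sqd m z p \<le> \<rho>\<^sup>2"
  shows "cdist m z p \<le> real m * \<rho>"
proof -
  have "cmod (z i - p i) \<le> \<rho>" if "i < m" for i
  proof (rule power2_le_imp_le[OF _ assms(1)])
    show "(cmod (z i - p i))\<^sup>2 \<le> \<rho>\<^sup>2" using cmod_le_sqd[OF that, of z p] assms(2) by linarith
  qed
  then have "(\<Sum>i<m. cmod (z i - p i)) \<le> real (card {..<m}) * \<rho>" by (intro sum_bounded_above) auto
  then show ?thesis by (simp add: cdist_def)
qed

lemma open_Cn_sqd: "open_Cn m {z \<in> Cn m. sqd m z p < r}"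
proof -
  have "openin (top_of_set (Cn m)) (Cn m \<inter> {z. sqd m z p < r})"
    by (rule openin_open_Int) (rule open_Collect_less[OF continuous_on_sqd continuous_on_const])
  then show ?thesis by (simp add: open_Cn_def Int_def)
qed

lemma continuous_chart_inv:
  assumes M: "holomorphic_atlas M" and c: "c \<in> cm_atlas M"
  shows "continuous_map (top_of_set (snd c ` fst c)) (cm_topology M) (chart_inv c)"
  unfolding continuous_map_def
proof (intro conjI allI impI)
  note inj = atlasD(1)[OF M c]
  have ci: "chart_inv c z \<in> fst c" "snd c (chart_inv c z) = z" if "z \<in> snd c ` fst c" for z
    using chart_inv_image[OF that subset_refl inj] by auto
  show "chart_inv c \<in> topspace (top_of_set (snd c ` fst c)) \<rightarrow> topspace (cm_topology M)"
    using ci(1) atlasD(3)[OF M c] by (auto simp: topspace_cm[OF M])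
  fix W assume W: "openin (cm_topology M) W"
  have "open_Cn (cm_dim M) (snd c ` (fst c \<inter> W))" by (rule open_chart_image[OF M c W])
  then obtain T where T: "open T" "snd c ` (fst c \<inter> W) = Cn (cm_dim M) \<inter> T" unfolding open_Cn_def openin_open by auto
  have sub: "snd c ` fst c \<subseteq> Cn (cm_dim M)" using atlasD(4)[OF M c] by auto
  have "{z \<in> topspace (top_of_set (snd c ` fst c)). chart_inv c z \<in> W} = snd c ` fst c \<inter> T"
  proof -
    have "chart_inv c z \<in> W \<longleftrightarrow> z \<in> T" if z: "z \<in> snd c ` fst c" for z
    proof
      assume "chart_inv c z \<in> W"
      then have "z \<in> snd c ` (fst c \<inter> W)" using ci[OF z] by (metis IntI imageI)
      then show "z \<in> T" using T(2) by blast
    next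
      assume "z \<in> T"
      then have "z \<in> snd c ` (fst c \<inter> W)" using T(2) z sub by blast
      then show "chart_inv c z \<in> W" using chart_inv_left[OF inj] by auto
    qed
    then show ?thesis by auto
  qed
  then show "openin (top_of_set (snd c ` fst c)) {z \<in> topspace (top_of_set (snd c ` fst c)). chart_inv c z \<in> W}"
    using T(1) by (simp add: openin_open_Int)
qed

text \<open>Here the Hausdorff property enters: the image of \<open>K'\<close> in the manifold is
  compact, hence closed, and so its preimage in the compact set \<open>K\<close> is compact.\<close>

lemma overlap_closed:
  assumes M: "holomorphic_atlas M" and H: "Hausdorff_space (cm_topology M)" and c: "c \<in> cm_atlas M" "c' \<in> cm_atlas M"
    and K: "compact K" "K \<subseteq> snd c ` fst c" "compact K'" "K' \<subseteq> snd c' ` fst c'"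
  shows "compact {z \<in> K. chart_inv c z \<in> fst c' \<and> snd c' (chart_inv c z) \<in> K'}"
proof -
  define T where "T = chart_inv c' ` K'"
  have "compactin (top_of_set (snd c' ` fst c')) K'" using K by (simp add: compactin_subtopology)
  then have "compactin (cm_topology M) T" unfolding T_def by (rule image_compactin[OF _ continuous_chart_inv[OF M c(2)]])
  then have "closedin (cm_topology M) T" using H by (simp add: compactin_imp_closedin)
  then have "closedin (top_of_set (snd c ` fst c)) {z \<in> topspace (top_of_set (snd c ` fst c)). chart_inv c z \<in> T}"
    by (rule closedin_continuous_map_preimage[OF continuous_chart_inv[OF M c(1)]])
  then obtain C where C: "closed C" "{z \<in> snd c ` fst c. chart_inv c z \<in> T} = snd c ` fst c \<inter> C"
    unfolding closedin_closed by auto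
  note inj' = atlasD(1)[OF M c(2)]
  have "{z \<in> K. chart_inv c z \<in> fst c' \<and> snd c' (chart_inv c z) \<in> K'} = K \<inter> C"
  proof -
    have "(chart_inv c z \<in> fst c' \<and> snd c' (chart_inv c z) \<in> K') \<longleftrightarrow> chart_inv c z \<in> T" for z
    proof
      assume *: "chart_inv c z \<in> fst c' \<and> snd c' (chart_inv c z) \<in> K'"
      then have "chart_inv c' (snd c' (chart_inv c z)) = chart_inv c z" by (simp add: chart_inv_left[OF inj'])
      then show "chart_inv c z \<in> T" unfolding T_def using * by (metis imageI)
    next
      assume "chart_inv c z \<in> T"
      then obtain w where w: "w \<in> K'" "chart_inv c z = chart_inv c' w" unfolding T_def by blast
      have "w \<in> snd c' ` fst c'" using w(1) K(4) by blast
      from chart_inv_image[OF this subset_refl inj'] show "chart_inv c z \<in> fst c' \<and> snd c' (chart_inv c z) \<in> K'"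
        unfolding w(2) using w(1) by simp
    qed
    moreover have "chart_inv c z \<in> T \<longleftrightarrow> z \<in> C" if "z \<in> K" for z
      using C(2) K(2) that by (simp add: set_eq_iff) blast
    ultimately show ?thesis by (simp add: set_eq_iff) blast
  qed
  then show ?thesis using compact_Int_closed[OF K(1) C(1)] by simp
qed

context rc_map
begin

text \<open>The balls of radius \<open>rad i\<close> already cover, while the doubled balls still
  lie in the coordinate domain of \<open>f\<close>. This margin keeps the maximum off the boundary
  and leaves room for the discs in \<open>locally_constant\<close>.\<close>

lemma cover_exists:
  assumes cpt: "compact_space (cm_topology M)" and fM: "\<And>x. x \<in> cm_pts M \<Longrightarrow> f x \<in> cm_pts N"
  shows "\<exists>I ch dh pt rad. finite I \<and> (\<forall>i\<in>I. ch i \<in> cm_atlas M \<and> dh i \<in> cm_atlas N \<and> 0 < rad i \<and> pt i \<in> Cn m \<and> KK m (pt i) (rad i) \<subseteq> Om (ch i) (dh i))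
    \<and> (\<forall>x\<in>cm_pts M. \<exists>i\<in>I :: 'a set. x \<in> fst (ch i) \<and> sqd m (snd (ch i) x) (pt i) < (rad i)\<^sup>2)"
proof -
  have "\<exists>c d \<rho>. c \<in> cm_atlas M \<and> d \<in> cm_atlas N \<and> x \<in> fst c \<and> 0 < \<rho> \<and> KK m (snd c x) \<rho> \<subseteq> Om c d" if x: "x \<in> cm_pts M" for x
  proof -
    obtain c where c: "c \<in> cm_atlas M" "x \<in> fst c" using atlas_cover[OF M x] by blast
    obtain d where d: "d \<in> cm_atlas N" "f x \<in> fst d" using atlas_cover[OF N fM[OF x]] by blast
    have "snd c x \<in> Om c d" using Om_props(5)[OF c(1) d(1) c(2) d(2)] by blast
    then obtain e where e: "e > 0" "\<And>w. w \<in> Cn m \<Longrightarrow> cdist m w (snd c x) < e \<Longrightarrow> w \<in> Om c d"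
      using open_CnE[OF Om_props(1)[OF c(1) d(1)]] by blast
    \<comment> \<open>On the doubled ball each coordinate differs by at most 2 rho, and
      \<open>cdist\<close> adds up \<open>m\<close> of them; \<open>m + 1\<close> keeps the
      inequality strict and the denominator nonzero.\<close>
    define \<rho> where "\<rho> = e / (2 * (real m + 1))"
    have \<rho>: "\<rho> > 0" using e by (simp add: \<rho>_def)
    have "KK m (snd c x) \<rho> \<subseteq> Om c d"
    proof
      fix w assume "w \<in> KK m (snd c x) \<rho>"
      then have w: "w \<in> Cn m" "cdist m w (snd c x) \<le> real m * (2 * \<rho>)"
        using cdist_le_sqd[of "2 * \<rho>"] \<rho> by (auto simp: KK_def)
      have "real m * (2 * \<rho>) < (real m + 1) * (2 * \<rho>)" using \<rho> by simp
      also have "\<dots> = e" using \<rho> by (simp add: \<rho>_def field_simps)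
      finally show "w \<in> Om c d" using w e(2) by simp
    qed
    then show ?thesis using c d \<rho> by blast
  qed
  then obtain ch dh rad where cdr: "\<And>x. x \<in> cm_pts M \<Longrightarrow> ch x \<in> cm_atlas M \<and> dh x \<in> cm_atlas N \<and> x \<in> fst (ch x) \<and> 0 < rad x \<and> KK m (snd (ch x) x) (rad x) \<subseteq> Om (ch x) (dh x)"
    by metis
  define U where "U x = {y \<in> fst (ch x). snd (ch x) y \<in> {z \<in> Cn m. sqd m z (snd (ch x) x) < (rad x)\<^sup>2}}" for x
  have sub: "{z \<in> Cn m. sqd m z (snd (ch x) x) < (rad x)\<^sup>2} \<subseteq> snd (ch x) ` fst (ch x)" if x: "x \<in> cm_pts M" for x
  proof -
    have "{z \<in> Cn m. sqd m z (snd (ch x) x) < (rad x)\<^sup>2} \<subseteq> KK m (snd (ch x) x) (rad x)" using in_KK by blast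
    then show ?thesis using cdr[OF x] Om_props(3)[of "ch x" "dh x"] by blast
  qed
  have U: "openin (cm_topology M) (U x)" "x \<in> U x" if x: "x \<in> cm_pts M" for x
  proof -
    show "openin (cm_topology M) (U x)"
      unfolding U_def using cdr[OF x] sub[OF x] open_Cn_sqd by (intro openin_chart_preimage[OF M]) (auto simp: m)
    show "x \<in> U x" unfolding U_def using cdr[OF x] atlasD(4)[OF M, of "ch x" x] by (simp add: sqd_eq m)
  qed
  have "\<exists>\<F>. finite \<F> \<and> \<F> \<subseteq> U ` cm_pts M \<and> cm_pts M \<subseteq> \<Union>\<F>"
  proof -
    have "compactin (cm_topology M) (cm_pts M)" using cpt by (simp add: compact_space_def topspace_cm[OF M])
    then have *: "\<forall>\<U>. Ball \<U> (openin (cm_topology M)) \<and> cm_pts M \<subseteq> \<Union>\<U> \<longrightarrow> (\<exists>\<F>. finite \<F> \<and> \<F> \<subseteq> \<U> \<and> cm_pts M \<subseteq> \<Union>\<F>)"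
      unfolding compactin_def by blast
    have "Ball (U ` cm_pts M) (openin (cm_topology M))" "cm_pts M \<subseteq> \<Union>(U ` cm_pts M)" using U by blast+
    then show ?thesis using * by blast
  qed
  then obtain I where I: "finite I" "I \<subseteq> cm_pts M" "cm_pts M \<subseteq> (\<Union>x\<in>I. U x)"
    by (metis finite_subset_image)
  have A: "\<forall>i\<in>I. ch i \<in> cm_atlas M \<and> dh i \<in> cm_atlas N \<and> 0 < rad i \<and> snd (ch i) i \<in> Cn m \<and> KK m (snd (ch i) i) (rad i) \<subseteq> Om (ch i) (dh i)"
  proof
    fix i assume "i \<in> I"
    then have "i \<in> cm_pts M" using I(2) by blast
    from cdr[OF this] show "ch i \<in> cm_atlas M \<and> dh i \<in> cm_atlas N \<and> 0 < rad i \<and> snd (ch i) i \<in> Cn m \<and> KK m (snd (ch i) i) (rad i) \<subseteq> Om (ch i) (dh i)"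
      using atlasD(4)[OF M, of "ch i" i] m by simp
  qed
  have B: "\<forall>x\<in>cm_pts M. \<exists>i\<in>I. x \<in> fst (ch i) \<and> sqd m (snd (ch i) x) (snd (ch i) i) < (rad i)\<^sup>2"
    using I(3) unfolding U_def by blast
  show ?thesis
    by (rule exI[of _ I], rule exI[of _ ch], rule exI[of _ dh], rule exI[of _ "\<lambda>i. snd (ch i) i"], rule exI[of _ rad]) (use I(1) A B in blast)
qed

end

locale rc_cover = rc_map M N f g m n NN for M :: "'a cmfd" and N :: "'b cmfd" and f g m n NN +
  fixes I :: "'i set" and ch :: "'i \<Rightarrow> 'a chart" and dh :: "'i \<Rightarrow> 'b chart" and pt :: "'i \<Rightarrow> cvec" and rad :: "'i \<Rightarrow> real"
  assumes finI: "finite I" and ch: "\<And>i. i \<in> I \<Longrightarrow> ch i \<in> cm_atlas M" and dh: "\<And>i. i \<in> I \<Longrightarrow> dh i \<in> cm_atlas N"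
    and rad: "\<And>i. i \<in> I \<Longrightarrow> 0 < rad i" and pt: "\<And>i. i \<in> I \<Longrightarrow> pt i \<in> Cn m"
    and KI: "\<And>i. i \<in> I \<Longrightarrow> KK m (pt i) (rad i) \<subseteq> Om (ch i) (dh i)"
    and cover: "\<And>x. x \<in> cm_pts M \<Longrightarrow> \<exists>i\<in>I. x \<in> fst (ch i) \<and> sqd m (snd (ch i) x) (pt i) < (rad i)\<^sup>2"
    and haus: "Hausdorff_space (cm_topology M)"
begin

abbreviation "K i \<equiv> KK m (pt i) (rad i)"

abbreviation "X i \<equiv> psh (ch i) (dh i)"

lemma compact_K: "i \<in> I \<Longrightarrow> compact (K i)"
  using rad by (intro compact_KK) (simp add: less_imp_le)

lemma K_pt:
  assumes "i \<in> I" "z \<in> K i"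
  shows "chart_inv (ch i) z \<in> fst (ch i)" "f (chart_inv (ch i) z) \<in> fst (dh i)" "snd (ch i) (chart_inv (ch i) z) = z"
    "z \<in> Om (ch i) (dh i)" "z \<in> snd (ch i) ` fst (ch i)" "z \<in> Cn m"
proof -
  show z: "z \<in> Om (ch i) (dh i)" using KI assms by blast
  show "chart_inv (ch i) z \<in> fst (ch i)" "f (chart_inv (ch i) z) \<in> fst (dh i)" "snd (ch i) (chart_inv (ch i) z) = z"
    using Om_props(4)[OF ch[OF assms(1)] dh[OF assms(1)] z] by auto
  show "z \<in> snd (ch i) ` fst (ch i)" using z Om_props(3)[OF ch[OF assms(1)] dh[OF assms(1)]] by blast
  show "z \<in> Cn m" using assms(2) by (simp add: KK_def)
qed

lemma chart_K:
  assumes i: "i \<in> I" and x: "x \<in> fst (ch i)" "snd (ch i) x \<in> K i"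
  shows "f x \<in> fst (dh i)" "chart_inv (ch i) (snd (ch i) x) = x"
proof -
  show e: "chart_inv (ch i) (snd (ch i) x) = x" by (rule chart_inv_left[OF atlasD(1)[OF M ch[OF i]] x(1)])
  show "f x \<in> fst (dh i)" using K_pt(2)[OF i x(2)] unfolding e .
qed

lemma continuous_X: "i \<in> I \<Longrightarrow> continuous_on (K i \<times> UNIV) (\<lambda>x. X i (fst x) (snd x) a)"
proof (cases "a < n")
  case True
  assume i: "i \<in> I"
  have "continuous_on (K i \<times> UNIV) (\<lambda>x. pd l (fh (ch i) (dh i) a) (fst x))" if "l < m" for l
    by (rule continuous_fst_comp[OF pd_continuous[OF Om_props(2)[OF ch[OF i] dh[OF i] True] Om_props(1)[OF ch[OF i] dh[OF i]] that]])
      (use KI[OF i] in auto)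
  then have "continuous_on (K i \<times> UNIV) (\<lambda>x. \<Sum>l<m. pd l (fh (ch i) (dh i) a) (fst x) * snd x l)"
    by (intro continuous_on_sum continuous_on_mult continuous_snd_coord) auto
  then show ?thesis using True by (simp add: push_def)
next
  case False
  then show ?thesis by (simp add: push_def)
qed

text \<open>The direction given by RC-positivity need not depend continuously on the vector, but one
  pair (u, b) serves a whole neighbourhood. Recorded are the size of \<open>u\<close> and the ratio
  of metric to curvature. No size of \<open>b\<close> is recorded: it influences the estimate
  through the fibre speed, which the Fubini-Study term absorbs.\<close>

lemma bound_RC:
  "\<exists>B\<ge>1. \<forall>i\<in>I. \<forall>z\<in>K i. \<forall>v\<in>SS m. \<exists>u\<in>Cn m. \<exists>b\<in>Cn m. cnrm m u \<le> B \<and>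
     0 \<le> - Re (gjet m m (Hc (ch i)) z v u b) \<and> herm m (Hc (ch i)) z v \<le> B * - Re (gjet m m (Hc (ch i)) z v u b)"
proof -
  define P where "P i x B \<longleftrightarrow> (\<exists>u\<in>Cn m. \<exists>b\<in>Cn m. cnrm m u \<le> B \<and>
     0 \<le> - Re (gjet m m (Hc (ch i)) (fst x) (snd x) u b) \<and> herm m (Hc (ch i)) (fst x) (snd x) \<le> B * - Re (gjet m m (Hc (ch i)) (fst x) (snd x) u b))"
    for i x B
  have mono: "P i x B'" if "P i x B" "B \<le> B'" for i x B B'
    using that mult_right_mono[OF that(2)] unfolding P_def by (meson order_trans)
  have "\<exists>B\<ge>1. \<forall>i\<in>I. \<forall>x\<in>K i \<times> SS m. P i x B"
  proof (rule finite_uniform[OF finI])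
    show "\<forall>x\<in>K i \<times> SS m. P i x C \<Longrightarrow> C \<le> C' \<Longrightarrow> \<forall>x\<in>K i \<times> SS m. P i x C'" for i C C' using mono by blast
    fix i assume i: "i \<in> I"
    let ?H = "Hc (ch i)" and ?KS = "K i \<times> SS m"
    note Hp = Hc_props[OF ch[OF i]]
    have fK: "fst x \<in> snd (ch i) ` fst (ch i)" if "x \<in> ?KS" for x using K_pt(5)[OF i, of "fst x"] that by auto
    have cKS: "compact ?KS" by (intro compact_Times compact_K i compact_SS)
    show "\<exists>C. \<forall>x\<in>?KS. P i x C"
    proof (rule compact_uniform[OF cKS])
      show "P i x C \<Longrightarrow> C \<le> C' \<Longrightarrow> P i x C'" for x C C' by (rule mono)
      fix x0 assume x0: "x0 \<in> ?KS"
      have "snd x0 \<in> SS m" using x0 by auto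
      then obtain u b where ub: "u \<in> Cn m" "b \<in> Cn m" "Re (gjet m m ?H (fst x0) (snd x0) u b) < 0"
        using RC_gjet[OF ch[OF i] fK[OF x0]] SS_nonzero by blast
      define h where "h x = - Re (gjet m m ?H (fst x) (snd x) u b)" for x
      have ch': "continuous_on ?KS h" unfolding h_def
        by (intro continuous_intros continuous_gjet(1)[where H="?H" and m=m, OF Hp(1) fK])
      obtain G where G: "\<forall>x\<in>?KS. herm m ?H (fst x) (snd x) \<le> G"
        using continuous_bounded_above[OF cKS continuous_gjet(2)[where H="?H" and m=m, OF Hp(1) fK]] by blast
      \<comment> \<open>Half of the value at \<open>x0\<close> remains a positive lower bound for
        \<open>h\<close> on a neighbourhood, so the ratio of metric to curvature stays bounded
        there.\<close>
      define e where "e = h x0 / 2"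
      have e: "e > 0" "e < h x0" using ub(3) by (auto simp: e_def h_def)
      obtain U where U: "open U" "x0 \<in> U" "\<forall>y\<in>U \<inter> ?KS. h y - e > 0"
        using continuous_pos_nbhd[OF continuous_on_diff[OF ch' continuous_on_const[of _ e]] x0] e(2) by (simp only: diff_gt_0_iff_gt) blast
      define C where "C = max (cnrm m u) (\<bar>G\<bar> / e)"
      have "P i y C" if y: "y \<in> U \<inter> ?KS" for y
      proof -
        have hy: "h y > e" using U(3) y by auto
        have "herm m ?H (fst y) (snd y) \<le> \<bar>G\<bar>" using G y by (meson IntD2 abs_ge_self order_trans)
        also have "\<dots> = \<bar>G\<bar> / e * e" using e by simp
        also have "\<dots> \<le> C * h y" using hy e by (intro mult_mono) (auto simp: C_def le_max_iff_disj)
        finally have "herm m ?H (fst y) (snd y) \<le> C * h y" .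
        moreover have "cnrm m u \<le> C" by (simp add: C_def)
        ultimately show ?thesis unfolding P_def using ub(1,2) hy e unfolding h_def by (intro bexI[of _ u] bexI[of _ b] conjI) auto
      qed
      then show "\<exists>U C. open U \<and> x0 \<in> U \<and> (\<forall>y\<in>U \<inter> ?KS. P i y C)" using U(1,2) by blast
    qed
  qed
  then obtain B where B: "B \<ge> 1" "\<And>i x. i \<in> I \<Longrightarrow> x \<in> K i \<times> SS m \<Longrightarrow> P i x B" by blast
  show ?thesis
  proof (intro exI[of _ B] conjI B(1) ballI)
    fix i z v assume "i \<in> I" "z \<in> K i" "v \<in> SS m"
    then show "\<exists>u\<in>Cn m. \<exists>b\<in>Cn m. cnrm m u \<le> B \<and>
     0 \<le> - Re (gjet m m (Hc (ch i)) z v u b) \<and> herm m (Hc (ch i)) z v \<le> B * - Re (gjet m m (Hc (ch i)) z v u b)"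
      using B(2)[of i "(z, v)"] unfolding P_def by simp
  qed
qed

lemma bound_pd: "\<exists>B\<ge>1. \<forall>i\<in>I. (\<forall>z\<in>K i. (\<Sum>a<n. \<Sum>l<m. cmod (pd l (fh (ch i) (dh i) a) z)) \<le> B) \<and> 1 / (rad i)\<^sup>2 \<le> B"
proof (rule finite_uniform[OF finI])
  fix i assume i: "i \<in> I"
  have "continuous_on (K i) (pd l (fh (ch i) (dh i) a))" if "a < n" "l < m" for a l
    using continuous_on_subset[OF pd_continuous[OF Om_props(2)[OF ch[OF i] dh[OF i] that(1)] Om_props(1)[OF ch[OF i] dh[OF i]] that(2)] KI[OF i]] .
  then have "continuous_on (K i) (\<lambda>z. \<Sum>a<n. \<Sum>l<m. cmod (pd l (fh (ch i) (dh i) a) z))"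
    by (intro continuous_on_sum continuous_on_norm) auto
  then obtain C where C: "\<forall>z\<in>K i. (\<Sum>a<n. \<Sum>l<m. cmod (pd l (fh (ch i) (dh i) a) z)) \<le> C"
    using continuous_bounded_above[OF compact_K[OF i]] by blast
  then show "\<exists>C. (\<forall>z\<in>K i. (\<Sum>a<n. \<Sum>l<m. cmod (pd l (fh (ch i) (dh i) a) z)) \<le> C) \<and> 1 / (rad i)\<^sup>2 \<le> C"
    by (intro exI[of _ "max C (1 / (rad i)\<^sup>2)"]) (auto simp: le_max_iff_disj)
next
  show "(\<forall>z\<in>K i. (\<Sum>a<n. \<Sum>l<m. cmod (pd l (fh (ch i) (dh i) a) z)) \<le> C) \<and> 1 / (rad i)\<^sup>2 \<le> C \<Longrightarrow> C \<le> C' \<Longrightarrow>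
    (\<forall>z\<in>K i. (\<Sum>a<n. \<Sum>l<m. cmod (pd l (fh (ch i) (dh i) a) z)) \<le> C') \<and> 1 / (rad i)\<^sup>2 \<le> C'" for i C C'
    by (meson order_trans)
qed

text \<open>The compact part of the affine chart \<open>j\<close> into which the quotients fall when
  the component \<open>j\<close> has the largest modulus.\<close>

definition polydisc :: "nat \<Rightarrow> cvec set" where
  "polydisc j = {a \<in> Cn n. \<forall>k<n. a k \<in> (if k = j then {1} else cball 0 1)}"

lemma ratio_box: "j < n \<Longrightarrow> X i z v j \<noteq> 0 \<Longrightarrow> (\<And>k. k < n \<Longrightarrow> cmod (X i z v k) \<le> cmod (X i z v j)) \<Longrightarrow> (\<lambda>k. X i z v k / X i z v j) \<in> polydisc j"
  using push_Cn by (auto simp: polydisc_def Cn_def norm_divide divide_le_eq_1)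

lemma enc_in_pdom:
  assumes i: "i \<in> I" and z: "z \<in> K i" and j: "j < n" and a: "a \<in> Cn n" "a j = 1"
  shows "enc n n j (\<lambda>k. fh (ch i) (dh i) k z) a \<in> pdom n NN (dh i) (fst (dh i))"
  unfolding Om_props(7)[OF ch[OF i] dh[OF i]] by (rule enc_pdom(1)[OF dh[OF i] K_pt(2)[OF i z] a j])

lemma continuous_enc_fh:
  assumes i: "i \<in> I" and S: "\<And>x. x \<in> S \<Longrightarrow> fst x \<in> K i" and \<alpha>: "\<And>k. continuous_on S (\<lambda>x. \<alpha> x k)"
  shows "continuous_on S (\<lambda>x. enc n n j (\<lambda>k. fh (ch i) (dh i) k (fst x)) (\<alpha> x))"
proof (rule continuous_enc[OF _ \<alpha>])
  fix k assume "k < n"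
  show "continuous_on S (\<lambda>x. fh (ch i) (dh i) k (fst x))"
    by (rule continuous_fst_comp[OF holo_on_cont[OF Om_props(2)[OF ch[OF i] dh[OF i] \<open>k < n\<close>]]]) (use KI[OF i] S in blast)
qed

text \<open>Kept general in \<open>w\<close> because it serves twice: for the factor
  \<open>C\<close> of the nefness error, before any weight is chosen, and for the weight itself in
  \<open>PC_upper\<close>.\<close>

lemma bound_enc:
  fixes w :: "'b chart \<Rightarrow> nat \<Rightarrow> cvec \<Rightarrow> real"
  assumes w: "\<And>d j. d \<in> cm_atlas N \<Longrightarrow> j < n \<Longrightarrow> continuous_on (pdom n NN d (fst d)) (w d j)"
  shows "\<exists>B\<ge>1. \<forall>i\<in>I. \<forall>j<n. \<forall>z\<in>K i. \<forall>a\<in>polydisc j. w (dh i) j (enc n n j (\<lambda>k. fh (ch i) (dh i) k z) a) \<le> B"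
proof -
  have "\<exists>B\<ge>1. \<forall>q\<in>I \<times> {..<n}. \<forall>x\<in>K (fst q) \<times> polydisc (snd q). w (dh (fst q)) (snd q) (enc n n (snd q) (\<lambda>k. fh (ch (fst q)) (dh (fst q)) k (fst x)) (snd x)) \<le> B"
  proof (rule finite_uniform)
    show "finite (I \<times> {..<n})" using finI by simp
    fix q assume "q \<in> I \<times> {..<n}"
    then obtain i j where ij: "i \<in> I" "j < n" "q = (i, j)" by auto
    have bx: "compact (polydisc j)" unfolding polydisc_def by (rule compact_Cn_box) simp
    have "continuous_on (K i \<times> polydisc j) (\<lambda>x. w (dh i) j (enc n n j (\<lambda>k. fh (ch i) (dh i) k (fst x)) (snd x)))"
    proof (rule continuous_on_compose2[OF w[OF dh[OF ij(1)] ij(2)]])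
      show "continuous_on (K i \<times> polydisc j) (\<lambda>x. enc n n j (\<lambda>k. fh (ch i) (dh i) k (fst x)) (snd x))"
        by (rule continuous_enc_fh[OF ij(1) _ continuous_snd_coord]) auto
      show "(\<lambda>x. enc n n j (\<lambda>k. fh (ch i) (dh i) k (fst x)) (snd x)) ` (K i \<times> polydisc j) \<subseteq> pdom n NN (dh i) (fst (dh i))"
        using enc_in_pdom[OF ij(1) _ ij(2)] ij(2) by (auto simp: polydisc_def)
    qed
    from continuous_bounded_above[OF compact_Times[OF compact_K[OF ij(1)] bx] this]
    show "\<exists>C. \<forall>x\<in>K (fst q) \<times> polydisc (snd q). w (dh (fst q)) (snd q) (enc n n (snd q) (\<lambda>k. fh (ch (fst q)) (dh (fst q)) k (fst x)) (snd x)) \<le> C"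
      using ij(3) by simp
  qed (meson order_trans)
  then show ?thesis by (fastforce simp: Ball_def)
qed

lemma bound_herm: "\<exists>B\<ge>1. \<forall>i\<in>I. \<forall>z\<in>K i. \<forall>v\<in>SS m. - ln (herm m (Hc (ch i)) z v) \<le> B"
proof -
  have "\<exists>B\<ge>1. \<forall>i\<in>I. \<forall>x\<in>K i \<times> SS m. - ln (herm m (Hc (ch i)) (fst x) (snd x)) \<le> B"
  proof (rule finite_uniform[OF finI])
    fix i assume i: "i \<in> I"
    have "continuous_on (K i \<times> SS m) (\<lambda>x. - ln (herm m (Hc (ch i)) (fst x) (snd x)))"
    proof (intro continuous_on_minus continuous_on_ln continuous_gjet(2)[where H="Hc (ch i)" and m=m, OF Hc_props(1)[OF ch[OF i]]] ballI)
      show "x \<in> K i \<times> SS m \<Longrightarrow> fst x \<in> snd (ch i) ` fst (ch i)" for x using K_pt(5)[OF i, of "fst x"] by auto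
      fix x assume "x \<in> K i \<times> SS m"
      then have "herm m (Hc (ch i)) (fst x) (snd x) > 0"
        using Hc_props(5)[OF ch[OF i] K_pt(5)[OF i, of "fst x"], of "snd x"] SS_nonzero[of "snd x" m] by auto
      then show "herm m (Hc (ch i)) (fst x) (snd x) \<noteq> 0" by simp
    qed
    from continuous_bounded_above[OF compact_Times[OF compact_K[OF i] compact_SS] this]
    show "\<exists>C. \<forall>x\<in>K i \<times> SS m. - ln (herm m (Hc (ch i)) (fst x) (snd x)) \<le> C" .
  qed (meson order_trans)
  then show ?thesis by (fastforce simp: Ball_def)
qed

text \<open>The transition matrices of \<open>N\<close> are continuous on the compact overlaps of
  the pieces, which bounds the ratio of the two flat norms of df(V). The bound knows nothing of the
  weights, so it can be fixed before them.\<close>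

lemma bound_overlap:
  "\<exists>B\<ge>1. \<forall>i\<in>I. \<forall>k\<in>I. \<forall>x V. x \<in> fst (ch i) \<longrightarrow> snd (ch i) x \<in> K i \<longrightarrow> x \<in> fst (ch k) \<longrightarrow> snd (ch k) x \<in> K k \<longrightarrow> V \<in> vs_set (tangent_space M x) \<longrightarrow>
     (\<Sum>a<n. (cmod (X k (snd (ch k) x) (V (ch k)) a))\<^sup>2) \<le> B * (\<Sum>a<n. (cmod (X i (snd (ch i) x) (V (ch i)) a))\<^sup>2)"
proof -
  define Q where "Q i k B \<longleftrightarrow> (\<forall>x V. x \<in> fst (ch i) \<longrightarrow> snd (ch i) x \<in> K i \<longrightarrow> x \<in> fst (ch k) \<longrightarrow> snd (ch k) x \<in> K k \<longrightarrow> V \<in> vs_set (tangent_space M x) \<longrightarrow>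
     (\<Sum>a<n. (cmod (X k (snd (ch k) x) (V (ch k)) a))\<^sup>2) \<le> B * (\<Sum>a<n. (cmod (X i (snd (ch i) x) (V (ch i)) a))\<^sup>2))" for i k B
  have "\<exists>B\<ge>1. \<forall>q\<in>I \<times> I. Q (fst q) (snd q) B"
  proof (rule finite_uniform)
    show "finite (I \<times> I)" using finI by simp
    show "Q (fst q) (snd q) B \<Longrightarrow> B \<le> B' \<Longrightarrow> Q (fst q) (snd q) B'" for q B B'
      unfolding Q_def by (meson mult_right_mono order_trans sum_nonneg zero_le_power2)
    fix q assume "q \<in> I \<times> I"
    then obtain i k where ik: "i \<in> I" "k \<in> I" "q = (i, k)" by auto
    let ?c = "ch i" and ?c' = "ch k" and ?d = "dh i" and ?d' = "dh k"
    note c = ch[OF ik(1)] ch[OF ik(2)] and d = dh[OF ik(1)] dh[OF ik(2)]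
    define T where "T = {z \<in> K i. chart_inv ?c z \<in> fst ?c' \<and> snd ?c' (chart_inv ?c z) \<in> K k}"
    have T: "compact T" unfolding T_def
      by (intro overlap_closed[OF M haus c] compact_K ik subsetI K_pt(5))
    have Tin: "f (chart_inv ?c z) \<in> fst ?d \<inter> fst ?d'" if "z \<in> T" for z
      using K_pt(2)[OF ik(1), of z] chart_K(1)[OF ik(2), of "chart_inv ?c z"] that unfolding T_def by blast
    define D where "D a b z = dmap (\<lambda>x. x) ?d ?d' (f (chart_inv ?c z)) a b" for a b z
    have cD: "continuous_on T (D a b)" if ab: "a < n" "b < n" for a b
    proof (rule continuous_on_eq)
      have h1: "continuous_on (snd ?d ` (fst ?d \<inter> fst ?d')) (\<lambda>w. dmap (\<lambda>x. x) ?d ?d' (chart_inv ?d w) a b)"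
        using holo_on_cont[OF dmap_holo[OF N N hmap_id[OF N] d, of a b]] ab n by simp
      have h2: "continuous_on T (\<lambda>z. snd ?d (f (chart_inv ?c z)))"
        by (rule continuous_on_subset[OF hmap_continuous(1)[OF f M N c(1) d(1)]])
          (use KI[OF ik(1)] in \<open>auto simp: T_def Om_def\<close>)
      show "continuous_on T (\<lambda>z. dmap (\<lambda>x. x) ?d ?d' (chart_inv ?d (snd ?d (f (chart_inv ?c z)))) a b)"
        by (rule continuous_on_compose2[OF h1 h2]) (use Tin in blast)
      show "dmap (\<lambda>x. x) ?d ?d' (chart_inv ?d (snd ?d (f (chart_inv ?c z)))) a b = D a b z" if "z \<in> T" for z
        unfolding D_def using chart_inv_left[OF atlasD(1)[OF N d(1)]] Tin[OF that] by simp
    qed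
    have "continuous_on T (\<lambda>z. \<Sum>a<n. \<Sum>b<n. cmod (D a b z))"
      using cD by (intro continuous_on_sum continuous_on_norm) auto
    then obtain G where G: "\<forall>z\<in>T. (\<Sum>a<n. \<Sum>b<n. cmod (D a b z)) \<le> G" using continuous_bounded_above[OF T] by blast
    \<comment> \<open>One factor \<open>n\<close> counts the components, the other comes from
      bounding the square of an l^1 norm by the sum of squares.\<close>
    have "Q i k (real n * (real n * G\<^sup>2))"
      unfolding Q_def
    proof (intro allI impI)
      fix x V assume x: "x \<in> fst ?c" "snd ?c x \<in> K i" "x \<in> fst ?c'" "snd ?c' x \<in> K k" and V: "V \<in> vs_set (tangent_space M x)"
      let ?Y = "\<lambda>a. X i (snd ?c x) (V ?c) a" and ?Y' = "\<lambda>a. X k (snd ?c' x) (V ?c') a"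
      note fx = chart_K[OF ik(1) x(1,2)] chart_K[OF ik(2) x(3,4)]
      have zT: "snd ?c x \<in> T" unfolding T_def using x fx by simp
      define s where "s = (\<Sum>b<n. cmod (?Y b))"
      have s: "s \<ge> 0" unfolding s_def by (intro sum_nonneg) auto
      have G0: "(\<Sum>a<n. \<Sum>b<n. cmod (D a b (snd ?c x))) \<le> G" using G zT by blast
      have "cmod (?Y' a) \<le> G * s" if a: "a < n" for a
      proof -
        have "?Y' a = (\<Sum>b<n. D a b (snd ?c x) * ?Y b)"
          unfolding D_def fx(2) using push_change[OF c x(1,3) d fx(1,3) V a] .
        then have "cmod (?Y' a) \<le> (\<Sum>b<n. cmod (D a b (snd ?c x)) * cmod (?Y b))" by (simp add: norm_sum norm_mult order_trans[OF norm_sum])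
        also have "\<dots> \<le> (\<Sum>b<n. G * cmod (?Y b))"
        proof (intro sum_mono mult_right_mono)
          fix b assume b: "b \<in> {..<n}"
          have "cmod (D a b (snd ?c x)) \<le> (\<Sum>b<n. cmod (D a b (snd ?c x)))" using b by (intro member_le_sum) auto
          also have "\<dots> \<le> (\<Sum>a<n. \<Sum>b<n. cmod (D a b (snd ?c x)))"
            using a by (intro member_le_sum[of a "{..<n}" "\<lambda>a. \<Sum>b<n. cmod (D a b (snd ?c x))"] sum_nonneg) auto
          finally show "cmod (D a b (snd ?c x)) \<le> G" using G0 by simp
        qed simp
        finally show ?thesis by (simp add: s_def sum_distrib_left)
      qed
      then have "(\<Sum>a<n. (cmod (?Y' a))\<^sup>2) \<le> real (card {..<n}) * (G * s)\<^sup>2"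
        by (intro sum_bounded_above power_mono) auto
      also have "\<dots> = real n * G\<^sup>2 * s\<^sup>2" by (simp add: power_mult_distrib)
      also have "\<dots> \<le> real n * G\<^sup>2 * (real n * (\<Sum>b<n. (cmod (?Y b))\<^sup>2))"
        unfolding s_def by (intro mult_left_mono sum_sq_bound) auto
      finally show "(\<Sum>a<n. (cmod (?Y' a))\<^sup>2) \<le> real n * (real n * G\<^sup>2) * (\<Sum>a<n. (cmod (?Y a))\<^sup>2)"
        by (simp add: mult.assoc mult.left_commute)
    qed
    then show "\<exists>B. Q (fst q) (snd q) B" using ik(3) by auto
  qed
  then obtain B where B: "B \<ge> 1" "\<And>i k. i \<in> I \<Longrightarrow> k \<in> I \<Longrightarrow> Q i k B" by auto
  show ?thesis by (rule exI[of _ B], intro conjI B(1) ballI B(2)[unfolded Q_def])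
qed

end

section \<open>The maximum principle\<close>

lemma compact_le:
  fixes \<phi> \<psi> :: "'x::topological_space \<Rightarrow> real"
  assumes "compact T" "continuous_on T \<phi>" "continuous_on T \<psi>"
  shows "compact {x \<in> T. \<phi> x \<le> \<psi> x}"
proof -
  have "closedin (top_of_set T) (T \<inter> (\<lambda>x. \<psi> x - \<phi> x) -` {0..})"
    by (rule continuous_closedin_preimage) (use assms in \<open>auto intro: continuous_intros\<close>)
  moreover have "T \<inter> (\<lambda>x. \<psi> x - \<phi> x) -` {0..} = {x \<in> T. \<phi> x \<le> \<psi> x}" by auto
  ultimately show ?thesis using closedin_compact[OF assms(1)] by simp
qed

lemma compact_all_le:
  fixes \<phi> :: "nat \<Rightarrow> 'x::topological_space \<Rightarrow> real"
  assumes "compact T" "\<And>k. continuous_on T (\<phi> k)" "continuous_on T \<psi>"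
  shows "compact {x \<in> T. \<forall>k<n. \<phi> k x \<le> \<psi> x}"
proof (induction n)
  case 0
  then show ?case using assms(1) by simp
next
  case (Suc n)
  have "compact {x \<in> {x \<in> T. \<forall>k<n. \<phi> k x \<le> \<psi> x}. \<phi> n x \<le> \<psi> x}"
    by (rule compact_le[OF Suc]) (rule continuous_on_subset[OF assms(2)] continuous_on_subset[OF assms(3)], blast)+
  then show ?case by (rule back_subst[of compact]) (auto simp: less_Suc_eq)
qed

lemma ratio_sum_bounds:
  fixes w :: "nat \<Rightarrow> complex"
  assumes j: "j < n" "w j \<noteq> 0" and le: "\<And>k. k < n \<Longrightarrow> cmod (w k) \<le> cmod (w j)"
  shows "1 \<le> (\<Sum>k<n. (cmod (w k / w j))\<^sup>2)" "(\<Sum>k<n. (cmod (w k / w j))\<^sup>2) \<le> real n"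
proof -
  have "(cmod (w j / w j))\<^sup>2 \<le> (\<Sum>k<n. (cmod (w k / w j))\<^sup>2)"
    using j by (intro member_le_sum[of j "{..<n}" "\<lambda>k. (cmod (w k / w j))\<^sup>2"]) auto
  then show "1 \<le> (\<Sum>k<n. (cmod (w k / w j))\<^sup>2)" using j by simp
  have "(cmod (w k / w j))\<^sup>2 \<le> 1" if "k < n" for k
    using le[OF that] j by (intro power_le_one) (auto simp: norm_divide divide_le_eq_1)
  then have "(\<Sum>k<n. (cmod (w k / w j))\<^sup>2) \<le> real (card {..<n}) * 1" by (intro sum_bounded_above) auto
  then show "(\<Sum>k<n. (cmod (w k / w j))\<^sup>2) \<le> real n" by simp
qed

lemma sqd_nonneg: "sqd m z p \<ge> 0"
  unfolding sqd_def by (intro sum_nonneg) auto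

lemma sum_sq_pos_iff:
  fixes w :: cvec
  assumes "w \<in> Cn n"
  shows "w \<noteq> (\<lambda>_. 0) \<longleftrightarrow> 0 < (\<Sum>k<n. (cmod (w k))\<^sup>2)"
proof
  assume "w \<noteq> (\<lambda>_. 0)"
  then obtain k where k: "w k \<noteq> 0" by (auto simp: fun_eq_iff)
  then have "k < n" using assms by (auto simp: Cn_def not_less[symmetric])
  then have "(cmod (w k))\<^sup>2 \<le> (\<Sum>k<n. (cmod (w k))\<^sup>2)"
    by (intro member_le_sum[of k "{..<n}" "\<lambda>k. (cmod (w k))\<^sup>2"]) auto
  moreover have "(cmod (w k))\<^sup>2 > 0" using k by simp
  ultimately show "0 < (\<Sum>k<n. (cmod (w k))\<^sup>2)" by linarith
qed auto

text \<open>With \<open>\<epsilon>\<close> of the order \<open>\<delta>/B\<close> the nefness error in \<open>S\<close> is absorbed by the strictly positive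
  Fubini-Study term, and the remaining terms are \<open>O(\<delta>)\<close>.\<close>

lemma second_variation_arith:
  fixes B A S :: real
  assumes B: "B \<ge> 1" and A: "A \<ge> 0" and n: "n \<ge> 1" and S: "S \<ge> 0"
    and \<delta>: "\<delta> = 1 / (2 * B * (A * B ^ 3 + B ^ 4 + 1))" and \<epsilon>: "\<epsilon> = \<delta> / (2 * n ^ 3 * B)"
    and T: "T \<ge> 1 / B" and U: "0 \<le> U" "U \<le> B\<^sup>2" and r: "0 \<le> r" "r \<le> B" and P: "0 \<le> P" "P \<le> B\<^sup>2"
    and le: "T + \<delta> * S / n\<^sup>2 \<le> \<delta> * (A * r) * U + (1 - \<delta>) * (\<epsilon> * B * (2 * P\<^sup>2 + 2 * n * S))"
  shows False
proof -
  define Q where "Q = A * B ^ 3 + B ^ 4"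
  have Q: "Q \<ge> 0" using A B by (simp add: Q_def)
  have \<delta>Q: "\<delta> = 1 / (2 * B * (Q + 1))" by (simp add: \<delta> Q_def)
  have d0: "\<delta> > 0" using B Q by (simp add: \<delta>Q)
  have e0: "\<epsilon> > 0" using d0 n B by (simp add: \<epsilon>)
  have "r * U \<le> B * B\<^sup>2" using r U by (intro mult_mono) (auto intro: order_trans)
  then have "A * (r * U) \<le> A * B ^ 3" using A by (intro mult_left_mono) (auto simp: power3_eq_cube power2_eq_square)
  then have 1: "\<delta> * (A * r) * U \<le> \<delta> * (A * B ^ 3)" using mult_left_mono[of "A * (r * U)" "A * B ^ 3" \<delta>] d0 by (simp add: mult.assoc)
  have "P\<^sup>2 \<le> (B\<^sup>2)\<^sup>2" using P by (intro power_mono)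
  then have P2: "P\<^sup>2 \<le> B ^ 4" by simp
  define Z where "Z = \<epsilon> * B * (2 * P\<^sup>2 + 2 * n * S)"
  have Z0: "Z \<ge> 0" unfolding Z_def using e0 B n S by auto
  have "(1 - \<delta>) * Z \<le> Z" using Z0 d0 by (simp add: algebra_simps)
  \<comment> \<open>The choice of \<open>\<epsilon>\<close> makes the \<open>S\<close>-part of the
    error equal to the Fubini-Study term, so the unknown \<open>S\<close> cancels exactly.\<close>
  also have "Z = (\<delta> / n ^ 3) * P\<^sup>2 + \<delta> * S / n\<^sup>2"
    unfolding Z_def \<epsilon> using n B by (simp add: field_simps power2_eq_square power3_eq_cube)
  also have "(\<delta> / n ^ 3) * P\<^sup>2 \<le> \<delta> * B ^ 4"
  proof -
    have "\<delta> / n ^ 3 \<le> \<delta> / 1" using n d0 by (intro divide_left_mono) auto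
    then show ?thesis using P2 d0 by (intro mult_mono) auto
  qed
  finally have "T \<le> \<delta> * (A * B ^ 3) + \<delta> * B ^ 4" using le 1 unfolding Z_def by linarith
  \<comment> \<open>\<open>\<delta>\<close> was chosen such that \<open>\<delta> * (Q + 1)\<close>
    is half of 1/B; the 1 keeps the denominator positive even when \<open>Q\<close> is 0.\<close>
  then have "1 / B \<le> \<delta> * Q" using T by (simp add: Q_def distrib_left)
  also have "\<dots> < \<delta> * (Q + 1)" using d0 by simp
  also have "\<dots> = (Q + 1) / (2 * B * (Q + 1))" by (simp add: \<delta>Q)
  also have "\<dots> = 1 / (2 * B)" using Q by (intro nonzero_divide_mult_cancel_right) linarith
  also have "\<dots> \<le> 1 / B" using B by (simp add: field_simps)
  finally show False by simp
qed

context rc_cover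
begin

definition PC where
  "PC \<Lambda> \<delta> A i j z v = PhiC m n (fh (ch i) (dh i)) (Wt \<Lambda> (dh i) j) (Hc (ch i)) \<delta> (A / (rad i)\<^sup>2) (pt i) j z v"

definition PH where
  "PH \<Lambda> \<delta> A i x V = Ph \<Lambda> \<delta> (A / (rad i)\<^sup>2) (ch i) (dh i) (pt i) x V"

text \<open>Selects an affine chart in which the quotients stay in the compact
  \<open>polydisc j\<close>; by \<open>dominant_exists\<close> every nonzero image vector has such
  an index.\<close>

definition dominant where
  "dominant i j z v \<longleftrightarrow> X i z v j \<noteq> 0 \<and> (\<forall>k<n. cmod (X i z v k) \<le> cmod (X i z v j))"

definition Wreg where
  "Wreg \<Lambda> \<longleftrightarrow> (\<forall>d\<in>cm_atlas N. \<forall>j<n. Ck_on NN 2 (pdom n NN d (fst d)) (\<lambda>\<zeta>. of_real (Wt \<Lambda> d j \<zeta>)))"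

lemma Wreg_cont:
  assumes "Wreg \<Lambda>" "d \<in> cm_atlas N" "j < n"
  shows "continuous_on (pdom n NN d (fst d)) (Wt \<Lambda> d j)"
proof -
  have "Ck_on NN 2 (pdom n NN d (fst d)) (\<lambda>\<zeta>. of_real (Wt \<Lambda> d j \<zeta>))" using assms unfolding Wreg_def by blast
  from continuous_on_Re[OF Ck_on_cont[OF this]] show ?thesis by simp
qed

lemma dominant_box: "j < n \<Longrightarrow> dominant i j z v \<Longrightarrow> (\<lambda>k. X i z v k / X i z v j) \<in> polydisc j"
  unfolding dominant_def by (intro ratio_box) auto

text \<open>Every term other than ln |X_j|^2 is bounded above on the compact pieces, the bump being
  nonpositive. So the function tends to minus infinity as df(v) tends to 0, which compensates for
  the lack of compactness.\<close>

lemma PC_upper: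
  assumes W: "Wreg \<Lambda>" and \<delta>: "0 < \<delta>" "\<delta> \<le> 1" and A: "A \<ge> 0"
  shows "\<exists>C. \<forall>i\<in>I. \<forall>j<n. \<forall>z\<in>K i. \<forall>v\<in>SS m. dominant i j z v \<longrightarrow> PC \<Lambda> \<delta> A i j z v \<le> C + ln ((cmod (X i z v j))\<^sup>2)"
proof -
  have "continuous_on (pdom n NN d (fst d)) (\<lambda>\<zeta>. - (1 - \<delta>) * Wt \<Lambda> d j \<zeta>)" if "d \<in> cm_atlas N" "j < n" for d j
    by (intro continuous_on_mult continuous_on_const Wreg_cont[OF W that])
  from bound_enc[of "\<lambda>d j \<zeta>. - (1 - \<delta>) * Wt \<Lambda> d j \<zeta>", OF this]
  obtain B1 where B1: "\<And>i j z a. i \<in> I \<Longrightarrow> j < n \<Longrightarrow> z \<in> K i \<Longrightarrow> a \<in> polydisc j \<Longrightarrow>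
      - (1 - \<delta>) * Wt \<Lambda> (dh i) j (enc n n j (\<lambda>k. fh (ch i) (dh i) k z) a) \<le> B1" by blast
  obtain B2 where B2: "\<And>i z v. i \<in> I \<Longrightarrow> z \<in> K i \<Longrightarrow> v \<in> SS m \<Longrightarrow> - ln (herm m (Hc (ch i)) z v) \<le> B2"
    using bound_herm by blast
  show ?thesis
  proof (intro exI[of _ "B1 + B2 + real n"] ballI allI impI)
    fix i j z v assume i: "i \<in> I" and j: "j < n" and z: "z \<in> K i" and v: "v \<in> SS m" and d: "dominant i j z v"
    have Xj: "X i z v j \<noteq> 0" "\<And>k. k < n \<Longrightarrow> cmod (X i z v k) \<le> cmod (X i z v j)" using d unfolding dominant_def by auto
    define s where "s = (\<Sum>k<n. (cmod (X i z v k / X i z v j))\<^sup>2)"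
    have s: "1 \<le> s" "s \<le> real n" unfolding s_def using ratio_sum_bounds[of j n "X i z v", OF j Xj] by auto
    have "ln s \<le> s - 1" using s by (intro ln_le_minus_one) simp
    then have "ln s \<le> real n" using s by linarith
    moreover have "0 \<le> ln s" using s by simp
    ultimately have l: "\<delta> * ln s \<le> 1 * real n" using \<delta> by (intro mult_mono) auto
    have q: "0 \<le> \<delta> * (A / (rad i)\<^sup>2) * sqd m z (pt i)" using \<delta> A sqd_nonneg by simp
    show "PC \<Lambda> \<delta> A i j z v \<le> B1 + B2 + real n + ln ((cmod (X i z v j))\<^sup>2)"
      using B1[OF i j z dominant_box[OF j d]] B2[OF i z v] l q unfolding PC_def PhiC_def s_def[symmetric] by linarith
  qed
qed

lemma PC_cont:
  assumes W: "Wreg \<Lambda>" and i: "i \<in> I" and j: "j < n" and S: "S \<subseteq> K i \<times> SS m" and d: "\<And>x. x \<in> S \<Longrightarrow> dominant i j (fst x) (snd x)"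
  shows "continuous_on S (\<lambda>x. PC \<Lambda> \<delta> A i j (fst x) (snd x))"
proof -
  have fK: "fst x \<in> K i" "snd x \<in> SS m" if "x \<in> S" for x using S that by auto
  have cX: "continuous_on S (\<lambda>x. X i (fst x) (snd x) a)" for a
    by (rule continuous_on_subset[OF continuous_X[OF i]]) (use S in auto)
  have Xj: "X i (fst x) (snd x) j \<noteq> 0" "\<And>k. k < n \<Longrightarrow> cmod (X i (fst x) (snd x) k) \<le> cmod (X i (fst x) (snd x) j)" if "x \<in> S" for x
    using d[OF that] unfolding dominant_def by auto
  have cq: "continuous_on S (\<lambda>x. X i (fst x) (snd x) k / X i (fst x) (snd x) j)" for k
    by (intro continuous_on_divide cX ballI Xj)
  have c1: "continuous_on S (\<lambda>x. Wt \<Lambda> (dh i) j (enc n n j (\<lambda>k. fh (ch i) (dh i) k (fst x)) (\<lambda>k. X i (fst x) (snd x) k / X i (fst x) (snd x) j)))"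
  proof (rule continuous_on_compose2[OF Wreg_cont[OF W dh[OF i] j]])
    show "continuous_on S (\<lambda>x. enc n n j (\<lambda>k. fh (ch i) (dh i) k (fst x)) (\<lambda>k. X i (fst x) (snd x) k / X i (fst x) (snd x) j))"
      by (rule continuous_enc_fh[OF i fK(1) cq])
    show "(\<lambda>x. enc n n j (\<lambda>k. fh (ch i) (dh i) k (fst x)) (\<lambda>k. X i (fst x) (snd x) k / X i (fst x) (snd x) j)) ` S \<subseteq> pdom n NN (dh i) (fst (dh i))"
    proof (rule image_subsetI)
      fix x assume x: "x \<in> S"
      show "enc n n j (\<lambda>k. fh (ch i) (dh i) k (fst x)) (\<lambda>k. X i (fst x) (snd x) k / X i (fst x) (snd x) j) \<in> pdom n NN (dh i) (fst (dh i))"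
        using dominant_box[OF j d[OF x]] j Xj(1)[OF x] by (intro enc_in_pdom[OF i fK(1)[OF x] j]) (auto simp: polydisc_def)
    qed
  qed
  have c2: "continuous_on S (\<lambda>x. ln ((cmod (X i (fst x) (snd x) j))\<^sup>2))"
    by (intro continuous_on_ln continuous_on_power continuous_on_norm cX ballI) (use Xj(1) in simp)
  have c3: "continuous_on S (\<lambda>x. sqd m (fst x) (pt i))"
    by (rule continuous_fst_comp[OF continuous_on_sqd[of UNIV]]) simp
  have c4: "continuous_on S (\<lambda>x. ln (\<Sum>k<n. (cmod (X i (fst x) (snd x) k / X i (fst x) (snd x) j))\<^sup>2))"
  proof (intro continuous_on_ln continuous_on_sum continuous_on_power continuous_on_norm cq ballI)
    fix x assume "x \<in> S"
    from ratio_sum_bounds(1)[of j n "X i (fst x) (snd x)", OF j Xj[OF this]]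
    show "(\<Sum>k<n. (cmod (X i (fst x) (snd x) k / X i (fst x) (snd x) j))\<^sup>2) \<noteq> 0" by linarith
  qed
  have c5: "continuous_on S (\<lambda>x. ln (herm m (Hc (ch i)) (fst x) (snd x)))"
  proof (intro continuous_on_ln continuous_gjet(2)[where H="Hc (ch i)" and m=m, OF Hc_props(1)[OF ch[OF i]]] ballI)
    show "x \<in> S \<Longrightarrow> fst x \<in> snd (ch i) ` fst (ch i)" for x using K_pt(5)[OF i fK(1)] .
    fix x assume x: "x \<in> S"
    have "herm m (Hc (ch i)) (fst x) (snd x) > 0"
      using Hc_props(5)[OF ch[OF i] K_pt(5)[OF i fK(1)[OF x]]] SS_nonzero[OF fK(2)[OF x]] by blast
    then show "herm m (Hc (ch i)) (fst x) (snd x) \<noteq> 0" by simp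
  qed
  show ?thesis unfolding PC_def PhiC_def
    by (intro continuous_on_diff continuous_on_add continuous_on_mult continuous_on_const c1 c2 c3 c4 c5)
qed

text \<open>The pairs whose dominant component has squared modulus at least \<open>\<tau>\<close>
  form compact sets, on which a maximum exists. Below \<open>\<tau>\<close> the bound of
  \<open>PC_upper\<close> is at most the value at the given pair, so nothing larger is
  missed.\<close>

lemma max_exists:
  assumes W: "Wreg \<Lambda>" and \<delta>: "0 < \<delta>" "\<delta> \<le> 1" and A: "A \<ge> 0"
    and st: "i1 \<in> I" "j1 < n" "z1 \<in> K i1" "v1 \<in> SS m" "dominant i1 j1 z1 v1"
  shows "\<exists>i0\<in>I. \<exists>j0<n. \<exists>z0\<in>K i0. \<exists>v0\<in>SS m. dominant i0 j0 z0 v0 \<and>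
     (\<forall>i\<in>I. \<forall>j<n. \<forall>z\<in>K i. \<forall>v\<in>SS m. dominant i j z v \<longrightarrow> PC \<Lambda> \<delta> A i j z v \<le> PC \<Lambda> \<delta> A i0 j0 z0 v0)"
proof -
  obtain C where C: "\<And>i j z v. i \<in> I \<Longrightarrow> j < n \<Longrightarrow> z \<in> K i \<Longrightarrow> v \<in> SS m \<Longrightarrow> dominant i j z v \<Longrightarrow>
      PC \<Lambda> \<delta> A i j z v \<le> C + ln ((cmod (X i z v j))\<^sup>2)"
    using PC_upper[OF assms(1-4)] by blast
  define \<Phi> where "\<Phi> = PC \<Lambda> \<delta> A i1 j1 z1 v1"
  \<comment> \<open>The first entry keeps the given pair in the compact set; the second makes
    \<open>C + ln \<tau>\<close> at most \<open>\<Phi>\<close>.\<close>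
  define \<tau> where "\<tau> = min ((cmod (X i1 z1 v1 j1))\<^sup>2) (exp (\<Phi> - C))"
  have \<tau>: "\<tau> > 0" using st(5) by (simp add: \<tau>_def dominant_def)
  define S where "S q = {x \<in> {x \<in> K (fst q) \<times> SS m. \<forall>k<n. cmod (X (fst q) (fst x) (snd x) k) \<le> cmod (X (fst q) (fst x) (snd x) (snd q))}.
      \<tau> \<le> (cmod (X (fst q) (fst x) (snd x) (snd q)))\<^sup>2}" for q
  have Sd: "dominant (fst q) (snd q) (fst x) (snd x)" if "x \<in> S q" for q x
    using that \<tau> unfolding S_def dominant_def by auto
  have "\<exists>q0\<in>I \<times> {..<n}. \<exists>s0\<in>S q0. \<forall>q\<in>I \<times> {..<n}. \<forall>s\<in>S q. PC \<Lambda> \<delta> A (fst q) (snd q) (fst s) (snd s) \<le> PC \<Lambda> \<delta> A (fst q0) (snd q0) (fst s0) (snd s0)"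
  proof (rule finite_compact_max)
    show "finite (I \<times> {..<n})" using finI by simp
    fix q assume q: "q \<in> I \<times> {..<n}"
    then have qI: "fst q \<in> I" "snd q < n" by auto
    have cX: "continuous_on (K (fst q) \<times> SS m) (\<lambda>x. X (fst q) (fst x) (snd x) a)" for a
      by (rule continuous_on_subset[OF continuous_X[OF qI(1)]]) auto
    have 1: "compact {x \<in> K (fst q) \<times> SS m. \<forall>k<n. cmod (X (fst q) (fst x) (snd x) k) \<le> cmod (X (fst q) (fst x) (snd x) (snd q))}"
      by (intro compact_all_le compact_Times compact_K qI compact_SS continuous_on_norm cX)
    show "compact (S q)" unfolding S_def
      by (rule compact_le[OF 1 continuous_on_const]) (intro continuous_on_power continuous_on_norm continuous_on_subset[OF cX]; blast)
    show "continuous_on (S q) (\<lambda>s. PC \<Lambda> \<delta> A (fst q) (snd q) (fst s) (snd s))"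
      by (rule PC_cont[OF W qI _ Sd]) (auto simp: S_def)
  next
    show "(i1, j1) \<in> I \<times> {..<n}" using st by simp
    show "(z1, v1) \<in> S (i1, j1)" using st by (auto simp: S_def dominant_def \<tau>_def)
  qed
  then obtain q0 s0 where q0: "q0 \<in> I \<times> {..<n}" "s0 \<in> S q0"
    and mx: "\<And>q s. q \<in> I \<times> {..<n} \<Longrightarrow> s \<in> S q \<Longrightarrow> PC \<Lambda> \<delta> A (fst q) (snd q) (fst s) (snd s) \<le> PC \<Lambda> \<delta> A (fst q0) (snd q0) (fst s0) (snd s0)"
    by blast
  let ?m = "PC \<Lambda> \<delta> A (fst q0) (snd q0) (fst s0) (snd s0)"
  have in1: "(z1, v1) \<in> S (i1, j1)" using st by (auto simp: S_def dominant_def \<tau>_def)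
  have \<Phi>m: "\<Phi> \<le> ?m" using mx[OF _ in1] st unfolding \<Phi>_def by simp
  have "PC \<Lambda> \<delta> A i j z v \<le> ?m" if i: "i \<in> I" "j < n" "z \<in> K i" "v \<in> SS m" "dominant i j z v" for i j z v
  proof (cases "\<tau> \<le> (cmod (X i z v j))\<^sup>2")
    case True
    then have "(z, v) \<in> S (i, j)" using i by (auto simp: S_def dominant_def)
    from mx[OF _ this] show ?thesis using i by simp
  next
    case False
    have "0 < (cmod (X i z v j))\<^sup>2" using i(5) by (simp add: dominant_def)
    moreover have "(cmod (X i z v j))\<^sup>2 \<le> exp (\<Phi> - C)" using False by (simp add: \<tau>_def)
    ultimately have "ln ((cmod (X i z v j))\<^sup>2) \<le> \<Phi> - C" by (metis exp_gt_zero ln_exp ln_le_cancel_iff)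
    then show ?thesis using C[OF i] \<Phi>m by linarith
  qed
  moreover have "fst q0 \<in> I" "snd q0 < n" "fst s0 \<in> K (fst q0)" "snd s0 \<in> SS m" using q0 by (auto simp: S_def)
  ultimately show ?thesis using Sd[OF q0(2)] by blast
qed

lemma PC_PH:
  assumes i: "i \<in> I" and x: "x \<in> fst (ch i)" "snd (ch i) x \<in> K i" and V: "V \<in> vs_set (tangent_space M x)"
    and j: "j < n" "X i (snd (ch i) x) (V (ch i)) j \<noteq> 0" and L: "lscale \<Lambda>"
  shows "PC \<Lambda> \<delta> A i j (snd (ch i) x) (V (ch i)) = PH \<Lambda> \<delta> A i x V"
  unfolding PC_def PH_def by (rule PhiC_Ph[OF ch[OF i] x(1) dh[OF i] chart_K(1)[OF i x] V j L])

lemma dominant_exists: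
  assumes "X i z v \<noteq> (\<lambda>_. 0)"
  shows "\<exists>j<n. dominant i j z v"
proof -
  obtain k where k: "X i z v k \<noteq> 0" using assms by (auto simp: fun_eq_iff)
  then have kn: "k < n" by (cases "k < n") (auto simp: push_def)
  let ?h = "\<lambda>k. cmod (X i z v k)"
  have "Max (?h ` {..<n}) \<in> ?h ` {..<n}" using kn by (intro Max_in) auto
  then obtain j where j: "j < n" "?h j = Max (?h ` {..<n})" by auto
  have le: "?h k \<le> ?h j" if "k < n" for k unfolding j(2) using that by (intro Max_ge) auto
  then have "?h k \<le> ?h j" using kn by blast
  then have "X i z v j \<noteq> 0" using k by auto
  then show ?thesis using j(1) le unfolding dominant_def by blast
qed

text \<open>By homogeneity of degree 0 a vector may be scaled to the unit sphere of the chart, where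
  a dominant index turns \<open>PH\<close> into \<open>PC\<close> and the assumed bound
  applies.\<close>

lemma PH_le:
  assumes mx: "\<And>i j z v. i \<in> I \<Longrightarrow> j < n \<Longrightarrow> z \<in> K i \<Longrightarrow> v \<in> SS m \<Longrightarrow> dominant i j z v \<Longrightarrow> PC \<Lambda> \<delta> A i j z v \<le> R"
    and L: "lscale \<Lambda>" and i: "i \<in> I" and x: "x \<in> fst (ch i)" "snd (ch i) x \<in> K i" and V: "V \<in> vs_set (tangent_space M x)"
    and X: "X i (snd (ch i) x) (V (ch i)) \<noteq> (\<lambda>_. 0)"
  shows "PH \<Lambda> \<delta> A i x V \<le> R"
proof -
  let ?c = "ch i"
  note T = tangent_linear_iso[OF M ch[OF i] x(1)]
  have VC: "V ?c \<in> Cn m" using linear_isoD(6)[OF T V] m by simp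
  have X0: "X i z (\<lambda>_. 0) = (\<lambda>_. 0)" for z by (auto simp: push_def)
  have Vc0: "V ?c \<noteq> (\<lambda>_. 0)" using X X0 by metis
  then have V0: "V \<noteq> vs_zero (tangent_space M x)" using linear_isoD(3)[OF T] by metis
  define q where "q = (\<Sum>l<m. (cmod (V ?c l))\<^sup>2)"
  have q: "q > 0" using sum_sq_pos_iff[OF VC] Vc0 unfolding q_def by blast
  define k where "k = complex_of_real (1 / sqrt q)"
  have k: "k \<noteq> 0" "(cmod k)\<^sup>2 = 1 / q" using q by (auto simp: k_def norm_divide power_divide)
  let ?W = "vs_scale (tangent_space M x) k V"
  have W: "?W \<in> vs_set (tangent_space M x)" "?W ?c = (\<lambda>l. k * V ?c l)" using linear_isoD(5)[OF T V, of k] by auto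
  have "sqd m (?W ?c) (\<lambda>_. 0) = (cmod k)\<^sup>2 * q"
    unfolding W(2) sqd_def q_def by (simp add: norm_mult power_mult_distrib sum_distrib_left)
  then have WS: "?W ?c \<in> SS m" using k q VC unfolding SS_def W(2) by (simp add: Cn_def)
  have "X i (snd ?c x) (?W ?c) = (\<lambda>l. k * X i (snd ?c x) (V ?c) l)" unfolding W(2) by (rule push_scale)
  then have "X i (snd ?c x) (?W ?c) \<noteq> (\<lambda>_. 0)" using X k(1) by (auto simp: fun_eq_iff)
  then obtain j where j: "j < n" "dominant i j (snd ?c x) (?W ?c)" using dominant_exists by blast
  have "PC \<Lambda> \<delta> A i j (snd ?c x) (?W ?c) \<le> R" by (rule mx[OF i j(1) x(2) WS j(2)])
  also have "PC \<Lambda> \<delta> A i j (snd ?c x) (?W ?c) = PH \<Lambda> \<delta> A i x ?W"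
    using j(2) by (intro PC_PH[OF i x W(1) j(1) _ L]) (simp add: dominant_def)
  also have "\<dots> = PH \<Lambda> \<delta> A i x V"
    unfolding PH_def by (rule Ph_scale[OF ch[OF i] x(1) dh[OF i] chart_K(1)[OF i x] V X L k(1) V0])
  finally show ?thesis .
qed

text \<open>Passing to a piece in which the point is central changes the flat norm by a factor at most
  \<open>C1 = exp A\<close>, so a maximum with large bump term would not be maximal.\<close>

lemma max_interior:
  assumes mx: "\<And>i x V. i \<in> I \<Longrightarrow> x \<in> fst (ch i) \<Longrightarrow> snd (ch i) x \<in> K i \<Longrightarrow> V \<in> vs_set (tangent_space M x) \<Longrightarrow>
        X i (snd (ch i) x) (V (ch i)) \<noteq> (\<lambda>_. 0) \<Longrightarrow> PH \<Lambda> \<delta> A i x V \<le> PH \<Lambda> \<delta> A i0 x0 V0"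
    and i0: "i0 \<in> I" and x0: "x0 \<in> fst (ch i0)" "snd (ch i0) x0 \<in> K i0" and V0: "V0 \<in> vs_set (tangent_space M x0)"
    and X0: "X i0 (snd (ch i0) x0) (V0 (ch i0)) \<noteq> (\<lambda>_. 0)"
    and C1: "C1 \<ge> 2" "A = ln C1" and \<delta>: "\<delta> > 0"
    and ov: "\<And>i k x V. i \<in> I \<Longrightarrow> k \<in> I \<Longrightarrow> x \<in> fst (ch i) \<Longrightarrow> snd (ch i) x \<in> K i \<Longrightarrow> x \<in> fst (ch k) \<Longrightarrow> snd (ch k) x \<in> K k \<Longrightarrow> V \<in> vs_set (tangent_space M x) \<Longrightarrow>
       (\<Sum>a<n. (cmod (X k (snd (ch k) x) (V (ch k)) a))\<^sup>2) \<le> C1 * (\<Sum>a<n. (cmod (X i (snd (ch i) x) (V (ch i)) a))\<^sup>2)"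
  shows "sqd m (snd (ch i0) x0) (pt i0) < (2 * rad i0)\<^sup>2"
proof -
  have "x0 \<in> cm_pts M" using atlasD(3)[OF M ch[OF i0]] x0(1) by blast
  then obtain i where i: "i \<in> I" "x0 \<in> fst (ch i)" "sqd m (snd (ch i) x0) (pt i) < (rad i)\<^sup>2" using cover by blast
  have xK: "snd (ch i) x0 \<in> K i" using atlasD(4)[OF M ch[OF i(1)] i(2)] m i(3) by (intro in_KK) auto
  define s0 where "s0 = (\<Sum>a<n. (cmod (X i0 (snd (ch i0) x0) (V0 (ch i0)) a))\<^sup>2)"
  define s where "s = (\<Sum>a<n. (cmod (X i (snd (ch i) x0) (V0 (ch i)) a))\<^sup>2)"
  have s0: "s0 > 0" using sum_sq_pos_iff[OF push_Cn] X0 unfolding s0_def by blast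
  have ss: "s0 \<le> C1 * s" unfolding s_def s0_def by (rule ov[OF i(1) i0 i(2) xK x0 V0])
  have s: "s > 0" using ss s0 C1 by (smt (verit) zero_less_mult_iff)
  then have "X i (snd (ch i) x0) (V0 (ch i)) \<noteq> (\<lambda>_. 0)" using sum_sq_pos_iff[OF push_Cn] unfolding s_def by blast
  from mx[OF i(1,2) xK V0 this]
  have le: "PH \<Lambda> \<delta> A i x0 V0 \<le> PH \<Lambda> \<delta> A i0 x0 V0" .
  \<comment> \<open>The Finsler term and the metric term are the same for both pieces, so the
    comparison of \<open>PH\<close> reduces to the two \<open>\<delta>\<close>-terms.\<close>
  have Xi: "Xi N (dh i) (f x0) (X i (snd (ch i) x0) (V0 (ch i))) = Xi N (dh i0) (f x0) (X i0 (snd (ch i0) x0) (V0 (ch i0)))"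
    by (rule Xi_push_change[OF ch[OF i0] ch[OF i(1)] x0(1) i(2) dh[OF i0] dh[OF i(1)] chart_K(1)[OF i0 x0] chart_K(1)[OF i(1,2) xK] V0])
  have "\<delta> * (- (A / (rad i)\<^sup>2) * sqd m (snd (ch i) x0) (pt i) + ln s) \<le> \<delta> * (- (A / (rad i0)\<^sup>2) * sqd m (snd (ch i0) x0) (pt i0) + ln s0)"
    using le unfolding PH_def Ph_def Xi s_def[symmetric] s0_def[symmetric] by linarith
  then have 1: "- (A / (rad i)\<^sup>2) * sqd m (snd (ch i) x0) (pt i) + ln s \<le> - (A / (rad i0)\<^sup>2) * sqd m (snd (ch i0) x0) (pt i0) + ln s0"
    using \<delta> by simp
  have A: "A > 0" using C1 by simp
  have "ln s0 \<le> ln (C1 * s)" using ss s0 by simp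
  also have "\<dots> = A + ln s" using C1 s by (simp add: ln_mult_pos)
  finally have 2: "ln s0 \<le> A + ln s" .
  have r: "0 < (rad i)\<^sup>2" "0 < (rad i0)\<^sup>2" using rad[OF i(1)] rad[OF i0] by auto
  have 3: "A / (rad i)\<^sup>2 * sqd m (snd (ch i) x0) (pt i) \<le> A"
  proof -
    have "A / (rad i)\<^sup>2 * sqd m (snd (ch i) x0) (pt i) \<le> A / (rad i)\<^sup>2 * (rad i)\<^sup>2" using i(3) A r by (intro mult_left_mono) auto
    also have "\<dots> = A" using r by simp
    finally show ?thesis .
  qed
  \<comment> \<open>One \<open>A\<close> pays for the change of the flat norm, the other for the
    bump of the second piece, whose value is small because the point lies in the undoubled
    ball.\<close>
  have "A / (rad i0)\<^sup>2 * sqd m (snd (ch i0) x0) (pt i0) \<le> 2 * A" using 1 2 3 by (simp add: minus_mult_left[symmetric])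
  then have "A * sqd m (snd (ch i0) x0) (pt i0) \<le> A * (2 * (rad i0)\<^sup>2)" using r by (simp add: field_simps)
  then have "sqd m (snd (ch i0) x0) (pt i0) \<le> 2 * (rad i0)\<^sup>2" using A by simp
  also have "\<dots> < (2 * rad i0)\<^sup>2" using r by (simp add: power_mult_distrib)
  finally show ?thesis .
qed

text \<open>Being interior keeps the line inside the piece for small \<open>t\<close>, and the
  component \<open>j\<close> stays nonzero. It may cease to be dominant along the line, so the
  comparison is made through \<open>PH\<close>, which does not refer to \<open>j\<close>.\<close>

lemma max_local:
  assumes mx: "\<And>x V. x \<in> fst (ch i) \<Longrightarrow> snd (ch i) x \<in> K i \<Longrightarrow> V \<in> vs_set (tangent_space M x) \<Longrightarrow>
        X i (snd (ch i) x) (V (ch i)) \<noteq> (\<lambda>_. 0) \<Longrightarrow> PH \<Lambda> \<delta> A i x V \<le> R"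
    and L: "lscale \<Lambda>" and i: "i \<in> I" and z: "z \<in> Cn m" "sqd m z (pt i) < (2 * rad i)\<^sup>2" and v: "v \<in> Cn m" and j: "j < n" "X i z v j \<noteq> 0"
    and u: "u \<in> Cn m" and b: "b \<in> Cn m"
  shows "\<forall>\<^sub>F t in nhds 0. PC \<Lambda> \<delta> A i j (\<lambda>k. z k + t * u k) (\<lambda>k. v k + t * b k) \<le> R"
proof -
  define zt where "zt t = (\<lambda>k. z k + t * u k)" for t :: complex
  define vt where "vt t = (\<lambda>k. v k + t * b k)" for t :: complex
  have C: "zt t \<in> Cn m" "vt t \<in> Cn m" for t unfolding zt_def vt_def by (intro Cn_add z(1) v Cn_scale u b)+
  have cz: "continuous_on UNIV zt" "continuous_on UNIV vt"
    unfolding zt_def vt_def by (intro continuous_on_coordinatewise_then_product continuous_intros)+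
  define T where "T = {t. sqd m (zt t) (pt i) < (2 * rad i)\<^sup>2}"
  have oT: "open T" unfolding T_def
    by (intro open_Collect_less continuous_on_const continuous_on_compose2[OF continuous_on_sqd[of UNIV] cz(1)]) auto
  have TK: "zt t \<in> K i" if "t \<in> T" for t using that C(1) by (simp add: T_def KK_def)
  have "continuous_on T (\<lambda>t. X i (fst (zt t, vt t)) (snd (zt t, vt t)) j)"
    by (rule continuous_on_compose2[OF continuous_X[OF i]])
      (use TK in \<open>auto intro!: continuous_on_Pair continuous_on_subset[OF cz(1)] continuous_on_subset[OF cz(2)]\<close>)
  then have "open (T \<inter> (\<lambda>t. X i (zt t) (vt t) j) -` (- {0}))"
    by (intro continuous_open_preimage oT) auto
  moreover have "0 \<in> T \<inter> (\<lambda>t. X i (zt t) (vt t) j) -` (- {0})" using z j by (simp add: T_def zt_def vt_def)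
  ultimately have "\<forall>\<^sub>F t in nhds 0. t \<in> T \<inter> (\<lambda>t. X i (zt t) (vt t) j) -` (- {0})" by (rule eventually_nhds_in_open)
  then have "\<forall>\<^sub>F t in nhds 0. PC \<Lambda> \<delta> A i j (zt t) (vt t) \<le> R"
  proof (rule eventually_mono)
    fix t assume "t \<in> T \<inter> (\<lambda>t. X i (zt t) (vt t) j) -` (- {0})"
    then have t: "zt t \<in> K i" "X i (zt t) (vt t) j \<noteq> 0" using TK by auto
    define x where "x = chart_inv (ch i) (zt t)"
    have x: "x \<in> fst (ch i)" "snd (ch i) x = zt t" unfolding x_def using K_pt[OF i t(1)] by auto
    note Ti = tangent_linear_iso[OF M ch[OF i] x(1)]
    define V where "V = linv (tangent_space M x) (\<lambda>v. v (ch i)) (vt t)"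
    have V: "V \<in> vs_set (tangent_space M x)" "V (ch i) = vt t" unfolding V_def using linv[OF Ti] C(2) m by auto
    have "PC \<Lambda> \<delta> A i j (snd (ch i) x) (V (ch i)) = PH \<Lambda> \<delta> A i x V"
      by (rule PC_PH[OF i x(1) _ V(1) j(1) _ L]) (use x V t in auto)
    moreover have "PH \<Lambda> \<delta> A i x V \<le> R"
      by (rule mx[OF x(1) _ V(1)]) (use x V t in auto)
    ultimately show "PC \<Lambda> \<delta> A i j (zt t) (vt t) \<le> R" using x V by simp
  qed
  then show ?thesis unfolding zt_def vt_def .
qed

end

lemma Ck_on_subset: "Ck_on n k U f \<Longrightarrow> V \<subseteq> U \<Longrightarrow> Ck_on n k V f"
  by (induction k arbitrary: f) (auto intro: continuous_on_subset)

lemma sum_sq_le_cnrm: "(\<Sum>i<m. (cmod (u i))\<^sup>2) \<le> (cnrm m u)\<^sup>2"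
proof -
  have "L2_set (\<lambda>i. cmod (u i)) {..<m} \<le> cnrm m u" unfolding cnrm_def by (rule L2_set_le_sum) simp
  then have "(L2_set (\<lambda>i. cmod (u i)) {..<m})\<^sup>2 \<le> (cnrm m u)\<^sup>2" by (intro power_mono L2_set_nonneg)
  then show ?thesis unfolding L2_set_def by (simp add: sum_nonneg)
qed

lemma cnrm_push_le:
  assumes pd: "(\<Sum>a<n. \<Sum>l<m. cmod (pd l (h a) z)) \<le> B" and u: "cnrm m u \<le> B"
  shows "cnrm n (push m n h z u) \<le> B\<^sup>2"
proof -
  have B: "B \<ge> 0" using u cnrm_nonneg[of m u] by linarith
  have "cmod (push m n h z u a) \<le> (\<Sum>l<m. cmod (pd l (h a) z)) * B" if "a < n" for a
  proof -
    have "cmod (push m n h z u a) \<le> (\<Sum>l<m. cmod (pd l (h a) z * u l))"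
      using that unfolding push_def by (simp only: if_True) (rule norm_sum)
    also have "\<dots> \<le> (\<Sum>l<m. cmod (pd l (h a) z) * B)"
    proof (rule sum_mono)
      fix l assume "l \<in> {..<m}"
      then have "cmod (u l) \<le> cnrm m u" unfolding cnrm_def by (intro member_le_sum) auto
      then have "cmod (u l) \<le> B" using u by linarith
      then show "cmod (pd l (h a) z * u l) \<le> cmod (pd l (h a) z) * B" by (simp add: norm_mult mult_left_mono)
    qed
    finally show ?thesis by (simp add: sum_distrib_right)
  qed
  then have "cnrm n (push m n h z u) \<le> (\<Sum>a<n. (\<Sum>l<m. cmod (pd l (h a) z)) * B)"
    unfolding cnrm_def by (intro sum_mono) auto
  also have "\<dots> = (\<Sum>a<n. \<Sum>l<m. cmod (pd l (h a) z)) * B" by (simp add: sum_distrib_right)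
  also have "\<dots> \<le> B * B" using pd B by (rule mult_right_mono)
  finally show ?thesis by (simp add: power2_eq_square)
qed

context rc_cover
begin

text \<open>\<open>nef_weight\<close> for the cotangent bundle, restricted to the trivialisations of
  the bidual that come from charts of \<open>N\<close>.\<close>

lemma nef_weights:
  assumes nef: "nef_vector_bundle (cotangent_bundle N)" and n1: "1 \<le> n"
  shows "\<exists>C. (\<forall>d\<in>cm_atlas N. \<forall>j<n. continuous_on (pdom n NN d (fst d)) (C d j)) \<and>
    (\<forall>\<epsilon>>0. \<exists>\<Lambda>. lscale \<Lambda> \<and> Wreg \<Lambda> \<and> (\<forall>d\<in>cm_atlas N. \<forall>j<n. \<forall>\<zeta>\<in>pdom n NN d (fst d). \<forall>a\<in>Cn NN.
       Re (levi NN (\<lambda>\<zeta>. of_real (Wt \<Lambda> d j \<zeta>)) \<zeta> a) \<le> \<epsilon> * (C d j \<zeta> * (cnrm NN a)\<^sup>2)))"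
proof -
  have e: "n = cm_dim (vb_base (cotangent_bundle N))" "n = vb_rank (cotangent_bundle N)" using n by auto
  obtain C where C: "\<forall>c\<in>cm_atlas N. \<forall>t\<in>vb_triv (bidual N). \<forall>k<n. continuous_on (pdom n NN c (fst t)) (C c t k)"
    and ex: "\<forall>\<epsilon>>0. \<exists>\<Lambda>.
      (\<forall>x\<in>cm_pts N. \<forall>\<xi>\<in>vs_set (vb_fib (bidual N) x). \<forall>a. \<xi> \<noteq> vs_zero (vb_fib (bidual N) x) \<longrightarrow> a \<noteq> 0 \<longrightarrow>
         \<Lambda> x (vs_scale (vb_fib (bidual N) x) a \<xi>) = \<Lambda> x \<xi> - 2 * ln (cmod a)) \<and>
      (\<forall>c\<in>cm_atlas N. \<forall>t\<in>vb_triv (bidual N). \<forall>k<n.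
         Ck_on NN 2 (pdom n NN c (fst t)) (\<lambda>\<zeta>. of_real (\<Lambda> (pbase n c \<zeta>) (pvec (bidual N) n n c t k \<zeta>))) \<and>
         (\<forall>\<zeta>\<in>pdom n NN c (fst t). \<forall>a\<in>Cn NN.
            Re (levi NN (\<lambda>\<zeta>. of_real (\<Lambda> (pbase n c \<zeta>) (pvec (bidual N) n n c t k \<zeta>))) \<zeta> a) \<le> \<epsilon> * (C c t k \<zeta> * (cnrm NN a)\<^sup>2)))"
    using nef_weight[OF hvb_cotangent[OF N] bidual_def e n1 NN nef] unfolding cotangent_simps(1) by (elim exE conjE) (rule that; assumption)
  show ?thesis
  proof (intro exI[of _ "\<lambda>d. C d (bitriv N d)"] conjI ballI allI impI)
    show "continuous_on (pdom n NN d (fst d)) (C d (bitriv N d) j)" if "d \<in> cm_atlas N" "j < n" for d j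
      using C that bitriv_in[OF that(1)] by fastforce
    fix \<epsilon> :: real assume "\<epsilon> > 0"
    then obtain \<Lambda> where sc: "\<forall>x\<in>cm_pts N. \<forall>\<xi>\<in>vs_set (vb_fib (bidual N) x). \<forall>a. \<xi> \<noteq> vs_zero (vb_fib (bidual N) x) \<longrightarrow> a \<noteq> 0 \<longrightarrow>
         \<Lambda> x (vs_scale (vb_fib (bidual N) x) a \<xi>) = \<Lambda> x \<xi> - 2 * ln (cmod a)"
      and rest0: "\<forall>c\<in>cm_atlas N. \<forall>t\<in>vb_triv (bidual N). \<forall>k<n.
         Ck_on NN 2 (pdom n NN c (fst t)) (\<lambda>\<zeta>. of_real (\<Lambda> (pbase n c \<zeta>) (pvec (bidual N) n n c t k \<zeta>))) \<and>
         (\<forall>\<zeta>\<in>pdom n NN c (fst t). \<forall>a\<in>Cn NN.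
            Re (levi NN (\<lambda>\<zeta>. of_real (\<Lambda> (pbase n c \<zeta>) (pvec (bidual N) n n c t k \<zeta>))) \<zeta> a) \<le> \<epsilon> * (C c t k \<zeta> * (cnrm NN a)\<^sup>2))"
      using ex[rule_format, OF \<open>\<epsilon> > 0\<close>] by (elim exE conjE) (rule that; assumption)
    note rest = rest0[rule_format]
    have "lscale \<Lambda>" unfolding lscale_def by (rule sc)
    moreover have "Wreg \<Lambda>"
      unfolding Wreg_def Wt_def using rest[OF _ bitriv_in, unfolded fst_bitriv] by blast
    moreover have "\<forall>d\<in>cm_atlas N. \<forall>j<n. \<forall>\<zeta>\<in>pdom n NN d (fst d). \<forall>a\<in>Cn NN.
       Re (levi NN (\<lambda>\<zeta>. of_real (Wt \<Lambda> d j \<zeta>)) \<zeta> a) \<le> \<epsilon> * (C d (bitriv N d) j \<zeta> * (cnrm NN a)\<^sup>2)"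
      unfolding Wt_def using rest[OF _ bitriv_in, unfolded fst_bitriv] by blast
    ultimately show "\<exists>\<Lambda>. lscale \<Lambda> \<and> Wreg \<Lambda> \<and> (\<forall>d\<in>cm_atlas N. \<forall>j<n. \<forall>\<zeta>\<in>pdom n NN d (fst d). \<forall>a\<in>Cn NN.
       Re (levi NN (\<lambda>\<zeta>. of_real (Wt \<Lambda> d j \<zeta>)) \<zeta> a) \<le> \<epsilon> * (C d (bitriv N d) j \<zeta> * (cnrm NN a)\<^sup>2))" by blast
  qed
qed

text \<open>A vector with nonzero image provides the pair from which \<open>max_exists\<close>
  starts. At the maximiser the second variation along the direction from \<open>bound_RC\<close>
  yields the inequality that \<open>second_variation_arith\<close> refutes.\<close>

lemma push_zero:
  assumes nef: "nef_vector_bundle (cotangent_bundle N)" and i: "i1 \<in> I" and z: "z1 \<in> K i1" and w: "w \<in> Cn m"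
  shows "X i1 z1 w = (\<lambda>_. 0)"
proof (rule ccontr)
  assume X1: "X i1 z1 w \<noteq> (\<lambda>_. 0)"
  have X0: "X i z (\<lambda>_. 0) = (\<lambda>_. 0)" for i z by (auto simp: push_def)
  have "w \<noteq> (\<lambda>_. 0)" using X1 X0 by metis
  then have q: "(\<Sum>l<m. (cmod (w l))\<^sup>2) > 0" using sum_sq_pos_iff[OF w] by blast
  define q where "q = (\<Sum>l<m. (cmod (w l))\<^sup>2)"
  define k where "k = complex_of_real (1 / sqrt q)"
  have k: "k \<noteq> 0" "(cmod k)\<^sup>2 = 1 / q" using q by (auto simp: k_def q_def[symmetric] norm_divide power_divide)
  define v1 where "v1 = (\<lambda>l. k * w l)"
  have "sqd m v1 (\<lambda>_. 0) = (cmod k)\<^sup>2 * q"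
    unfolding v1_def sqd_def q_def by (simp add: norm_mult power_mult_distrib sum_distrib_left)
  then have v1: "v1 \<in> SS m" using k q w unfolding SS_def v1_def q_def by (simp add: Cn_def)
  have "X i1 z1 v1 = (\<lambda>l. k * X i1 z1 w l)" unfolding v1_def by (rule push_scale)
  then have "X i1 z1 v1 \<noteq> (\<lambda>_. 0)" using X1 k(1) by (auto simp: fun_eq_iff)
  then obtain j1 where j1: "j1 < n" "dominant i1 j1 z1 v1" using dominant_exists by blast
  \<comment> \<open>With truncated subtraction the tautological quotient has rank n - (n - 1), which
    is 1 exactly when \<open>n\<close> is positive.\<close>
  have n1: "1 \<le> n" using j1 by simp
  obtain C where C: "\<And>d j. d \<in> cm_atlas N \<Longrightarrow> j < n \<Longrightarrow> continuous_on (pdom n NN d (fst d)) (C d j)"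
    and nw: "\<And>\<epsilon>. \<epsilon> > 0 \<Longrightarrow> \<exists>\<Lambda>. lscale \<Lambda> \<and> Wreg \<Lambda> \<and> (\<forall>d\<in>cm_atlas N. \<forall>j<n. \<forall>\<zeta>\<in>pdom n NN d (fst d). \<forall>a\<in>Cn NN.
       Re (levi NN (\<lambda>\<zeta>. of_real (Wt \<Lambda> d j \<zeta>)) \<zeta> a) \<le> \<epsilon> * (C d j \<zeta> * (cnrm NN a)\<^sup>2))"
    using nef_weights[OF nef n1] by blast
  obtain B1 where B1: "B1 \<ge> 1" "\<And>i z v. i \<in> I \<Longrightarrow> z \<in> K i \<Longrightarrow> v \<in> SS m \<Longrightarrow> \<exists>u\<in>Cn m. \<exists>b\<in>Cn m. cnrm m u \<le> B1 \<and>
     0 \<le> - Re (gjet m m (Hc (ch i)) z v u b) \<and> herm m (Hc (ch i)) z v \<le> B1 * - Re (gjet m m (Hc (ch i)) z v u b)"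
    using bound_RC by blast
  obtain B2 where B2: "\<And>i z. i \<in> I \<Longrightarrow> z \<in> K i \<Longrightarrow> (\<Sum>a<n. \<Sum>l<m. cmod (pd l (fh (ch i) (dh i) a) z)) \<le> B2" "\<And>i. i \<in> I \<Longrightarrow> 1 / (rad i)\<^sup>2 \<le> B2"
    using bound_pd by blast
  obtain B3 where B3: "\<And>i j z a. i \<in> I \<Longrightarrow> j < n \<Longrightarrow> z \<in> K i \<Longrightarrow> a \<in> polydisc j \<Longrightarrow> C (dh i) j (enc n n j (\<lambda>k. fh (ch i) (dh i) k z) a) \<le> B3"
    using bound_enc[of C, OF C] by blast
  obtain C0 where C0: "\<And>i k x V. i \<in> I \<Longrightarrow> k \<in> I \<Longrightarrow> x \<in> fst (ch i) \<Longrightarrow> snd (ch i) x \<in> K i \<Longrightarrow> x \<in> fst (ch k) \<Longrightarrow> snd (ch k) x \<in> K k \<Longrightarrow> V \<in> vs_set (tangent_space M x) \<Longrightarrow>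
     (\<Sum>a<n. (cmod (X k (snd (ch k) x) (V (ch k)) a))\<^sup>2) \<le> C0 * (\<Sum>a<n. (cmod (X i (snd (ch i) x) (V (ch i)) a))\<^sup>2)"
    using bound_overlap by blast
  \<comment> \<open>The constants collected here and \<open>C0\<close> belong to the fixed geometry;
    the weight \<open>\<Lambda>\<close> is chosen after them.\<close>
  define B where "B = max B1 (max B2 B3)"
  have B: "B \<ge> 1" "B1 \<le> B" "B2 \<le> B" "B3 \<le> B" using B1(1) by (auto simp: B_def)
  \<comment> \<open>The lower bound 2 makes \<open>A = ln C1\<close> strictly positive, so that the
    bump can push the maximum inwards.\<close>
  define C1 where "C1 = max 2 C0"
  have ov: "(\<Sum>a<n. (cmod (X k (snd (ch k) x) (V (ch k)) a))\<^sup>2) \<le> C1 * (\<Sum>a<n. (cmod (X i (snd (ch i) x) (V (ch i)) a))\<^sup>2)"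
    if "i \<in> I" "k \<in> I" "x \<in> fst (ch i)" "snd (ch i) x \<in> K i" "x \<in> fst (ch k)" "snd (ch k) x \<in> K k" "V \<in> vs_set (tangent_space M x)" for i k x V
  proof -
    have "C0 * (\<Sum>a<n. (cmod (X i (snd (ch i) x) (V (ch i)) a))\<^sup>2) \<le> C1 * (\<Sum>a<n. (cmod (X i (snd (ch i) x) (V (ch i)) a))\<^sup>2)"
      by (intro mult_right_mono sum_nonneg) (auto simp: C1_def)
    then show ?thesis using C0[OF that] by linarith
  qed
  define A where "A = ln C1"
  have A: "A \<ge> 0" by (simp add: A_def C1_def)
  define \<delta> where "\<delta> = 1 / (2 * B * (A * B ^ 3 + B ^ 4 + 1))"
  define \<epsilon> where "\<epsilon> = \<delta> / (2 * real n ^ 3 * B)"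
  have Q: "A * B ^ 3 + B ^ 4 + 1 \<ge> 1" using A B by simp
  have "2 * B * (A * B ^ 3 + B ^ 4 + 1) \<ge> 1 * 1" using Q B by (intro mult_mono) auto
  then have \<delta>: "0 < \<delta>" "\<delta> \<le> 1" by (auto simp: \<delta>_def divide_le_eq_1)
  have \<epsilon>: "\<epsilon> > 0" using \<delta> n1 B by (simp add: \<epsilon>_def)
  obtain \<Lambda> where L: "lscale \<Lambda>" and W: "Wreg \<Lambda>" and lev: "\<And>d j \<zeta> a. d \<in> cm_atlas N \<Longrightarrow> j < n \<Longrightarrow> \<zeta> \<in> pdom n NN d (fst d) \<Longrightarrow> a \<in> Cn NN \<Longrightarrow>
       Re (levi NN (\<lambda>\<zeta>. of_real (Wt \<Lambda> d j \<zeta>)) \<zeta> a) \<le> \<epsilon> * (C d j \<zeta> * (cnrm NN a)\<^sup>2)"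
    using nw[OF \<epsilon>] by blast
  obtain i0 j0 z0 v0 where m0: "i0 \<in> I" "j0 < n" "z0 \<in> K i0" "v0 \<in> SS m" "dominant i0 j0 z0 v0"
    and mx: "\<And>i j z v. i \<in> I \<Longrightarrow> j < n \<Longrightarrow> z \<in> K i \<Longrightarrow> v \<in> SS m \<Longrightarrow> dominant i j z v \<Longrightarrow> PC \<Lambda> \<delta> A i j z v \<le> PC \<Lambda> \<delta> A i0 j0 z0 v0"
    using max_exists[OF W \<delta> A i j1(1) z v1 j1(2)] by blast
  note i0 = m0(1) and j0 = m0(2) and z0 = m0(3)
  note Kz = K_pt[OF i0 z0]
  have v0: "v0 \<in> Cn m" "v0 \<noteq> (\<lambda>_. 0)" using SS_nonzero[OF m0(4)] by auto
  have Xj: "X i0 z0 v0 j0 \<noteq> 0" "\<And>k. k < n \<Longrightarrow> cmod (X i0 z0 v0 k) \<le> cmod (X i0 z0 v0 j0)"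
    using m0(5) unfolding dominant_def by auto
  define x0 where "x0 = chart_inv (ch i0) z0"
  have x0: "x0 \<in> fst (ch i0)" "snd (ch i0) x0 = z0" unfolding x0_def by (rule Kz(1), rule Kz(3))
  note T0 = tangent_linear_iso[OF M ch[OF i0] x0(1)]
  define V0 where "V0 = linv (tangent_space M x0) (\<lambda>v. v (ch i0)) v0"
  have V0: "V0 \<in> vs_set (tangent_space M x0)" "V0 (ch i0) = v0" unfolding V0_def using linv[OF T0] v0 m by auto
  have x0K: "snd (ch i0) x0 \<in> K i0" using x0(2) z0 by simp
  have XV0: "X i0 (snd (ch i0) x0) (V0 (ch i0)) j0 \<noteq> 0" unfolding x0(2) V0(2) by (rule Xj(1))
  have R: "PC \<Lambda> \<delta> A i0 j0 z0 v0 = PH \<Lambda> \<delta> A i0 x0 V0"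
    using PC_PH[OF i0 x0(1) x0K V0(1) j0 XV0 L] unfolding x0(2) V0(2) .
  have PHle: "PH \<Lambda> \<delta> A i x V \<le> PC \<Lambda> \<delta> A i0 j0 z0 v0"
    if "i \<in> I" "x \<in> fst (ch i)" "snd (ch i) x \<in> K i" "V \<in> vs_set (tangent_space M x)" "X i (snd (ch i) x) (V (ch i)) \<noteq> (\<lambda>_. 0)" for i x V
    by (rule PH_le[OF _ L that], rule mx)
  have XV0': "X i0 (snd (ch i0) x0) (V0 (ch i0)) \<noteq> (\<lambda>_. 0)" using XV0 by metis
  have int: "sqd m (snd (ch i0) x0) (pt i0) < (2 * rad i0)\<^sup>2"
  proof (rule max_interior[OF _ i0 x0(1) x0K V0(1) XV0' _ A_def \<delta>(1)])
    show "PH \<Lambda> \<delta> A i x V \<le> PH \<Lambda> \<delta> A i0 x0 V0"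
      if "i \<in> I" "x \<in> fst (ch i)" "snd (ch i) x \<in> K i" "V \<in> vs_set (tangent_space M x)" "X i (snd (ch i) x) (V (ch i)) \<noteq> (\<lambda>_. 0)" for i x V
      using PHle[OF that] unfolding R .
    show "C1 \<ge> 2" by (simp add: C1_def)
  qed (rule ov)
  obtain u b where ub: "u \<in> Cn m" "b \<in> Cn m" and uB: "cnrm m u \<le> B1"
    and g0: "0 \<le> - Re (gjet m m (Hc (ch i0)) z0 v0 u b)" "herm m (Hc (ch i0)) z0 v0 \<le> B1 * - Re (gjet m m (Hc (ch i0)) z0 v0 u b)"
    using B1(2)[OF i0 z0 m0(4)] by blast
  have loc: "\<forall>\<^sub>F t in nhds 0. PC \<Lambda> \<delta> A i0 j0 (\<lambda>k. z0 k + t * u k) (\<lambda>k. v0 k + t * b k) \<le> PC \<Lambda> \<delta> A i0 j0 z0 v0"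
    by (rule max_local[OF _ L i0 Kz(6) int[unfolded x0(2)] v0(1) j0 Xj(1) ub], rule PHle[OF i0])
  let ?H = "Hc (ch i0)" and ?d = "dh i0" and ?\<zeta> = "enc n n j0 (\<lambda>k. fh (ch i0) (dh i0) k z0) (\<lambda>k. X i0 z0 v0 k / X i0 z0 v0 j0)"
  note box0 = dominant_box[OF j0 m0(5)]
  have \<zeta>in: "?\<zeta> \<in> pdom n NN ?d (fst ?d)"
    using box0 j0 Xj(1) by (intro enc_in_pdom[OF i0 z0 j0]) (auto simp: polydisc_def)
  have Gpos: "herm m ?H z0 v0 > 0" by (rule Hc_props(5)[OF ch[OF i0] Kz(5) v0])
  have "\<exists>S\<ge>0. - Re (gjet m m ?H z0 v0 u b) / herm m ?H z0 v0 + \<delta> * S / (real n)\<^sup>2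
     \<le> \<delta> * (A / (rad i0)\<^sup>2) * (\<Sum>i<m. (cmod (u i))\<^sup>2) + (1 - \<delta>) * ((\<epsilon> * B) * (2 * (cnrm n (X i0 z0 u))\<^sup>2 + 2 * real n * S))"
  proof (rule second_variation[where D="pdom n NN ?d (fst ?d)" and W="Wt \<Lambda> ?d j0" and v=v0 and b=b and j=j0 and p="pt i0" and \<Omega>="Om (ch i0) ?d" and N=NN])
    show "open_Cn m (Om (ch i0) ?d)" by (rule Om_props(1)[OF ch[OF i0] dh[OF i0]])
    show "holo_on m (Om (ch i0) ?d) (fh (ch i0) ?d i)" if "i < n" for i by (rule Om_props(2)[OF ch[OF i0] dh[OF i0] that])
    show "z0 \<in> Om (ch i0) ?d" by (rule Kz(4))
    show "u \<in> Cn m" "v0 \<in> Cn m" "b \<in> Cn m" by fact+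
    show "NN = n + (n - 1)" by (rule NN)
    show "open_Cn NN (pdom n NN ?d (fst ?d))"
      by (rule pdom_open[OF bd NN]) (simp_all add: dh[OF i0] openin_chart[OF N])
    show "Ck_on NN 2 (pdom n NN ?d (fst ?d)) (\<lambda>\<zeta>. of_real (Wt \<Lambda> ?d j0 \<zeta>))" using W dh[OF i0] j0 unfolding Wreg_def by blast
    show "j0 < n" "X i0 z0 v0 j0 \<noteq> 0" by (rule j0, rule Xj(1))
    show "cmod (X i0 z0 v0 i) \<le> cmod (X i0 z0 v0 j0)" if "i < n" for i by (rule Xj(2)[OF that])
    show "?\<zeta> \<in> pdom n NN ?d (fst ?d)" by (rule \<zeta>in)
    show "Re (levi NN (\<lambda>\<zeta>. of_real (Wt \<Lambda> ?d j0 \<zeta>)) ?\<zeta> a) \<le> \<epsilon> * B * (cnrm NN a)\<^sup>2" if "a \<in> Cn NN" for a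
    proof -
      have "C ?d j0 ?\<zeta> \<le> B" using B3[OF i0 j0 z0 box0] B(4) by linarith
      then have "\<epsilon> * (C ?d j0 ?\<zeta> * (cnrm NN a)\<^sup>2) \<le> \<epsilon> * (B * (cnrm NN a)\<^sup>2)" using \<epsilon> by (intro mult_left_mono mult_right_mono) auto
      then show ?thesis using lev[OF dh[OF i0] j0 \<zeta>in that] by (simp add: mult.assoc)
    qed
    show "\<epsilon> * B \<ge> 0" using \<epsilon> B by simp
    show "0 < \<delta>" "\<delta> \<le> 1" by (rule \<delta>)+
    show "Ck_on m 2 (Om (ch i0) ?d) (?H \<alpha> \<beta>)" if "\<alpha> < m" "\<beta> < m" for \<alpha> \<beta>
      by (rule Ck_on_subset[OF Hc_props(1)[OF ch[OF i0] that] Om_props(3)[OF ch[OF i0] dh[OF i0]]])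
    show "?H \<beta> \<alpha> w = cnj (?H \<alpha> \<beta> w)" if "\<alpha> < m" "\<beta> < m" "w \<in> Om (ch i0) ?d" for \<alpha> \<beta> w
      using Hc_props(2)[OF ch[OF i0] that(1,2)] that(3) Om_props(3)[OF ch[OF i0] dh[OF i0]] by blast
    show "herm m ?H z0 v0 > 0" by (rule Gpos)
    show "\<forall>\<^sub>F t in nhds 0. PhiC m n (fh (ch i0) ?d) (Wt \<Lambda> ?d j0) ?H \<delta> (A / (rad i0)\<^sup>2) (pt i0) j0 (\<lambda>i. z0 i + t * u i) (\<lambda>i. v0 i + t * b i)
        \<le> PhiC m n (fh (ch i0) ?d) (Wt \<Lambda> ?d j0) ?H \<delta> (A / (rad i0)\<^sup>2) (pt i0) j0 z0 v0"
      using loc unfolding PC_def .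
  qed
  then obtain S where S: "S \<ge> 0" and le: "- Re (gjet m m ?H z0 v0 u b) / herm m ?H z0 v0 + \<delta> * S / (real n)\<^sup>2
     \<le> \<delta> * (A / (rad i0)\<^sup>2) * (\<Sum>i<m. (cmod (u i))\<^sup>2) + (1 - \<delta>) * ((\<epsilon> * B) * (2 * (cnrm n (X i0 z0 u))\<^sup>2 + 2 * real n * S))" by blast
  show False
  proof (rule second_variation_arith[of B A "real n" S \<delta> \<epsilon> "- Re (gjet m m ?H z0 v0 u b) / herm m ?H z0 v0" "\<Sum>i<m. (cmod (u i))\<^sup>2" "1 / (rad i0)\<^sup>2" "cnrm n (X i0 z0 u)"])
    show "B \<ge> 1" "A \<ge> 0" "real n \<ge> 1" "S \<ge> 0" using B A n1 S by auto
    show "\<delta> = 1 / (2 * B * (A * B ^ 3 + B ^ 4 + 1))" "\<epsilon> = \<delta> / (2 * real n ^ 3 * B)" by (rule \<delta>_def, rule \<epsilon>_def)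
    have "herm m ?H z0 v0 \<le> B * - Re (gjet m m ?H z0 v0 u b)" using g0 mult_right_mono[OF B(2) g0(1)] by linarith
    then show "1 / B \<le> - Re (gjet m m ?H z0 v0 u b) / herm m ?H z0 v0" using B Gpos by (simp add: field_simps)
    show "0 \<le> (\<Sum>i<m. (cmod (u i))\<^sup>2)" by (intro sum_nonneg) auto
    have "(cnrm m u)\<^sup>2 \<le> B\<^sup>2" using uB B(2) cnrm_nonneg[of m u] by (intro power_mono) auto
    then show "(\<Sum>i<m. (cmod (u i))\<^sup>2) \<le> B\<^sup>2" using sum_sq_le_cnrm[of u m] by linarith
    show "0 \<le> 1 / (rad i0)\<^sup>2" by simp
    show "1 / (rad i0)\<^sup>2 \<le> B" using B2(2)[OF i0] B(3) by linarith
    show "0 \<le> cnrm n (X i0 z0 u)" by (rule cnrm_nonneg)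
    show "cnrm n (X i0 z0 u) \<le> B\<^sup>2"
      by (rule cnrm_push_le) (use B2(1)[OF i0 z0] B uB in linarith)+
    show "- Re (gjet m m ?H z0 v0 u b) / herm m ?H z0 v0 + \<delta> * S / (real n)\<^sup>2
      \<le> \<delta> * (A * (1 / (rad i0)\<^sup>2)) * (\<Sum>i<m. (cmod (u i))\<^sup>2) + (1 - \<delta>) * (\<epsilon> * B * (2 * (cnrm n (X i0 z0 u))\<^sup>2 + 2 * real n * S))"
      using le by simp
  qed
qed

text \<open>On the complex line through the centre and the point, the derivative of each coordinate
  of \<open>f\<close> is a component of \<open>X\<close> and hence 0.\<close>

lemma locally_constant:
  assumes X0: "\<And>i z w. i \<in> I \<Longrightarrow> z \<in> K i \<Longrightarrow> w \<in> Cn m \<Longrightarrow> X i z w = (\<lambda>_. 0)"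
    and i: "i \<in> I" and x: "x \<in> fst (ch i)" "sqd m (snd (ch i) x) (pt i) < (rad i)\<^sup>2"
  shows "f x = f (chart_inv (ch i) (pt i))"
proof -
  define z where "z = snd (ch i) x"
  have zC: "z \<in> Cn m" unfolding z_def using atlasD(4)[OF M ch[OF i] x(1)] m by simp
  define w where "w k = z k - pt i k" for k
  have wC: "w \<in> Cn m" using zC pt[OF i] by (simp add: w_def Cn_def)
  define zt where "zt t = (\<lambda>k. pt i k + t * w k)" for t
  \<comment> \<open>The doubled radius of the piece admits the open disc of radius 2, which contains
    both parameters 0 and 1.\<close>
  have ztK: "zt t \<in> K i" if "t \<in> ball 0 2" for t
  proof -
    have "zt t \<in> Cn m" unfolding zt_def by (intro Cn_add pt[OF i] Cn_scale wC)
    moreover have "sqd m (zt t) (pt i) = (cmod t)\<^sup>2 * sqd m z (pt i)"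
      unfolding sqd_def zt_def w_def by (simp add: norm_mult power_mult_distrib sum_distrib_left)
    moreover have "(cmod t)\<^sup>2 * sqd m z (pt i) \<le> 2\<^sup>2 * (rad i)\<^sup>2"
      using that x(2) sqd_nonneg by (intro mult_mono power_mono) (auto simp: z_def)
    ultimately show ?thesis by (simp add: KK_def power_mult_distrib)
  qed
  have ztO: "zt t \<in> Om (ch i) (dh i)" if "t \<in> ball 0 2" for t using K_pt(4)[OF i ztK[OF that]] .
  have zt01: "zt 0 = pt i" "zt 1 = z" by (auto simp: zt_def w_def)
  have e: "fh (ch i) (dh i) a (pt i) = fh (ch i) (dh i) a z" if a: "a < n" for a
  proof -
    have "\<exists>c. \<forall>t\<in>ball 0 2. fh (ch i) (dh i) a (zt t) = c"
    proof (rule has_field_derivative_zero_constant)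
      show "convex (ball (0::complex) 2)" by simp
      fix t :: complex assume t: "t \<in> ball 0 2"
      have "((\<lambda>t. fh (ch i) (dh i) a (zt t)) has_field_derivative (\<Sum>l<m. pd l (fh (ch i) (dh i) a) (zt t) * w l)) (at t)"
        unfolding zt_def by (rule holo_on_line(2)[OF Om_props(2)[OF ch[OF i] dh[OF i] a] Om_props(1)[OF ch[OF i] dh[OF i]] pt[OF i] wC _ _ t])
          (use ztO in \<open>auto simp: zt_def\<close>)
      moreover have "(\<Sum>l<m. pd l (fh (ch i) (dh i) a) (zt t) * w l) = 0"
        using fun_cong[OF X0[OF i ztK[OF t] wC], of a] a by (simp add: push_def)
      ultimately show "((\<lambda>t. fh (ch i) (dh i) a (zt t)) has_field_derivative 0) (at t within ball 0 2)"
        by (simp add: has_field_derivative_at_within)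
    qed
    then obtain c where "\<forall>t\<in>ball 0 2. fh (ch i) (dh i) a (zt t) = c" by blast
    then have "fh (ch i) (dh i) a (zt 0) = c" "fh (ch i) (dh i) a (zt 1) = c" by auto
    then show ?thesis unfolding zt01 by simp
  qed
  have O: "pt i \<in> Om (ch i) (dh i)" "z \<in> Om (ch i) (dh i)" using ztO[of 0] ztO[of 1] unfolding zt01 by auto
  note P = Om_props(4)[OF ch[OF i] dh[OF i] O(1)] Om_props(4)[OF ch[OF i] dh[OF i] O(2)]
  note Q = Om_props(6)[OF ch[OF i] dh[OF i] O(1)] Om_props(6)[OF ch[OF i] dh[OF i] O(2)]
  have "snd (dh i) (f (chart_inv (ch i) (pt i))) = snd (dh i) (f (chart_inv (ch i) z))"
  proof (rule Cn_eqI[of _ n])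
    show "snd (dh i) (f (chart_inv (ch i) (pt i))) a = snd (dh i) (f (chart_inv (ch i) z)) a" if "a < n" for a
      using e[OF that] by (simp add: fh_def)
  qed (use Q in auto)
  then have "f (chart_inv (ch i) (pt i)) = f (chart_inv (ch i) z)"
    using inj_onD[OF atlasD(1)[OF N dh[OF i]]] P by blast
  then show ?thesis unfolding z_def chart_inv_left[OF atlasD(1)[OF M ch[OF i]] x(1)] by simp
qed

text \<open>A locally constant map has fibres that are open and closed, and connectedness leaves a
  single one.\<close>

lemma map_constant:
  assumes nef: "nef_vector_bundle (cotangent_bundle N)" and conn: "connected_space (cm_topology M)"
  shows "f constant_on (cm_pts M)"
proof (cases "cm_pts M = {}")
  case True
  then show ?thesis by (simp add: constant_on_def)
next
  case False
  then obtain x0 where x0: "x0 \<in> cm_pts M" by blast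
  define U where "U i = {x \<in> fst (ch i). snd (ch i) x \<in> {z \<in> Cn m. sqd m z (pt i) < (rad i)\<^sup>2}}" for i
  define q where "q i = f (chart_inv (ch i) (pt i))" for i
  have U: "openin (cm_topology M) (U i)" if i: "i \<in> I" for i
  proof -
    have "{z \<in> Cn m. sqd m z (pt i) < (rad i)\<^sup>2} \<subseteq> K i" using in_KK by blast
    then have "{z \<in> Cn m. sqd m z (pt i) < (rad i)\<^sup>2} \<subseteq> snd (ch i) ` fst (ch i)" using K_pt(5)[OF i] by blast
    then show ?thesis unfolding U_def using open_Cn_sqd m by (intro openin_chart_preimage[OF M ch[OF i]]) auto
  qed
  have Uq: "f x = q i" if "i \<in> I" "x \<in> U i" for i x
    unfolding q_def by (rule locally_constant[OF push_zero[OF nef] that(1)]) (use that(2) in \<open>auto simp: U_def\<close>)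
  have cov: "\<exists>i\<in>I. x \<in> U i" if "x \<in> cm_pts M" for x
    using cover[OF that] atlasD(4)[OF M ch] m unfolding U_def by blast
  have UM: "U i \<subseteq> cm_pts M" if "i \<in> I" for i using atlasD(3)[OF M ch[OF that]] by (auto simp: U_def)
  define T where "T = {x \<in> cm_pts M. f x = f x0}"
  \<comment> \<open>An arbitrary predicate \<open>P\<close> covers a fibre and its complement at
    once: both are unions of pieces on which \<open>f\<close> is constant.\<close>
  have fibre: "openin (cm_topology M) {x \<in> cm_pts M. P (f x)}" for P
  proof -
    have "{x \<in> cm_pts M. P (f x)} = (\<Union>i\<in>{i\<in>I. P (q i)}. U i)"
    proof (intro equalityI subsetI)
      fix x assume x: "x \<in> {x \<in> cm_pts M. P (f x)}"
      then obtain i where i: "i \<in> I" "x \<in> U i" using cov by blast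
      then have "P (q i)" using x Uq[OF i] by simp
      then show "x \<in> (\<Union>i\<in>{i\<in>I. P (q i)}. U i)" using i by blast
    next
      fix x assume "x \<in> (\<Union>i\<in>{i\<in>I. P (q i)}. U i)"
      then obtain i where i: "i \<in> I" "x \<in> U i" "P (q i)" by blast
      then show "x \<in> {x \<in> cm_pts M. P (f x)}" using Uq[OF i(1,2)] UM[OF i(1)] by auto
    qed
    then show ?thesis using U by auto
  qed
  have oT: "openin (cm_topology M) T" unfolding T_def by (rule fibre)
  have "topspace (cm_topology M) - T = {x \<in> cm_pts M. f x \<noteq> f x0}" unfolding T_def topspace_cm[OF M] by blast
  then have "openin (cm_topology M) (topspace (cm_topology M) - T)" using fibre[of "\<lambda>y. y \<noteq> f x0"] by simp
  then have "closedin (cm_topology M) T" unfolding closedin_def using openin_subset[OF oT] by blast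
  then have "T = cm_pts M" using conn oT x0 unfolding connected_space_clopen_in topspace_cm[OF M] T_def by blast
  then show ?thesis unfolding T_def constant_on_def by blast
qed

end

theorem theorem1p3:
  fixes M :: "'a cmfd" and N :: "'b cmfd" and f :: "'a \<Rightarrow> 'b"
  assumes "compact_complex_manifold M" and "compact_complex_manifold N"
    and "holomorphic_map M N f"
    and "RC_positive_tangent_bundle M"
    and "nef_vector_bundle (cotangent_bundle N)"
  shows "f constant_on (cm_pts M)"
proof -
  have M: "holomorphic_atlas M" "Hausdorff_space (cm_topology M)" "connected_space (cm_topology M)" "compact_space (cm_topology M)"
    using assms(1) by (auto simp: compact_complex_manifold_def complex_manifold_def)
  have N: "holomorphic_atlas N" using assms(2) by (auto simp: compact_complex_manifold_def complex_manifold_def)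
  obtain g where g: "RC_positive (tangent_bundle M) g" using assms(4) by (auto simp: RC_positive_tangent_bundle_def)
  define n where "n = cm_dim N"
  define NN where "NN = n + (n - 1)"
  have rc: "rc_map M N f g (cm_dim M) n NN"
    by (intro rc_map.intro M(1) N holomorphic_map_hmap assms(3) refl n_def NN_def g)
  have "continuous_map (cm_topology M) (cm_topology N) f" using assms(3) by (simp add: holomorphic_map_def)
  then have fM: "f x \<in> cm_pts N" if "x \<in> cm_pts M" for x
    using that unfolding continuous_map_def topspace_cm[OF M(1)] topspace_cm[OF N] by blast
  obtain I :: "'a set" and ch dh pt rad where fin: "finite I"
    and P: "\<forall>i\<in>I. ch i \<in> cm_atlas M \<and> dh i \<in> cm_atlas N \<and> 0 < rad i \<and> pt i \<in> Cn (cm_dim M) \<and> KK (cm_dim M) (pt i) (rad i) \<subseteq> rc_map.Om f (ch i) (dh i)"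
    and cov: "\<forall>x\<in>cm_pts M. \<exists>i\<in>I. x \<in> fst (ch i) \<and> sqd (cm_dim M) (snd (ch i) x) (pt i) < (rad i)\<^sup>2"
    using rc_map.cover_exists[OF rc M(4)] by - (drule meta_mp, erule fM, elim exE conjE, (rule that; assumption))
  have "rc_cover M N f g (cm_dim M) n NN I ch dh pt rad"
    by (intro rc_cover.intro rc rc_cover_axioms.intro fin cov[rule_format] M(2)) (use P in blast)+
  then show ?thesis by (rule rc_cover.map_constant[OF _ assms(5) M(3)])
qed

end
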